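(* Let $\Gamma$ be the fundamental group of a closed orientable surface of genus $g\ge2$. For $x=\sum_{\gamma\in\Gamma}\alpha_\gamma\gamma\in\mathbb{C}[\Gamma]$ put $u_1(x)=\sum_\gamma\alpha_\gamma[\omega(\gamma)-1]$. Then for any self-adjoint $x\in\mathbb{C}[\Gamma]$, $$\limsup_{p\to\infty}|u_1(x^p)|^{1/p}\le\|\lambda(x)\|.$$
   Context: Every $1\ne\gamma\in\Gamma$ can be written uniquely as $\gamma=\gamma_0^k$ with $k\in\mathbb{N}=\{1,2,\dots\}$ and $\gamma_0\in\Gamma$ not a proper power (i.e. not of the form $\delta^m$ with $\delta\in\Gamma$, $m\ge2$). Define $\omega(\gamma)$ to be the number of positive divisors of $k$ in this case, and $\omega(1)=0$. $\lambda$ is the left regular representation of $\Gamma$ on $\ell^2(\Gamma)$, extended linearly to the group algebra $\mathbb{C}[\Gamma]$; $\|\lambda(x)\|$ is the operator norm. $x$ is self-adjoint if $x=x^*$, where $(\sum_\gamma\alpha_\gamma\gamma)^*=\sum_\gamma\bar\alpha_\gamma\gamma^{-1}$. *)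

theory Defs
  imports "HOL-Analysis.Analysis" "HOL-Algebra.Ring"
begin

text \<open>
  The closed orientable surface of genus \<open>g \<ge> 1\<close> is the closed disc, viewed as a polygon whose
  boundary circle is divided into \<open>4g\<close> sides, with the sides identified in pairs following the
  boundary word \<open>a\<^sub>1 b\<^sub>1 a\<^sub>1\<^sup>-\<^sup>1 b\<^sub>1\<^sup>-\<^sup>1 \<dots> a\<^sub>g b\<^sub>g a\<^sub>g\<^sup>-\<^sup>1 b\<^sub>g\<^sup>-\<^sup>1\<close>. The sides are numbered from \<open>0\<close>, counterclockwise.
\<close>

definition polygon_side :: "nat \<Rightarrow> nat \<Rightarrow> real \<Rightarrow> complex" where
  "polygon_side g j t = cis (2 * pi * (real j + t) / (4 * real g))"

inductive glued :: "nat \<Rightarrow> complex \<Rightarrow> complex \<Rightarrow> bool" for g :: nat where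
  glued_a: "i < g \<Longrightarrow> t \<in> {0..1} \<Longrightarrow>
    glued g (polygon_side g (4 * i) t) (polygon_side g (4 * i + 2) (1 - t))"
| glued_b: "i < g \<Longrightarrow> t \<in> {0..1} \<Longrightarrow>
    glued g (polygon_side g (4 * i + 1) t) (polygon_side g (4 * i + 3) (1 - t))"

text \<open>
  \<open>S\<close> (with the subspace topology) is homeomorphic to the glued polygon: it is the image of a
  quotient map whose fibres are exactly the classes of the equivalence relation generated by the
  gluing.
\<close>

definition closed_orientable_surface :: "nat \<Rightarrow> 'a::topological_space set \<Rightarrow> bool" where
  "closed_orientable_surface g S \<longleftrightarrow>
    (\<exists>q. quotient_map (top_of_set (cball (0::complex) 1)) (top_of_set S) q \<and>
         (\<forall>z\<in>cball 0 1. \<forall>w\<in>cball 0 1. q z = q w \<longleftrightarrow> equivclp (glued g) z w))"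

definition loops :: "'a::topological_space set \<Rightarrow> 'a \<Rightarrow> (real \<Rightarrow> 'a) set" where
  "loops S x0 = {p. path p \<and> path_image p \<subseteq> S \<and> pathstart p = x0 \<and> pathfinish p = x0}"

definition path_class :: "'a::topological_space set \<Rightarrow> (real \<Rightarrow> 'a) \<Rightarrow> (real \<Rightarrow> 'a) set" where
  "path_class S p = {q. homotopic_paths S p q}"

definition fundamental_group ::
    "'a::topological_space set \<Rightarrow> 'a \<Rightarrow> (real \<Rightarrow> 'a) set monoid" where
  "fundamental_group S x0 =
    \<lparr> carrier = path_class S ` loops S x0,
      mult = (\<lambda>C D. \<Union>p\<in>C. \<Union>q\<in>D. path_class S (p +++ q)),
      one = path_class S (\<lambda>t. x0) \<rparr>"

lemma path_class_eq_iff: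
  assumes "p \<in> loops S x0"
  shows "path_class S p = path_class S q \<longleftrightarrow> homotopic_paths S p q"
proof
  assume "path_class S p = path_class S q"
  moreover have "p \<in> path_class S p"
    using assms by (simp add: path_class_def loops_def)
  ultimately show "homotopic_paths S p q"
    by (simp add: path_class_def homotopic_paths_sym)
next
  assume "homotopic_paths S p q"
  then show "path_class S p = path_class S q"
    unfolding path_class_def by (blast intro: homotopic_paths_sym homotopic_paths_trans)
qed

lemma loops_joinpaths: "p \<in> loops S x0 \<Longrightarrow> q \<in> loops S x0 \<Longrightarrow> p +++ q \<in> loops S x0"
  by (auto simp: loops_def path_image_join)

lemma loops_homotopic: "p \<in> loops S x0 \<Longrightarrow> homotopic_paths S p q \<Longrightarrow> q \<in> loops S x0"
  unfolding loops_def mem_Collect_eq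
  by (metis homotopic_paths_imp_path homotopic_paths_imp_pathfinish
      homotopic_paths_imp_pathstart homotopic_paths_imp_subset)

lemma fundamental_group_mult:
  assumes "p \<in> loops S x0" "q \<in> loops S x0"
  shows "path_class S p \<otimes>\<^bsub>fundamental_group S x0\<^esub> path_class S q = path_class S (p +++ q)"
proof -
  have eq: "path_class S (p' +++ q') = path_class S (p +++ q)"
    if "p' \<in> path_class S p" "q' \<in> path_class S q" for p' q'
  proof -
    have "homotopic_paths S (p +++ q) (p' +++ q')"
      using that assms by (intro homotopic_paths_join) (auto simp: path_class_def loops_def)
    then show ?thesis
      using path_class_eq_iff[OF loops_joinpaths[OF assms]] by blast
  qed
  have "p \<in> path_class S p" "q \<in> path_class S q"
    using assms by (auto simp: path_class_def loops_def)
  then have "(\<Union>p'\<in>path_class S p. \<Union>q'\<in>path_class S q. path_class S (p' +++ q')) =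
      path_class S (p +++ q)"
    using eq by blast
  then show ?thesis
    by (simp add: fundamental_group_def)
qed

lemma homotopic_paths_compose_loop:
  assumes "p \<in> loops S x0" "homotopic_paths {0..1} r s"
  shows "homotopic_paths S (p \<circ> r) (p \<circ> s)"
proof (rule homotopic_paths_continuous_image[OF assms(2)])
  show "continuous_on {0..1} p" "p \<in> {0..1} \<rightarrow> S"
    using assms(1) by (auto simp: loops_def path_def path_image_def)
qed

lemma homotopic_paths_const_joinpaths:
  assumes "p \<in> loops S x0"
  shows "homotopic_paths S ((\<lambda>t. x0) +++ p) p"
proof -
  have "homotopic_paths {0..1} (linepath 0 0 +++ linepath 0 1) (linepath 0 (1::real))"
    using homotopic_paths_lid[of "linepath 0 (1::real)" "{0..1}"]
    by (simp add: closed_segment_eq_real_ivl)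
  then have "homotopic_paths S (p \<circ> (linepath 0 0 +++ linepath 0 1)) (p \<circ> linepath 0 1)"
    by (rule homotopic_paths_compose_loop[OF assms])
  moreover have "p \<circ> (linepath 0 0 +++ linepath 0 1) = (\<lambda>t. x0) +++ p" "p \<circ> linepath 0 1 = p"
    using assms by (auto simp: loops_def joinpaths_def linepath_def pathstart_def fun_eq_iff)
  ultimately show ?thesis by simp
qed

lemma homotopic_paths_reversepath_joinpaths:
  assumes "p \<in> loops S x0"
  shows "homotopic_paths S (reversepath p +++ p) (\<lambda>t. x0)"
proof -
  have "homotopic_paths {0..1} (reversepath (linepath 0 1) +++ linepath 0 1) (linepath 1 (1::real))"
    using homotopic_paths_linv[of "linepath 0 (1::real)" "{0..1}"]
    by (simp add: closed_segment_eq_real_ivl)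
  then have "homotopic_paths S (p \<circ> (reversepath (linepath 0 1) +++ linepath 0 1)) (p \<circ> linepath 1 1)"
    by (rule homotopic_paths_compose_loop[OF assms])
  moreover have "p \<circ> (reversepath (linepath 0 1) +++ linepath 0 1) = reversepath p +++ p"
    by (auto simp: joinpaths_def linepath_def reversepath_def fun_eq_iff)
  moreover have "p \<circ> linepath 1 1 = (\<lambda>t. x0)"
    using assms by (auto simp: loops_def linepath_def pathfinish_def fun_eq_iff)
  ultimately show ?thesis by simp
qed

lemma group_fundamental_group:
  assumes "x0 \<in> S"
  shows "group (fundamental_group S x0)"
proof -
  let ?G = "fundamental_group S x0"
  let ?e = "\<lambda>t::real. x0"
  have e: "?e \<in> loops S x0"
    using assms by (auto simp: loops_def path_def path_image_def pathstart_def pathfinish_def)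
  have carr: "carrier ?G = path_class S ` loops S x0" and one: "\<one>\<^bsub>?G\<^esub> = path_class S ?e"
    by (auto simp: fundamental_group_def)
  note mult = fundamental_group_mult loops_joinpaths
  show ?thesis
  proof (rule groupI)
    fix x y assume "x \<in> carrier ?G" "y \<in> carrier ?G"
    then show "x \<otimes>\<^bsub>?G\<^esub> y \<in> carrier ?G"
      by (auto simp: carr mult)
  next
    show "\<one>\<^bsub>?G\<^esub> \<in> carrier ?G"
      using e by (auto simp: carr one)
  next
    fix x y z assume "x \<in> carrier ?G" "y \<in> carrier ?G" "z \<in> carrier ?G"
    then obtain p q r where pqr: "p \<in> loops S x0" "q \<in> loops S x0" "r \<in> loops S x0"
      and [simp]: "x = path_class S p" "y = path_class S q" "z = path_class S r"
      by (auto simp: carr)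
    have "homotopic_paths S (p +++ (q +++ r)) ((p +++ q) +++ r)"
      using pqr by (intro homotopic_paths_assoc) (auto simp: loops_def)
    then show "x \<otimes>\<^bsub>?G\<^esub> y \<otimes>\<^bsub>?G\<^esub> z = x \<otimes>\<^bsub>?G\<^esub> (y \<otimes>\<^bsub>?G\<^esub> z)"
      using pqr by (simp add: mult path_class_eq_iff[where ?x0.0 = x0] homotopic_paths_sym)
  next
    fix x assume "x \<in> carrier ?G"
    then obtain p where p: "p \<in> loops S x0" and [simp]: "x = path_class S p"
      by (auto simp: carr)
    have "homotopic_paths S (?e +++ p) p"
      by (rule homotopic_paths_const_joinpaths[OF p])
    then show "\<one>\<^bsub>?G\<^esub> \<otimes>\<^bsub>?G\<^esub> x = x"
      using p e by (simp add: one mult path_class_eq_iff[where ?x0.0 = x0])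
  next
    fix x assume "x \<in> carrier ?G"
    then obtain p where p: "p \<in> loops S x0" and [simp]: "x = path_class S p"
      by (auto simp: carr)
    have r: "reversepath p \<in> loops S x0"
      using p by (auto simp: loops_def)
    have "homotopic_paths S (reversepath p +++ p) ?e"
      by (rule homotopic_paths_reversepath_joinpaths[OF p])
    then have "path_class S (reversepath p) \<otimes>\<^bsub>?G\<^esub> x = \<one>\<^bsub>?G\<^esub>"
      using p r by (simp add: one mult path_class_eq_iff[where ?x0.0 = x0])
    moreover have "path_class S (reversepath p) \<in> carrier ?G"
      using r by (simp add: carr)
    ultimately show "\<exists>y\<in>carrier ?G. y \<otimes>\<^bsub>?G\<^esub> x = \<one>\<^bsub>?G\<^esub>"
      by blast
  qed
qed

definition supp :: "('b \<Rightarrow> complex) \<Rightarrow> 'b set" where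
  "supp x = {\<gamma>. x \<gamma> \<noteq> 0}"

definition group_algebra :: "('b, 'm) monoid_scheme \<Rightarrow> ('b \<Rightarrow> complex) ring" where
  "group_algebra G =
    \<lparr> carrier = {x. finite (supp x) \<and> supp x \<subseteq> carrier G},
      mult = (\<lambda>x y \<gamma>. \<Sum>(a, b) | a \<in> supp x \<and> b \<in> supp y \<and> a \<otimes>\<^bsub>G\<^esub> b = \<gamma>. x a * y b),
      one = (\<lambda>\<gamma>. if \<gamma> = \<one>\<^bsub>G\<^esub> then 1 else 0),
      zero = (\<lambda>\<gamma>. 0),
      add = (\<lambda>x y \<gamma>. x \<gamma> + y \<gamma>) \<rparr>"

definition adjoint_elem :: "('b, 'm) monoid_scheme \<Rightarrow> ('b \<Rightarrow> complex) \<Rightarrow> 'b \<Rightarrow> complex" where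
  "adjoint_elem G x = (\<lambda>\<gamma>. if \<gamma> \<in> carrier G then cnj (x (inv\<^bsub>G\<^esub> \<gamma>)) else 0)"

definition l2_space :: "('b, 'm) monoid_scheme \<Rightarrow> ('b \<Rightarrow> complex) set" where
  "l2_space G = {\<xi>. supp \<xi> \<subseteq> carrier G \<and> (\<lambda>h. (cmod (\<xi> h))\<^sup>2) summable_on carrier G}"

definition l2_norm :: "('b, 'm) monoid_scheme \<Rightarrow> ('b \<Rightarrow> complex) \<Rightarrow> real" where
  "l2_norm G \<xi> = sqrt (\<Sum>\<^sub>\<infinity>h\<in>carrier G. (cmod (\<xi> h))\<^sup>2)"

definition left_regular ::
    "('b, 'm) monoid_scheme \<Rightarrow> ('b \<Rightarrow> complex) \<Rightarrow> ('b \<Rightarrow> complex) \<Rightarrow> 'b \<Rightarrow> complex" where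
  "left_regular G x \<xi> =
    (\<lambda>h. if h \<in> carrier G then \<Sum>\<gamma>\<in>supp x. x \<gamma> * \<xi> (inv\<^bsub>G\<^esub> \<gamma> \<otimes>\<^bsub>G\<^esub> h) else 0)"

text \<open>
  The operator norm, for operators bounded on \<open>l2_space G\<close>. Every \<open>left_regular G x\<close> with \<open>x\<close> in the
  group algebra is one: its norm is at most the sum of the \<open>cmod (x \<gamma>)\<close>.
\<close>

definition l2_opnorm ::
    "('b, 'm) monoid_scheme \<Rightarrow> (('b \<Rightarrow> complex) \<Rightarrow> ('b \<Rightarrow> complex)) \<Rightarrow> real" where
  "l2_opnorm G T = (SUP \<xi>\<in>{\<xi> \<in> l2_space G. l2_norm G \<xi> \<le> 1}. l2_norm G (T \<xi>))"

definition proper_power :: "('b, 'm) monoid_scheme \<Rightarrow> 'b \<Rightarrow> bool" where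
  "proper_power G \<gamma> \<longleftrightarrow> (\<exists>\<delta>\<in>carrier G. \<exists>m::nat. m \<ge> 2 \<and> \<gamma> = \<delta> [^]\<^bsub>G\<^esub> m)"

text \<open>
  The exponent \<open>k\<close> in \<open>\<gamma> = \<gamma>\<^sub>0\<^sup>k\<close> with \<open>\<gamma>\<^sub>0\<close> not a proper power. It is meaningful in groups, such as
  surface groups, in which every nontrivial element has a unique such expression.
\<close>

definition power_exponent :: "('b, 'm) monoid_scheme \<Rightarrow> 'b \<Rightarrow> nat" where
  "power_exponent G \<gamma> =
    (THE k. k \<ge> 1 \<and> (\<exists>\<gamma>0\<in>carrier G. \<not> proper_power G \<gamma>0 \<and> \<gamma> = \<gamma>0 [^]\<^bsub>G\<^esub> k))"

definition omega :: "('b, 'm) monoid_scheme \<Rightarrow> 'b \<Rightarrow> nat" where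
  "omega G \<gamma> = (if \<gamma> = \<one>\<^bsub>G\<^esub> then 0 else card {d. d dvd power_exponent G \<gamma>})"

definition u1 :: "('b, 'm) monoid_scheme \<Rightarrow> ('b \<Rightarrow> complex) \<Rightarrow> complex" where
  "u1 G x = (\<Sum>\<gamma>\<in>supp x. x \<gamma> * (of_nat (omega G \<gamma>) - 1))"

end

theory Submission
  imports Defs "HOL-Real_Asymp.Real_Asymp"
begin

text \<open>
  The surface group acts on the hyperbolic plane as the label-preserving subgroup of a triangle
  reflection group, whose chambers assemble into a tessellation by regular \<open>4g\<close>-gons with the
  prescribed gluing; that it is the deck group of the universal covering follows from Tits' solution
  of the word problem, which replaces Poincare's polygon theorem. Hence the length
  \<open>\<ell>(\<gamma>) = d(o, \<gamma> o)\<close> satisfies the four-point condition, and the nontrivial elements translate along axes.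

  In \<open>u\<^sub>1(x\<^sup>p)\<close> only \<open>1\<close> and the proper powers contribute, since \<open>\<omega>(\<gamma>) = 1\<close> otherwise. A word of length
  \<open>p\<close> in the support of \<open>x\<close> with product \<open>h\<^sup>k\<close> describes a path from \<open>1\<close> to \<open>h\<^sup>k\<close>, which by the four-point
  condition stays near the geodesic and so passes near \<open>u\<close>, \<open>hu\<close> and \<open>h\<^sup>k u\<close>, where \<open>u\<close> is near the axis
  of \<open>h\<close>. Cutting there gives words for \<open>u\<close>, \<open>v\<close>, \<open>v\<^sup>k\<^sup>-\<^sup>1\<close> and \<open>u\<^sup>-\<^sup>1\<close> with \<open>v = u\<^sup>-\<^sup>1 h u\<close>, and by Cauchy--Schwarz
  over \<open>u\<close> and \<open>v\<close> the sum is bounded by l2-norms of powers of \<open>x\<close>, that is by \<open>\<parallel>\<lambda>(x)\<parallel>\<^sup>p\<close>. As the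
  coefficients may cancel, this is applied to the absolute values of the coefficients of about \<open>\<surd>p\<close>
  blocks \<open>x\<^sup>q\<close>; rapid decay costs a polynomial factor per block, in all \<open>exp (O(\<surd>p ln p))\<close>.
\<close>

subsection \<open>Reflection systems\<close>

text \<open>Two choices shape the proof. The reflection group is never given by a presentation: a
  word acts at once on vectors and on the \<open>8 * g\<close> flags of the glued polygon, and
  equality of these joint actions serves as equality of group elements. Only the dihedral relations
  are needed, and they hold in both components; so the flag of a tile is well defined, and the
  stabiliser of flag 0 becomes the deck group.

  On the analytic side the cut of a word is inexact. Its error grows linearly with the length of a
  block and with the number of blocks, and summing over the errors costs the volume of a ball of
  that radius, which is exponential. Both quantities must therefore be \<open>o(p)\<close>, and
  about \<surd>p balances them. Cauchy--Schwarz in \<open>v\<close> needs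
  \<open>v \<mapsto> v\<^sup>k\<^sup>-\<^sup>1\<close> to be injective. This is uniqueness of roots:
  all roots of an element translate along its axis, and the stabiliser of an axis is cyclic. The
  factor \<open>\<omega> - 1\<close> is harmless because the exponent of a power is at most linear
  in its length.\<close>

fun act :: "('i \<Rightarrow> 'x \<Rightarrow> 'x) \<Rightarrow> 'i list \<Rightarrow> 'x \<Rightarrow> 'x" where
  "act \<tau> [] x = x"
| "act \<tau> (i # w) x = \<tau> i (act \<tau> w x)"

fun alt :: "nat \<Rightarrow> 'i \<Rightarrow> 'i \<Rightarrow> 'i list" where
  "alt 0 i j = []"
| "alt (Suc k) i j = i # alt k j i"

lemma act_append: "act \<tau> (u @ v) x = act \<tau> u (act \<tau> v x)"
  by (induction u) auto

lemma length_alt [simp]: "length (alt k i j) = k"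
  by (induction k arbitrary: i j) auto

lemma set_alt: "set (alt k i j) \<subseteq> {i, j}"
  by (induction k arbitrary: i j) auto

lemma alt_add: "alt (a + b) i j = alt a i j @ (if even a then alt b i j else alt b j i)"
  by (induction a arbitrary: i j) auto

lemma alternating_list:
  assumes "set w \<subseteq> {i, j}" "\<And>u v s. w \<noteq> u @ s # s # v"
  shows "w = alt (length w) i j \<or> w = alt (length w) j i"
  using assms
proof (induction w)
  case (Cons a w)
  have "w = alt (length w) i j \<or> w = alt (length w) j i"
  proof (rule Cons.IH)
    show "set w \<subseteq> {i, j}" using Cons.prems by auto
    show "w \<noteq> u @ s # s # v" for u v s using Cons.prems(2)[of "a # u" s v] by auto
  qed
  then show ?case
  proof (cases w)
    case (Cons b w')
    then have "a \<noteq> b" using Cons.prems(2)[of "[]" a w'] by auto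
    moreover have "a \<in> {i,j}" "b \<in> {i,j}" using Cons Cons.prems(1) by auto
    moreover have "w = alt (length w) b (if b = i then j else i)"
      using \<open>w = alt (length w) i j \<or> w = alt (length w) j i\<close> Cons
      by (auto)
    ultimately show ?thesis by (auto split: if_splits)
  qed (use Cons.prems in auto)
qed auto

locale involutions =
  fixes \<tau> :: "'i \<Rightarrow> 'x \<Rightarrow> 'x"
  assumes invol [simp]: "\<tau> i (\<tau> i x) = x"
begin

lemma act_rev [simp]: "act \<tau> (rev w) (act \<tau> w x) = x" "act \<tau> w (act \<tau> (rev w) x) = x"
proof -
  show *: "act \<tau> (rev w) (act \<tau> w x) = x" for w x
    by (induction w arbitrary: x) (auto simp: act_append)
  from *[of "rev w"] show "act \<tau> w (act \<tau> (rev w) x) = x" by simp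
qed

text \<open>Word length in the group generated by the \<open>\<tau> i\<close>, as a function of the
  transformation itself: equal actions count as equal elements.\<close>

definition len :: "('x \<Rightarrow> 'x) \<Rightarrow> nat" where
  "len f = (LEAST n. \<exists>w. act \<tau> w = f \<and> length w = n)"

lemma len_le: "act \<tau> w = f \<Longrightarrow> len f \<le> length w"
  unfolding len_def by (rule Least_le) auto

lemma reduced_word: obtains w' where "act \<tau> w' = act \<tau> w" "length w' = len (act \<tau> w)"
  using LeastI[of "\<lambda>n. \<exists>w'. act \<tau> w' = act \<tau> w \<and> length w' = n" "length w"]
  unfolding len_def by auto

lemma len_0: "len (act \<tau> w) = 0 \<longleftrightarrow> act \<tau> w = act \<tau> []"
  by (metis reduced_word len_le length_0_conv list.size(3) le_zero_eq)

lemma len_append: "len (act \<tau> (u @ v)) \<le> length u + len (act \<tau> v)"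
proof -
  obtain v' where v': "act \<tau> v' = act \<tau> v" "length v' = len (act \<tau> v)" by (rule reduced_word)
  have "act \<tau> (u @ v') = act \<tau> (u @ v)" using v' by (auto simp: act_append fun_eq_iff)
  from len_le[OF this] v' show ?thesis by simp
qed

lemma len_Cons_less:
  assumes "len (act \<tau> w) > 0"
  obtains s w' where "act \<tau> w = act \<tau> (s # w')" "len (act \<tau> w) = Suc (len (act \<tau> w'))"
    "len (act \<tau> w') = length w'"
proof -
  obtain v where v: "act \<tau> v = act \<tau> w" "length v = len (act \<tau> w)" by (rule reduced_word)
  then obtain s w' where sw: "v = s # w'" using assms by (cases v) auto
  have "len (act \<tau> w') \<le> length w'" by (rule len_le) simp
  moreover have "len (act \<tau> v) \<le> Suc (len (act \<tau> w'))" using len_append[of "[s]" w'] sw by simp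
  ultimately show ?thesis using that[of s w'] v sw by auto
qed

end

text \<open>Only rank two data are assumed. With \<open>A i\<close> the positive side of mirror
  \<open>i\<close>, \<open>pos\<close> says that alternating words in \<open>i\<close> and
  \<open>j\<close> that begin with \<open>j\<close> and are shorter than \<open>m i j\<close> keep
  the sector \<open>A i \<inter> A j\<close> on the positive side of \<open>i\<close>. The behaviour
  of words in all letters follows from this.\<close>

locale tits = involutions \<tau> for \<tau> :: "'i \<Rightarrow> 'x \<Rightarrow> 'x" +
  fixes A :: "'i \<Rightarrow> 'x set" and m :: "'i \<Rightarrow> 'i \<Rightarrow> nat"
  assumes braid: "i \<noteq> j \<Longrightarrow> act \<tau> (alt (m i j) i j) = act \<tau> (alt (m i j) j i)"
    and m_pos: "i \<noteq> j \<Longrightarrow> m i j > 0"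
    and pos: "i \<noteq> j \<Longrightarrow> k < m i j \<Longrightarrow> x \<in> A i \<Longrightarrow> x \<in> A j \<Longrightarrow> act \<tau> (alt k j i) x \<in> A i"
    and m_sym: "m i j = m j i"
begin

text \<open>A shortest word in the two letters alternates because equal neighbours cancel. It is not
  longer than \<open>m i j\<close>, since otherwise the braid relation applied just behind its first
  letter would bring two equal letters together.\<close>

lemma dihedral_reduced:
  assumes "i \<noteq> j" "set V \<subseteq> {i, j}"
  obtains k V' where "V' = alt k i j \<or> V' = alt k j i" "k \<le> m i j" "k \<le> length V"
    "act \<tau> V' = act \<tau> V"
proof -
  define P where "P n \<longleftrightarrow> (\<exists>V'. set V' \<subseteq> {i,j} \<and> act \<tau> V' = act \<tau> V \<and> length V' = n)" for n
  define k where "k = (LEAST n. P n)"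
  have "P (length V)" using assms by (auto simp: P_def)
  then have "P k" and kle: "k \<le> length V"
    unfolding k_def by (rule LeastI, rule Least_le)
  then obtain V' where V': "set V' \<subseteq> {i,j}" "act \<tau> V' = act \<tau> V" "length V' = k"
    by (auto simp: P_def)
  have min: "k \<le> length U" if "set U \<subseteq> {i,j}" "act \<tau> U = act \<tau> V" for U
    unfolding k_def by (rule Least_le) (use that in \<open>auto simp: P_def\<close>)
  have "V' = alt (length V') i j \<or> V' = alt (length V') j i"
  proof (rule alternating_list[OF V'(1)])
    fix u v s
    show "V' \<noteq> u @ s # s # v"
    proof
      assume eq: "V' = u @ s # s # v"
      have "act \<tau> (u @ v) = act \<tau> V" using V'(2) unfolding eq by (auto simp: act_append fun_eq_iff)
      from min[OF _ this] V' eq show False by auto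
    qed
  qed
  then have alt: "V' = alt k i j \<or> V' = alt k j i" using V' by simp
  have "k \<le> m i j"
  proof (rule ccontr)
    assume "\<not> k \<le> m i j"
    have False if ab: "a \<noteq> b" "{a,b} = {i,j}" "V' = alt k a b" for a b
    proof -
      have mab: "m b a = m i j" using ab m_sym by (metis doubleton_eq_iff)
      obtain r where r: "k = Suc (m b a + r)"
        using \<open>\<not> k \<le> m i j\<close> mab less_imp_Suc_add[of "m b a" k] by auto
      obtain p where p: "m b a = Suc p" using m_pos[of b a] ab by (cases "m b a") auto
      define R where "R = (if even (m b a) then alt r b a else alt r a b)"
      have "V' = a # alt (m b a) b a @ R" using ab(3) r by (simp add: alt_add R_def)
      then have "act \<tau> V' = act \<tau> (a # alt (m b a) a b @ R)"
        using braid[of b a] ab by (auto simp: act_append fun_eq_iff)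
      also have "\<dots> = act \<tau> (alt p b a @ R)" using p by (auto simp: act_append fun_eq_iff)
      finally have "act \<tau> (alt p b a @ R) = act \<tau> V" using V' by simp
      moreover have "set (alt p b a @ R) \<subseteq> {i,j}"
        using set_alt[of p b a] set_alt[of r b a] set_alt[of r a b] ab(2) unfolding R_def by auto
      ultimately have "k \<le> length (alt p b a @ R)" by (intro min)
      then show False using r p by (auto simp: R_def split: if_splits)
    qed
    from this[of i j] this[of j i] alt assms show False by auto
  qed
  then show ?thesis using that alt kle V' by blast
qed

text \<open>Replace \<open>V\<close> by its reduced alternating form. If this starts with
  \<open>j\<close> (or is empty) and is shorter than \<open>m i j\<close>, then \<open>pos\<close>
  applies. Otherwise it can be made to start with \<open>i\<close>, by the braid relation if its
  length is exactly \<open>m i j\<close>, and deleting this \<open>i\<close> leaves a shorter word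
  to which \<open>pos\<close> applies.\<close>

lemma dihedral_dichotomy:
  assumes "i \<noteq> j" "set V \<subseteq> {i, j}"
  shows "(\<forall>x\<in>A i \<inter> A j. act \<tau> V x \<in> A i) \<or>
    ((\<forall>x\<in>A i \<inter> A j. \<tau> i (act \<tau> V x) \<in> A i) \<and>
      (\<exists>V'. set V' \<subseteq> {i,j} \<and> length V' < length V \<and> act \<tau> V' = act \<tau> (i # V)))"
proof -
  obtain k V' where V': "V' = alt k i j \<or> V' = alt k j i" "k \<le> m i j" "k \<le> length V"
    "act \<tau> V' = act \<tau> V"
    by (rule dihedral_reduced[OF assms])
  show ?thesis
  proof (cases "(k = 0 \<or> V' = alt k j i) \<and> k < m i j")
    case True
    then have "V' = alt k j i" using V'(1) by auto
    then show ?thesis using pos[of i j k] True assms V'(4) by auto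
  next
    case False
    have "k > 0" using False m_pos assms by (cases k) auto
    have "act \<tau> V = act \<tau> (alt k i j)"
    proof (cases "k = m i j")
      case True
      then show ?thesis using V' braid[of i j] assms by auto
    next
      case False2: False
      then show ?thesis using V' False by auto
    qed
    moreover obtain p where p: "k = Suc p" using \<open>k > 0\<close> by (cases k) auto
    ultimately have "act \<tau> V = act \<tau> (i # alt p j i)" by simp
    then have 1: "\<tau> i (act \<tau> V x) = act \<tau> (alt p j i) x" for x by auto
    have "\<forall>x\<in>A i \<inter> A j. \<tau> i (act \<tau> V x) \<in> A i"
      unfolding 1 using pos[of i j p] p V' assms by auto
    moreover have "act \<tau> (alt p j i) = act \<tau> (i # V)" using 1 by (auto simp: fun_eq_iff)
    moreover have "length (alt p j i) < length V" using p V' by simp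
    moreover have "set (alt p j i) \<subseteq> {i, j}" using set_alt[of p j i] by auto
    ultimately show ?thesis
      by (intro disjI2 conjI exI[of _ "alt p j i"]) assumption+
  qed
qed

definition chamber :: "'x set" where "chamber = (\<Inter>i. A i)"

lemma chamberD: "x \<in> chamber \<Longrightarrow> x \<in> A i"
  by (auto simp: chamber_def)

text \<open>Tits' simultaneous induction. By the first claim a translated chamber never straddles a
  mirror, and it lies on the negative side only if the reflection shortens the word. The second
  splits off a left factor \<open>U\<close> in two letters, without lengthening, so that the
  remaining element sends the chamber into the sector of these letters. At length
  \<open>n + 1\<close> the first claim uses both claims at \<open>n\<close>; the second uses the
  first at \<open>n + 1\<close> and itself at \<open>n\<close>.\<close>

lemma tits_dichotomy_aux:
  shows "len (act \<tau> w) = n \<Longrightarrow> (\<forall>x\<in>chamber. act \<tau> w x \<in> A s) \<or>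
      ((\<forall>x\<in>chamber. \<tau> s (act \<tau> w x) \<in> A s) \<and> len (act \<tau> (s # w)) < n)"
    and "len (act \<tau> w) = n \<Longrightarrow> s \<noteq> t \<Longrightarrow> \<exists>U. set U \<subseteq> {s,t} \<and>
      (\<forall>x\<in>chamber. act \<tau> (rev U @ w) x \<in> A s \<inter> A t) \<and> length U + len (act \<tau> (rev U @ w)) \<le> n"
proof (induction n arbitrary: w s t)
  case 0
  {
    case 1
    then have "act \<tau> w = act \<tau> []" by (simp add: len_0)
    then show ?case by (auto intro: chamberD)
  next
    case 2
    then have "act \<tau> w = act \<tau> []" by (simp add: len_0)
    then show ?case using 2 by (intro exI[of _ "[]"]) (auto intro: chamberD)
  }
next
  case (Suc n)
  have P: "(\<forall>x\<in>chamber. act \<tau> w x \<in> A s) \<or>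
      ((\<forall>x\<in>chamber. \<tau> s (act \<tau> w x) \<in> A s) \<and> len (act \<tau> (s # w)) < Suc n)"
    if lw: "len (act \<tau> w) = Suc n" for w s
  proof -
    obtain t w' where w': "act \<tau> w = act \<tau> (t # w')" "len (act \<tau> w) = Suc (len (act \<tau> w'))"
      using len_Cons_less[of w] lw by (metis zero_less_Suc)
    then have lw': "len (act \<tau> w') = n" using lw by simp
    have sw: "act \<tau> (u # w) = act \<tau> (u # t # w')" for u using w' by (auto simp: fun_eq_iff)
    show ?thesis
    proof (cases "s = t")
      case True
      have "act \<tau> (s # w) = act \<tau> w'" using sw[of s] True by (auto simp: fun_eq_iff)
      moreover have "\<not> len (act \<tau> (s # w')) < n"
        using w' True lw by (metis Suc_lessD less_irrefl)
      then have "\<forall>x\<in>chamber. act \<tau> w' x \<in> A s"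
        using Suc(1)[OF lw', of s] by blast
      ultimately show ?thesis using lw' w' True by auto
    next
      case False
      \<comment> \<open>With \<open>w'\<close> written as \<open>U\<close> times an element that
        maps the chamber into the sector of \<open>s\<close> and \<open>t\<close>, the position of
        the chamber relative to mirror \<open>s\<close> is decided by the two-letter word
        \<open>t # U\<close>.\<close>
      from Suc(2)[OF lw' False] obtain U where U: "set U \<subseteq> {s,t}"
        "\<forall>x\<in>chamber. act \<tau> (rev U @ w') x \<in> A s \<inter> A t"
        "length U + len (act \<tau> (rev U @ w')) \<le> n" by blast
      have w'U: "act \<tau> w' x = act \<tau> U (act \<tau> (rev U @ w') x)" for x by (simp add: act_append)
      have wU: "act \<tau> w x = act \<tau> (t # U) (act \<tau> (rev U @ w') x)" for x
        using w'(1) w'U by simp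
      from dihedral_dichotomy[OF False, of "t # U"] U(1)
      consider "\<forall>x\<in>A s \<inter> A t. act \<tau> (t # U) x \<in> A s"
        | V' where "\<forall>x\<in>A s \<inter> A t. \<tau> s (act \<tau> (t # U) x) \<in> A s" "length V' < length (t # U)"
           "act \<tau> V' = act \<tau> (s # t # U)" by (auto simp del: act.simps)
      then show ?thesis
      proof cases
        case 1
        then show ?thesis using U(2) wU by metis
      next
        case 2
        have "act \<tau> (s # w) x = act \<tau> (V' @ (rev U @ w')) x" for x
        proof -
          have "act \<tau> (V' @ (rev U @ w')) x = act \<tau> (s # t # U) (act \<tau> (rev U @ w') x)"
            by (subst act_append) (simp only: 2(3))
          then show ?thesis using wU by simp
        qed
        then have "len (act \<tau> (s # w)) = len (act \<tau> (V' @ (rev U @ w')))" by presburger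
        also have "\<dots> \<le> length V' + len (act \<tau> (rev U @ w'))" by (rule len_append)
        finally have "len (act \<tau> (s # w)) < Suc n" using U 2 by simp
        moreover have "\<forall>x\<in>chamber. \<tau> s (act \<tau> w x) \<in> A s" using 2(1) U(2) wU by metis
        ultimately show ?thesis by blast
      qed
    qed
  qed
  {
    case 1
    then show ?case by (rule P)
  next
    case 2
    have Q1: "\<exists>U. set U \<subseteq> {a,b} \<and>
      (\<forall>x\<in>chamber. act \<tau> (rev U @ w) x \<in> A a \<inter> A b) \<and> length U + len (act \<tau> (rev U @ w)) \<le> Suc n"
      if "a \<noteq> b" "\<not> (\<forall>x\<in>chamber. act \<tau> w x \<in> A a)" for a b
    proof -
      have "len (act \<tau> (a # w)) < Suc n" using P[OF 2(1), of a] that by blast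
      moreover have "len (act \<tau> w) \<le> Suc (len (act \<tau> (a # w)))"
      proof -
        have "act \<tau> w = act \<tau> ([a] @ a # w)" by (auto simp: fun_eq_iff)
        then show ?thesis using len_append[of "[a]" "a # w"] by simp
      qed
      ultimately have "len (act \<tau> (a # w)) = n" using 2(1) by simp
      from Suc(2)[OF this that(1)] obtain U where "set U \<subseteq> {a,b}"
        "\<forall>x\<in>chamber. act \<tau> (rev U @ a # w) x \<in> A a \<inter> A b"
        "length U + len (act \<tau> (rev U @ a # w)) \<le> n" by blast
      then show ?thesis by (intro exI[of _ "a # U"]) auto
    qed
    have st: "s \<noteq> t" by (rule 2(2))
    show ?case
    proof (cases "\<forall>x\<in>chamber. act \<tau> w x \<in> A s \<inter> A t")
      case True
      then show ?thesis using 2 by (intro exI[of _ "[]"]) auto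
    next
      case False
      then consider "\<not> (\<forall>x\<in>chamber. act \<tau> w x \<in> A s)" | "\<not> (\<forall>x\<in>chamber. act \<tau> w x \<in> A t)" by blast
      then show ?thesis
      proof cases
        case 1
        then show ?thesis using Q1[OF 2(2)] by blast
      next
        case 2
        then show ?thesis using Q1[of t s] st by (simp add: insert_commute Int_commute)
      qed
    qed
  }
qed

lemma act_in_halfspace:
  assumes "len (act \<tau> w) \<le> len (act \<tau> (s # w))" "x \<in> chamber"
  shows "act \<tau> w x \<in> A s"
  using tits_dichotomy_aux(1)[OF refl, of w s] assms by auto

end

subsection \<open>The hyperboloid model\<close>

definition lor :: "real^3 \<Rightarrow> real^3 \<Rightarrow> real" where
  "lor x y = x$1 * y$1 + x$2 * y$2 - x$3 * y$3"

definition hyperboloid :: "(real^3) set" where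
  "hyperboloid = {x. lor x x = -1 \<and> x$3 > 0}"

definition hdist :: "real^3 \<Rightarrow> real^3 \<Rightarrow> real" where
  "hdist x y = arcosh (- lor x y)"

lemma lor_commute: "lor x y = lor y x"
  by (simp add: lor_def)

lemma lor_linear [simp]:
  "lor (x + y) z = lor x z + lor y z" "lor z (x + y) = lor z x + lor z y"
  "lor (x - y) z = lor x z - lor y z" "lor z (x - y) = lor z x - lor z y"
  "lor (c *\<^sub>R x) z = c * lor x z" "lor z (c *\<^sub>R x) = c * lor z x"
  "lor (- x) z = - lor x z" "lor z (- x) = - lor z x" "lor 0 z = 0" "lor z 0 = 0"
  by (simp_all add: lor_def algebra_simps)

lemma continuous_on_lor [continuous_intros]:
  "continuous_on S f \<Longrightarrow> continuous_on S g \<Longrightarrow> continuous_on S (\<lambda>x. lor (f x) (g x))"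
  unfolding lor_def by (intro continuous_intros)

lemma sum_three_squares_zero:
  fixes a b c :: real
  assumes "a\<^sup>2 + b\<^sup>2 + c\<^sup>2 = 0"
  shows "a = 0" "b = 0"
proof -
  have "a\<^sup>2 \<le> 0" "b\<^sup>2 \<le> 0"
    using assms zero_le_power2[of a] zero_le_power2[of b] zero_le_power2[of c] by linarith+
  then show "a = 0" "b = 0" by auto
qed

lemma lor_hyperboloid:
  assumes "x \<in> hyperboloid" "y \<in> hyperboloid"
  shows "- lor x y \<ge> 1" "lor x y = -1 \<longleftrightarrow> x = y"
proof -
  have x: "(x$3)\<^sup>2 = 1 + (x$1)\<^sup>2 + (x$2)\<^sup>2" "x$3 > 0" and y: "(y$3)\<^sup>2 = 1 + (y$1)\<^sup>2 + (y$2)\<^sup>2" "y$3 > 0"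
    using assms by (auto simp: hyperboloid_def lor_def power2_eq_square)
  let ?c = "1 + x$1 * y$1 + x$2 * y$2"
  \<comment> \<open>Lagrange's identity for the vectors \<open>(1, x$1, x$2)\<close> and
    \<open>(1, y$1, y$2)\<close>: the three extra squares are the defect in the reversed
    Cauchy--Schwarz inequality and settle the case of equality as well.\<close>
  have sq: "(x$3 * y$3)\<^sup>2 = ?c\<^sup>2 + (x$1 - y$1)\<^sup>2 + (x$2 - y$2)\<^sup>2 + (x$1 * y$2 - x$2 * y$1)\<^sup>2"
    unfolding power_mult_distrib x y by (simp add: power2_eq_square algebra_simps)
  then have "?c\<^sup>2 \<le> (x$3 * y$3)\<^sup>2" by simp
  then have "?c \<le> x$3 * y$3" using x y by (meson power2_le_imp_le mult_pos_pos less_imp_le)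
  then show "- lor x y \<ge> 1" by (simp add: lor_def)
  show "lor x y = -1 \<longleftrightarrow> x = y"
  proof
    assume "lor x y = -1"
    then have "x$3 * y$3 = ?c" by (simp add: lor_def)
    with sq have "(x$1 - y$1)\<^sup>2 + (x$2 - y$2)\<^sup>2 + (x$1 * y$2 - x$2 * y$1)\<^sup>2 = 0" by simp
    from sum_three_squares_zero[OF this] have "x$1 - y$1 = 0" "x$2 - y$2 = 0" .
    then have "x$1 = y$1" "x$2 = y$2" by (simp_all only: right_minus_eq)
    then have "(x$3)\<^sup>2 = (y$3)\<^sup>2" unfolding x(1) y(1) by (simp only:)
    then have "x$3 = y$3" using x(2) y(2) power2_eq_imp_eq less_imp_le by blast
    then show "x = y" using \<open>x$1 = y$1\<close> \<open>x$2 = y$2\<close> by (simp add: vec_eq_iff forall_3)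
  next
    assume "x = y" then show "lor x y = -1" using assms by (simp add: hyperboloid_def)
  qed
qed

lemma cosh_hdist: "x \<in> hyperboloid \<Longrightarrow> y \<in> hyperboloid \<Longrightarrow> cosh (hdist x y) = - lor x y"
  unfolding hdist_def using lor_hyperboloid(1)[of x y] by (intro cosh_arcosh_real)

lemma hdist_nonneg: "x \<in> hyperboloid \<Longrightarrow> y \<in> hyperboloid \<Longrightarrow> hdist x y \<ge> 0"
  unfolding hdist_def using lor_hyperboloid(1)[of x y] by (intro arcosh_nonneg_real)

lemma hdist_commute: "hdist x y = hdist y x"
  by (simp add: hdist_def lor_commute)

lemma hdist_eq_0: "x \<in> hyperboloid \<Longrightarrow> y \<in> hyperboloid \<Longrightarrow> hdist x y = 0 \<longleftrightarrow> x = y"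
  by (metis cosh_hdist cosh_0 lor_hyperboloid(2) minus_minus hdist_def arcosh_1)

lemma hdist_eqI:
  "x \<in> hyperboloid \<Longrightarrow> y \<in> hyperboloid \<Longrightarrow> t \<ge> 0 \<Longrightarrow> lor x y = - cosh t \<Longrightarrow> hdist x y = t"
  by (simp add: hdist_def arcosh_cosh_real)

lemma hdist_le_iff:
  "x \<in> hyperboloid \<Longrightarrow> y \<in> hyperboloid \<Longrightarrow> t \<ge> 0 \<Longrightarrow> hdist x y \<le> t \<longleftrightarrow> - lor x y \<le> cosh t"
  by (metis cosh_hdist cosh_real_nonneg_le_iff hdist_nonneg)

lemma hdist_less_iff:
  "x \<in> hyperboloid \<Longrightarrow> y \<in> hyperboloid \<Longrightarrow> t \<ge> 0 \<Longrightarrow> hdist x y < t \<longleftrightarrow> - lor x y < cosh t"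
  by (metis cosh_hdist cosh_real_nonneg_less_iff hdist_nonneg)

text \<open>The form is positive definite on the orthogonal complement of a timelike vector;
  multiplied by \<open>(y$3)\<^sup>2\<close> it becomes a sum of squares.\<close>

lemma lor_orthogonal:
  assumes "y \<in> hyperboloid" "lor v y = 0"
  shows "lor v v \<ge> 0" "lor v v = 0 \<Longrightarrow> v = 0"
proof -
  have y: "(y$3)\<^sup>2 = 1 + (y$1)\<^sup>2 + (y$2)\<^sup>2" "y$3 > 0"
    using assms by (auto simp: hyperboloid_def lor_def power2_eq_square)
  have v: "v$3 * y$3 = v$1 * y$1 + v$2 * y$2" using assms by (simp add: lor_def)
  have "lor v v * (y$3)\<^sup>2 = ((v$1)\<^sup>2 + (v$2)\<^sup>2) * (y$3)\<^sup>2 - (v$3 * y$3)\<^sup>2"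
    by (simp add: lor_def power2_eq_square algebra_simps)
  also have "\<dots> = (v$1)\<^sup>2 + (v$2)\<^sup>2 + (v$1 * y$2 - v$2 * y$1)\<^sup>2"
    unfolding y v by (simp add: power2_eq_square algebra_simps)
  finally have eq: "lor v v * (y$3)\<^sup>2 = (v$1)\<^sup>2 + (v$2)\<^sup>2 + (v$1 * y$2 - v$2 * y$1)\<^sup>2" .
  then have "lor v v * (y$3)\<^sup>2 \<ge> 0" by simp
  then show "lor v v \<ge> 0" using y(2) by (simp add: zero_le_mult_iff)
  assume "lor v v = 0"
  with eq have "(v$1)\<^sup>2 + (v$2)\<^sup>2 + (v$1 * y$2 - v$2 * y$1)\<^sup>2 = 0" by simp
  then have "v$1 = 0" "v$2 = 0" by (rule sum_three_squares_zero)+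
  moreover have "v$3 = 0" using v calculation y(2) by simp
  ultimately show "v = 0" by (simp add: vec_eq_iff forall_3)
qed

lemma lor_Cauchy_Schwarz:
  assumes "y \<in> hyperboloid" "lor u y = 0" "lor v y = 0"
  shows "\<bar>lor u v\<bar> \<le> sqrt (lor u u) * sqrt (lor v v)"
proof (cases "lor v v = 0")
  case True
  then have "v = 0" using lor_orthogonal assms by blast
  then show ?thesis by simp
next
  case False
  then have v: "lor v v > 0" using lor_orthogonal[OF assms(1,3)] by simp
  let ?w = "u - (lor u v / lor v v) *\<^sub>R v"
  have "0 \<le> lor ?w ?w" using lor_orthogonal[OF assms(1), of ?w] assms by simp
  also have "lor ?w ?w = lor u u - (lor u v)\<^sup>2 / lor v v"
    using v by (simp add: lor_commute[of v u] power2_eq_square field_simps)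
  finally have "(lor u v)\<^sup>2 \<le> lor u u * lor v v" using v by (simp add: field_simps)
  then have "sqrt ((lor u v)\<^sup>2) \<le> sqrt (lor u u * lor v v)" by (rule real_sqrt_le_mono)
  then show ?thesis by (simp add: real_sqrt_mult)
qed

lemma hdist_triangle:
  assumes xyz: "x \<in> hyperboloid" "y \<in> hyperboloid" "z \<in> hyperboloid"
  shows "hdist x z \<le> hdist x y + hdist y z"
proof -
  define a where "a = - lor x y"
  define b where "b = - lor y z"
  have ab: "a \<ge> 1" "b \<ge> 1" using lor_hyperboloid xyz by (auto simp: a_def b_def)
  have self: "lor x x = -1" "lor y y = -1" "lor z z = -1" using xyz by (auto simp: hyperboloid_def)
  \<comment> \<open>The parts of \<open>x\<close> and \<open>z\<close> orthogonal to
    \<open>y\<close> have as norms the hyperbolic sines of the two sides; Cauchy--Schwarz replaces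
    the angle at \<open>y\<close> in the law of cosines by a straight one.\<close>
  let ?u = "x - a *\<^sub>R y" and ?v = "z - b *\<^sub>R y"
  have "\<bar>lor ?u ?v\<bar> \<le> sqrt (lor ?u ?u) * sqrt (lor ?v ?v)"
    using xyz by (intro lor_Cauchy_Schwarz[of y]) (simp_all add: self a_def b_def lor_commute)
  moreover have "lor ?u ?v = lor x z + a * b"
    by (simp add: self a_def b_def lor_commute algebra_simps)
  moreover have "lor ?u ?u = a\<^sup>2 - 1" "lor ?v ?v = b\<^sup>2 - 1"
    by (simp_all add: self a_def b_def lor_commute algebra_simps power2_eq_square)
  moreover have "sqrt (a\<^sup>2 - 1) = sinh (hdist x y)" "sqrt (b\<^sup>2 - 1) = sinh (hdist y z)"
    unfolding hdist_def using ab
    by (simp_all add: a_def[symmetric] b_def[symmetric] sinh_arcosh_real)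
  ultimately have "- lor x z \<le> a * b + sinh (hdist x y) * sinh (hdist y z)" by (auto simp: abs_if split: if_splits)
  also have "\<dots> = cosh (hdist x y + hdist y z)"
    using xyz by (simp add: cosh_add cosh_hdist a_def b_def)
  finally show ?thesis using xyz by (subst hdist_le_iff) (auto intro: add_nonneg_nonneg hdist_nonneg)
qed

section \<open>Ptolemy's inequality and the four-point condition\<close>

definition chord :: "real^3 \<Rightarrow> real^3 \<Rightarrow> real" where
  "chord x y = sinh (hdist x y / 2)"

text \<open>Projection to the Poincare disc. \<open>chord\<close> is half the Lorentz length of
  \<open>x - y\<close>; in the disc it becomes the Euclidean distance up to one conformal factor per
  point.\<close>

definition stereo :: "real^3 \<Rightarrow> complex" where
  "stereo x = Complex (x$1 / (1 + x$3)) (x$2 / (1 + x$3))"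

lemma cosh_minus_one: "cosh t - 1 = 2 * (sinh (t/2))\<^sup>2" for t :: real
  using cosh_double[of "t/2"] cosh_square_eq[of "t/2"] by simp

lemma cmod_stereo:
  assumes "x \<in> hyperboloid" "y \<in> hyperboloid"
  shows "cmod (stereo x - stereo y) = 2 * chord x y / (sqrt (1 + x$3) * sqrt (1 + y$3))"
proof -
  have x: "(x$1)\<^sup>2 + (x$2)\<^sup>2 = (x$3 - 1) * (x$3 + 1)" "x$3 > 0"
   and y: "(y$1)\<^sup>2 + (y$2)\<^sup>2 = (y$3 - 1) * (y$3 + 1)" "y$3 > 0"
    using assms by (auto simp: hyperboloid_def lor_def power2_eq_square algebra_simps)
  have "(cmod (stereo x - stereo y))\<^sup>2 =
    ((x$1)\<^sup>2 + (x$2)\<^sup>2) / (1+x$3)\<^sup>2 + ((y$1)\<^sup>2 + (y$2)\<^sup>2) / (1+y$3)\<^sup>2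
     - 2 * (x$1 * y$1 + x$2 * y$2) / ((1+x$3) * (1+y$3))"
    by (simp add: stereo_def cmod_power2 power2_diff power_divide add_divide_distrib diff_divide_distrib algebra_simps)
  also have "((x$1)\<^sup>2 + (x$2)\<^sup>2) / (1+x$3)\<^sup>2 = (x$3 - 1) / (1+x$3)"
    unfolding x(1) using x(2) by (simp add: divide_simps power2_eq_square)
  also have "((y$1)\<^sup>2 + (y$2)\<^sup>2) / (1+y$3)\<^sup>2 = (y$3 - 1) / (1+y$3)"
    unfolding y(1) using y(2) by (simp add: divide_simps power2_eq_square)
  also have "(x$3 - 1) / (1+x$3) + (y$3 - 1) / (1+y$3) - 2 * (x$1 * y$1 + x$2 * y$2) / ((1+x$3) * (1+y$3))
     = 2 * (- lor x y - 1) / ((1+x$3) * (1+y$3))"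
  proof -
    have "1 + x$3 \<noteq> 0" "1 + y$3 \<noteq> 0" using x(2) y(2) by auto
    then show ?thesis by (simp add: lor_def divide_simps) (simp add: algebra_simps)
  qed
  also have "- lor x y - 1 = 2 * (chord x y)\<^sup>2"
    unfolding chord_def cosh_minus_one[symmetric] using assms by (simp add: cosh_hdist)
  also have "2 * (2 * (chord x y)\<^sup>2) / ((1+x$3) * (1+y$3)) = (2 * chord x y / (sqrt (1 + x$3) * sqrt (1 + y$3)))\<^sup>2"
    using x(2) y(2) by (simp add: power_divide power_mult_distrib)
  finally show ?thesis
    by (rule power2_eq_imp_eq) (use assms x(2) y(2) hdist_nonneg in \<open>auto simp: chord_def\<close>)
qed

text \<open>Ptolemy's inequality for four complex numbers, pulled back by \<open>stereo\<close>:
  every product contains each of the four points exactly once, so the conformal factors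
  cancel.\<close>

lemma chord_Ptolemy:
  assumes "x \<in> hyperboloid" "y \<in> hyperboloid" "z \<in> hyperboloid" "w \<in> hyperboloid"
  shows "chord x y * chord z w \<le> chord x z * chord y w + chord x w * chord y z"
proof -
  let ?s = stereo
  have "(?s x - ?s y) * (?s z - ?s w) = (?s x - ?s z) * (?s y - ?s w) - (?s x - ?s w) * (?s y - ?s z)"
    by (simp add: algebra_simps)
  then have "cmod (?s x - ?s y) * cmod (?s z - ?s w) \<le>
      cmod (?s x - ?s z) * cmod (?s y - ?s w) + cmod (?s x - ?s w) * cmod (?s y - ?s z)"
    by (metis norm_mult norm_triangle_ineq4)
  moreover define p where "p v = sqrt (1 + v$3)" for v :: "real^3"
  have p: "p x > 0" "p y > 0" "p z > 0" "p w > 0" using assms by (auto simp: p_def hyperboloid_def)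
  have frac: "(2 * a / (p1 * p2)) * (2 * b / (p3 * p4)) = 4 * (a * b) / (p1 * p2 * p3 * p4)"
    for a b p1 p2 p3 p4 :: real by simp
  ultimately have "4 * (chord x y * chord z w) / (p x * p y * p z * p w) \<le>
     4 * (chord x z * chord y w) / (p x * p z * p y * p w) + 4 * (chord x w * chord y z) / (p x * p w * p y * p z)"
    using assms unfolding frac[symmetric] by (simp add: cmod_stereo p_def)
  also have "\<dots> = 4 * (chord x z * chord y w + chord x w * chord y z) / (p x * p y * p z * p w)"
    by (simp add: mult_ac add_divide_distrib)
  finally show ?thesis using p by (simp add: divide_le_cancel)
qed

text \<open>\<open>sinh (t/2)\<close> is at most half of \<open>exp (t/2)\<close>, and at least a
  quarter of it once \<open>t \<ge> 2 * ln 2\<close>. Logarithms then turn the sum of products into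
  a maximum of sums; the factors combine to 8, whence twice \<open>3 * ln 2\<close>.\<close>

lemma four_point_real:
  fixes a b c d e f :: real
  assumes "a \<ge> 2 * ln 2" "b \<ge> 2 * ln 2" "c \<ge> 0" "d \<ge> 0" "e \<ge> 0" "f \<ge> 0"
    and "sinh (a/2) * sinh (b/2) \<le> sinh (c/2) * sinh (d/2) + sinh (e/2) * sinh (f/2)"
  shows "a + b \<le> max (c + d) (e + f) + 6 * ln 2"
proof -
  have lower: "exp (t/2) / 4 \<le> sinh (t/2)" if "t \<ge> 2 * ln 2" for t :: real
  proof -
    have "exp (ln 2) \<le> exp (t/2)" using that unfolding exp_le_cancel_iff by simp
    then have "exp (t/2) \<ge> 2" by simp
    moreover from this have "exp (-(t/2)) \<le> exp (t/2) / 4"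
      using mult_mono[of 2 "exp (t/2)" 2 "exp (t/2)"] by (simp add: exp_minus field_simps)
    ultimately show ?thesis by (simp add: sinh_field_def)
  qed
  have upper: "sinh (t/2) \<le> exp (t/2) / 2" for t :: real by (simp add: sinh_field_def)
  define M where "M = max (c + d) (e + f)"
  have "exp (a/2) / 4 * (exp (b/2) / 4) \<le> sinh (a/2) * sinh (b/2)"
    using assms by (intro mult_mono lower) (auto intro: order_trans[OF _ assms(1)])
  also have "\<dots> \<le> sinh (c/2) * sinh (d/2) + sinh (e/2) * sinh (f/2)" by fact
  also have "\<dots> \<le> exp (c/2) / 2 * (exp (d/2) / 2) + exp (e/2) / 2 * (exp (f/2) / 2)"
    using assms by (intro add_mono mult_mono upper) auto
  also have "\<dots> = (exp ((c+d)/2) + exp ((e+f)/2)) / 4"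
    by (simp add: exp_add add_divide_distrib)
  also have "\<dots> \<le> exp (M/2) / 2"
  proof -
    have "exp ((c+d)/2) \<le> exp (M/2)" "exp ((e+f)/2) \<le> exp (M/2)"
      unfolding M_def exp_le_cancel_iff by (rule divide_right_mono; simp)+
    moreover have "(p + q) / 4 \<le> m / 2" if "p \<le> m" "q \<le> m" for p q m :: real using that by simp
    ultimately show ?thesis by blast
  qed
  finally have "exp (a/2) * exp (b/2) \<le> 8 * exp (M/2)" by simp
  also have "8 = exp (3 * ln (2::real))" by (simp add: exp_of_nat_mult[of 3, simplified] )
  finally have "exp (a/2 + b/2) \<le> exp (3 * ln 2 + M/2)" by (simp add: exp_add)
  then show ?thesis by (simp add: M_def)
qed

lemma four_point:
  assumes "x \<in> hyperboloid" "y \<in> hyperboloid" "z \<in> hyperboloid" "w \<in> hyperboloid"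
  shows "hdist x y + hdist z w \<le> max (hdist x z + hdist y w) (hdist x w + hdist y z) + 6 * ln 2"
proof -
  note tri = hdist_triangle hdist_commute
  consider "hdist x y \<ge> 2 * ln 2" "hdist z w \<ge> 2 * ln 2" | "hdist x y \<le> 2 * ln 2" | "hdist z w \<le> 2 * ln 2"
    by linarith
  then show ?thesis
  proof cases
    case 1
    then show ?thesis
      using four_point_real[OF 1, of "hdist x z" "hdist y w" "hdist x w" "hdist y z"]
       chord_Ptolemy[OF assms] hdist_nonneg assms by (auto simp: chord_def)
  next
    \<comment> \<open>If one side on the left is short, the triangle inequality alone
      suffices.\<close>
    case 2
    have "hdist z w \<le> hdist x z + hdist x w" "hdist x w \<le> hdist x y + hdist y w"
      using assms hdist_triangle[of z x w] hdist_triangle[of x y w] by (auto simp: hdist_commute)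
    then show ?thesis using 2 ln_gt_zero[of "2::real"] by linarith
  next
    case 3
    have "hdist x y \<le> hdist x z + hdist y z" "hdist y z \<le> hdist z w + hdist y w"
      using assms hdist_triangle[of x z y] hdist_triangle[of y w z] by (auto simp: hdist_commute)
    then show ?thesis using 3 ln_gt_zero[of "2::real"] by linarith
  qed
qed

section \<open>Geodesics, closed balls and convergence\<close>

lemma hyperboloid_sign:
  assumes "lor a a = -1" "x \<in> hyperboloid" "lor x a < 0"
  shows "a \<in> hyperboloid"
proof (rule ccontr)
  assume "a \<notin> hyperboloid"
  then have "a$3 \<le> 0" using assms by (auto simp: hyperboloid_def)
  moreover have "a$3 \<noteq> 0"
  proof
    assume "a$3 = 0"
    then have "lor a a = (a$1)\<^sup>2 + (a$2)\<^sup>2" by (simp add: lor_def power2_eq_square)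
    with assms(1) show False by (smt (verit) zero_le_power2)
  qed
  ultimately have "- a \<in> hyperboloid" using assms by (auto simp: hyperboloid_def)
  from lor_hyperboloid(1)[OF assms(2) this] assms(3) show False by simp
qed

lemma geodesic_point:
  assumes xy: "x \<in> hyperboloid" "y \<in> hyperboloid" and s: "0 \<le> s" "s \<le> hdist x y"
  obtains z where "z \<in> hyperboloid" "hdist x z = s" "hdist z y = hdist x y - s"
proof (cases "x = y")
  case True
  then have "hdist x y = 0" using hdist_eq_0 xy by blast
  then show ?thesis using that[of x] xy s True by auto
next
  case False
  define l where "l = hdist x y"
  have l: "l > 0" using False xy hdist_eq_0[of x y] hdist_nonneg[of x y] by (auto simp: l_def)
  then have sl: "sinh l > 0" by simp
  \<comment> \<open>Hyperbolic analogue of spherical linear interpolation, by distance from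
    \<open>x\<close>.\<close>
  define z where "z = (1 / sinh l) *\<^sub>R (sinh (l - s) *\<^sub>R x + sinh s *\<^sub>R y)"
  have self: "lor x x = -1" "lor y y = -1" "lor x y = - cosh l" "lor y x = - cosh l"
    using xy cosh_hdist[OF xy] lor_commute[of x y] by (auto simp: hyperboloid_def l_def)
  have xz: "lor x z = - cosh s"
    using sl by (simp add: z_def self sinh_diff field_simps)
  have yz: "lor y z = - cosh (l - s)"
  proof -
    have "cosh l * sinh (l - s) + sinh s = sinh l * cosh (l - s)"
      using sinh_diff[of l "l - s"] by (simp add: algebra_simps)
    then show ?thesis using sl by (simp add: z_def self field_simps)
  qed
  have "lor z z = (sinh (l - s) * lor x z + sinh s * lor y z) / sinh l"
    by (subst (1) z_def) (simp add: add_divide_distrib lor_commute)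
  also have "\<dots> = - sinh (l - s + s) / sinh l"
    unfolding xz yz sinh_add by (simp add: field_simps)
  finally have "lor z z = -1" using sl by simp
  then have z: "z \<in> hyperboloid"
    using xz xy cosh_real_pos[of s] by (intro hyperboloid_sign[of z x]) auto
  show ?thesis
  proof (rule that[OF z])
    show "hdist x z = s" using xy z s xz by (intro hdist_eqI)
    show "hdist z y = hdist x y - s"
      using xy z s yz by (intro hdist_eqI) (simp_all add: l_def lor_commute)
  qed
qed

text \<open>The third coordinate is the hyperbolic cosine of the distance to
  \<open>(0, 0, 1)\<close>; the rest is the triangle inequality and
  \<open>cosh (a + b) \<le> 2 * cosh a * cosh b\<close> for nonnegative arguments.\<close>

lemma hyperboloid_height:
  assumes "x \<in> hyperboloid" "y \<in> hyperboloid"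
  shows "y$3 \<le> 2 * x$3 * (- lor x y)"
proof -
  define e where "e = (vector [0, 0, 1] :: real^3)"
  have e: "e \<in> hyperboloid" by (simp add: hyperboloid_def e_def lor_def)
  have c: "cosh (hdist e v) = v$3" if "v \<in> hyperboloid" for v
    using cosh_hdist[OF e that] by (simp add: lor_def e_def)
  have "cosh (hdist e y) \<le> cosh (hdist e x + hdist x y)"
    using hdist_triangle[OF e assms] hdist_nonneg e assms
    by (subst cosh_real_nonneg_le_iff) (auto intro: add_nonneg_nonneg)
  also have "\<dots> \<le> cosh (hdist e x) * cosh (hdist x y) + cosh (hdist e x) * cosh (hdist x y)"
    unfolding cosh_add using hdist_nonneg e assms
    by (intro add_left_mono mult_mono) (auto intro: sinh_le_cosh_real)
  finally show ?thesis using assms by (simp add: c cosh_hdist mult_ac)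
qed

lemma compact_hball:
  assumes "x \<in> hyperboloid"
  shows "compact {y \<in> hyperboloid. hdist x y \<le> r}"
proof (cases "r \<ge> 0")
  case True
  \<comment> \<open>No vector of norm -1 has third coordinate 0, so the open condition in
    \<open>hyperboloid\<close> can be replaced by a closed one.\<close>
  have eq: "{y \<in> hyperboloid. hdist x y \<le> r} = {y. lor y y = -1} \<inter> {y. 0 \<le> y$3} \<inter> {y. - lor x y \<le> cosh r}"
  proof -
    have "y$3 > 0" if "lor y y = -1" "0 \<le> y$3" for y
    proof (rule ccontr)
      assume "\<not> y$3 > 0"
      then have "y$3 = 0" using that by simp
      then have "lor y y = (y$1)\<^sup>2 + (y$2)\<^sup>2" by (simp add: lor_def power2_eq_square)
      then show False using that zero_le_power2[of "y$1"] zero_le_power2[of "y$2"] by linarith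
    qed
    then have "{y. lor y y = -1} \<inter> {y. 0 \<le> y$3} = hyperboloid" by (auto simp: hyperboloid_def)
    then show ?thesis using hdist_le_iff[OF assms _ True] by auto
  qed
  have "closed ({y. lor y y = -1} \<inter> {y. 0 \<le> y$3} \<inter> {y. - lor x y \<le> cosh r})"
    by (intro closed_Int closed_Collect_eq closed_Collect_le continuous_intros)
  then have "closed {y \<in> hyperboloid. hdist x y \<le> r}" using eq by simp
  moreover have "bounded {y \<in> hyperboloid. hdist x y \<le> r}"
  proof (rule boundedI)
    fix y assume "y \<in> {y \<in> hyperboloid. hdist x y \<le> r}"
    then have y: "y \<in> hyperboloid" "- lor x y \<le> cosh r" using hdist_le_iff[OF assms _ True] by auto
    have x3: "x$3 > 0" and y3: "(y$3)\<^sup>2 = 1 + (y$1)\<^sup>2 + (y$2)\<^sup>2" "y$3 > 0"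
      using assms y by (auto simp: hyperboloid_def lor_def power2_eq_square)
    have "(norm y)\<^sup>2 = (y$1)\<^sup>2 + (y$2)\<^sup>2 + (y$3)\<^sup>2"
      unfolding power2_norm_eq_inner by (simp add: inner_vec_def sum_3 power2_eq_square)
    also have "\<dots> \<le> (2 * y$3)\<^sup>2" using y3 by (simp add: power_mult_distrib)
    finally have "norm y \<le> 2 * y$3" by (rule power2_le_imp_le) (use y3(2) in simp)
    also have "y$3 \<le> 2 * x$3 * cosh r"
      by (rule order_trans[OF hyperboloid_height[OF assms y(1)]], rule mult_left_mono[OF y(2)])
        (use x3 in simp)
    finally show "norm y \<le> 2 * (2 * x$3 * cosh r)" by simp
  qed
  ultimately show ?thesis by (simp add: compact_eq_bounded_closed)
next
  case False
  then have "{y \<in> hyperboloid. hdist x y \<le> r} = {}" using hdist_nonneg[OF assms] by force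
  then show ?thesis by (simp only: compact_empty)
qed

text \<open>Connects \<open>hdist\<close> with the Euclidean topology, in which limits are taken:
  the points \<open>z n\<close> eventually stay in a compact ball, and a subsequential limit
  \<open>l\<close> has \<open>lor t l = -1\<close>, which forces \<open>l = t\<close>.\<close>

lemma hdist_LIMSEQ:
  assumes t: "t \<in> hyperboloid" and u: "\<And>n. u n \<in> hyperboloid" and z: "\<And>n. z n \<in> hyperboloid"
    and lim: "u \<longlonglongrightarrow> t" "(\<lambda>n. hdist (u n) (z n)) \<longlonglongrightarrow> 0"
  obtains r where "strict_mono r" "(z \<circ> r) \<longlonglongrightarrow> t"
proof -
  have lu: "(\<lambda>n. lor (f n) (g n)) \<longlonglongrightarrow> lor a b" if "f \<longlonglongrightarrow> a" "g \<longlonglongrightarrow> b"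
    for f g :: "nat \<Rightarrow> real^3" and a b
    unfolding lor_def by (intro tendsto_intros that)
  have cosh_lim: "(\<lambda>n. - lor (u n) (z n)) \<longlonglongrightarrow> 1"
  proof -
    have "(\<lambda>n. cosh (hdist (u n) (z n))) \<longlonglongrightarrow> cosh 0"
      by (intro tendsto_intros lim)
    then show ?thesis using cosh_hdist[OF u z] by simp
  qed
  have "(\<lambda>n. - lor t (u n)) \<longlonglongrightarrow> - lor t t" by (intro tendsto_minus lu tendsto_const lim)
  then have "(\<lambda>n. - lor t (u n)) \<longlonglongrightarrow> 1" using t by (simp add: hyperboloid_def)
  then have "\<forall>\<^sub>F n in sequentially. - lor t (u n) < cosh 1"
    using cosh_real_nonneg_less_iff[of 0 1] by (intro order_tendstoD) auto
  moreover have "\<forall>\<^sub>F n in sequentially. hdist (u n) (z n) < 1"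
    using lim(2) by (intro order_tendstoD) auto
  ultimately have "\<forall>\<^sub>F n in sequentially. z n \<in> {y \<in> hyperboloid. hdist t y \<le> 2}"
  proof eventually_elim
    case (elim n)
    have "hdist t (u n) < 1" using elim(1) t u by (simp add: hdist_less_iff)
    then show ?case using elim hdist_triangle[OF t u z, of n n] z by auto
  qed
  then obtain N where N: "\<And>n. n \<ge> N \<Longrightarrow> z n \<in> {y \<in> hyperboloid. hdist t y \<le> 2}"
    by (auto simp: eventually_sequentially)
  then have "\<forall>n. z (n + N) \<in> {y \<in> hyperboloid. hdist t y \<le> 2}" by auto
  with compact_hball[OF t, of 2, unfolded compact_def] obtain l r where
    l: "l \<in> hyperboloid" and r: "strict_mono (r :: nat \<Rightarrow> nat)" "((\<lambda>n. z (n + N)) \<circ> r) \<longlonglongrightarrow> l"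
    by (metis (mono_tags, lifting) mem_Collect_eq)
  define r' where "r' n = r n + N" for n
  have r': "strict_mono r'" using r(1) by (auto simp: r'_def strict_mono_def)
  have zr: "(z \<circ> r') \<longlonglongrightarrow> l" using r(2) by (simp add: r'_def o_def)
  have "(\<lambda>n. - lor ((u \<circ> r') n) ((z \<circ> r') n)) \<longlonglongrightarrow> - lor t l"
    by (intro tendsto_minus lu zr LIMSEQ_subseq_LIMSEQ[OF lim(1) r'])
  moreover have "(\<lambda>n. - lor ((u \<circ> r') n) ((z \<circ> r') n)) \<longlonglongrightarrow> 1"
    using LIMSEQ_subseq_LIMSEQ[OF cosh_lim r'] by (simp add: o_def)
  ultimately have "- lor t l = 1" by (rule LIMSEQ_unique)
  then have "lor t l = -1" by simp
  then have "t = l" using lor_hyperboloid(2)[OF t l] by simp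
  then show ?thesis using that r' zr by blast
qed

subsection \<open>Discrete groups of isometries\<close>

definition lorentz_map :: "(real^3 \<Rightarrow> real^3) \<Rightarrow> bool" where
  "lorentz_map f \<longleftrightarrow> linear f \<and> (\<forall>x y. lor (f x) (f y) = lor x y) \<and> f ` hyperboloid \<subseteq> hyperboloid"

lemma lorentz_mapD:
  assumes "lorentz_map f"
  shows "linear f" "lor (f x) (f y) = lor x y" "x \<in> hyperboloid \<Longrightarrow> f x \<in> hyperboloid"
    "f (a + b) = f a + f b" "f (a - b) = f a - f b" "f (c *\<^sub>R a) = c *\<^sub>R f a"
    "hdist (f x) (f y) = hdist x y" "f 0 = 0"
  using assms unfolding lorentz_map_def hdist_def
  by (auto simp: linear_add linear_diff linear_scale linear_0)

definition base :: "real^3" where "base = vector [0, 0, 1]"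

lemma base: "base \<in> hyperboloid"
  by (simp add: base_def hyperboloid_def lor_def)

lemma null_vector_sign:
  assumes "lor n n = 0" "n \<noteq> 0" "y \<in> hyperboloid"
  shows "n$3 > 0 \<longleftrightarrow> lor n y < 0" "lor n y \<noteq> 0"
proof -
  have y: "(y$3)\<^sup>2 = 1 + (y$1)\<^sup>2 + (y$2)\<^sup>2" "y$3 > 0" and n: "(n$3)\<^sup>2 = (n$1)\<^sup>2 + (n$2)\<^sup>2"
    using assms by (auto simp: hyperboloid_def lor_def power2_eq_square)
  have n3: "n$3 \<noteq> 0"
  proof
    assume z: "n$3 = 0"
    with n have "(n$1)\<^sup>2 + (n$2)\<^sup>2 + 0\<^sup>2 = 0" by simp
    from sum_three_squares_zero[OF this] z assms(2) show False by (simp add: vec_eq_iff forall_3)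
  qed
  have "(n$3 * y$3)\<^sup>2 = (n$1 * y$1 + n$2 * y$2)\<^sup>2 + (n$1 * y$2 - n$2 * y$1)\<^sup>2 + (n$3)\<^sup>2"
    unfolding power_mult_distrib n y(1) by (simp add: power2_eq_square algebra_simps)
  then have "(n$1 * y$1 + n$2 * y$2)\<^sup>2 < (n$3 * y$3)\<^sup>2" using n3
    by (smt (verit) zero_le_power2 zero_less_power2)
  then have "\<bar>n$1 * y$1 + n$2 * y$2\<bar> < \<bar>n$3 * y$3\<bar>" by (simp add: abs_le_square_iff[symmetric] not_le[symmetric])
  moreover have "\<bar>n$3 * y$3\<bar> = (if n$3 > 0 then n$3 * y$3 else - (n$3 * y$3))"
    using y(2) n3 by (auto simp: abs_mult)
  moreover have "lor n y = (n$1 * y$1 + n$2 * y$2) - n$3 * y$3" by (simp add: lor_def)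
  ultimately show "n$3 > 0 \<longleftrightarrow> lor n y < 0" "lor n y \<noteq> 0" by (auto split: if_splits)
qed

text \<open>The inverse \<open>N\<close> of the matrix \<open>M\<close> is conjugate to its
  transpose by \<open>J\<close>, so \<open>det (M - 1) = det (1 - N) = det (1 - M\<^sup>T) = - det
  (M - 1)\<close>; the last sign comes from the odd dimension.\<close>

lemma eigenvalue_one:
  assumes f: "lorentz_map f" and det: "det (matrix f) = 1"
  obtains e where "e \<noteq> 0" "f e = e"
proof -
  define J :: "real^3^3" where "J = (\<chi> i j. if i = j then (if i = 3 then -1 else 1) else 0)"
  let ?M = "matrix f"
  have J1: "transpose J = J" by (simp add: J_def transpose_def vec_eq_iff)
  have J2: "J ** J = mat 1" by (simp add: J_def matrix_matrix_mult_def mat_def vec_eq_iff forall_3 sum_3)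
  have J3: "det J = -1" unfolding det_3 by (simp add: J_def)
  note J = J1 J2 J3
  have lorJ: "lor x y = x \<bullet> (J *v y)" for x y
    by (simp add: lor_def J_def inner_vec_def matrix_vector_mult_def sum_3)
  have Mv: "?M *v x = f x" for x using lorentz_mapD(1)[OF f] by (simp add: matrix_works)
  have adj: "x \<bullet> (transpose A *v w) = (A *v x) \<bullet> w" for A :: "real^3^3" and x w
    by (metis dot_lmul_matrix inner_commute transpose_matrix_vector)
  have "x \<bullet> ((transpose ?M ** J ** ?M) *v y) = x \<bullet> (J *v y)" for x y
  proof -
    have "x \<bullet> ((transpose ?M ** J ** ?M) *v y) = (?M *v x) \<bullet> (J *v (?M *v y))"
      by (simp only: matrix_vector_mul_assoc[symmetric] adj)
    also have "\<dots> = lor (f x) (f y)" unfolding lorJ Mv ..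
    also have "\<dots> = x \<bullet> (J *v y)" using lorentz_mapD(2)[OF f] lorJ by simp
    finally show ?thesis .
  qed
  then have "(transpose ?M ** J ** ?M) *v y = J *v y" for y
    by (metis vector_eq_ldot)
  then have *: "transpose ?M ** J ** ?M = J" by (simp add: matrix_eq)
  define N where "N = J ** transpose ?M ** J"
  have NM: "N ** ?M = mat 1" unfolding N_def using * J(2) by (metis matrix_mul_assoc)
  have sub: "A ** (B - C) = A ** B - A ** C" "(B - C) ** A = B ** A - C ** A" for A B C :: "real^3^3"
    by (simp_all add: matrix_matrix_mult_def vec_eq_iff sum_subtractf algebra_simps)
  have "det N = 1" by (simp add: N_def det_mul J det)
  then have "det (?M - mat 1) = det (N ** (?M - mat 1))" by (simp add: det_mul)
  also have "N ** (?M - mat 1) = mat 1 - N"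
    by (simp add: sub NM)
  also have "mat 1 - N = J ** (mat 1 - transpose ?M) ** J"
    unfolding N_def using J by (simp add: sub)
  also have "det (J ** (mat 1 - transpose ?M) ** J) = det (mat 1 - transpose ?M)"
    by (simp add: det_mul J)
  also have "mat 1 - transpose ?M = transpose (mat 1 - ?M)"
    by (simp add: transpose_def mat_def vec_eq_iff)
  also have "det (transpose (mat 1 - ?M)) = det (- (?M - mat 1))" by (simp add: det_transpose)
  also have "\<dots> = - det (?M - mat 1)"
  proof -
    have "det (- A) = - det A" for A :: "real^3^3" by (simp add: det_3 algebra_simps)
    then show ?thesis .
  qed
  finally have "det (?M - mat 1) = 0" by simp
  then have "\<not> invertible (?M - mat 1)" using invertible_det_nz by blast
  then obtain e where e: "(?M - mat 1) *v e = 0" "e \<noteq> 0"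
    using matrix_left_invertible_ker invertible_left_inverse by metis
  then have "?M *v e = e" by (simp add: matrix_vector_mult_diff_rdistrib)
  then show ?thesis using that e(2) Mv by simp
qed

text \<open>Parabolic maps are excluded because their displacement tends to zero towards the fixed null vector.\<close>

lemma spacelike_axis:
  assumes f: "lorentz_map f" and det: "det (matrix f) = 1"
    and eps: "\<epsilon> > 0" "\<And>z. z \<in> hyperboloid \<Longrightarrow> hdist z (f z) \<ge> \<epsilon>"
  obtains e where "lor e e = 1" "f e = e"
proof -
  note fD = lorentz_mapD[OF f]
  obtain e where e: "e \<noteq> 0" "f e = e" by (rule eigenvalue_one[OF f det])
  have nofix: "f z \<noteq> z" if "z \<in> hyperboloid" for z
    using eps(2)[OF that] eps(1) hdist_eq_0[OF that that] by auto
  consider "lor e e < 0" | "lor e e = 0" | "lor e e > 0" by linarith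
  then show ?thesis
  proof cases
    case 1
    define z where "z = (1 / sqrt (- lor e e)) *\<^sub>R e"
    have "lor z z = -1" "f z = z" using 1 e by (simp_all add: z_def fD)
    moreover have "z \<in> hyperboloid \<or> - z \<in> hyperboloid"
    proof -
      have "lor base z \<noteq> 0"
        using lor_orthogonal(1)[OF base, of z] \<open>lor z z = -1\<close> by (auto simp: lor_commute)
      then consider "lor base z < 0" | "lor base (- z) < 0" by fastforce
      then show ?thesis using hyperboloid_sign[OF _ base] \<open>lor z z = -1\<close> by cases auto
    qed
    moreover have "f (- z) = - z" using fD(6)[of "-1" z] \<open>f z = z\<close> by simp
    ultimately show ?thesis using nofix by blast
  next
    case 2
    define n where "n = (if lor e base < 0 then e else - e)"
    have n: "lor n n = 0" "n \<noteq> 0" "f n = n"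
      using e 2 fD(6)[of "-1" e] by (auto simp: n_def)
    have nb: "lor n base < 0" using null_vector_sign(2)[OF n(1,2) base] by (auto simp: n_def)
    then have n3: "n$3 > 0" using null_vector_sign(1)[OF n(1,2) base] by blast
    define \<beta> where "\<beta> = - 2 * lor base n"
    have \<beta>: "\<beta> > 0" using nb by (simp add: \<beta>_def lor_commute)
    define c where "c = - lor base (f base)"
    define C where "C = cosh \<epsilon>"
    have C: "C > 1" unfolding C_def using cosh_real_nonneg_less_iff[of 0 \<epsilon>] eps by simp
    \<comment> \<open>On the ray from \<open>base\<close> towards the null direction
      \<open>n\<close> the displacement has hyperbolic cosine
      \<open>(c + s * \<beta>) / (1 + s * \<beta>)\<close>. This tends to 1, although it is bounded
      below by \<open>C > 1\<close>.\<close>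
    have ineq: "c + s * \<beta> \<ge> C * (1 + s * \<beta>)" if s: "s \<ge> 0" for s
    proof -
      have pos: "1 + s * \<beta> > 0" using s \<beta> by (smt (verit) mult_nonneg_nonneg)
      define w where "w = base + s *\<^sub>R n"
      define z where "z = (1 / sqrt (1 + s * \<beta>)) *\<^sub>R w"
      have bb: "lor base base = -1" using base by (simp add: hyperboloid_def)
      have "lor w w = - (1 + s * \<beta>)"
        by (simp add: w_def n bb \<beta>_def lor_commute algebra_simps)
      then have "lor z z = -1" using pos by (simp add: z_def field_simps)
      moreover have "z$3 > 0" using pos n3 s by (simp add: z_def w_def base_def add_pos_nonneg)
      ultimately have z: "z \<in> hyperboloid" by (simp add: hyperboloid_def)
      have "lor base n = lor (f base) n" using fD(2)[of base n] n by simp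
      then have "lor w (f w) = - (c + s * \<beta>)"
        by (simp add: w_def fD n c_def \<beta>_def lor_commute algebra_simps)
      then have "- lor z (f z) = (c + s * \<beta>) / (1 + s * \<beta>)"
        using pos by (simp add: z_def fD minus_divide_left)
      moreover have "- lor z (f z) \<ge> C"
        using eps(2)[OF z] hdist_less_iff[OF z fD(3)[OF z], of \<epsilon>] eps(1) by (simp add: C_def)
      ultimately show ?thesis using pos by (simp add: field_simps)
    qed
    define s where "s = (\<bar>c\<bar> + 1) / (\<beta> * (C - 1))"
    have "s \<ge> 0" using \<beta> C by (simp add: s_def)
    from ineq[OF this] have "s * \<beta> * (C - 1) \<le> c - C" by (simp add: algebra_simps)
    moreover have "s * \<beta> * (C - 1) = \<bar>c\<bar> + 1" using \<beta> C by (simp add: s_def)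
    ultimately show ?thesis using C by simp
  next
    case 3
    then show ?thesis using that[of "(1 / sqrt (lor e e)) *\<^sub>R e"] e by (simp add: fD)
  qed
qed

text \<open>\<open>a\<close> is the foot of the perpendicular from \<open>z\<close> to the geodesic
  with pole \<open>e\<close>, and \<open>lor z e\<close> is the hyperbolic sine of the signed
  distance.\<close>

lemma foot_on_axis:
  assumes e: "lor e e = 1" and z: "z \<in> hyperboloid"
  obtains a where "a \<in> hyperboloid" "lor a e = 0" "z = sqrt (1 + (lor z e)\<^sup>2) *\<^sub>R a + lor z e *\<^sub>R e"
proof -
  define q where "q = lor z e"
  define s where "s = sqrt (1 + q\<^sup>2)"
  have s: "s > 0" "s\<^sup>2 = 1 + q\<^sup>2" by (auto simp: s_def add_pos_nonneg)
  define w where "w = z - q *\<^sub>R e"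
  define a where "a = (1/s) *\<^sub>R w"
  have zz: "lor z z = -1" "lor z e = q" "lor e z = q" using z by (auto simp: hyperboloid_def q_def lor_commute)
  have "lor w w = - s\<^sup>2"
    unfolding s(2) w_def by (simp add: zz e power2_eq_square)
  then have aa: "lor a a = -1" using s(1) by (simp add: a_def power2_eq_square)
  have "lor z a = - s\<^sup>2 / s" unfolding s(2) by (simp add: a_def w_def zz power2_eq_square)
  then have "lor z a < 0" using s(1) by (simp add: power2_eq_square)
  then have "a \<in> hyperboloid" by (intro hyperboloid_sign[OF aa z])
  moreover have "lor a e = 0" by (simp add: a_def w_def zz e)
  moreover have "z = s *\<^sub>R a + q *\<^sub>R e" using s(1) by (simp add: a_def w_def)
  ultimately show ?thesis using that by (simp add: s_def q_def)
qed

text \<open>The third vector is the Lorentzian cross product, which is the Euclidean one followed by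
  the sign change \<open>J\<close>. A vector orthogonal to all three is a multiple of
  \<open>b\<close> by the triple product identity, hence 0.\<close>

lemma orthogonal_frame:
  assumes e: "lor e e = 1" and a: "lor a a = -1" "lor a e = 0"
  obtains b where "lor b b = 1" "lor a b = 0" "lor b e = 0"
    "\<And>x. x = (- lor x a) *\<^sub>R a + lor x b *\<^sub>R b + lor x e *\<^sub>R e"
proof -
  define J :: "real^3 \<Rightarrow> real^3" where "J x = vector [x$1, x$2, - x$3]" for x
  have lorJ: "lor x y = x \<bullet> J y" for x y
    by (simp add: lor_def J_def inner_vec_def sum_3)
  have JJ: "J (J x) = x" for x by (simp add: J_def vec_eq_iff forall_3)
  define c where "c = cross3 e a"
  define b where "b = J c"
  have bx: "lor b x = c \<bullet> x" "lor x b = c \<bullet> x" for x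
    by (simp_all add: lor_def b_def J_def inner_vec_def sum_3)
  have "lor b b = - (lor e e * lor a a - (lor a e)\<^sup>2)"
    by (simp add: lor_def b_def J_def c_def cross3_def power2_eq_square algebra_simps)
  then have bb: "lor b b = 1" using e a by simp
  have ba: "lor a b = 0" and be: "lor b e = 0"
    by (simp_all add: bx c_def dot_cross_self)
  have "c \<noteq> 0" using bb by (auto simp: bx)
  have zero: "y = 0" if "lor y a = 0" "lor y b = 0" "lor y e = 0" for y
  proof -
    let ?w = "J y"
    have "a \<bullet> ?w = 0" "e \<bullet> ?w = 0" using that by (simp_all add: lorJ[symmetric] lor_commute)
    then have "cross3 ?w c = 0" by (simp add: c_def Lagrange inner_commute)
    then have "0 = cross3 c (cross3 ?w c)" by simp
    also have "\<dots> = (c \<bullet> c) *\<^sub>R ?w - (c \<bullet> ?w) *\<^sub>R c" by (simp add: Lagrange)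
    finally have "(c \<bullet> c) *\<^sub>R ?w = (c \<bullet> ?w) *\<^sub>R c" by simp
    then have "?w = ((c \<bullet> ?w) / (c \<bullet> c)) *\<^sub>R c" using \<open>c \<noteq> 0\<close>
      by (simp add: eq_vector_fraction_iff field_simps vector_fraction_eq_iff)
    then obtain t where t: "?w = t *\<^sub>R c" by blast
    have "y = J ?w" by (simp add: JJ)
    also have "\<dots> = t *\<^sub>R b" unfolding t by (simp add: J_def b_def vec_eq_iff forall_3)
    finally have "y = t *\<^sub>R b" .
    with that bb show ?thesis by simp
  qed
  have "x = (- lor x a) *\<^sub>R a + lor x b *\<^sub>R b + lor x e *\<^sub>R e" for x
  proof -
    have "x - ((- lor x a) *\<^sub>R a + lor x b *\<^sub>R b + lor x e *\<^sub>R e) = 0"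
      by (rule zero) (use e a bb ba be in \<open>simp_all add: lor_commute\<close>)
    then show ?thesis by simp
  qed
  then show ?thesis using that bb ba be by blast
qed

text \<open>A map fixing the pole of a geodesic either scales the two null directions of the geodesic
  reciprocally, or swaps them and then has a fixed point on the geodesic.\<close>

lemma axis_scaling:
  assumes f: "lorentz_map f" and e: "lor e e = 1" "f e = e"
    and a: "a \<in> hyperboloid" "lor a e = 0" and b: "lor b b = 1" "lor a b = 0" "lor b e = 0"
    and frame: "\<And>x. x = (- lor x a) *\<^sub>R a + lor x b *\<^sub>R b + lor x e *\<^sub>R e"
    and free: "\<And>z. z \<in> hyperboloid \<Longrightarrow> f z = z \<Longrightarrow> f = id"
  obtains l where "l > 0" "f (a + b) = l *\<^sub>R (a + b)" "f (a - b) = (1 / l) *\<^sub>R (a - b)"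
proof (cases "f = id")
  case True
  then show ?thesis using that[of 1] by simp
next
  case False
  note fD = lorentz_mapD[OF f]
  have aa: "lor a a = -1" using a by (simp add: hyperboloid_def)
  have ba: "lor b a = 0" using b by (simp add: lor_commute)
  \<comment> \<open>The plane orthogonal to \<open>e\<close> contains just two null lines, spanned
    by \<open>a + b\<close> and \<open>a - b\<close>; a future null vector of this plane goes to a
    positive multiple of one of these two vectors.\<close>
  have null: "\<exists>\<mu>>0. f n = \<mu> *\<^sub>R (a + b) \<or> f n = \<mu> *\<^sub>R (a - b)"
    if n: "lor n n = 0" "lor n e = 0" "lor n a < 0" for n
  proof -
    have fn: "lor (f n) (f n) = 0" "lor (f n) e = 0"
      using n fD(2)[of n e] fD(2)[of n n] e by simp_all
    define \<alpha> where "\<alpha> = - lor (f n) a"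
    define \<beta> where "\<beta> = lor (f n) b"
    have eq: "f n = \<alpha> *\<^sub>R a + \<beta> *\<^sub>R b" using frame[of "f n"] fn by (simp add: \<alpha>_def \<beta>_def)
    have "lor (f n) (f n) = \<beta>\<^sup>2 - \<alpha>\<^sup>2"
      unfolding eq by (simp add: aa b ba power2_eq_square algebra_simps)
    then have ab: "\<beta> = \<alpha> \<or> \<beta> = - \<alpha>" using fn by (simp add: power2_eq_iff)
    have n0: "n \<noteq> 0" using n by auto
    have "n$3 > 0" using null_vector_sign(1)[OF n(1) n0 a(1)] n by blast
    have fn0: "f n \<noteq> 0" using fD(2)[of n a] n(3) by auto
    have "lor (f n) (f a) < 0" using n fD(2)[of n a] by simp
    then have "(f n)$3 > 0" using null_vector_sign(1)[OF fn(1) fn0 fD(3)[OF a(1)]] by simp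
    then have "lor (f n) a < 0" using null_vector_sign(1)[OF fn(1) fn0 a(1)] by simp
    then have "\<alpha> > 0" by (simp add: \<alpha>_def)
    with ab eq show ?thesis by (auto simp: algebra_simps)
  qed
  have n: "lor (a + b) (a + b) = 0" "lor (a + b) e = 0" "lor (a + b) a < 0"
    "lor (a - b) (a - b) = 0" "lor (a - b) e = 0" "lor (a - b) a < 0"
    "lor (a + b) (a - b) = -2" "lor (a - b) (a + b) = -2" using a b aa ba by auto
  obtain \<mu> where \<mu>: "\<mu> > 0" "f (a + b) = \<mu> *\<^sub>R (a + b) \<or> f (a + b) = \<mu> *\<^sub>R (a - b)"
    using null[OF n(1-3)] by blast
  obtain \<nu> where \<nu>: "\<nu> > 0" "f (a - b) = \<nu> *\<^sub>R (a + b) \<or> f (a - b) = \<nu> *\<^sub>R (a - b)"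
    using null[OF n(4-6)] by blast
  have pres: "lor (f (a + b)) (f (a - b)) = -2" using fD(2) n by simp
  consider "f (a + b) = \<mu> *\<^sub>R (a + b)" "f (a - b) = \<nu> *\<^sub>R (a - b)"
    | "f (a + b) = \<mu> *\<^sub>R (a - b)" "f (a - b) = \<nu> *\<^sub>R (a + b)"
    using \<mu>(2) \<nu>(2) pres n by (auto simp del: lor_linear(1-4))
  then show ?thesis
  proof cases
    case 1
    then have "\<nu> * (\<mu> * -2) = -2" using pres n(7,8) by (simp only: lor_linear(5,6))
    then have "\<mu> * \<nu> = 1" by (simp add: mult.commute)
    then have "\<nu> = 1 / \<mu>" using \<mu> by (simp add: field_simps)
    then show ?thesis using that[of \<mu>] \<mu> 1 by simp
  next
    case 2
    then have "\<nu> * (\<mu> * -2) = -2" using pres n(7,8) by (simp only: lor_linear(5,6))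
    then have mn: "\<mu> * \<nu> = 1" by (simp add: mult.commute)
    \<comment> \<open>If the null lines are swapped, this timelike combination is fixed, and its
      normalisation is a fixed point on the geodesic.\<close>
    define w where "w = (a + b) + \<mu> *\<^sub>R (a - b)"
    define z where "z = (1 / (2 * sqrt \<mu>)) *\<^sub>R w"
    have "f w = w"
    proof -
      have "f w = f (a + b) + \<mu> *\<^sub>R f (a - b)"
        unfolding w_def using fD(4)[of "a + b" "\<mu> *\<^sub>R (a - b)"] fD(6)[of \<mu> "a - b"] by simp
      then show ?thesis using mn by (simp add: 2 w_def)
    qed
    then have fz: "f z = z" by (simp add: z_def fD)
    have "lor w w = - 4 * \<mu>" by (simp add: w_def aa b ba algebra_simps)
    then have zz: "lor z z = -1" using \<mu> by (simp add: z_def)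
    have "lor a w = - 1 - \<mu>" by (simp add: w_def aa b algebra_simps)
    then have "lor a z < 0" using \<mu> by (simp add: z_def divide_neg_pos)
    then have "z \<in> hyperboloid" by (intro hyperboloid_sign[OF zz a(1)])
    with free fz False show ?thesis by blast
  qed
qed

text \<open>The classical argument that a discrete subgroup of the reals is cyclic, transported
  through \<open>L\<close>, which the gap at 0 makes injective on \<open>H\<close>.\<close>

lemma additive_cyclic:
  fixes G (structure)
  assumes "group G" and H: "subgroup H G" and \<epsilon>: "\<epsilon> > 0" and xH: "x \<in> H" "x \<noteq> \<one>"
    and hom: "\<And>f g. f \<in> H \<Longrightarrow> g \<in> H \<Longrightarrow> L (f \<otimes> g) = L f + (L g :: real)"
    and sep: "\<And>f. f \<in> H \<Longrightarrow> f \<noteq> \<one> \<Longrightarrow> \<bar>L f\<bar> \<ge> \<epsilon>"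
  obtains c where "c \<in> H" "\<And>f. f \<in> H \<Longrightarrow> \<exists>j::int. f = c [^] j"
proof -
  interpret group G by fact
  note HG = subgroup.subset[OF H, THEN subsetD] and H1 = subgroup.one_closed[OF H]
    and Hm = subgroup.m_closed[OF H] and Hi = subgroup.m_inv_closed[OF H]
  have L1: "L \<one> = 0" using hom[OF H1 H1] by simp
  have Linv: "L (inv f) = - L f" if "f \<in> H" for f
    using hom[OF Hi[OF that] that] HG[OF that] L1 by simp
  have powH: "f [^] (n::nat) \<in> H" "L (f [^] n) = real n * L f" if "f \<in> H" for f n
    by (induction n) (use that H1 Hm hom L1 in \<open>auto simp: algebra_simps\<close>)
  have ipowH: "f [^] (j::int) \<in> H \<and> L (f [^] j) = of_int j * L f" if "f \<in> H" for f j
    using powH[OF that] Hi Linv HG[OF that] by (cases j rule: int_cases2) (auto simp: int_pow_int int_pow_neg)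
  define P where "P = {L f | f. f \<in> H \<and> L f > 0}"
  have "P \<noteq> {}"
  proof -
    have "\<bar>L x\<bar> \<ge> \<epsilon>" by (rule sep) (use xH in auto)
    then have "L x > 0 \<or> L (inv x) > 0" using Linv[OF xH(1)] \<epsilon> by auto
    then show ?thesis using xH Hi by (auto simp: P_def)
  qed
  moreover have lower: "t \<ge> \<epsilon>" if "t \<in> P" for t
    using that sep L1 by (force simp: P_def)
  ultimately have "Inf P \<ge> \<epsilon>" by (intro cInf_greatest)
  obtain t where t: "t \<in> P" "t < Inf P + \<epsilon>"
    using cInf_lessD[OF \<open>P \<noteq> {}\<close>, of "Inf P + \<epsilon>"] \<epsilon> by auto
  then obtain c where c: "c \<in> H" "L c > 0" "L c < Inf P + \<epsilon>" by (auto simp: P_def)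
  have bdd: "bdd_below P" using lower by (meson bdd_belowI)
  have min: "L f \<ge> L c" if "f \<in> H" "L f > 0" for f
  proof (rule ccontr)
    assume "\<not> L f \<ge> L c"
    moreover have "Inf P \<le> L f" using that bdd by (intro cInf_lower) (auto simp: P_def)
    \<comment> \<open>Both values lie between \<open>Inf P\<close> and
      \<open>Inf P + \<epsilon>\<close>, so their difference would be a positive value of
      \<open>L\<close> inside the gap.\<close>
    ultimately have "L (c \<otimes> inv f) > 0" "L (c \<otimes> inv f) < \<epsilon>"
      using hom[OF c(1) Hi[OF that(1)]] Linv[OF that(1)] c by auto
    moreover have "L (c \<otimes> inv f) \<in> P" using calculation Hm[OF c(1) Hi[OF that(1)]] by (auto simp: P_def)
    ultimately show False using lower by force
  qed
  show ?thesis
  proof (rule that[OF c(1)])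
    fix f assume f: "f \<in> H"
    define j where "j = \<lfloor>L f / L c\<rfloor>"
    define r where "r = f \<otimes> inv (c [^] j)"
    have cj: "c [^] j \<in> H" "L (c [^] j) = of_int j * L c" using ipowH[OF c(1)] by auto
    have r: "r \<in> H" "L r = L f - of_int j * L c"
      using f cj Hm Hi hom[OF f Hi[OF cj(1)]] Linv[OF cj(1)] by (auto simp: r_def)
    have "of_int j \<le> L f / L c" "L f / L c < of_int j + 1" unfolding j_def by linarith+
    then have "0 \<le> L r" "L r < L c" using c(2) r(2) by (simp_all add: field_simps)
    then have "L r = 0" using min[OF r(1)] by force
    then have "r = \<one>" using sep[OF r(1)] \<epsilon> by auto
    then have "f = c [^] j" using f cj HG unfolding r_def
      by (metis group.inv_equality inv_inv is_group inv_closed)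
    then show "\<exists>j::int. f = c [^] j" by blast
  qed
qed

text \<open>A cocompact group of orientation preserving isometries. The uniform displacement
  \<open>\<epsilon>\<close> yields at once freeness, discreteness and the exclusion of elliptic and
  parabolic elements; \<open>D\<close> bounds the covering radius of the orbit of
  \<open>o'\<close>.\<close>

locale lorentz_group = group G for G (structure) +
  fixes \<rho> :: "'g \<Rightarrow> real^3 \<Rightarrow> real^3" and o' :: "real^3" and \<epsilon> D :: real
  assumes hom: "x \<in> carrier G \<Longrightarrow> y \<in> carrier G \<Longrightarrow> \<rho> (x \<otimes> y) = \<rho> x \<circ> \<rho> y"
    and lorentz: "x \<in> carrier G \<Longrightarrow> lorentz_map (\<rho> x)"
    and det: "x \<in> carrier G \<Longrightarrow> det (matrix (\<rho> x)) = 1"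
    and eps: "\<epsilon> > 0"
    and free: "x \<in> carrier G \<Longrightarrow> x \<noteq> \<one> \<Longrightarrow> z \<in> hyperboloid \<Longrightarrow> hdist z (\<rho> x z) \<ge> \<epsilon>"
    and o': "o' \<in> hyperboloid"
    and cobounded: "z \<in> hyperboloid \<Longrightarrow> \<exists>x\<in>carrier G. hdist z (\<rho> x o') \<le> D"
begin

lemma rho_one: "\<rho> \<one> = id"
proof -
  have l: "lorentz_map (\<rho> \<one>)" by (simp add: lorentz)
  have "\<rho> \<one> (\<rho> \<one> v) = \<rho> \<one> v" for v using hom[of \<one> \<one>] by (metis comp_apply one_closed r_one)
  then have "lor (v - \<rho> \<one> v) w = 0" for v w
    using lorentz_mapD(2)[OF l, of "v - \<rho> \<one> v" w] lorentz_mapD(2)[OF l, of v w]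
    by (metis lorentz_mapD(2,5,8)[OF l] diff_self lor_linear(9))
  then have "\<rho> \<one> v = v" for v
  proof -
    assume "\<And>v w. lor (v - \<rho> \<one> v) w = 0"
    from this[of v "axis 1 1"] this[of v "axis 2 1"] this[of v "axis 3 1"]
    show ?thesis by (simp add: lor_def axis_def vec_eq_iff forall_3)
  qed
  then show ?thesis by auto
qed

lemma rho_pow: "x \<in> carrier G \<Longrightarrow> \<rho> (x [^] (n::nat)) = (\<rho> x) ^^ n"
  by (induction n) (simp_all add: rho_one hom funpow_swap1 fun_eq_iff)

lemma rho_fixed:
  assumes "x \<in> carrier G" "z \<in> hyperboloid" "\<rho> x z = z" shows "x = \<one>"
  using free[OF assms(1) _ assms(2)] eps hdist_eq_0[OF assms(2,2)] assms(3) by fastforce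

lemma rho_id: "x \<in> carrier G \<Longrightarrow> \<rho> x = id \<Longrightarrow> x = \<one>"
  using rho_fixed[OF _ o'] by simp

lemma axis_exists:
  assumes x: "x \<in> carrier G" "x \<noteq> \<one>"
  obtains e where "lor e e = 1" "\<rho> x e = e"
  using spacelike_axis[OF lorentz det eps free] x by metis

text \<open>The group elements fixing the pole \<open>e\<close> translate along its geodesic:
  \<open>l x\<close> is the multiplier on the null vector \<open>a + b\<close> and
  \<open>\<bar>ln (l x)\<bar>\<close> the translation length. The frame sits at the foot
  \<open>a\<close> of \<open>z\<close> and is common to all \<open>x\<close>.\<close>

lemma axis_scaling_stabilizer:
  assumes e: "lor e e = 1" and z: "z \<in> hyperboloid"
  obtains a b l where "a \<in> hyperboloid" "lor a e = 0" "z = sqrt (1 + (lor z e)\<^sup>2) *\<^sub>R a + lor z e *\<^sub>R e"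
    "lor b b = 1" "lor a b = 0" "lor b e = 0"
    "\<And>x. x = (- lor x a) *\<^sub>R a + lor x b *\<^sub>R b + lor x e *\<^sub>R e"
    "\<And>x. x \<in> carrier G \<Longrightarrow> \<rho> x e = e \<Longrightarrow> l x > 0 \<and>
      \<rho> x (a + b) = l x *\<^sub>R (a + b) \<and> \<rho> x (a - b) = (1 / l x) *\<^sub>R (a - b) \<and> hdist a (\<rho> x a) = \<bar>ln (l x)\<bar>"
proof -
  obtain a where a: "a \<in> hyperboloid" "lor a e = 0" "z = sqrt (1 + (lor z e)\<^sup>2) *\<^sub>R a + lor z e *\<^sub>R e"
    by (rule foot_on_axis[OF e z])
  then have aa: "lor a a = -1" by (simp add: hyperboloid_def)
  obtain b where b: "lor b b = 1" "lor a b = 0" "lor b e = 0"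
    "\<And>x. x = (- lor x a) *\<^sub>R a + lor x b *\<^sub>R b + lor x e *\<^sub>R e"
    by (rule orthogonal_frame[OF e aa a(2)]) blast
  have "\<exists>l. l > 0 \<and> \<rho> x (a + b) = l *\<^sub>R (a + b) \<and> \<rho> x (a - b) = (1 / l) *\<^sub>R (a - b)
      \<and> hdist a (\<rho> x a) = \<bar>ln l\<bar>"
    if x: "x \<in> carrier G" "\<rho> x e = e" for x
  proof -
    note xD = lorentz_mapD[OF lorentz[OF x(1)]]
    have "\<rho> x = id" if "z \<in> hyperboloid" "\<rho> x z = z" for z
      using rho_fixed[OF x(1) that] rho_one by simp
    from axis_scaling[OF lorentz[OF x(1)] e x(2) a(1,2) b this]
    obtain l where l: "l > 0" "\<rho> x (a + b) = l *\<^sub>R (a + b)" "\<rho> x (a - b) = (1 / l) *\<^sub>R (a - b)"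
      by metis
    have "2 *\<^sub>R a = (a + b) + (a - b)" by (simp add: scaleR_2)
    then have "2 *\<^sub>R \<rho> x a = l *\<^sub>R (a + b) + (1 / l) *\<^sub>R (a - b)"
      using xD(4,6) l(2,3) by metis
    then have "lor a (2 *\<^sub>R \<rho> x a) = - (l + 1 / l)" by (simp add: aa b)
    then have "lor a (\<rho> x a) = - cosh (ln l)"
      using l(1) by (simp add: cosh_ln_real field_simps)
    then have "lor a (\<rho> x a) = - cosh \<bar>ln l\<bar>" by simp
    then have "hdist a (\<rho> x a) = \<bar>ln l\<bar>" by (intro hdist_eqI a xD(3)) auto
    then show ?thesis using l by blast
  qed
  then obtain l where "\<And>x. x \<in> carrier G \<Longrightarrow> \<rho> x e = e \<Longrightarrow> l x > 0 \<and>
      \<rho> x (a + b) = l x *\<^sub>R (a + b) \<and> \<rho> x (a - b) = (1 / l x) *\<^sub>R (a - b) \<and> hdist a (\<rho> x a) = \<bar>ln (l x)\<bar>"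
    by metis
  then show ?thesis using that a b by blast
qed

text \<open>From \<open>sinh s \<ge> (1 - exp (- \<epsilon>)) / 2 * exp s\<close> for
  \<open>2 * s \<ge> \<epsilon>\<close>: the factor becomes this additive error when half-distances
  are turned into distances.\<close>

definition axis_const :: real where "axis_const = - 2 * ln ((1 - exp (- \<epsilon>)) / 2)"

text \<open>With \<open>r\<close> the distance from \<open>o'\<close> to its foot \<open>a\<close>
  on the axis, the displacement \<open>d\<close> of a power satisfies
  \<open>sinh (d/2) = cosh r * sinh (real k * t / 2)\<close>; comparison with exponentials shows
  that the detour along the axis costs at most \<open>axis_const\<close>.\<close>

lemma axis_displacement:
  assumes x: "x \<in> carrier G" "x \<noteq> \<one>"
  obtains a t where "a \<in> hyperboloid" "t \<ge> \<epsilon>" "\<And>k::nat. hdist a (\<rho> (x [^] k) a) = real k * t"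
    "\<And>k::nat. k \<ge> 1 \<Longrightarrow> hdist o' (\<rho> (x [^] k) o') \<ge> 2 * hdist o' a + real k * t - axis_const"
proof -
  obtain e where e: "lor e e = 1" "\<rho> x e = e" by (rule axis_exists[OF x])
  define q where "q = lor o' e"
  obtain a b l where a: "a \<in> hyperboloid" "lor a e = 0" "o' = sqrt (1 + q\<^sup>2) *\<^sub>R a + q *\<^sub>R e"
    and b: "lor b b = 1" "lor a b = 0" "lor b e = 0"
    and l: "\<And>x. x \<in> carrier G \<Longrightarrow> \<rho> x e = e \<Longrightarrow> l x > 0 \<and>
      \<rho> x (a + b) = l x *\<^sub>R (a + b) \<and> \<rho> x (a - b) = (1 / l x) *\<^sub>R (a - b) \<and> hdist a (\<rho> x a) = \<bar>ln (l x)\<bar>"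
    by (rule axis_scaling_stabilizer[OF e(1) o']) (unfold q_def, blast)
  have aa: "lor a a = -1" using a by (simp add: hyperboloid_def)
  note xk = nat_pow_closed[OF x(1)]
  have fix_e: "\<rho> (x [^] k) e = e" for k :: nat
    unfolding rho_pow[OF x(1)] by (induction k) (simp_all add: e)
  note xkD = lorentz_mapD[OF lorentz[OF xk]]
  have lk: "l (x [^] k) = l x ^ k" for k :: nat
  proof -
    have "\<rho> (x [^] k) (a + b) = (l x ^ k) *\<^sub>R (a + b)"
    proof (induction k)
      case (Suc k)
      have "\<rho> (x [^] Suc k) (a + b) = \<rho> (x [^] k) (\<rho> x (a + b))" using x by (simp add: hom)
      also have "\<dots> = (l x ^ Suc k) *\<^sub>R (a + b)" using l[OF x(1) e(2)] Suc xkD(6)[of k] by simp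
      finally show ?case .
    qed (simp add: rho_one)
    moreover have "\<rho> (x [^] k) (a + b) = l (x [^] k) *\<^sub>R (a + b)" using l[OF xk fix_e] by blast
    moreover have "a + b \<noteq> 0" using aa b by (metis add.commute add_0 lor_linear(1,9) lor_commute zero_neq_neg_one)
    ultimately show ?thesis by simp
  qed
  define t where "t = \<bar>ln (l x)\<bar>"
  have dk: "hdist a (\<rho> (x [^] k) a) = real k * t" for k :: nat
    using l[OF xk fix_e, of k] l[OF x(1) e(2)] by (simp add: lk t_def ln_realpow abs_mult)
  have t: "t \<ge> \<epsilon>" using free[OF x a(1)] l[OF x(1) e(2)] by (simp add: t_def)
  have "hdist o' (\<rho> (x [^] k) o') \<ge> 2 * hdist o' a + real k * t - axis_const" if k: "k \<ge> 1" for k :: nat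
  proof -
    let ?f = "\<rho> (x [^] k)" and ?s = "sqrt (1 + q\<^sup>2)"
    define d where "d = hdist o' (?f o')"
    define r where "r = hdist o' a"
    have d0: "d \<ge> 0" "r \<ge> 0" unfolding d_def r_def using o' a xkD(3) by (auto intro: hdist_nonneg)
    have "lor o' a = - ?s" by (subst a(3)) (use aa a in \<open>simp add: lor_commute\<close>)
    then have coshr: "cosh r = ?s" using cosh_hdist[OF o' a(1)] by (simp add: r_def)
    have ck: "lor a (?f a) = - cosh (real k * t)" using cosh_hdist[OF a(1) xkD(3)[OF a(1)], of k] dk by simp
    have "?f o' = ?s *\<^sub>R ?f a + q *\<^sub>R e" by (subst a(3)) (simp add: xkD fix_e)
    moreover have "lor e (?f a) = 0" using xkD(2)[of k e a] fix_e a(2) by (simp add: lor_commute)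
    ultimately have "lor o' (?f o') = ?s * (?s * lor a (?f a)) + q * q"
      by (subst a(3)) (simp add: a e lor_commute)
    also have "?s * (?s * lor a (?f a)) = (1 + q\<^sup>2) * lor a (?f a)"
      by (simp add: mult.assoc[symmetric])
    finally have "cosh d = (cosh r)\<^sup>2 * cosh (real k * t) - q\<^sup>2"
      using cosh_hdist[OF o' xkD(3)[OF o'], of k] by (simp add: ck d_def coshr power2_eq_square)
    then have "cosh d - 1 = (cosh r)\<^sup>2 * (cosh (real k * t) - 1)"
      by (simp add: coshr algebra_simps)
    then have "(sinh (d/2))\<^sup>2 = (cosh r * sinh (real k * t / 2))\<^sup>2"
      unfolding cosh_minus_one by (simp add: power_mult_distrib)
    moreover have kt: "real k * t \<ge> \<epsilon>" using t k eps mult_mono[of 1 "real k" \<epsilon> t] by simp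
    moreover have "sinh (d/2) \<ge> 0" "cosh r * sinh (real k * t / 2) \<ge> 0" using d0 kt eps by simp_all
    ultimately have sd: "sinh (d/2) = cosh r * sinh (real k * t / 2)"
      by (metis power2_eq_imp_eq)
    have "exp (d/2) / 2 \<ge> sinh (d/2)" by (simp add: sinh_field_def)
    moreover have "cosh r \<ge> exp r / 2" by (simp add: cosh_field_def)
    moreover have "sinh (real k * t / 2) \<ge> (1 - exp (- \<epsilon>)) / 2 * exp (real k * t / 2)"
    proof -
      have "exp (- (real k * t / 2)) = exp (- (real k * t)) * exp (real k * t / 2)"
        by (simp add: exp_add[symmetric])
      also have "\<dots> \<le> exp (- \<epsilon>) * exp (real k * t / 2)" using kt by (intro mult_right_mono) auto
      finally have le: "exp (- (real k * t / 2)) \<le> exp (- \<epsilon>) * exp (real k * t / 2)" .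
      have "(1 - E) / 2 * u \<le> (u - v) / 2" if "v \<le> E * u" for E u v :: real
        using that by (simp add: field_simps)
      from this[OF le] show ?thesis by (simp add: sinh_field_def)
    qed
    moreover have pos: "1 - exp (- \<epsilon>) > 0" using eps by simp
    ultimately have "exp (d/2) / 2 \<ge> exp r / 2 * ((1 - exp (- \<epsilon>)) / 2 * exp (real k * t / 2))"
      unfolding sd using mult_mono[of "exp r / 2" "cosh r" "(1 - exp (- \<epsilon>)) / 2 * exp (real k * t / 2)"
         "sinh (real k * t / 2)"] by (smt (verit) exp_gt_zero mult_nonneg_nonneg divide_nonneg_nonneg cosh_real_pos)
    then have "exp (d/2) \<ge> exp (r + real k * t / 2 + ln ((1 - exp (- \<epsilon>)) / 2))"
      using pos by (simp add: exp_add mult_ac)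
    then show ?thesis unfolding exp_le_cancel_iff by (simp add: axis_const_def d_def r_def algebra_simps)
  qed
  then show ?thesis using that a(1) t dk by blast
qed

text \<open>A root of \<open>x\<close> has the same axis as \<open>x\<close>, and the elements
  fixing the pole of this axis form a cyclic group, because the logarithm of the multiplier has a
  gap at 0.\<close>

lemma roots_cyclic:
  assumes x: "x \<in> carrier G" "x \<noteq> \<one>"
  obtains c where "c \<in> carrier G"
    "\<And>y k. y \<in> carrier G \<Longrightarrow> (k::nat) \<ge> 1 \<Longrightarrow> y [^] k = x \<Longrightarrow> \<exists>j::int. y = c [^] j"
proof -
  obtain e where e: "lor e e = 1" "\<rho> x e = e" by (rule axis_exists[OF x])
  obtain a b l where a: "a \<in> hyperboloid" "lor a e = 0"
    and b: "lor b b = 1" "lor a b = 0" "lor b e = 0"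
    and frame: "\<And>x. x = (- lor x a) *\<^sub>R a + lor x b *\<^sub>R b + lor x e *\<^sub>R e"
    and l: "\<And>x. x \<in> carrier G \<Longrightarrow> \<rho> x e = e \<Longrightarrow> l x > 0 \<and>
      \<rho> x (a + b) = l x *\<^sub>R (a + b) \<and> \<rho> x (a - b) = (1 / l x) *\<^sub>R (a - b) \<and> hdist a (\<rho> x a) = \<bar>ln (l x)\<bar>"
    by (rule axis_scaling_stabilizer[OF e(1) o']) blast
  have aa: "lor a a = -1" using a by (simp add: hyperboloid_def)
  have ab: "a + b \<noteq> 0" using aa b by (metis add.commute add_0 lor_linear(1,9) lor_commute zero_neq_neg_one)
  define H where "H = {y \<in> carrier G. \<rho> y e = e}"
  have H: "subgroup H G"
  proof (rule subgroupI)
    show "H \<noteq> {}" using x e by (auto simp: H_def)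
    fix y assume y: "y \<in> H"
    then have "\<rho> (inv y) (\<rho> y e) = e" using hom[of "inv y" y] rho_one by (simp add: H_def fun_eq_iff) (metis)
    then show "inv y \<in> H" using y by (simp add: H_def)
  qed (auto simp: H_def hom)
  have mult: "l (f \<otimes> g) = l f * l g" if "f \<in> H" "g \<in> H" for f g
  proof -
    note f = that(1)[unfolded H_def, simplified] and g = that(2)[unfolded H_def, simplified]
    have fg: "f \<otimes> g \<in> carrier G" "\<rho> (f \<otimes> g) e = e" using f g by (auto simp: hom)
    have "l (f \<otimes> g) *\<^sub>R (a + b) = \<rho> f (\<rho> g (a + b))" using l[OF fg] f g by (simp add: hom)
    also have "\<dots> = (l g * l f) *\<^sub>R (a + b)"
      using l[of f] l[of g] f g lorentz_mapD(6)[OF lorentz] by (simp)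
    finally show ?thesis using ab by simp
  qed
  have "\<bar>ln (l f)\<bar> \<ge> \<epsilon>" if "f \<in> H" "f \<noteq> \<one>" for f
    using that l[of f] free[of f a] a by (auto simp: H_def)
  moreover have "ln (l (f \<otimes> g)) = ln (l f) + ln (l g)" if "f \<in> H" "g \<in> H" for f g
    using mult[OF that] l[of f] l[of g] that by (auto simp: H_def ln_mult)
  moreover have "x \<in> H" using x e by (simp add: H_def)
  ultimately obtain c where c: "c \<in> H" "\<And>f. f \<in> H \<Longrightarrow> \<exists>j::int. f = c [^] j"
    using additive_cyclic[OF is_group H eps, of x "\<lambda>f. ln (l f)"] x(2) by metis
  have lx: "l x > 0" "\<rho> x (a + b) = l x *\<^sub>R (a + b)" "\<rho> x (a - b) = (1 / l x) *\<^sub>R (a - b)"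
    and ln_lx: "\<bar>ln (l x)\<bar> \<ge> \<epsilon>" using l[OF x(1) e(2)] free[OF x a(1)] by auto
  have lx1: "l x \<noteq> 1" using ln_lx eps by auto
  have "y \<in> H" if y: "y \<in> carrier G" "(k::nat) \<ge> 1" "y [^] k = x" for y k
  proof -
    have "y \<noteq> \<one>" using y x by auto
    then obtain e' where e': "lor e' e' = 1" "\<rho> y e' = e'" using axis_exists[OF y(1)] by blast
    have "\<rho> x e' = e'" unfolding y(3)[symmetric] rho_pow[OF y(1)] by (induction k) (simp_all add: e')
    note xD = lorentz_mapD[OF lorentz[OF x(1)]]
    \<comment> \<open>A vector fixed by \<open>x\<close> is orthogonal to both null eigenvectors,
      whose eigenvalues are not 1. Hence the pole \<open>e'\<close> of the axis of \<open>y\<close>,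
      which \<open>x\<close> fixes too, is a multiple of \<open>e\<close>.\<close>
    have ip: "lor e' (a + b) = 0"
    proof -
      have "lor e' (a + b) = lor (\<rho> x e') (\<rho> x (a + b))" using xD(2) by simp
      also have "\<dots> = l x * lor e' (a + b)" using \<open>\<rho> x e' = e'\<close> lx(2) by (simp del: lor_linear(1-4))
      finally show ?thesis using lx1 by simp
    qed
    have im: "lor e' (a - b) = 0"
    proof -
      have "lor e' (a - b) = lor (\<rho> x e') (\<rho> x (a - b))" using xD(2) by simp
      also have "\<dots> = (1 / l x) * lor e' (a - b)"
        using \<open>\<rho> x e' = e'\<close> lx(3) by (simp only: lor_linear(6))
      finally show ?thesis using lx1 lx(1) by (simp add: field_simps del: lor_linear(1-4))
    qed
    have "lor e' a = 0" "lor e' b = 0" using ip im by simp_all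
    then have "e' = lor e' e *\<^sub>R e" using frame[of e'] by simp
    then obtain s where s: "e' = s *\<^sub>R e" by blast
    then have "s \<noteq> 0" using e'(1) by auto
    moreover have "s *\<^sub>R \<rho> y e = s *\<^sub>R e" using e'(2) lorentz_mapD(6)[OF lorentz[OF y(1)]] by (simp add: s)
    ultimately show "y \<in> H" using y by (simp add: H_def)
  qed
  then show ?thesis using that[of c] c by (auto simp: H_def)
qed

end

subsection \<open>The triangle group of the regular polygon\<close>

datatype mirror = S0 | S1 | S2

lemma UNIV_mirror: "(UNIV :: mirror set) = {S0, S1, S2}"
  using mirror.exhaust by auto

text \<open>The mirrors of a triangle with angles \<open>\<pi>/4g, \<pi>/2, \<pi>/4g\<close> at the center of the regular \<open>4g\<close>-gon,
  at the midpoint of a side and at a vertex.\<close>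

locale surface =
  fixes g :: nat
  assumes g: "g \<ge> 2"
begin

definition n :: nat where "n = 4 * g"
definition \<theta> :: real where "\<theta> = pi / real n"
text \<open>\<open>ch\<close> and \<open>sh\<close> are the hyperbolic cosine and sine of the
  inradius of the polygon: in a right triangle whose acute angles are both \<theta>, a leg has
  hyperbolic cosine \<open>cos \<theta> / sin \<theta>\<close>.\<close>

definition ch :: real where "ch = cos \<theta> / sin \<theta>"
definition sh :: real where "sh = sqrt (ch\<^sup>2 - 1)"

lemma n8: "n \<ge> 8" using g by (simp add: n_def)

lemma theta: "0 < \<theta>" "\<theta> \<le> pi / 8" "real n * \<theta> = pi"
  using n8 pi_gt_zero by (auto simp: \<theta>_def field_simps)

lemma sin_pos: "sin \<theta> > 0" "cos \<theta> > 0" "cos \<theta> < 1"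
proof -
  have "\<theta> < pi / 2" using theta pi_gt_zero by linarith
  then show "sin \<theta> > 0" "cos \<theta> > 0" using theta by (auto intro: sin_gt_zero2 cos_gt_zero)
  show "cos \<theta> < 1" using cos_monotone_0_pi[of 0 \<theta>] theta pi_gt_zero by simp
qed

lemma cos_gt_sin: "cos \<theta> > sin \<theta>"
proof -
  have "sin \<theta> < sin (pi / 4)" using theta pi_gt_zero by (intro sin_monotone_2pi) auto
  also have "\<dots> = cos (pi / 4)" by (simp add: sin_45 cos_45)
  also have "\<dots> < cos \<theta>" using theta pi_gt_zero by (intro cos_monotone_0_pi) auto
  finally show ?thesis .
qed

lemma ch: "ch > 1" "sh > 0" "sh\<^sup>2 = ch\<^sup>2 - 1" "ch * sin \<theta> = cos \<theta>"
proof -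
  show c: "ch > 1" using cos_gt_sin sin_pos by (simp add: ch_def field_simps)
  then have "ch\<^sup>2 > 1" by (rule one_less_power) simp
  then show "sh > 0" "sh\<^sup>2 = ch\<^sup>2 - 1" by (simp_all add: sh_def)
  show "ch * sin \<theta> = cos \<theta>" using sin_pos by (simp add: ch_def)
qed

text \<open>Inward unit normals. A vertex of the polygon lies on the ray of angle 0 and the midpoint
  of the next side on the ray of angle \<theta>, in accordance with
  \<open>polygon_side\<close>.\<close>

fun \<alpha> :: "mirror \<Rightarrow> real^3" where
  "\<alpha> S0 = vector [0, 1, 0]"
| "\<alpha> S1 = vector [sin \<theta>, - cos \<theta>, 0]"
| "\<alpha> S2 = vector [- ch * cos \<theta>, - ch * sin \<theta>, - sh]"

fun m :: "mirror \<Rightarrow> mirror \<Rightarrow> nat" where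
  "m S1 S2 = 2" | "m S2 S1 = 2" | "m _ _ = n"

lemma m_sym: "m i j = m j i" by (cases i; cases j) auto

lemma lor_alpha:
  "lor v (\<alpha> S0) = v$2" "lor v (\<alpha> S1) = v$1 * sin \<theta> - v$2 * cos \<theta>"
  "lor v (\<alpha> S2) = v$3 * sh - ch * (v$1 * cos \<theta> + v$2 * sin \<theta>)"
  by (simp_all add: lor_def algebra_simps)

lemma gram_self: "lor (\<alpha> i) (\<alpha> i) = 1"
proof (cases i)
  case S2
  have "lor (\<alpha> S2) (\<alpha> S2) = ch\<^sup>2 * (cos \<theta>)\<^sup>2 + ch\<^sup>2 * (sin \<theta>)\<^sup>2 - sh\<^sup>2"
    by (simp add: lor_def power2_eq_square)
  also have "\<dots> = ch\<^sup>2 * ((cos \<theta>)\<^sup>2 + (sin \<theta>)\<^sup>2) - sh\<^sup>2" by (simp only: distrib_left)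
  finally show ?thesis using S2 ch(3) by simp
qed (simp_all add: lor_def power2_eq_square[symmetric])

lemma gram: "i \<noteq> j \<Longrightarrow> lor (\<alpha> i) (\<alpha> j) = - cos (pi / real (m i j))"
  using ch(4) by (cases i; cases j) (auto simp add: lor_def \<theta>_def[symmetric] mult.commute)

lemma m_even: "i \<noteq> j \<Longrightarrow> even (m i j)" "i \<noteq> j \<Longrightarrow> m i j \<ge> 2"
  using n8 by (cases i; cases j; simp add: n_def)+

definition mrefl :: "mirror \<Rightarrow> real^3 \<Rightarrow> real^3" where
  "mrefl i x = x - (2 * lor x (\<alpha> i)) *\<^sub>R \<alpha> i"

lemma mrefl_mrefl [simp]: "mrefl i (mrefl i x) = x"
  by (simp add: mrefl_def gram_self algebra_simps)

lemma lor_mrefl: "lor (mrefl i x) y = lor x y - 2 * lor x (\<alpha> i) * lor (\<alpha> i) y"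
  by (simp add: mrefl_def)

lemma lor_mrefl_self [simp]: "lor (mrefl i x) (\<alpha> i) = - lor x (\<alpha> i)"
  by (simp add: lor_mrefl gram_self)

lemma lor_mrefl_mrefl: "lor (mrefl i x) (mrefl i y) = lor x y"
  by (simp add: mrefl_def gram_self lor_commute algebra_simps)

lemma linear_mrefl: "linear (mrefl i)"
  by (rule linearI) (simp_all add: mrefl_def algebra_simps scaleR_add_left)

lemma lor_act_mrefl: "lor (act mrefl w x) (act mrefl w y) = lor x y"
  by (induction w) (simp_all add: lor_mrefl_mrefl)

lemma linear_act_mrefl: "linear (act mrefl w)"
proof (induction w)
  case Nil
  show ?case using linear_id by (simp add: id_def)
next
  case (Cons i w)
  show ?case
    by (rule linearI) (simp_all add: linear_add[OF Cons] linear_scale[OF Cons]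
        linear_add[OF linear_mrefl] linear_scale[OF linear_mrefl])
qed

lemma mrefl_hyperboloid: "x \<in> hyperboloid \<Longrightarrow> mrefl i x \<in> hyperboloid"
proof -
  assume x: "x \<in> hyperboloid"
  have "lor (mrefl i x) (mrefl i x) = -1" using x by (simp add: lor_mrefl_mrefl hyperboloid_def)
  moreover have "lor x (mrefl i x) = - 1 - 2 * (lor x (\<alpha> i))\<^sup>2"
    using x by (simp add: mrefl_def hyperboloid_def power2_eq_square lor_commute)
  moreover have "- 1 - 2 * (lor x (\<alpha> i))\<^sup>2 < 0" using zero_le_power2[of "lor x (\<alpha> i)"] by linarith
  ultimately show "mrefl i x \<in> hyperboloid" using hyperboloid_sign[of "mrefl i x" x] x by simp
qed

lemma lorentz_act_mrefl: "lorentz_map (act mrefl w)"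
proof -
  have "act mrefl w x \<in> hyperboloid" if "x \<in> hyperboloid" for x
    by (induction w) (use that in \<open>simp_all add: mrefl_hyperboloid\<close>)
  then show ?thesis unfolding lorentz_map_def using linear_act_mrefl lor_act_mrefl by blast
qed

text \<open>The coordinates with respect to two mirrors along alternating words are Chebyshev polynomials.\<close>

lemma alt_coordinates:
  assumes ij: "i \<noteq> j"
  shows "lor (act mrefl (alt k j i) x) (\<alpha> i) * sin (pi / real (m i j)) =
    (if even k then sin (real (k + 1) * (pi / real (m i j))) * lor x (\<alpha> i) + sin (real k * (pi / real (m i j))) * lor x (\<alpha> j)
     else sin (real (k + 1) * (pi / real (m i j))) * lor x (\<alpha> j) + sin (real k * (pi / real (m i j))) * lor x (\<alpha> i))"
  using ij
proof (induction k arbitrary: i j rule: less_induct)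
  case (less k)
  define t where "t = pi / real (m i j)"
  have ji: "m j i = m i j" by (rule m_sym)
  consider "k = 0" | "k = 1" | l where "k = Suc (Suc l)" by (metis One_nat_def not0_implies_Suc)
  then show ?case
  proof cases
    case 1
    then show ?thesis by simp
  next
    case 2
    have "sin (2 * t) = 2 * sin t * cos t" by (rule sin_double)
    then show ?thesis using 2 less.prems
      by (simp add: lor_mrefl gram ji t_def[symmetric] algebra_simps)
  next
    case 3
    define y where "y = act mrefl (alt (Suc l) i j) x"
    have a: "lor y (\<alpha> j) * sin t = (if even (Suc l) then sin (real (Suc l + 1) * t) * lor x (\<alpha> j) + sin (real (Suc l) * t) * lor x (\<alpha> i)
       else sin (real (Suc l + 1) * t) * lor x (\<alpha> i) + sin (real (Suc l) * t) * lor x (\<alpha> j))"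
      using less.IH[of "Suc l" j i] less.prems 3 by (simp add: y_def ji t_def)
    have b: "lor y (\<alpha> i) * sin t = - (if even l then sin (real (l + 1) * t) * lor x (\<alpha> i) + sin (real l * t) * lor x (\<alpha> j)
       else sin (real (l + 1) * t) * lor x (\<alpha> j) + sin (real l * t) * lor x (\<alpha> i))"
      using less.IH[of l i j] less.prems 3 by (simp add: y_def t_def)
    have "lor (act mrefl (alt k j i) x) (\<alpha> i) = lor y (\<alpha> i) + 2 * cos t * lor y (\<alpha> j)"
      using less.prems by (simp add: 3 y_def lor_mrefl gram ji t_def)
    then have c: "lor (act mrefl (alt k j i) x) (\<alpha> i) * sin t = lor y (\<alpha> i) * sin t + 2 * cos t * (lor y (\<alpha> j) * sin t)"
      by (simp add: algebra_simps)
    have rec: "2 * cos t * sin (real (Suc p) * t) = sin (real (Suc (Suc p)) * t) + sin (real p * t)" for p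
      using sin_add[of "real (Suc p) * t" t] sin_diff[of "real (Suc p) * t" t]
      by (simp add: algebra_simps)
    have "2 * cos t * (if even (Suc l) then sin (real (Suc l + 1) * t) * lor x (\<alpha> j) + sin (real (Suc l) * t) * lor x (\<alpha> i)
       else sin (real (Suc l + 1) * t) * lor x (\<alpha> i) + sin (real (Suc l) * t) * lor x (\<alpha> j)) =
       (if even (Suc l) then (2 * cos t * sin (real (Suc (Suc l)) * t)) * lor x (\<alpha> j) + (2 * cos t * sin (real (Suc l) * t)) * lor x (\<alpha> i)
       else (2 * cos t * sin (real (Suc (Suc l)) * t)) * lor x (\<alpha> i) + (2 * cos t * sin (real (Suc l) * t)) * lor x (\<alpha> j))"
      by (simp add: algebra_simps del: of_nat_Suc)
    then show ?thesis unfolding t_def[symmetric] c a b rec using 3 by (simp add: algebra_simps)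
  qed
qed

lemma sin_m: "i \<noteq> j \<Longrightarrow> sin (pi / real (m i j)) > 0"
  using m_even[of i j] pi_gt_zero by (intro sin_gt_zero) (auto simp: field_simps)

text \<open>The coefficients are the sines of \<open>(k + 1) t\<close> and \<open>k t\<close>
  divided by \<open>sin t\<close>, where \<open>t = pi / m i j\<close>, in an order that depends on
  the parity of \<open>k\<close>; they are nonnegative because \<open>k < m i j\<close>. This is the
  rank two condition of \<open>tits\<close>.\<close>

lemma alt_coordinate_coeffs:
  assumes ij: "i \<noteq> j" and k: "k < m i j"
  obtains a b where "a \<ge> 0" "b \<ge> 0" "a + b > 0"
    "\<And>x. lor (act mrefl (alt k j i) x) (\<alpha> i) = a * lor x (\<alpha> i) + b * lor x (\<alpha> j)"
proof -
  define t where "t = pi / real (m i j)"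
  have mt: "real (m i j) * t = pi" using m_even[OF ij] by (simp add: t_def)
  have t: "t > 0" "sin t > 0" using sin_m[OF ij] m_even[OF ij] by (auto simp: t_def)
  have le: "real (k + 1) * t \<le> pi" unfolding mt[symmetric] using k t by (intro mult_right_mono) auto
  have lt: "real k * t < pi" unfolding mt[symmetric] using k t by (intro mult_strict_right_mono) auto
  have s1: "sin (real (k + 1) * t) \<ge> 0" using le t by (intro sin_ge_zero) auto
  have s2: "sin (real k * t) \<ge> 0" using lt t by (intro sin_ge_zero) auto
  have pos: "sin (real (k + 1) * t) / sin t + sin (real k * t) / sin t > 0"
  proof (cases "k = 0")
    case True then show ?thesis using t by simp
  next
    case False
    then have "sin (real k * t) > 0" using lt t by (intro sin_gt_zero) auto
    then show ?thesis using s1 t by (simp add: add_nonneg_pos)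
  qed
  have eq: "lor (act mrefl (alt k j i) x) (\<alpha> i) =
    (if even k then sin (real (k + 1) * t) / sin t * lor x (\<alpha> i) + sin (real k * t) / sin t * lor x (\<alpha> j)
     else sin (real k * t) / sin t * lor x (\<alpha> i) + sin (real (k + 1) * t) / sin t * lor x (\<alpha> j))" for x
    using alt_coordinates[OF ij, of k x] t unfolding t_def[symmetric]
    by (auto simp: field_simps split: if_splits)
  show ?thesis
  proof (cases "even k")
    case True
    then show ?thesis using s1 s2 t pos eq
      by (intro that[of "sin (real (k + 1) * t) / sin t" "sin (real k * t) / sin t"]) auto
  next
    case False
    then show ?thesis using s1 s2 t pos eq
      by (intro that[of "sin (real k * t) / sin t" "sin (real (k + 1) * t) / sin t"]) auto
  qed
qed

text \<open>As \<open>m i j\<close> is even, this word is a power of the rotation by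
  \<open>2 pi / m i j\<close>, namely the half turn.\<close>

lemma alt_coordinates_m:
  assumes ij: "i \<noteq> j"
  shows "lor (act mrefl (alt (m i j) j i) x) (\<alpha> i) = - lor x (\<alpha> i)"
    and "lor (act mrefl (alt (m i j) j i) x) (\<alpha> j) = - lor x (\<alpha> j)"
proof -
  define t where "t = pi / real (m i j)"
  have mt: "real (m i j) * t = pi" using m_even[OF ij] by (simp add: t_def)
  have t: "sin t > 0" using sin_m[OF ij] by (simp add: t_def)
  have s: "sin (real (m i j + 1) * t) = - sin t" "sin (real (m i j) * t) = 0"
    using mt by (simp_all add: distrib_right)
  show "lor (act mrefl (alt (m i j) j i) x) (\<alpha> i) = - lor x (\<alpha> i)"
  proof -
    have "(lor (act mrefl (alt (m i j) j i) x) (\<alpha> i) + lor x (\<alpha> i)) * sin t = 0"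
      using alt_coordinates[OF ij, of "m i j" x] m_even[OF ij] s unfolding t_def[symmetric]
      by (simp add: algebra_simps)
    then show ?thesis using t by simp
  qed
  obtain p where p: "m i j = Suc p" using m_even[OF ij] by (cases "m i j") auto
  have "real p * t = pi - t" using mt by (simp add: p algebra_simps)
  then have s': "sin (real (p + 1) * t) = 0" "sin (real p * t) = sin t"
    using mt p by simp_all
  have "odd p" using m_even[OF ij] p by simp
  have "lor (act mrefl (alt p i j) x) (\<alpha> j) * sin t = sin t * lor x (\<alpha> j)"
    using alt_coordinates[of j i p x] ij \<open>odd p\<close> s' unfolding m_sym[of j i] t_def[symmetric] by simp
  then show "lor (act mrefl (alt (m i j) j i) x) (\<alpha> j) = - lor x (\<alpha> j)"
    using t by (simp add: p)
qed

lemma act_mrefl_span: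
  assumes "set w \<subseteq> {i, j}" shows "\<exists>a b. act mrefl w x = x + a *\<^sub>R \<alpha> i + b *\<^sub>R \<alpha> j"
  using assms
proof (induction w)
  case Nil
  show ?case by (intro exI[of _ 0]) simp
next
  case (Cons k w)
  then obtain a b where ab: "act mrefl w x = x + a *\<^sub>R \<alpha> i + b *\<^sub>R \<alpha> j" by auto
  define c where "c = 2 * lor (act mrefl w x) (\<alpha> k)"
  have "act mrefl (k # w) x = (x + a *\<^sub>R \<alpha> i + b *\<^sub>R \<alpha> j) - c *\<^sub>R \<alpha> k"
    by (simp add: mrefl_def c_def ab)
  moreover have "k = i \<or> k = j" using Cons.prems by auto
  ultimately have "act mrefl (k # w) x = x + (a - c) *\<^sub>R \<alpha> i + b *\<^sub>R \<alpha> j \<or>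
    act mrefl (k # w) x = x + a *\<^sub>R \<alpha> i + (b - c) *\<^sub>R \<alpha> j" by (auto simp: algebra_simps)
  then show ?case by blast
qed

text \<open>Both sides have the same products with \<open>\<alpha> i\<close> and
  \<open>\<alpha> j\<close>, and they differ by a vector in the span of these two, where the form is
  nondegenerate.\<close>

lemma braid_mrefl:
  assumes ij: "i \<noteq> j"
  shows "act mrefl (alt (m i j) i j) x = act mrefl (alt (m i j) j i) x"
proof -
  let ?y = "act mrefl (alt (m i j) i j) x" and ?z = "act mrefl (alt (m i j) j i) x"
  obtain a b where 1: "?y = x + a *\<^sub>R \<alpha> i + b *\<^sub>R \<alpha> j" using act_mrefl_span[OF set_alt] by blast
  obtain a' b' where 2: "?z = x + a' *\<^sub>R \<alpha> i + b' *\<^sub>R \<alpha> j"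
    using act_mrefl_span[of "alt (m i j) j i" i j] set_alt[of "m i j" j i] by blast
  define c where "c = cos (pi / real (m i j))"
  define p where "p = a - a'"
  define q where "q = b - b'"
  have w: "?y - ?z = p *\<^sub>R \<alpha> i + q *\<^sub>R \<alpha> j" unfolding 1 2 by (simp add: p_def q_def algebra_simps)
  have gj: "lor (\<alpha> j) (\<alpha> i) = - c" "lor (\<alpha> i) (\<alpha> j) = - c" using gram[OF ij] by (simp_all add: c_def lor_commute)
  have "lor (?y - ?z) (\<alpha> i) = 0" "lor (?y - ?z) (\<alpha> j) = 0"
    using alt_coordinates_m[OF ij, of x] alt_coordinates_m[of j i x] ij m_sym[of j i] by simp_all
  then have "p - q * c = 0" "q - p * c = 0" unfolding w by (simp_all add: gram_self gj)
  then have pq: "p = q * c" "q * (1 - c\<^sup>2) = 0" by (simp_all add: power2_eq_square algebra_simps)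
  have "1 - c\<^sup>2 = (sin (pi / real (m i j)))\<^sup>2" by (simp add: c_def sin_squared_eq)
  then have "1 - c\<^sup>2 \<noteq> 0" using sin_m[OF ij] by simp
  then have "q = 0" using pq by simp
  then have "?y - ?z = 0" using pq w by simp
  then show ?thesis by simp
qed

text \<open>The \<open>8g\<close> flags of the surface: \<open>2j\<close> and \<open>2j+1\<close> are the two halves of side \<open>j\<close>, in
  counterclockwise order.\<close>

fun flag :: "mirror \<Rightarrow> int \<Rightarrow> int" where
  "flag i k = (if k \<in> {0..<8 * int g} then (case i of
      S0 \<Rightarrow> (if even k then k - 1 else k + 1) mod (8 * int g)
    | S1 \<Rightarrow> if even k then k + 1 else k - 1
    | S2 \<Rightarrow> if k mod 8 < 4 then (if even k then k + 5 else k + 3) else (if even k then k - 3 else k - 5)) else k)"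

declare flag.simps [simp del]

section \<open>Rotations of the flags about face, edge and vertex\<close>

abbreviation "flags \<equiv> {0..<8 * int g}"

lemma even_mod_flags [simp]: "even (k mod (8 * int g)) = even k"
  by (simp add: dvd_mod_iff)

lemma flag_parity: "k \<in> flags \<Longrightarrow> even (flag i k) \<longleftrightarrow> odd k"
  by (cases i) (auto simp: flag.simps)

lemma flag_in: "k \<in> flags \<Longrightarrow> flag i k \<in> flags"
proof (cases i)
  case S0
  then show "k \<in> flags \<Longrightarrow> flag i k \<in> flags" using g by (auto simp: flag.simps)
next
  case S1
  then show "k \<in> flags \<Longrightarrow> flag i k \<in> flags" by (auto simp: flag.simps) presburger+
next
  case S2
  assume "k \<in> flags"
  then show ?thesis using S2 by (auto simp: flag.simps) presburger+
qed

lemma flag_outside: "k \<notin> flags \<Longrightarrow> flag i k = k"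
  by (auto simp: flag.simps)

lemma flag_invol [simp]: "flag i (flag i k) = k"
proof (cases "k \<in> flags")
  case True
  note fk = flag_in[OF True, of i] and pk = flag_parity[OF True, of i]
  show ?thesis
  proof (cases i)
    case S0
    have "((k - 1) mod (8 * int g) + 1) mod (8 * int g) = k" "((k + 1) mod (8 * int g) - 1) mod (8 * int g) = k"
      using True by (simp_all add: mod_simps)
    then show ?thesis using S0 True fk pk by (auto simp: flag.simps[of _ k] flag.simps[of _ "_ mod _"])
  next
    case S1
    then show ?thesis using True fk pk by (auto simp: flag.simps)
  next
    case S2
    have "flag i k = (if k mod 8 < 4 then (if even k then k + 5 else k + 3) else (if even k then k - 3 else k - 5))"
      using S2 True by (simp add: flag.simps)
    moreover have "flag i (flag i k) = (if flag i k mod 8 < 4 then (if even (flag i k) then flag i k + 5 else flag i k + 3)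
        else (if even (flag i k) then flag i k - 3 else flag i k - 5))"
      using S2 fk by (simp add: flag.simps[of _ "flag _ _"])
    ultimately show ?thesis by (auto split: if_splits) presburger+
  qed
qed (simp add: flag_outside)

lemma act_alt_even: "act f (alt (2 * l) i j) x = ((f i \<circ> f j) ^^ l) x"
  by (induction l arbitrary: x) auto

text \<open>Lift to all integers of the turn about the vertex, \<open>S0\<close> after
  \<open>S2\<close>. On even flags it runs through the corners of one commutator block in the order
  0, 6, 4, 2 and then enters the next block at 8; so all corners belong to a single vertex.\<close>

definition vrot :: "int \<Rightarrow> int" where
  "vrot k = (if even k then (if k mod 8 < 4 then k + 6 else k - 2) else (if k mod 8 < 4 then k + 2 else k - 6))"

lemma flag_S0_S1: "flag S0 (flag S1 (k mod (8 * int g))) = (if even k then k + 2 else k - 2) mod (8 * int g)"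
proof -
  define y where "y = k mod (8 * int g)"
  have y: "y \<in> flags" using g by (simp add: y_def)
  have e: "even y = even k" by (simp add: y_def)
  note f = flag_in[OF y, of S1] and p = flag_parity[OF y, of S1]
  have "flag S1 y = (if even y then y + 1 else y - 1)" using y by (simp add: flag.simps)
  moreover have "flag S0 (flag S1 y) = (if even (flag S1 y) then flag S1 y - 1 else flag S1 y + 1) mod (8 * int g)"
    using f by (simp add: flag.simps[of S0])
  ultimately have "flag S0 (flag S1 y) = (if even k then y + 2 else y - 2) mod (8 * int g)"
    using p e by (auto simp: add.commute)
  then show ?thesis by (simp add: y_def mod_simps)
qed

lemma flag_S0_S2: "flag S0 (flag S2 (k mod (8 * int g))) = vrot k mod (8 * int g)"
proof -
  define y where "y = k mod (8 * int g)"
  have y: "y \<in> flags" using g by (simp add: y_def)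
  have e: "even y = even k" "y mod 8 = k mod 8" by (simp_all add: y_def mod_mod_cancel)
  note f = flag_in[OF y, of S2] and p = flag_parity[OF y, of S2]
  have "flag S2 y = (if k mod 8 < 4 then (if even k then y + 5 else y + 3) else (if even k then y - 3 else y - 5))"
    using y by (simp add: flag.simps e)
  moreover have "flag S0 (flag S2 y) = (if even (flag S2 y) then flag S2 y - 1 else flag S2 y + 1) mod (8 * int g)"
    using f by (simp add: flag.simps[of S0])
  ultimately have "flag S0 (flag S2 y) = (if even k then (if k mod 8 < 4 then y + 6 else y - 2)
     else (if k mod 8 < 4 then y + 2 else y - 6)) mod (8 * int g)"
    using p e by (auto simp: add.commute)
  then show ?thesis by (simp add: y_def vrot_def mod_simps)
qed

lemma flag_S1_S2: "k \<in> flags \<Longrightarrow> flag S1 (flag S2 k) = (if k mod 8 < 4 then k + 4 else k - 4)"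
  using flag_in[of k S2] flag_parity[of k S2] by (auto simp: flag.simps[of S1] flag.simps[of S2 k])

lemma vrot_mod: "vrot k mod 8 = (if even k then k - 2 else k + 2) mod 8" "even (vrot k) = even k"
  by (auto simp: vrot_def mod_eq_dvd_iff)

lemma vrot_shift: "vrot (8 * q + r) = 8 * q + vrot r"
proof -
  have "(8 * q + r) mod 8 = r mod 8" "even (8 * q + r) = even r" by simp_all
  then show ?thesis unfolding vrot_def by simp
qed

lemma vrot_4: "vrot (vrot (vrot (vrot k))) = (if even k then k + 8 else k - 8)"
proof -
  define q r where "q = k div 8" and "r = k mod 8"
  have k: "k = 8 * q + r" by (simp add: q_def r_def)
  have "r \<in> {0..<8}" by (simp add: r_def)
  also have "{0..<8} = {0, 1, 2, 3, 4, 5, 6, 7 :: int}" by auto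
  finally have "vrot (vrot (vrot (vrot r))) = (if even r then r + 8 else r - 8)"
    by (elim insertE emptyE) (simp_all add: vrot_def)
  then show ?thesis unfolding k vrot_shift by simp
qed

lemma vrot_funpow: "even ((vrot ^^ l) k) = even k"
  "(vrot ^^ l) k mod 8 = (if even k then k - 2 * int l else k + 2 * int l) mod 8"
  "(vrot ^^ (4 * l)) k = (if even k then k + 8 * int l else k - 8 * int l)"
proof -
  show e: "even ((vrot ^^ l) k) = even k" for l by (induction l) (auto simp: vrot_mod)
  show "(vrot ^^ l) k mod 8 = (if even k then k - 2 * int l else k + 2 * int l) mod 8"
  proof (induction l)
    case (Suc l)
    let ?y = "(vrot ^^ l) k"
    have "(vrot ^^ Suc l) k mod 8 = (if even k then ?y mod 8 - 2 else ?y mod 8 + 2) mod 8"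
      using e[of l] by (simp add: vrot_mod mod_simps)
    also have "\<dots> = (if even k then k - 2 * int (Suc l) else k + 2 * int (Suc l)) mod 8"
      unfolding Suc by (simp add: mod_simps algebra_simps)
    finally show ?case .
  qed simp
  show "(vrot ^^ (4 * l)) k = (if even k then k + 8 * int l else k - 8 * int l)"
  proof (induction l)
    case (Suc l)
    have "(vrot ^^ (4 * Suc l)) k = vrot (vrot (vrot (vrot ((vrot ^^ (4 * l)) k))))" by (simp add: numeral_eq_Suc)
    then show ?case unfolding vrot_4 using Suc e[of "4 * l"] by simp
  qed simp
qed

lemma rotation_funpow:
  assumes "k \<in> flags"
  shows "((flag S0 \<circ> flag S1) ^^ l) k = (if even k then k + 2 * int l else k - 2 * int l) mod (8 * int g)"
    and "((flag S0 \<circ> flag S2) ^^ l) k = (vrot ^^ l) k mod (8 * int g)"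
proof -
  have k: "k mod (8 * int g) = k" using assms by simp
  show "((flag S0 \<circ> flag S1) ^^ l) k = (if even k then k + 2 * int l else k - 2 * int l) mod (8 * int g)"
  proof (induction l)
    case (Suc l)
    let ?y = "if even k then k + 2 * int l else k - 2 * int l"
    have "((flag S0 \<circ> flag S1) ^^ Suc l) k = (if even ?y then ?y + 2 else ?y - 2) mod (8 * int g)"
      by (simp only: funpow.simps comp_apply Suc flag_S0_S1)
    also have "(if even ?y then ?y + 2 else ?y - 2) = (if even k then k + 2 * int (Suc l) else k - 2 * int (Suc l))"
      by simp
    finally show ?case .
  qed (simp add: k)
  show "((flag S0 \<circ> flag S2) ^^ l) k = (vrot ^^ l) k mod (8 * int g)"
    by (induction l) (simp_all add: k flag_S0_S2)
qed

lemma funpow_inverse: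
  assumes "\<And>k. f (f k) = k" "\<And>k. h (h k) = k"
  shows "((f \<circ> h) ^^ l) (((h \<circ> f) ^^ l) k) = k"
proof (induction l arbitrary: k)
  case (Suc l)
  define F where "F = f \<circ> h"
  define H where "H = h \<circ> f"
  have FH: "F (H x) = x" for x by (simp add: F_def H_def assms)
  have "(F ^^ Suc l) ((H ^^ Suc l) k) = (F ^^ l) (F (H ((H ^^ l) k)))"
    by (simp only: funpow_Suc_right[of l F] funpow.simps(2)[of l H] comp_apply)
  then show ?case using Suc unfolding F_def[symmetric] H_def[symmetric] FH by simp
qed simp

text \<open>\<open>S0\<close> after \<open>S1\<close> turns about the face and shifts a flag by 2
  along the boundary, \<open>S0\<close> after \<open>S2\<close> turns about the vertex, and
  \<open>S1\<close> after \<open>S2\<close> is the half turn at an edge. The point is that each has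
  its full order on every single flag.\<close>

lemma rotation_order:
  assumes ij: "i \<noteq> j" and k: "k \<in> flags"
  shows "((flag i \<circ> flag j) ^^ m i j) k = k"
    and "0 < l \<Longrightarrow> l < m i j \<Longrightarrow> ((flag i \<circ> flag j) ^^ l) k \<noteq> k"
proof -
  have inv: "((flag i \<circ> flag j) ^^ l) k = k \<longleftrightarrow> ((flag j \<circ> flag i) ^^ l) k = k" for i j l k
    using funpow_inverse[of "flag i" "flag j" l k] funpow_inverse[of "flag j" "flag i" l k] by (metis flag_invol)
  have 01: "((flag S0 \<circ> flag S1) ^^ l) k = k \<longleftrightarrow> int n dvd int l" for l
  proof -
    have "((flag S0 \<circ> flag S1) ^^ l) k = k \<longleftrightarrow> (if even k then k + 2 * int l else k - 2 * int l) mod (8 * int g) = k mod (8 * int g)"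
      using k by (simp add: rotation_funpow)
    also have "\<dots> \<longleftrightarrow> 8 * int g dvd 2 * int l" by (auto simp: mod_eq_dvd_iff)
    also have "\<dots> \<longleftrightarrow> 2 * int n dvd 2 * int l" by (simp add: n_def)
    finally show ?thesis by simp
  qed
  have 02: "((flag S0 \<circ> flag S2) ^^ l) k = k \<longleftrightarrow> int n dvd int l" for l
  proof
    assume "int n dvd int l"
    then obtain c where "int l = int n * c" by blast
    then have "l = 4 * (g * nat c)"
      using g by (metis (no_types, lifting) n_def int_ops(7) mult.assoc nat_int nat_mult_distrib of_nat_0_le_iff)
    then have "((flag S0 \<circ> flag S2) ^^ l) k = (if even k then k + 8 * int (g * nat c) else k - 8 * int (g * nat c)) mod (8 * int g)"
      using k by (simp only: rotation_funpow vrot_funpow(3))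
    also have "\<dots> = k mod (8 * int g)" by (auto simp: mod_eq_dvd_iff)
    finally show "((flag S0 \<circ> flag S2) ^^ l) k = k" using k by simp
  next
    assume eq: "((flag S0 \<circ> flag S2) ^^ l) k = k"
    then have eq': "(vrot ^^ l) k mod (8 * int g) = k mod (8 * int g)" using k by (simp add: rotation_funpow)
    \<comment> \<open>Modulo 8 every turn shifts by 2, so \<open>l\<close> is a multiple of 4; four
      turns together advance by one block of 8.\<close>
    then have "(vrot ^^ l) k mod 8 = k mod 8" by (metis mod_mod_cancel dvd_triv_left)
    then have "(if even k then k - 2 * int l else k + 2 * int l) mod 8 = k mod 8" by (simp only: vrot_funpow(2))
    then have "8 dvd 2 * int l" by (cases "even k") (auto simp: mod_eq_dvd_iff)
    then have "2 * 4 dvd 2 * int l" by simp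
    then have "4 dvd int l" by (simp only: dvd_mult_cancel_left) simp
    then have "4 dvd l" by (metis int_dvd_int_iff of_nat_numeral)
    then obtain b where b: "l = 4 * b" by blast
    then have "(if even k then k + 8 * int b else k - 8 * int b) mod (8 * int g) = k mod (8 * int g)"
      using eq' by (simp only: vrot_funpow(3))
    then have "8 * int g dvd 8 * int b" by (cases "even k") (auto simp: mod_eq_dvd_iff)
    then show "int n dvd int l" by (simp add: n_def b)
  qed
  have 12: "((flag S1 \<circ> flag S2) ^^ 2) k = k" "(flag S1 \<circ> flag S2) k \<noteq> k"
  proof -
    have f: "flag S1 (flag S2 k) \<in> flags" using flag_in k by blast
    have "flag S1 (flag S2 (flag S1 (flag S2 k))) = k"
      unfolding flag_S1_S2[OF f] unfolding flag_S1_S2[OF k] by (auto; presburger)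
    then show "((flag S1 \<circ> flag S2) ^^ 2) k = k" by (simp add: numeral_2_eq_2)
    show "(flag S1 \<circ> flag S2) k \<noteq> k" using flag_S1_S2[OF k] by auto
  qed
  have nl: "\<not> int n dvd int l" if "0 < l" "l < n" using that by (simp add: nat_dvd_not_less)
  show "((flag i \<circ> flag j) ^^ m i j) k = k"
    using ij 01[of n] 02[of n] 12 inv[where i = S1 and j = S0] inv[where i = S2 and j = S0] inv[where i = S2 and j = S1] by (cases i; cases j) auto
  show "0 < l \<Longrightarrow> l < m i j \<Longrightarrow> ((flag i \<circ> flag j) ^^ l) k \<noteq> k"
  proof -
    assume l: "0 < l" "l < m i j"
    have 3: "((flag S1 \<circ> flag S2) ^^ l) k \<noteq> k" if "l < 2"
    proof -
      have "l = 1" using l(1) that by simp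
      then show ?thesis using 12(2) by simp
    qed
    show ?thesis
      using ij l 01[of l] 02[of l] 3 nl inv[where i = S1 and j = S0 and l = l]
        inv[where i = S2 and j = S0 and l = l] inv[where i = S2 and j = S1 and l = l]
      by (cases i; cases j) simp_all
  qed
qed

lemma braid_flag:
  assumes ij: "i \<noteq> j"
  shows "act flag (alt (m i j) i j) k = act flag (alt (m i j) j i) k"
proof -
  obtain l where l: "m i j = 2 * l" using m_even[OF ij] by blast
  have all: "((flag i \<circ> flag j) ^^ m i j) k = k" for k
  proof (cases "k \<in> flags")
    case False
    have "((flag i \<circ> flag j) ^^ p) k = k" for p by (induction p) (simp_all add: flag_outside[OF False])
    then show ?thesis .
  qed (rule rotation_order[OF ij])
  let ?y = "((flag j \<circ> flag i) ^^ l) k"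
  have "?y = ((flag i \<circ> flag j) ^^ (l + l)) ?y" using all[of ?y] l by (simp add: mult_2)
  also have "\<dots> = ((flag i \<circ> flag j) ^^ l) k"
    using funpow_inverse[of "flag i" "flag j" l k] by (metis comp_apply funpow_add flag_invol)
  finally show ?thesis unfolding l act_alt_even by simp
qed

lemma act_flag_in: "k \<in> flags \<Longrightarrow> act flag w k \<in> flags"
  by (induction w) (simp_all add: flag_in del: atLeastLessThan_iff)

lemma act_flag_parity: "k \<in> flags \<Longrightarrow> even (act flag w k) \<longleftrightarrow> (even k \<longleftrightarrow> even (length w))"
  by (induction w) (simp_all add: flag_parity act_flag_in del: atLeastLessThan_iff)

text \<open>Both components satisfy the dihedral relations, so a single instance of
  \<open>tits\<close> covers isometries and flags together, and the flag permutation of a word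
  depends only on \<open>act \<tau>\<close> of that word.\<close>

definition \<tau> :: "mirror \<Rightarrow> (real^3) \<times> int \<Rightarrow> (real^3) \<times> int" where
  "\<tau> i = (\<lambda>(v, k). (mrefl i v, flag i k))"

lemma act_tau: "act \<tau> w (v, k) = (act mrefl w v, act flag w k)"
  by (induction w) (auto simp: \<tau>_def)

lemma act_tau_eqI: "(\<And>v. act mrefl w v = act mrefl u v) \<Longrightarrow> (\<And>k. act flag w k = act flag u k) \<Longrightarrow> act \<tau> w = act \<tau> u"
  by (auto simp: act_tau fun_eq_iff)

lemma act_tau_eqD: "act \<tau> w = act \<tau> u \<Longrightarrow> act mrefl w v = act mrefl u v"
  "act \<tau> w = act \<tau> u \<Longrightarrow> act flag w k = act flag u k"
  by (metis act_tau prod.inject)+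

sublocale tits \<tau> "\<lambda>i. {(v, k). lor v (\<alpha> i) > 0}" m
proof
  show "\<tau> i (\<tau> i x) = x" for i x by (cases x) (simp add: \<tau>_def)
  show "act \<tau> (alt (m i j) i j) = act \<tau> (alt (m i j) j i)" if "i \<noteq> j" for i j
    by (intro act_tau_eqI braid_mrefl braid_flag that)
  show "0 < m i j" if "i \<noteq> j" for i j using m_even[OF that] by simp
  show "m i j = m j i" for i j by (rule m_sym)
  fix i j k and x :: "(real^3) \<times> int"
  assume "i \<noteq> j" "k < m i j" "x \<in> {(v, k). 0 < lor v (\<alpha> i)}" "x \<in> {(v, k). 0 < lor v (\<alpha> j)}"
  moreover obtain v f where "x = (v, f)" by (cases x)
  ultimately show "act \<tau> (alt k j i) x \<in> {(v, k). 0 < lor v (\<alpha> i)}"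
  proof -
    assume h: "i \<noteq> j" "k < m i j" "x \<in> {(v, k). 0 < lor v (\<alpha> i)}" "x \<in> {(v, k). 0 < lor v (\<alpha> j)}" "x = (v, f)"
    obtain a b where ab: "a \<ge> 0" "b \<ge> 0" "a + b > 0"
      "\<And>x. lor (act mrefl (alt k j i) x) (\<alpha> i) = a * lor x (\<alpha> i) + b * lor x (\<alpha> j)"
      using alt_coordinate_coeffs[OF h(1,2)] by metis
    have p: "lor v (\<alpha> i) > 0" "lor v (\<alpha> j) > 0" using h by auto
    have "a * lor v (\<alpha> i) + b * lor v (\<alpha> j) > 0"
    proof (cases "a = 0")
      case True
      then show ?thesis using ab p by simp
    next
      case False
      then show ?thesis using ab(1,2) p by (simp add: add_pos_nonneg)
    qed
    then show ?thesis unfolding h(5) act_tau ab(4)[symmetric] by simp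
  qed
qed

text \<open>The reason is that the surface has a single face and a single vertex, both of degree \<open>4g\<close>.\<close>

lemma dihedral_free:
  assumes ij: "i \<noteq> j" and w: "set w \<subseteq> {i, j}" and k: "k \<in> flags" "act flag w k = k"
  shows "act \<tau> w = act \<tau> []"
proof -
  obtain p V where V: "V = alt p i j \<or> V = alt p j i" "p \<le> m i j" "act \<tau> V = act \<tau> w"
    by (rule dihedral_reduced[OF ij w])
  have fV: "act flag V k = k" using act_tau_eqD(2)[OF V(3)] k by simp
  then have "even (length V)" using act_flag_parity[OF k(1), of V] by (metis (full_types))
  then have "even p" using V(1) by auto
  then obtain l where l: "p = 2 * l" by blast
  have "l = 0"
  proof (rule ccontr)
    assume "l \<noteq> 0"
    then have "0 < l" "l < m i j" "l < m j i" using V(2) l m_sym[of i j] by auto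
    then show False
      using rotation_order(2)[OF ij k(1), of l] rotation_order(2)[OF ij[symmetric] k(1), of l] fV V(1)
      unfolding l by (auto simp: act_alt_even)
  qed
  then have "V = []" using V(1) l by auto
  then show ?thesis using V(3) by simp
qed

end

section \<open>Chambers, folding and the tessellation by triangles\<close>

context surface
begin

abbreviation \<rho> where "\<rho> \<equiv> act mrefl"

definition T :: "(real^3) set" where
  "T = {v \<in> hyperboloid. \<forall>i. lor v (\<alpha> i) \<ge> 0}"

lemma T_hyp: "t \<in> T \<Longrightarrow> t \<in> hyperboloid" by (simp add: T_def)

lemmas rhoD = lorentz_mapD[OF lorentz_act_mrefl]

text \<open>The direction bisecting the angle at the centre, at half the Klein distance of the side.
  It is not normalised to the hyperboloid, since only the signs of its products with the normals
  matter.\<close>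

definition inner_point :: "real^3" where
  "inner_point = vector [sh / (2 * ch) * cos (\<theta> / 2), sh / (2 * ch) * sin (\<theta> / 2), 1]"

lemma inner_point: "lor inner_point (\<alpha> i) > 0"
proof -
  define r where "r = sh / (2 * ch)"
  have r: "r > 0" "ch * r = sh / 2" using ch by (simp_all add: r_def)
  have s: "sin (\<theta> / 2) > 0" using theta pi_gt_zero by (intro sin_gt_zero) auto
  show ?thesis
  proof (cases i)
    case S0
    show ?thesis unfolding S0 lor_alpha using s r by (simp add: inner_point_def r_def[symmetric])
  next
    case S1
    have e: "sin \<theta> * cos (\<theta> / 2) - cos \<theta> * sin (\<theta> / 2) = sin (\<theta> / 2)"
      using sin_diff[of \<theta> "\<theta> / 2"] by simp
    have "lor inner_point (\<alpha> S1) = r * cos (\<theta> / 2) * sin \<theta> - r * sin (\<theta> / 2) * cos \<theta>"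
      unfolding lor_alpha by (simp add: inner_point_def r_def)
    also have "\<dots> = r * (sin \<theta> * cos (\<theta> / 2) - cos \<theta> * sin (\<theta> / 2))" by (simp only: algebra_simps)
    finally have "lor inner_point (\<alpha> S1) = r * sin (\<theta> / 2)" unfolding e .
    then show ?thesis using s r S1 by simp
  next
    case S2
    have e: "cos \<theta> * cos (\<theta> / 2) + sin \<theta> * sin (\<theta> / 2) = cos (\<theta> / 2)"
      using cos_diff[of \<theta> "\<theta> / 2"] by simp
    have "lor inner_point (\<alpha> S2) = sh - ch * (r * cos (\<theta> / 2) * cos \<theta> + r * sin (\<theta> / 2) * sin \<theta>)"
      unfolding lor_alpha by (simp add: inner_point_def r_def)
    also have "\<dots> = sh - ch * r * (cos \<theta> * cos (\<theta> / 2) + sin \<theta> * sin (\<theta> / 2))" by (simp only: algebra_simps)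
    finally have "lor inner_point (\<alpha> S2) = sh - ch * r * cos (\<theta> / 2)" unfolding e .
    then have "lor inner_point (\<alpha> i) = sh - sh / 2 * cos (\<theta> / 2)" unfolding S2 r(2) .
    moreover have "sh / 2 * cos (\<theta> / 2) \<le> sh / 2 * 1" using ch by (intro mult_left_mono) auto
    ultimately show ?thesis using ch(2) by linarith
  qed
qed

lemma perturb_nonneg:
  fixes x y :: real
  assumes "\<And>\<delta>. \<delta> > 0 \<Longrightarrow> x + \<delta> * y > 0" shows "x \<ge> 0"
proof (rule tendsto_lowerbound)
  have "((\<lambda>\<delta>. x + \<delta> * y) \<longlongrightarrow> x + 0 * y) (at_right 0)" by (intro tendsto_intros)
  then show "((\<lambda>\<delta>. x + \<delta> * y) \<longlongrightarrow> x) (at_right 0)" by simp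
  show "\<forall>\<^sub>F \<delta> in at_right 0. 0 \<le> x + \<delta> * y"
    using eventually_at_right_less[of 0] by eventually_elim (use assms in \<open>auto intro: less_imp_le\<close>)
qed simp

text \<open>\<open>chamber\<close> is an open cone. Adding a small multiple of
  \<open>inner_point\<close> moves \<open>t\<close> into it, and letting the multiple tend to 0
  carries \<open>act_in_halfspace\<close> over to the closed cone.\<close>

lemma chamber_side:
  assumes "len (act \<tau> w) \<le> len (act \<tau> (s # w))" and t: "\<And>i. lor t (\<alpha> i) \<ge> 0"
  shows "lor (\<rho> w t) (\<alpha> s) \<ge> 0"
proof (rule perturb_nonneg)
  fix \<delta> :: real assume "\<delta> > 0"
  then have "(t + \<delta> *\<^sub>R inner_point, 0) \<in> chamber"
    using t inner_point by (auto simp: chamber_def intro!: add_nonneg_pos)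
  from act_in_halfspace[OF assms(1) this] have "lor (\<rho> w (t + \<delta> *\<^sub>R inner_point)) (\<alpha> s) > 0"
    by (simp add: act_tau)
  then show "lor (\<rho> w t) (\<alpha> s) + \<delta> * lor (\<rho> w inner_point) (\<alpha> s) > 0" by (simp add: rhoD)
qed

lemma chamber_meet:
  assumes t: "t \<in> T" and t': "\<rho> w t \<in> T"
  shows "\<rho> w t = t" "\<exists>u. set u \<subseteq> {i. lor t (\<alpha> i) = 0} \<and> act \<tau> u = act \<tau> w"
proof -
  have "\<rho> w t = t \<and> (\<exists>u. set u \<subseteq> {i. lor t (\<alpha> i) = 0} \<and> act \<tau> u = act \<tau> w)"
    using t'
  proof (induction "len (act \<tau> w)" arbitrary: w rule: less_induct)
    case less
    show ?case
    proof (cases "len (act \<tau> w) = 0")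
      case True
      then have e: "act \<tau> w = act \<tau> []" by (simp add: len_0)
      then have "\<rho> w t = t" using act_tau_eqD(1)[OF e] by simp
      then show ?thesis using e by (intro conjI exI[of _ "[]"]) auto
    next
      case False
      then obtain s w' where w': "act \<tau> w = act \<tau> (s # w')" "len (act \<tau> w) = Suc (len (act \<tau> w'))"
        using len_Cons_less[of w] by (metis gr0I)
      have eq: "\<rho> w t = mrefl s (\<rho> w' t)" using act_tau_eqD(1)[OF w'(1)] by simp
      have "lor (\<rho> w' t) (\<alpha> s) \<ge> 0" using w' t by (intro chamber_side) (auto simp: T_def)
      moreover have "lor (\<rho> w t) (\<alpha> s) \<ge> 0" using less.prems by (simp add: T_def)
      ultimately have z: "lor (\<rho> w' t) (\<alpha> s) = 0" using eq by simp
      then have eq': "\<rho> w t = \<rho> w' t" using eq by (simp add: mrefl_def)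
      then have "\<rho> w' t \<in> T" using less.prems by simp
      from less.hyps[OF _ this] w'(2) obtain u where u: "\<rho> w' t = t"
        "set u \<subseteq> {i. lor t (\<alpha> i) = 0}" "act \<tau> u = act \<tau> w'" by auto
      have "act \<tau> (s # u) = act \<tau> w" using u(3) w'(1) by (auto simp: fun_eq_iff)
      moreover have "set (s # u) \<subseteq> {i. lor t (\<alpha> i) = 0}" using u(1,2) z by simp
      ultimately show ?thesis using u(1) eq' by metis
    qed
  qed
  then show "\<rho> w t = t" "\<exists>u. set u \<subseteq> {i. lor t (\<alpha> i) = 0} \<and> act \<tau> u = act \<tau> w" by auto
qed

definition others :: "mirror \<Rightarrow> mirror set" where "others k = - {k}"

lemma others: "\<exists>i j. i \<noteq> j \<and> others k = {i, j} \<and> i \<noteq> k \<and> j \<noteq> k"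
proof (cases k)
  case S0
  then show ?thesis by (intro exI[of _ S1] exI[of _ S2]) (use UNIV_mirror in \<open>auto simp: others_def\<close>)
next
  case S1
  then show ?thesis by (intro exI[of _ S0] exI[of _ S2]) (use UNIV_mirror in \<open>auto simp: others_def\<close>)
next
  case S2
  then show ?thesis by (intro exI[of _ S0] exI[of _ S1]) (use UNIV_mirror in \<open>auto simp: others_def\<close>)
qed

lemma gram_nonpos: "i \<noteq> k \<Longrightarrow> lor (\<alpha> i) (\<alpha> k) \<le> 0"
proof -
  assume ik: "i \<noteq> k"
  have "pi / real (m i k) \<le> pi / 2" using m_even[OF ik] by (intro divide_left_mono) auto
  then have "cos (pi / real (m i k)) \<ge> 0" by (intro cos_ge_zero) (auto intro: order_trans[of _ 0])
  then show ?thesis using gram[OF ik] by simp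
qed

text \<open>Distinct normals have nonpositive product, so reflecting in \<open>i\<close> a point on
  the nonnegative side of \<open>i\<close> can only increase its coordinate for the third mirror
  \<open>k\<close>.\<close>

lemma alt_increases:
  assumes "i \<noteq> j" "i \<noteq> k" "j \<noteq> k" "p \<le> m i j" and t: "\<And>i. lor t (\<alpha> i) \<ge> 0"
  shows "lor (\<rho> (alt p i j) t) (\<alpha> k) \<ge> lor t (\<alpha> k)"
  using assms(1-4)
proof (induction p arbitrary: i j)
  case (Suc p)
  have IH: "lor (\<rho> (alt p j i) t) (\<alpha> k) \<ge> lor t (\<alpha> k)"
    using Suc.prems m_sym[of i j] by (intro Suc.IH) auto
  obtain a b where "a \<ge> 0" "b \<ge> 0" "\<And>x. lor (\<rho> (alt p j i) x) (\<alpha> i) = a * lor x (\<alpha> i) + b * lor x (\<alpha> j)"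
    using alt_coordinate_coeffs[of i j p] Suc.prems by (metis Suc_le_lessD)
  then have "lor (\<rho> (alt p j i) t) (\<alpha> i) \<ge> 0" using t by simp
  moreover have "lor (\<alpha> i) (\<alpha> k) \<le> 0" using Suc.prems by (intro gram_nonpos) auto
  ultimately have "lor (\<rho> (alt p j i) t) (\<alpha> i) * lor (\<alpha> i) (\<alpha> k) \<le> 0" by (simp add: mult_nonneg_nonpos)
  then show ?case using IH by (simp add: lor_mrefl)
qed simp

text \<open>An open set, invariant under the dihedral group of the corner opposite to mirror
  \<open>k\<close>. It contains \<open>T\<close> without the side on \<open>k\<close>, and the
  dihedral images of \<open>T\<close> cover it; so it acts as a neighbourhood of that
  corner.\<close>

definition Y :: "mirror \<Rightarrow> (real^3) set" where
  "Y k = {z \<in> hyperboloid. \<forall>w. set w \<subseteq> others k \<longrightarrow> lor (\<rho> w z) (\<alpha> k) > 0}"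

lemma T_subset_Y: "t \<in> T \<Longrightarrow> lor t (\<alpha> k) > 0 \<Longrightarrow> t \<in> Y k"
proof -
  assume t: "t \<in> T" "lor t (\<alpha> k) > 0"
  have "lor (\<rho> w t) (\<alpha> k) > 0" if w: "set w \<subseteq> others k" for w
  proof -
    obtain i j where ij: "i \<noteq> j" "others k = {i, j}" "i \<noteq> k" "j \<noteq> k" using others by blast
    obtain p V where V: "V = alt p i j \<or> V = alt p j i" "p \<le> m i j" "act \<tau> V = act \<tau> w"
      using dihedral_reduced[OF ij(1), of w] w ij(2) by metis
    have "lor (\<rho> V t) (\<alpha> k) \<ge> lor t (\<alpha> k)"
    proof -
      have t0: "\<And>i. lor t (\<alpha> i) \<ge> 0" using t by (simp add: T_def)
      have p': "p \<le> m j i" using V(2) m_sym[of i j] by simp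
      from V(1) show ?thesis
        using alt_increases[OF ij(1,3,4) V(2) t0] alt_increases[OF ij(1)[symmetric] ij(4,3) p' t0] by metis
    qed
    then show ?thesis using t act_tau_eqD(1)[OF V(3)] by simp
  qed
  then show "t \<in> Y k" using t by (simp add: Y_def T_def)
qed

lemma T_some_positive: "t \<in> T \<Longrightarrow> \<exists>k. lor t (\<alpha> k) > 0"
proof (rule ccontr)
  assume t: "t \<in> T" "\<nexists>k. lor t (\<alpha> k) > 0"
  have z: "lor t (\<alpha> k) = 0" for k
  proof -
    have "lor t (\<alpha> k) \<ge> 0" using t(1) by (simp add: T_def)
    moreover have "\<not> lor t (\<alpha> k) > 0" using t(2) by blast
    ultimately show ?thesis by linarith
  qed
  have "t$2 = 0" using z[of S0] by (simp only: lor_alpha)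
  moreover from this have "t$1 = 0" using z[of S1] sin_pos by (simp only: lor_alpha) simp
  ultimately have "t$3 = 0" using z[of S2] ch by (simp only: lor_alpha) simp
  then show False using t by (simp add: T_def hyperboloid_def)
qed

lemma finite_dihedral: "finite (act \<tau> ` {w. set w \<subseteq> others k})"
proof -
  obtain i j where ij: "i \<noteq> j" "others k = {i, j}" using others by blast
  have "act \<tau> ` {w. set w \<subseteq> others k} \<subseteq> (\<Union>p\<in>{..m i j}. {act \<tau> (alt p i j), act \<tau> (alt p j i)})"
  proof clarify
    fix w assume "set w \<subseteq> others k"
    then obtain p V where "V = alt p i j \<or> V = alt p j i" "p \<le> m i j" "act \<tau> V = act \<tau> w"
      using dihedral_reduced[OF ij(1), of w] ij(2) by metis
    then show "act \<tau> w \<in> (\<Union>p\<in>{..m i j}. {act \<tau> (alt p i j), act \<tau> (alt p j i)})"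
      by (intro UN_I[of p]) auto
  qed
  then show ?thesis by (rule finite_subset) auto
qed

lemma finite_dihedral_rho: "finite (\<rho> ` {w. set w \<subseteq> others k})"
proof -
  have "\<rho> w = (\<lambda>v. fst (act \<tau> w (v, 0)))" for w by (auto simp: act_tau)
  then have "\<rho> ` {w. set w \<subseteq> others k} = (\<lambda>f v. fst (f (v, 0))) ` act \<tau> ` {w. set w \<subseteq> others k}"
    by (simp add: image_image)
  then show ?thesis using finite_dihedral by simp
qed

lemma Y_open: "openin (top_of_set hyperboloid) (Y k)"
proof -
  let ?F = "\<rho> ` {w. set w \<subseteq> others k}"
  have "Y k = hyperboloid \<inter> (\<Inter>f\<in>?F. {z. lor (f z) (\<alpha> k) > 0})" by (auto simp: Y_def)
  moreover have "open (\<Inter>f\<in>?F. {z. lor (f z) (\<alpha> k) > 0})"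
  proof (rule open_INT[OF finite_dihedral_rho], rule ballI)
    fix f assume "f \<in> ?F"
    then obtain w where "f = \<rho> w" by auto
    then have "continuous_on UNIV f" using linear_continuous_on[OF linear_conv_bounded_linear[THEN iffD1, OF rhoD(1)]] by simp
    then show "open {z. lor (f z) (\<alpha> k) > 0}" by (intro open_Collect_less continuous_intros)
  qed
  ultimately show ?thesis by (metis openin_open_Int)
qed

text \<open>Folding into the sector: minimize a linear functional over the finite dihedral group.\<close>

lemma Y_fold:
  assumes z: "z \<in> Y k"
  obtains w t where "set w \<subseteq> others k" "t \<in> T" "z = \<rho> w t"
proof -
  let ?D = "{w. set w \<subseteq> others k}"
  define h where "h f = - lor (f z) inner_point" for f :: "real^3 \<Rightarrow> real^3"
  have "?D \<noteq> {}" by (auto intro: exI[of _ "[]"])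
  then have fin: "finite (h ` \<rho> ` ?D)" "h ` \<rho> ` ?D \<noteq> {}" using finite_dihedral_rho by auto
  obtain w where w: "set w \<subseteq> others k" and hw: "h (\<rho> w) = Min (h ` \<rho> ` ?D)" using Min_in[OF fin] by auto
  have min: "h (\<rho> w) \<le> h (\<rho> u)" if "set u \<subseteq> others k" for u
    unfolding hw using fin(1) that by (intro Min_le) auto
  define t where "t = \<rho> w z"
  have zh: "z \<in> hyperboloid" using z by (simp add: Y_def)
  have "lor t (\<alpha> i) \<ge> 0" for i
  proof (cases "i = k")
    case True
    then show ?thesis using z w by (simp add: Y_def t_def less_imp_le)
  next
    case False
    then have "set (i # w) \<subseteq> others k" using w by (simp add: others_def)
    from min[OF this] have "0 \<le> 2 * (lor t (\<alpha> i) * lor (\<alpha> i) inner_point)" by (simp add: h_def lor_mrefl t_def)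
    then show ?thesis using inner_point[of i] by (simp add: lor_commute zero_le_mult_iff)
  qed
  then have "t \<in> T" using rhoD(3)[OF zh] by (simp add: T_def t_def)
  moreover have "z = \<rho> (rev w) t"
  proof -
    have "act \<tau> (rev w) (act \<tau> w (z, 0)) = (z, 0)" by simp
    then show ?thesis unfolding act_tau by (simp add: t_def)
  qed
  ultimately show ?thesis using that[of "rev w" t] w by simp
qed

lemma rho_rev [simp]: "\<rho> (rev w) (\<rho> w z) = z" "\<rho> w (\<rho> (rev w) z) = z"
  using act_rev[of w "(z, 0)"] by (simp_all add: act_tau)

lemma compact_T: "compact T"
proof -
  have T_eq: "T = hyperboloid \<inter> (\<Inter>i. {v. lor v (\<alpha> i) \<ge> 0})" by (auto simp: T_def)
  \<comment> \<open>Hyperbolic cosine of the circumradius, the hypotenuse of the right triangle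
    whose acute angles are both \<theta>.\<close>
  define B where "B = (cos \<theta>)\<^sup>2 / (sin \<theta>)\<^sup>2"
  have B0: "B \<ge> 0" by (simp add: B_def)
  have bound: "v$3 \<le> B" if v: "v \<in> T" for v
  proof -
    have v3: "(v$3)\<^sup>2 = 1 + (v$1)\<^sup>2 + (v$2)\<^sup>2" "v$3 > 0"
      using v by (auto simp: T_def hyperboloid_def lor_def power2_eq_square)
    have a: "v$2 \<ge> 0" "v$1 * sin \<theta> - v$2 * cos \<theta> \<ge> 0" "v$3 * sh - ch * (v$1 * cos \<theta> + v$2 * sin \<theta>) \<ge> 0"
    proof -
      have "lor v (\<alpha> i) \<ge> 0" for i using v by (simp add: T_def)
      from this[of S0] this[of S1] this[of S2] show "v$2 \<ge> 0" "v$1 * sin \<theta> - v$2 * cos \<theta> \<ge> 0"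
        "v$3 * sh - ch * (v$1 * cos \<theta> + v$2 * sin \<theta>) \<ge> 0" unfolding lor_alpha .
    qed
    have v1: "v$1 \<ge> 0"
    proof -
      have "v$2 * cos \<theta> \<ge> 0" using a sin_pos by simp
      then show ?thesis using a(2) sin_pos by (smt (verit) mult_neg_pos)
    qed
    define q where "q = v$1 * cos \<theta> + v$2 * sin \<theta>"
    have q0: "q \<ge> 0" using v1 a sin_pos by (simp add: q_def)
    have e: "(sin \<theta>)\<^sup>2 = 1 - (cos \<theta>)\<^sup>2" by (simp add: sin_squared_eq)
    have "(cos \<theta>)\<^sup>2 * ((v$1)\<^sup>2 + (v$2)\<^sup>2) \<le> q\<^sup>2"
    proof -
      have "q\<^sup>2 - (cos \<theta>)\<^sup>2 * ((v$1)\<^sup>2 + (v$2)\<^sup>2) =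
         2 * (v$2 * cos \<theta>) * (v$1 * sin \<theta> - v$2 * cos \<theta>) + (v$2)\<^sup>2 * ((sin \<theta>)\<^sup>2 + (cos \<theta>)\<^sup>2)"
        by (simp only: q_def power2_eq_square) (simp only: algebra_simps)
      also have "\<dots> \<ge> 0" using a sin_pos by simp
      finally show ?thesis by simp
    qed
    moreover have "(v$1)\<^sup>2 + (v$2)\<^sup>2 = (v$3)\<^sup>2 - 1" unfolding v3(1) by simp
    ultimately have "ch\<^sup>2 * ((cos \<theta>)\<^sup>2 * ((v$3)\<^sup>2 - 1)) \<le> ch\<^sup>2 * q\<^sup>2" by (intro mult_left_mono) simp_all
    also have "\<dots> = (ch * q)\<^sup>2" by (simp add: power_mult_distrib)
    also have "\<dots> \<le> (v$3 * sh)\<^sup>2" using a q0 ch by (intro power_mono) (auto simp: q_def)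
    also have "\<dots> = (v$3)\<^sup>2 * (ch\<^sup>2 - 1)" by (simp add: power_mult_distrib ch(3))
    finally have "ch\<^sup>2 * ((cos \<theta>)\<^sup>2 * ((v$3)\<^sup>2 - 1)) \<le> (v$3)\<^sup>2 * (ch\<^sup>2 - 1)" .
    then have "(v$3)\<^sup>2 * (ch\<^sup>2 * (cos \<theta>)\<^sup>2 - ch\<^sup>2 + 1) \<le> ch\<^sup>2 * (cos \<theta>)\<^sup>2" by (simp add: algebra_simps)
    also have "ch\<^sup>2 * (cos \<theta>)\<^sup>2 - ch\<^sup>2 + 1 = (sin \<theta>)\<^sup>2"
    proof -
      have "ch\<^sup>2 * (sin \<theta>)\<^sup>2 = (cos \<theta>)\<^sup>2" unfolding ch(4)[symmetric] by (simp add: power_mult_distrib)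
      then have "ch\<^sup>2 - ch\<^sup>2 * (cos \<theta>)\<^sup>2 = (cos \<theta>)\<^sup>2" unfolding e by (simp add: algebra_simps)
      then show ?thesis unfolding e by simp
    qed
    finally have "(v$3)\<^sup>2 * (sin \<theta>)\<^sup>2 \<le> ch\<^sup>2 * (cos \<theta>)\<^sup>2" .
    then have "(v$3 * sin \<theta>)\<^sup>2 \<le> (ch * cos \<theta>)\<^sup>2" by (simp add: power_mult_distrib)
    moreover have "0 \<le> ch * cos \<theta>" using ch(1) sin_pos by simp
    ultimately have "v$3 * sin \<theta> \<le> ch * cos \<theta>" by (rule power2_le_imp_le)
    then have "v$3 \<le> ch * cos \<theta> / sin \<theta>" using sin_pos by (simp only: pos_le_divide_eq)
    also have "\<dots> = B" by (simp add: B_def ch_def power2_eq_square)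
    finally show ?thesis .
  qed
  have "T \<subseteq> {y \<in> hyperboloid. hdist base y \<le> arcosh (B + 1)}"
  proof
    fix v assume v: "v \<in> T"
    have "arcosh (B + 1) \<ge> 0" using B0 by (intro arcosh_nonneg_real) simp
    then show "v \<in> {y \<in> hyperboloid. hdist base y \<le> arcosh (B + 1)}"
      using hdist_le_iff[OF base T_hyp[OF v]] bound[OF v] B0 T_hyp[OF v]
      by (simp add: cosh_arcosh_real lor_def base_def)
  qed
  moreover have "closed (\<Inter>i. {v. lor v (\<alpha> i) \<ge> 0})"
    by (intro closed_INT ballI closed_Collect_le continuous_intros)
  ultimately have "T = {y \<in> hyperboloid. hdist base y \<le> arcosh (B + 1)} \<inter> (\<Inter>i. {v. lor v (\<alpha> i) \<ge> 0})"
    using T_eq by blast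
  then show ?thesis using compact_Int_closed[OF compact_hball[OF base]] \<open>closed _\<close> by simp
qed

text \<open>A Lebesgue number for the covering of the compact triangle by the sets
  \<open>Y k\<close>.\<close>

lemma uniform_fold:
  obtains \<epsilon> where "\<epsilon> > 0" "\<And>t. t \<in> T \<Longrightarrow> \<exists>k. \<forall>z\<in>hyperboloid. hdist t z < \<epsilon> \<longrightarrow> z \<in> Y k"
proof -
  have "\<exists>\<epsilon>>0. \<forall>t\<in>T. \<exists>k. \<forall>z\<in>hyperboloid. hdist t z < \<epsilon> \<longrightarrow> z \<in> Y k"
  proof (rule ccontr)
    assume "\<not> ?thesis"
    then have "\<forall>\<epsilon>>0. \<exists>t\<in>T. \<forall>k. \<exists>z\<in>hyperboloid. hdist t z < \<epsilon> \<and> z \<notin> Y k" by meson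
    then have "\<forall>p::nat. \<exists>t\<in>T. \<forall>k. \<exists>z\<in>hyperboloid. hdist t z < inverse (real (Suc p)) \<and> z \<notin> Y k" by simp
    then obtain t where t: "\<And>p. t p \<in> T"
      and *: "\<And>p k. \<exists>z\<in>hyperboloid. hdist (t p) z < inverse (real (Suc p)) \<and> z \<notin> Y k" by metis
    obtain l r where l: "l \<in> T" and r: "strict_mono (r :: nat \<Rightarrow> nat)" "(t \<circ> r) \<longlonglongrightarrow> l"
      using compact_T t unfolding compact_def by metis
    obtain k where k: "l \<in> Y k" using T_some_positive[OF l] T_subset_Y[OF l] by blast
    obtain z where z: "\<And>p. z p \<in> hyperboloid" "\<And>p. hdist (t p) (z p) < inverse (real (Suc p))" "\<And>p. z p \<notin> Y k"
      using *[where k = k] by metis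
    have th: "t p \<in> hyperboloid" for p using t T_hyp by blast
    have "(\<lambda>p. hdist (t p) (z p)) \<longlonglongrightarrow> 0"
    proof (rule tendsto_sandwich[OF _ _ tendsto_const LIMSEQ_inverse_real_of_nat])
      show "\<forall>\<^sub>F p in sequentially. 0 \<le> hdist (t p) (z p)" using hdist_nonneg[OF th z(1)] by simp
      show "\<forall>\<^sub>F p in sequentially. hdist (t p) (z p) \<le> inverse (real (Suc p))"
        using z(2) by (intro always_eventually allI less_imp_le)
    qed
    then have "(\<lambda>p. hdist ((t \<circ> r) p) ((z \<circ> r) p)) \<longlonglongrightarrow> 0"
      using LIMSEQ_subseq_LIMSEQ[OF _ r(1), of "\<lambda>p. hdist (t p) (z p)" 0] by (simp add: o_def)
    then obtain r' where r': "strict_mono r'" "((z \<circ> r) \<circ> r') \<longlonglongrightarrow> l"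
      using hdist_LIMSEQ[OF T_hyp[OF l], of "t \<circ> r" "z \<circ> r"] r(2) th z(1) by auto
    obtain O' where O': "open O'" "Y k = hyperboloid \<inter> O'" using Y_open[of k] by (auto simp: openin_open)
    have "(\<lambda>p. z (r (r' p))) \<longlonglongrightarrow> l" using r'(2) by (simp add: o_def)
    then have "\<forall>\<^sub>F p in sequentially. z (r (r' p)) \<in> O'" by (rule topological_tendstoD) (use k O' in auto)
    then obtain p where "z (r (r' p)) \<in> O'" by (auto simp: eventually_sequentially)
    then show False using z(1,3) O' by auto
  qed
  then show ?thesis using that by blast
qed

text \<open>The ball of the fixed radius \<epsilon> about any point of a tile is covered by tiles,
  since moved back to \<open>T\<close> it lies in some \<open>Y k\<close>. A walk along a geodesic
  in steps of half that radius therefore reaches every point.\<close>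

lemma tiling:
  assumes z: "z \<in> hyperboloid"
  obtains w t where "t \<in> T" "z = \<rho> w t"
proof -
  obtain \<epsilon> where \<epsilon>: "\<epsilon> > 0" "\<And>t. t \<in> T \<Longrightarrow> \<exists>k. \<forall>z\<in>hyperboloid. hdist t z < \<epsilon> \<longrightarrow> z \<in> Y k"
    by (rule uniform_fold) blast
  let ?Z = "{z. \<exists>w. \<exists>t\<in>T. z = \<rho> w t}"
  have step: "z' \<in> ?Z" if "z \<in> ?Z" "z' \<in> hyperboloid" "hdist z z' < \<epsilon>" for z z'
  proof -
    obtain w t where wt: "t \<in> T" "z = \<rho> w t" using \<open>z \<in> ?Z\<close> by blast
    have "hdist t (\<rho> (rev w) z') < \<epsilon>" using that(3) rhoD(7)[of "rev w" z z'] wt by simp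
    moreover have "\<rho> (rev w) z' \<in> hyperboloid" using rhoD(3) that(2) by blast
    ultimately obtain k where "\<rho> (rev w) z' \<in> Y k" using \<epsilon>(2)[OF wt(1)] by blast
    then obtain u t' where u: "t' \<in> T" "\<rho> (rev w) z' = \<rho> u t'" using Y_fold by metis
    then have "z' = \<rho> w (\<rho> u t')" by (metis rho_rev(2))
    then have "z' = \<rho> (w @ u) t'" by (simp add: act_append)
    then show ?thesis using u(1) by blast
  qed
  have chain: "z \<in> ?Z" if "z0 \<in> T" "z \<in> hyperboloid" "hdist z0 z \<le> real p * (\<epsilon> / 2)" for z z0 p
    using that(2,3)
  proof (induction p arbitrary: z)
    case 0
    then have "z = z0" using hdist_eq_0[OF T_hyp[OF that(1)] 0(1)] hdist_nonneg[OF T_hyp[OF that(1)] 0(1)] by simp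
    then show ?case using that(1) by (auto intro!: exI[of _ "[]"])
  next
    case (Suc p)
    define s where "s = min (hdist z0 z) (real p * (\<epsilon> / 2))"
    have d0: "hdist z0 z \<ge> 0" using hdist_nonneg[OF T_hyp[OF that(1)] Suc.prems(1)] .
    have "0 \<le> s" "s \<le> hdist z0 z" using d0 \<epsilon>(1) by (simp_all add: s_def)
    from geodesic_point[OF T_hyp[OF that(1)] Suc.prems(1) this]
    obtain y where y: "y \<in> hyperboloid" "hdist z0 y = s" "hdist y z = hdist z0 z - s" by blast
    have "y \<in> ?Z" by (rule Suc.IH[OF y(1)]) (simp add: y(2) s_def)
    moreover have "hdist y z < \<epsilon>"
    proof -
      have "real (Suc p) * (\<epsilon> / 2) = real p * (\<epsilon> / 2) + \<epsilon> / 2" by (simp add: algebra_simps)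
      moreover have "s = hdist z0 z \<or> s = real p * (\<epsilon> / 2)" by (auto simp: s_def min_def)
      ultimately show ?thesis using Suc.prems(2) y(3) \<epsilon>(1) by linarith
    qed
    ultimately show ?case using step Suc.prems(1) by blast
  qed
  have "T \<noteq> {}"
  proof -
    have "base \<in> T"
    proof -
      have "lor base (\<alpha> i) \<ge> 0" for i
        by (cases i) (use ch in \<open>simp_all add: lor_def base_def\<close>)
      then show ?thesis using base by (simp add: T_def)
    qed
    then show ?thesis by blast
  qed
  then obtain z0 where z0: "z0 \<in> T" by blast
  obtain p :: nat where "hdist z0 z / (\<epsilon> / 2) \<le> real p" using real_arch_simple by blast
  then have "hdist z0 z \<le> real p * (\<epsilon> / 2)" using \<epsilon>(1) by (simp add: field_simps)
  from chain[OF z0 z this] show ?thesis using that by blast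
qed

text \<open>The flag carried by the tile of \<open>w\<close>. The reversal makes this an action from
  the right, so that appending a letter means crossing a side of the current tile; the words of
  label 0 form the stabiliser of flag 0, the later deck group.\<close>

definition lab :: "mirror list \<Rightarrow> int" where "lab w = act flag (rev w) 0"

lemma zero_flag: "0 \<in> flags" using g by simp

lemma lab_in: "lab w \<in> flags"
  unfolding lab_def by (rule act_flag_in[OF zero_flag])

lemma flag_rev [simp]: "act flag (rev w) (act flag w k) = k" "act flag w (act flag (rev w) k) = k"
  using act_rev[of w "(0, k)"] by (simp_all add: act_tau)

lemma lab_append: "lab (u @ v) = act flag (rev v) (lab u)"
  by (simp add: lab_def act_append)

lemma lab_cong:
  assumes "act \<tau> u = act \<tau> v" shows "lab u = lab v"
proof -
  have "act flag v (lab u) = act flag u (lab u)" using act_tau_eqD(2)[OF assms] by simp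
  also have "\<dots> = 0" by (simp add: lab_def)
  finally have "act flag (rev v) (act flag v (lab u)) = lab v" by (simp add: lab_def)
  then show ?thesis by simp
qed

text \<open>Conjugated to a point \<open>t\<close> of \<open>T\<close>, the element
  \<open>w'\<close> keeps \<open>t\<close> inside some \<open>Y k\<close>, so up to the stabiliser
  of \<open>t\<close> it belongs to the dihedral group of the corner opposite to \<open>k\<close>.
  That stabiliser avoids \<open>k\<close> as well, because \<open>t\<close> is off this mirror.
  Since \<open>w'\<close> fixes the flag \<open>lab u\<close>, \<open>dihedral_free\<close> makes it
  trivial.\<close>

lemma displacement:
  obtains \<epsilon> where "\<epsilon> > 0"
    "\<And>w z. lab w = 0 \<Longrightarrow> z \<in> hyperboloid \<Longrightarrow> hdist z (\<rho> w z) < \<epsilon> \<Longrightarrow> act \<tau> w = act \<tau> []"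
proof -
  obtain \<epsilon> where \<epsilon>: "\<epsilon> > 0" "\<And>t. t \<in> T \<Longrightarrow> \<exists>k. \<forall>z\<in>hyperboloid. hdist t z < \<epsilon> \<longrightarrow> z \<in> Y k"
    by (rule uniform_fold) blast
  have "act \<tau> w = act \<tau> []" if w: "lab w = 0" and z: "z \<in> hyperboloid" and d: "hdist z (\<rho> w z) < \<epsilon>" for w z
  proof -
    obtain u t where ut: "t \<in> T" "z = \<rho> u t" by (rule tiling[OF z])
    define w' where "w' = rev u @ w @ u"
    define f where "f = lab u"
    have f: "f \<in> flags" unfolding f_def by (rule lab_in)
    have tw: "hdist t (\<rho> w' t) < \<epsilon>"
      using d rhoD(7)[of "rev u" z "\<rho> w z"] ut by (simp add: w'_def act_append)
    have w'h: "\<rho> w' t \<in> hyperboloid" using rhoD(3)[OF T_hyp[OF ut(1)]] .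
    obtain k where k: "\<forall>z\<in>hyperboloid. hdist t z < \<epsilon> \<longrightarrow> z \<in> Y k" using \<epsilon>(2)[OF ut(1)] by blast
    have "hdist t t = 0" using hdist_eq_0 T_hyp[OF ut(1)] by blast
    then have "t \<in> Y k" using k \<epsilon>(1) T_hyp[OF ut(1)] by simp
    then have tk: "lor t (\<alpha> k) > 0" unfolding Y_def by (auto dest!: spec[of _ "[]"])
    have "\<rho> w' t \<in> Y k" using k tw w'h by blast
    then obtain v t' where v: "set v \<subseteq> others k" "t' \<in> T" "\<rho> w' t = \<rho> v t'" by (rule Y_fold)
    have "\<rho> (rev v @ w') t = t'" using v(3) by (simp add: act_append)
    then obtain x where x: "set x \<subseteq> {i. lor t (\<alpha> i) = 0}" "act \<tau> x = act \<tau> (rev v @ w')"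
      using chamber_meet(2)[OF ut(1), of "rev v @ w'"] v(2) by auto
    define y where "y = v @ x"
    have ys: "set y \<subseteq> others k" using v(1) x(1) tk by (auto simp: y_def others_def)
    have yw: "act \<tau> y = act \<tau> w'" using x(2) by (auto simp: y_def act_append fun_eq_iff)
    have "act flag (rev w') f = f"
      using w by (simp add: w'_def f_def lab_def act_append)
    then have "act flag w' f = f" by (metis flag_rev(2))
    then have yf: "act flag y f = f" using act_tau_eqD(2)[OF yw] by simp
    obtain i j where ij: "i \<noteq> j" "others k = {i, j}" using others by blast
    have "act \<tau> y = act \<tau> []" using dihedral_free[OF ij(1) _ f yf] ys ij(2) by simp
    then have "act \<tau> w' p = p" for p using yw by simp
    then have "act \<tau> u (act \<tau> w' (act \<tau> (rev u) p)) = p" for p by simp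
    then have "act \<tau> w p = p" for p by (simp add: w'_def act_append)
    then show ?thesis by auto
  qed
  then show ?thesis using that \<epsilon>(1) by blast
qed

text \<open>Every letter changes the parity of a flag, so words of label 0 have even length; this
  reflects the orientability of the surface.\<close>

lemma det_rho: "lab w = 0 \<Longrightarrow> det (matrix (\<rho> w)) = 1"
proof -
  assume "lab w = 0"
  then have ev: "even (length w)" using act_flag_parity[OF zero_flag, of "rev w"] by (simp add: lab_def)
  have refl_det: "det (matrix (mrefl i)) = -1" for i
  proof -
    define x y z where "x = \<alpha> i $ 1" and "y = \<alpha> i $ 2" and "z = \<alpha> i $ 3"
    have n: "x * x + y * y - z * z = 1" using gram_self[of i] by (simp add: lor_def x_def y_def z_def)
    have "det (matrix (mrefl i)) = 1 - 2 * (x * x + y * y - z * z)"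
      unfolding det_3 by (simp add: matrix_def mrefl_def lor_def axis_def x_def[symmetric] y_def[symmetric] z_def[symmetric])
        (simp add: algebra_simps)
    then show ?thesis using n by simp
  qed
  have "det (matrix (\<rho> w)) = (-1) ^ length w"
  proof (induction w)
    case Nil
    show ?case unfolding det_3 by (simp add: matrix_def axis_def)
  next
    case (Cons i w)
    have "\<rho> (i # w) = mrefl i \<circ> \<rho> w" by auto
    then have "matrix (\<rho> (i # w)) = matrix (mrefl i) ** matrix (\<rho> w)"
      using matrix_compose[OF rhoD(1)[of w] linear_mrefl[of i]] by simp
    then show ?case unfolding \<open>matrix (\<rho> (i # w)) = _\<close> by (simp add: Cons refl_det det_mul)
  qed
  then show ?thesis using ev by simp
qed

end

subsection \<open>The polygon in the tessellated plane\<close>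

lemma continuous_on_Max_finite:
  fixes f :: "'i \<Rightarrow> 'a::topological_space \<Rightarrow> real"
  assumes "finite I" "I \<noteq> {}" "\<And>i. i \<in> I \<Longrightarrow> continuous_on S (f i)"
  shows "continuous_on S (\<lambda>x. Max ((\<lambda>i. f i x) ` I))"
  using assms
proof (induction I rule: finite_ne_induct)
  case (insert i I)
  have "(\<lambda>x. Max ((\<lambda>i. f i x) ` insert i I)) = (\<lambda>x. max (f i x) (Max ((\<lambda>i. f i x) ` I)))"
    using insert.hyps by (simp add: Max_insert)
  then show ?case using insert by (auto intro!: continuous_on_max)
qed simp

text \<open>Inverse of the central projection to the Klein disc, in which geodesics are straight and
  the polygon is a regular Euclidean one.\<close>

definition klein :: "complex \<Rightarrow> real^3" where
  "klein w = (1 / sqrt (1 - (cmod w)\<^sup>2)) *\<^sub>R (\<chi> i. if i = 1 then Re w else if i = 2 then Im w else 1)"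

lemma klein_nth:
  "klein w $ 1 = Re w / sqrt (1 - (cmod w)\<^sup>2)" "klein w $ 2 = Im w / sqrt (1 - (cmod w)\<^sup>2)"
  "klein w $ 3 = 1 / sqrt (1 - (cmod w)\<^sup>2)"
  by (simp_all add: klein_def)

lemma sqrt_pos: "cmod w < 1 \<Longrightarrow> sqrt (1 - (cmod w)\<^sup>2) > 0"
  by (simp add: abs_square_less_1)

lemma klein_hyperboloid:
  assumes "cmod w < 1" shows "klein w \<in> hyperboloid"
proof -
  define r where "r = sqrt (1 - (cmod w)\<^sup>2)"
  have r: "r > 0" "r\<^sup>2 = 1 - (cmod w)\<^sup>2" using sqrt_pos[OF assms] by (auto simp: r_def)
  have "lor (klein w) (klein w) = ((Re w)\<^sup>2 + (Im w)\<^sup>2 - 1) / r\<^sup>2"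
    unfolding lor_def klein_nth r_def[symmetric] by (simp add: power2_eq_square add_divide_distrib diff_divide_distrib)
  also have "(Re w)\<^sup>2 + (Im w)\<^sup>2 - 1 = - r\<^sup>2" unfolding r(2) cmod_power2 by simp
  also have "- r\<^sup>2 / r\<^sup>2 = - (r\<^sup>2 / r\<^sup>2)" by simp
  also have "\<dots> = -1" using r(1) by simp
  finally show ?thesis using r by (simp add: hyperboloid_def klein_nth r_def[symmetric])
qed

lemma klein_inj:
  assumes "cmod w < 1" "cmod w' < 1" "klein w = klein w'" shows "w = w'"
proof -
  have "sqrt (1 - (cmod w)\<^sup>2) = sqrt (1 - (cmod w')\<^sup>2)"
    using arg_cong[OF assms(3), of "\<lambda>v. v $ 3"] unfolding klein_nth by simp
  then show ?thesis
    using arg_cong[OF assms(3), of "\<lambda>v. v $ 1"] arg_cong[OF assms(3), of "\<lambda>v. v $ 2"] sqrt_pos[OF assms(2)]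
    unfolding klein_nth by (simp add: complex_eq_iff)
qed

lemma continuous_on_klein: "continuous_on {w. cmod w < 1} klein"
proof -
  have 1: "continuous_on {w. cmod w < 1} (\<lambda>w. 1 / sqrt (1 - (cmod w)\<^sup>2))"
    by (intro continuous_intros) (use sqrt_pos in force)
  have 2: "continuous_on {w. cmod w < 1} (\<lambda>w. (\<chi> i. if i = 1 then Re w else if i = 2 then Im w else 1) :: real^3)"
  proof (rule continuous_on_vec_lambda)
    fix i :: 3
    show "continuous_on {w. cmod w < 1} (\<lambda>w. if i = 1 then Re w else if i = 2 then Im w else 1)"
      by (cases "i = 1"; cases "i = 2") (auto intro!: continuous_intros)
  qed
  from continuous_on_scaleR[OF 1 2]
  show ?thesis by (simp add: klein_def[abs_def])
qed

section \<open>The central polygon in polar Klein coordinates\<close>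

context surface
begin

text \<open>Hyperbolic tangent of the inradius, that is, the apothem of the polygon in the Klein
  disc; \<open>hh / cos \<theta>\<close> is its Euclidean circumradius.\<close>

definition hh :: real where "hh = sh / ch"

definition K :: "real \<Rightarrow> real \<Rightarrow> real^3" where "K s \<psi> = klein (rcis s \<psi>)"

lemma hh: "hh > 0" "hh / cos \<theta> < 1"
proof -
  show "hh > 0" using ch by (simp add: hh_def)
  have e: "(sin \<theta>)\<^sup>2 = 1 - (cos \<theta>)\<^sup>2" by (simp add: sin_squared_eq)
  have "ch\<^sup>2 * (sin \<theta>)\<^sup>2 = (cos \<theta>)\<^sup>2" unfolding ch(4)[symmetric] by (simp add: power_mult_distrib)
  then have "ch\<^sup>2 - ch\<^sup>2 * (cos \<theta>)\<^sup>2 = (cos \<theta>)\<^sup>2" unfolding e by (simp add: algebra_simps)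
  moreover have "(cos \<theta>)\<^sup>2 < 1" using sin_pos by (simp add: e[symmetric] abs_square_less_1)
  ultimately have "sh\<^sup>2 < (ch * cos \<theta>)\<^sup>2" unfolding ch(3) power_mult_distrib by linarith
  moreover have "0 \<le> ch * cos \<theta>" using ch(1) sin_pos(2) by simp
  ultimately have "sh < ch * cos \<theta>" by (rule power2_less_imp_less)
  moreover have "ch * cos \<theta> > 0" using ch(1) sin_pos(2) by simp
  ultimately have "sh / (ch * cos \<theta>) < 1" by (simp only: pos_divide_less_eq mult_1)
  then show "hh / cos \<theta> < 1" by (simp add: hh_def)
qed

lemma cos_x: "\<bar>x\<bar> \<le> \<theta> \<Longrightarrow> cos x \<ge> cos \<theta>" "\<bar>x\<bar> \<le> \<theta> \<Longrightarrow> cos x > 0"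
proof -
  assume x: "\<bar>x\<bar> \<le> \<theta>"
  have "cos \<bar>x\<bar> \<ge> cos \<theta>" using x theta pi_gt_zero by (intro cos_monotone_0_pi_le) auto
  then show "cos x \<ge> cos \<theta>" by simp
  then show "cos x > 0" using sin_pos by linarith
qed

lemma K_nth: "K s \<psi> $ 1 = s * cos \<psi> / sqrt (1 - s\<^sup>2)" "K s \<psi> $ 2 = s * sin \<psi> / sqrt (1 - s\<^sup>2)"
  "K s \<psi> $ 3 = 1 / sqrt (1 - s\<^sup>2)"
  by (simp_all add: K_def klein_nth)

lemma mrefl_nth_0: "mrefl S0 v = vector [v$1, - v$2, v$3]"
  by (simp add: mrefl_def lor_alpha[simplified] lor_def vec_eq_iff forall_3)

lemma mrefl_nth_1: "mrefl S1 v = vector [v$1 * cos (2 * \<theta>) + v$2 * sin (2 * \<theta>), v$1 * sin (2 * \<theta>) - v$2 * cos (2 * \<theta>), v$3]"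
proof -
  have c: "cos (2 * \<theta>) = 1 - 2 * (sin \<theta> * sin \<theta>)" "cos (2 * \<theta>) = 2 * (cos \<theta> * cos \<theta>) - 1"
    using cos_double_sin[of \<theta>] cos_double_cos[of \<theta>] by (simp_all add: power2_eq_square)
  have S: "sin (2 * \<theta>) = 2 * (sin \<theta> * cos \<theta>)" by (simp add: sin_double)
  have l: "lor v (\<alpha> S1) = v$1 * sin \<theta> - v$2 * cos \<theta>" by (rule lor_alpha)
  have "v$1 - 2 * (v$1 * sin \<theta> - v$2 * cos \<theta>) * sin \<theta> = v$1 * cos (2 * \<theta>) + v$2 * sin (2 * \<theta>)"
    unfolding c(1) S by (simp add: algebra_simps)
  moreover have "v$2 - 2 * (v$1 * sin \<theta> - v$2 * cos \<theta>) * - cos \<theta> = v$1 * sin (2 * \<theta>) - v$2 * cos (2 * \<theta>)"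
    unfolding c(2) S by (simp add: algebra_simps)
  ultimately show ?thesis unfolding mrefl_def l by (simp add: vec_eq_iff forall_3)
qed

lemma mrefl_K: "mrefl S0 (K s \<psi>) = K s (- \<psi>)" "mrefl S1 (K s \<psi>) = K s (2 * \<theta> - \<psi>)"
  unfolding mrefl_nth_0 mrefl_nth_1
  by (simp_all add: vec_eq_iff forall_3 K_nth cos_diff sin_diff add_divide_distrib diff_divide_distrib algebra_simps)

primrec rotw :: "nat \<Rightarrow> mirror list" where
  "rotw 0 = []"
| "rotw (Suc j) = rotw j @ [S1, S0]"

text \<open>A word in the mirrors through the centre that carries \<open>T\<close> to the triangle
  of flag \<open>f\<close> in the central polygon: a rotation for even flags, preceded by the
  reflection in \<open>S1\<close> for odd ones.\<close>

definition wd :: "int \<Rightarrow> mirror list" where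
  "wd f = rotw (nat (f div 2)) @ (if even f then [] else [S1])"

lemma rho_rotw: "\<rho> (rotw j) (K s \<psi>) = K s (\<psi> + 2 * \<theta> * real j)"
  by (induction j arbitrary: \<psi>) (simp_all add: act_append mrefl_K algebra_simps)

lemma lab_rotw: "j < 4 * g \<Longrightarrow> lab (rotw j) = 2 * int j"
proof (induction j)
  case 0
  then show ?case by (simp add: lab_def)
next
  case (Suc j)
  then have "lab (rotw (Suc j)) = flag S0 (flag S1 ((2 * int j) mod (8 * int g)))"
    by (simp add: lab_append)
  also have "\<dots> = 2 * int (Suc j)" unfolding flag_S0_S1 using Suc.prems by simp
  finally show ?case .
qed

lemma lab_wd: "f \<in> flags \<Longrightarrow> lab (wd f) = f"
proof -
  assume f: "f \<in> flags"
  define j where "j = nat (f div 2)"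
  have j: "int j = f div 2" "j < 4 * g" using f by (auto simp: j_def)
  have "lab (rotw j) = 2 * int j" using lab_rotw[OF j(2)] .
  moreover have "2 * int j \<in> flags" using j(2) by simp
  ultimately show ?thesis using j(1) by (auto simp: wd_def j_def[symmetric] lab_append flag.simps)
qed

lemma rho_wd: "f \<in> flags \<Longrightarrow> \<rho> (wd f) (K s \<psi>) = K s ((if even f then \<psi> else 2 * \<theta> - \<psi>) + 2 * \<theta> * real_of_int (f div 2))"
  by (simp add: wd_def rho_rotw act_append mrefl_K)

lemma set_wd: "set (wd f) \<subseteq> {S0, S1}"
proof -
  have "set (rotw j) \<subseteq> {S0, S1}" for j by (induction j) auto
  then show ?thesis by (auto simp: wd_def)
qed

lemma T_polar:
  assumes "t \<in> T"
  obtains s \<psi> where "t = K s \<psi>" "0 \<le> \<psi>" "\<psi> \<le> \<theta>" "0 \<le> s" "s * cos (\<theta> - \<psi>) \<le> hh"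
    "lor t (\<alpha> S2) = 0 \<Longrightarrow> s * cos (\<theta> - \<psi>) = hh"
proof -
  have t3: "(t$3)\<^sup>2 = 1 + (t$1)\<^sup>2 + (t$2)\<^sup>2" "t$3 > 0"
    using assms by (auto simp: T_def hyperboloid_def lor_def power2_eq_square)
  have "lor t (\<alpha> i) \<ge> 0" for i using assms by (simp add: T_def)
  from this[of S0] this[of S1] this[of S2] have a: "t$2 \<ge> 0" "t$1 * sin \<theta> - t$2 * cos \<theta> \<ge> 0"
    "t$3 * sh - ch * (t$1 * cos \<theta> + t$2 * sin \<theta>) \<ge> 0" unfolding lor_alpha .
  define w where "w = Complex (t$1) (t$2)"
  define \<psi> where "\<psi> = (if w = 0 then 0 else Arg w)"
  define c where "c = cmod w"
  have wc: "w = rcis c \<psi>" unfolding c_def \<psi>_def using rcis_cmod_Arg[of w] by auto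
  have t12: "t$1 = c * cos \<psi>" "t$2 = c * sin \<psi>"
    using arg_cong[OF wc, of Re] arg_cong[OF wc, of Im] by (simp_all add: w_def)
  have c2: "(t$3)\<^sup>2 = 1 + c\<^sup>2" unfolding t3(1) c_def cmod_power2 by (simp add: w_def)
  have \<psi>: "0 \<le> \<psi>" "\<psi> \<le> \<theta>"
  proof -
    have "0 \<le> \<psi> \<and> \<psi> \<le> \<theta>"
    proof (cases "w = 0")
      case False
      then have c0: "c > 0" by (simp add: c_def)
      have ar: "- pi < \<psi>" "\<psi> \<le> pi" using mpi_less_Arg[of w] Arg_le_pi[of w] False by (auto simp: \<psi>_def)
      have "sin \<psi> \<ge> 0" using a(1) c0 t12(2) by (simp add: zero_le_mult_iff)
      then have p0: "\<psi> \<ge> 0" using ar sin_gt_zero[of "- \<psi>"] by (smt (verit) sin_minus)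
      have "c * sin (\<theta> - \<psi>) \<ge> 0" using a(2) unfolding t12 sin_diff by (simp add: algebra_simps)
      then have "sin (\<theta> - \<psi>) \<ge> 0" using c0 by (simp add: zero_le_mult_iff)
      then have "\<psi> \<le> \<theta>" using sin_gt_zero[of "\<psi> - \<theta>"] ar theta
        by (smt (verit) sin_minus)
      with p0 show ?thesis by simp
    qed (use theta in \<open>simp add: \<psi>_def\<close>)
    then show "0 \<le> \<psi>" "\<psi> \<le> \<theta>" by auto
  qed
  define s where "s = c / t$3"
  have s0: "s \<ge> 0" using t3(2) by (simp add: s_def c_def)
  have "s\<^sup>2 = ((t$3)\<^sup>2 - 1) / (t$3)\<^sup>2" unfolding c2 by (simp add: s_def power_divide c2)
  then have "1 - s\<^sup>2 = 1 / (t$3)\<^sup>2" using t3(2) by (simp add: diff_divide_distrib)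
  then have rt: "sqrt (1 - s\<^sup>2) = 1 / t$3" using t3(2) by (simp add: real_sqrt_divide)
  have eq: "t = K s \<psi>"
    unfolding vec_eq_iff forall_3 K_nth rt t12 using t3(2) by (simp add: s_def)
  have cd: "t$1 * cos \<theta> + t$2 * sin \<theta> = c * cos (\<theta> - \<psi>)" unfolding t12 cos_diff by (simp add: algebra_simps)
  have "c * cos (\<theta> - \<psi>) * ch \<le> t$3 * sh" using a(3) unfolding cd by (simp add: mult_ac)
  then have le: "s * cos (\<theta> - \<psi>) \<le> hh" using t3(2) ch(1) by (simp add: s_def hh_def field_simps)
  have "s * cos (\<theta> - \<psi>) = hh" if "lor t (\<alpha> S2) = 0"
  proof -
    have "t$3 * sh = ch * (c * cos (\<theta> - \<psi>))" using that unfolding lor_alpha cd by simp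
    then show ?thesis using t3(2) ch(1) by (simp add: s_def hh_def field_simps)
  qed
  with that eq \<psi> s0 le show ?thesis by blast
qed

lemma K_in_T:
  assumes \<psi>: "0 \<le> \<psi>" "\<psi> \<le> \<theta>" and s: "0 \<le> s" "s * cos (\<theta> - \<psi>) \<le> hh"
  shows "K s \<psi> \<in> T" "s < 1" "s * cos (\<theta> - \<psi>) = hh \<Longrightarrow> lor (K s \<psi>) (\<alpha> S2) = 0"
proof -
  have "s * cos \<theta> \<le> s * cos (\<theta> - \<psi>)" using cos_x(1)[of "\<theta> - \<psi>"] \<psi> s by (intro mult_left_mono) auto
  moreover have "hh < 1 * cos \<theta>" using hh(2) sin_pos(2) by (simp only: pos_divide_less_eq)
  ultimately have "s * cos \<theta> < 1 * cos \<theta>" using s(2) by linarith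
  then show s1: "s < 1" using sin_pos(2) by (simp only: mult_less_cancel_right_pos)
  define r where "r = sqrt (1 - s\<^sup>2)"
  have r: "r > 0" using s1 s(1) by (simp add: r_def abs_square_less_1)
  have l2: "lor (K s \<psi>) (\<alpha> S2) = (sh - ch * (s * cos (\<theta> - \<psi>))) / r"
    unfolding lor_alpha K_nth r_def[symmetric] cos_diff using r by (simp add: field_simps)
  have "lor (K s \<psi>) (\<alpha> i) \<ge> 0" for i
  proof (cases i)
    case S0
    have "sin \<psi> \<ge> 0" using \<psi> theta pi_gt_zero by (intro sin_ge_zero) auto
    then show ?thesis unfolding S0 lor_alpha K_nth r_def[symmetric] using s(1) r by simp
  next
    case S1
    have "sin (\<theta> - \<psi>) \<ge> 0" using \<psi> theta pi_gt_zero by (intro sin_ge_zero) auto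
    moreover have "lor (K s \<psi>) (\<alpha> S1) = s * sin (\<theta> - \<psi>) / r"
      unfolding lor_alpha K_nth r_def[symmetric] sin_diff using r by (simp add: field_simps)
    ultimately show ?thesis using s(1) r S1 by simp
  next
    case S2
    have "ch * (s * cos (\<theta> - \<psi>)) \<le> ch * hh" using s(2) ch(1) by (intro mult_left_mono) auto
    then show ?thesis unfolding S2 l2 using r ch(1) by (simp add: hh_def)
  qed
  then show "K s \<psi> \<in> T" using klein_hyperboloid[of "rcis s \<psi>"] s1 s(1) by (simp add: T_def K_def)
  show "s * cos (\<theta> - \<psi>) = hh \<Longrightarrow> lor (K s \<psi>) (\<alpha> S2) = 0"
    unfolding l2 using ch(1) by (simp add: hh_def)
qed

text \<open>The polygon map stretches each ray so that the unit circle goes to the regular geodesic \<open>4g\<close>-gon,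
  given in the Klein model by the gauge \<open>gauge\<close>.\<close>

definition gauge :: "complex \<Rightarrow> real" where
  "gauge z = Max ((\<lambda>j. Re (z * cis (- (2 * real j + 1) * \<theta>))) ` {..<n})"

definition stretch :: "complex \<Rightarrow> complex" where
  "stretch z = complex_of_real (hh * cmod z / gauge z) * z"

definition J :: "complex \<Rightarrow> real^3" where "J z = klein (stretch z)"

text \<open>For positive \<open>l\<close> the difference of the cosines is twice a product of sines
  of angles between 0 and \<open>pi\<close>. It shows that the maximum in \<open>gauge\<close> is
  attained at the side whose sector contains the point.\<close>

lemma cos_sector:
  assumes x: "\<bar>x\<bar> \<le> \<theta>" and l: "\<bar>l\<bar> < int n"
  shows "cos (x + 2 * real_of_int l * \<theta>) \<le> cos x"
proof -
  have pos: "cos (x + 2 * real_of_int l * \<theta>) \<le> cos x" if x: "\<bar>x\<bar> \<le> \<theta>" and l: "l \<ge> 1" "l < int n" for l x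
  proof -
    have lt: "real_of_int l * \<theta> \<le> pi - \<theta>"
    proof -
      have "real_of_int l + 1 \<le> real n" using l by linarith
      then have "(real_of_int l + 1) * \<theta> \<le> real n * \<theta>" using theta by (intro mult_right_mono) auto
      then show ?thesis using theta(3) by (simp add: algebra_simps)
    qed
    have l1: "\<theta> \<le> real_of_int l * \<theta>" using l theta mult_right_mono[of 1 "real_of_int l" \<theta>] by simp
    have "cos x - cos (x + 2 * real_of_int l * \<theta>) = 2 * sin (x + real_of_int l * \<theta>) * sin (real_of_int l * \<theta>)"
      using cos_diff_cos[of x "x + 2 * real_of_int l * \<theta>"] by (simp add: algebra_simps add_divide_distrib)
    moreover have "sin (x + real_of_int l * \<theta>) \<ge> 0" using x lt l1 by (intro sin_ge_zero) auto
    moreover have "sin (real_of_int l * \<theta>) \<ge> 0" using lt l1 theta by (intro sin_ge_zero) auto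
    ultimately show ?thesis by (smt (verit) mult_nonneg_nonneg)
  qed
  consider "l = 0" | "l \<ge> 1" | "- l \<ge> 1" by linarith
  then show ?thesis
  proof cases
    case 3
    have "cos (- x + 2 * real_of_int (- l) * \<theta>) \<le> cos (- x)" using 3 l x by (intro pos) auto
    moreover have "- x + 2 * real_of_int (- l) * \<theta> = - (x + 2 * real_of_int l * \<theta>)" by simp
    ultimately show ?thesis by (metis cos_minus)
  qed (use pos x l in auto)
qed

lemma gauge_polar:
  assumes r: "r \<ge> 0" and x: "\<bar>x\<bar> \<le> \<theta>" and j: "j < n"
  shows "gauge (rcis r ((2 * real j + 1) * \<theta> + x)) = r * cos x"
proof -
  have e: "Re (rcis r ((2 * real j + 1) * \<theta> + x) * cis (- (2 * real i + 1) * \<theta>)) =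
      r * cos (x + 2 * real_of_int (int j - int i) * \<theta>)" for i
    by (simp add: cis_rcis_eq rcis_mult) (simp add: algebra_simps)
  show ?thesis unfolding gauge_def e
  proof (rule Max_eqI)
    fix y assume "y \<in> (\<lambda>i. r * cos (x + 2 * real_of_int (int j - int i) * \<theta>)) ` {..<n}"
    then obtain i where i: "i < n" "y = r * cos (x + 2 * real_of_int (int j - int i) * \<theta>)" by auto
    show "y \<le> r * cos x" unfolding i(2) by (rule mult_left_mono[OF cos_sector[OF x] r]) (use i j in auto)
  next
    show "r * cos x \<in> (\<lambda>i. r * cos (x + 2 * real_of_int (int j - int i) * \<theta>)) ` {..<n}"
      by (rule image_eqI[of _ _ j]) (use j in auto)
  qed simp
qed

lemma polar_sector:
  obtains j x where "j < n" "\<bar>x\<bar> \<le> \<theta>" "z = rcis (cmod z) ((2 * real j + 1) * \<theta> + x)"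
proof -
  define a where "a = Arg2pi z"
  have a: "0 \<le> a" "a < 2 * pi" "z = rcis (cmod z) a"
    using Arg2pi[of z] by (auto simp: a_def rcis_def cis_conv_exp is_Arg_def mult.commute)
  define j where "j = nat \<lfloor>a / (2 * \<theta>)\<rfloor>"
  have fl: "\<lfloor>a / (2 * \<theta>)\<rfloor> \<ge> 0" using a theta by simp
  have j: "real j \<le> a / (2 * \<theta>)" "a / (2 * \<theta>) < real j + 1"
    using fl by (simp_all add: j_def)
  have "a / (2 * \<theta>) < real n" using a(2) theta by (simp add: field_simps)
  then have "j < n" using j(1) by linarith
  moreover have "\<bar>a - (2 * real j + 1) * \<theta>\<bar> \<le> \<theta>" using j theta(1) by (simp add: field_simps abs_le_iff)
  moreover have "z = rcis (cmod z) ((2 * real j + 1) * \<theta> + (a - (2 * real j + 1) * \<theta>))" using a(3) by simp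
  ultimately show ?thesis by (rule that)
qed

lemma stretch_polar:
  assumes "r \<ge> 0" "\<bar>x\<bar> \<le> \<theta>" "j < n"
  shows "stretch (rcis r ((2 * real j + 1) * \<theta> + x)) = rcis (hh * r / cos x) ((2 * real j + 1) * \<theta> + x)"
  using assms cos_x(2)[OF assms(2)] by (simp add: stretch_def gauge_polar) (simp add: rcis_def)

lemma J_polar:
  assumes "r \<ge> 0" "\<bar>x\<bar> \<le> \<theta>" "j < n"
  shows "J (rcis r ((2 * real j + 1) * \<theta> + x)) = K (hh * r / cos x) ((2 * real j + 1) * \<theta> + x)"
  unfolding J_def K_def stretch_polar[OF assms] ..

lemma norm_stretch: "cmod (stretch z) \<le> hh / cos \<theta> * cmod z"
proof -
  obtain j x where jx: "j < n" "\<bar>x\<bar> \<le> \<theta>" "z = rcis (cmod z) ((2 * real j + 1) * \<theta> + x)" by (rule polar_sector)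
  have "cmod (stretch z) = hh * cmod z / cos x"
    using cos_x(2)[OF jx(2)] hh(1) by (subst jx(3)) (simp add: stretch_polar[OF _ jx(2,1)])
  also have "\<dots> \<le> hh * cmod z / cos \<theta>" using cos_x[OF jx(2)] sin_pos hh(1) by (intro divide_left_mono) auto
  finally show ?thesis by simp
qed

lemma stretch_lt_1: "z \<in> cball 0 1 \<Longrightarrow> cmod (stretch z) < 1"
proof -
  assume "z \<in> cball 0 1"
  then have "hh / cos \<theta> * cmod z \<le> hh / cos \<theta> * 1" using hh(1) sin_pos by (intro mult_left_mono) auto
  then show ?thesis using norm_stretch[of z] hh(2) by linarith
qed

lemma J_hyperboloid: "z \<in> cball 0 1 \<Longrightarrow> J z \<in> hyperboloid"
  unfolding J_def by (intro klein_hyperboloid stretch_lt_1)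

lemma continuous_stretch: "continuous_on UNIV stretch"
proof -
  have cg: "continuous_on UNIV gauge"
  proof -
    have "0 \<in> {..<n}" using n8 by simp
    then have "{..<n} \<noteq> {}" by blast
    then show ?thesis unfolding gauge_def[abs_def]
      by (intro continuous_on_Max_finite continuous_intros) auto
  qed
  have "isCont stretch z" for z
  proof (cases "z = 0")
    case True
    have "((\<lambda>z. hh / cos \<theta> * cmod z) \<longlongrightarrow> hh / cos \<theta> * cmod 0) (at 0)" by (intro tendsto_intros)
    then have "((\<lambda>z. hh / cos \<theta> * cmod z) \<longlongrightarrow> 0) (at 0)" by simp
    then have "(stretch \<longlongrightarrow> 0) (at 0)"
      by (rule Lim_null_comparison[rotated]) (intro always_eventually allI norm_stretch)
    then show ?thesis using True by (simp add: isCont_def stretch_def)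
  next
    case False
    obtain j x where jx: "j < n" "\<bar>x\<bar> \<le> \<theta>" "z = rcis (cmod z) ((2 * real j + 1) * \<theta> + x)" by (rule polar_sector)
    have "gauge z = cmod z * cos x" by (subst jx(3)) (simp add: gauge_polar[OF _ jx(2,1)])
    then have "gauge z \<noteq> 0" using False cos_x(2)[OF jx(2)] by simp
    moreover have "isCont gauge z" using cg by (simp add: continuous_on_eq_continuous_at)
    ultimately show ?thesis unfolding stretch_def[abs_def] by (intro continuous_intros) auto
  qed
  then show ?thesis by (simp add: continuous_on_eq_continuous_at)
qed

lemma continuous_on_J: "continuous_on (cball 0 1) J"
proof -
  have "continuous_on (cball 0 1) (klein \<circ> stretch)"
    by (rule continuous_on_compose[OF continuous_on_subset[OF continuous_stretch] continuous_on_subset[OF continuous_on_klein]])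
      (use stretch_lt_1 in auto)
  then show ?thesis by (simp add: J_def[abs_def] o_def)
qed

lemma J_inj: "z \<in> cball 0 1 \<Longrightarrow> z' \<in> cball 0 1 \<Longrightarrow> J z = J z' \<Longrightarrow> z = z'"
proof -
  assume zz: "z \<in> cball 0 1" "z' \<in> cball 0 1" "J z = J z'"
  then have eq: "stretch z = stretch z'" unfolding J_def by (intro klein_inj stretch_lt_1)
  obtain j x where jx: "j < n" "\<bar>x\<bar> \<le> \<theta>" "z = rcis (cmod z) ((2 * real j + 1) * \<theta> + x)" by (rule polar_sector)
  obtain j' x' where jx': "j' < n" "\<bar>x'\<bar> \<le> \<theta>" "z' = rcis (cmod z') ((2 * real j' + 1) * \<theta> + x')" by (rule polar_sector)
  define a where "a = (2 * real j + 1) * \<theta> + x"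
  define a' where "a' = (2 * real j' + 1) * \<theta> + x'"
  define r where "r = cmod z"
  define r' where "r' = cmod z'"
  have c: "cos x > 0" "cos x' > 0" using cos_x(2) jx(2) jx'(2) by auto
  have z: "z = rcis r a" "z' = rcis r' a'" using jx(3) jx'(3) by (simp_all add: r_def r'_def a_def a'_def)
  have st: "rcis (hh * r / cos x) a = rcis (hh * r' / cos x') a'"
  proof -
    have r0: "r \<ge> 0" "r' \<ge> 0" by (simp_all add: r_def r'_def)
    show ?thesis using eq
      unfolding z stretch_polar[OF r0(1) jx(2,1), folded a_def] stretch_polar[OF r0(2) jx'(2,1), folded a'_def] .
  qed
  have hr: "hh * r / cos x = hh * r' / cos x'"
  proof -
    have "0 \<le> hh * r / cos x" "0 \<le> hh * r' / cos x'" using c hh(1) by (simp_all add: r_def r'_def)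
    then show ?thesis using arg_cong[OF st, of cmod] unfolding complex_mod_rcis by simp
  qed
  then have m: "r / cos x = r' / cos x'" using hh(1) c by (simp add: field_simps)
  show "z = z'"
  proof (cases "r = 0")
    case True
    then have "r' = 0" using m c by simp
    then show ?thesis using True z by simp
  next
    case False
    then have "hh * r / cos x \<noteq> 0" using hh(1) c by simp
    then have cis: "cis a = cis a'" using st unfolding hr[symmetric] by (simp add: rcis_def)
    have "cos x = gauge (rcis 1 a)" using gauge_polar[OF _ jx(2,1), of 1] by (simp add: a_def)
    also have "\<dots> = gauge (rcis 1 a')" using cis by (simp add: rcis_def)
    also have "\<dots> = cos x'" using gauge_polar[OF _ jx'(2,1), of 1] by (simp add: a'_def)
    finally have "r = r'" using m c by simp
    then show ?thesis using z cis by (simp add: rcis_def)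
  qed
qed

lemma J_flag:
  assumes z: "z \<in> cball 0 1"
  obtains f t where "f \<in> flags" "t \<in> T" "J z = \<rho> (wd f) t"
proof -
  obtain j x where jx: "j < n" "\<bar>x\<bar> \<le> \<theta>" "z = rcis (cmod z) ((2 * real j + 1) * \<theta> + x)" by (rule polar_sector)
  define s where "s = hh * cmod z / cos x"
  have c: "cos x > 0" using cos_x(2) jx(2) by auto
  have s: "s \<ge> 0" "s * cos x \<le> hh" using c hh(1) z mult_left_mono[of "cmod z" 1 hh] by (simp_all add: s_def)
  have Jz: "J z = K s ((2 * real j + 1) * \<theta> + x)"
    by (subst jx(3)) (simp add: J_polar[OF _ jx(2,1)] s_def)
  show ?thesis
  proof (cases "x \<le> 0")
    case True
    have f: "2 * int j \<in> flags" using jx(1) by (simp add: n_def)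
    have "K s (\<theta> + x) \<in> T" using K_in_T(1)[of "\<theta> + x" s] True jx(2) s by simp
    moreover have "J z = \<rho> (wd (2 * int j)) (K s (\<theta> + x))" unfolding rho_wd[OF f] Jz by (simp add: algebra_simps)
    ultimately show ?thesis using that f by blast
  next
    case False
    have f: "2 * int j + 1 \<in> flags" using jx(1) by (simp add: n_def)
    have "K s (\<theta> - x) \<in> T" using K_in_T(1)[of "\<theta> - x" s] False jx(2) s by simp
    moreover have "J z = \<rho> (wd (2 * int j + 1)) (K s (\<theta> - x))" unfolding rho_wd[OF f] Jz by (simp add: algebra_simps)
    ultimately show ?thesis using that f by blast
  qed
qed

lemma flag_J:
  assumes f: "f \<in> flags" and t: "t \<in> T"
  obtains z where "z \<in> cball 0 1" "J z = \<rho> (wd f) t"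
proof -
  obtain s \<psi> where t: "t = K s \<psi>" "0 \<le> \<psi>" "\<psi> \<le> \<theta>" "0 \<le> s" "s * cos (\<theta> - \<psi>) \<le> hh" by (rule T_polar[OF t]) blast
  define x where "x = (if even f then \<psi> - \<theta> else \<theta> - \<psi>)"
  have x: "\<bar>x\<bar> \<le> \<theta>" "cos x = cos (\<theta> - \<psi>)" using t cos_minus[of "\<theta> - \<psi>"] by (auto simp: x_def)
  define j where "j = nat (f div 2)"
  have j: "j < n" "real_of_int (f div 2) = real j" using f by (auto simp: j_def n_def)
  define r where "r = s * cos x / hh"
  have r: "0 \<le> r" "r \<le> 1" using t cos_x(2)[OF x(1)] hh(1) by (auto simp: r_def x(2)[symmetric])
  have "J (rcis r ((2 * real j + 1) * \<theta> + x)) = K s ((2 * real j + 1) * \<theta> + x)"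
    using J_polar[OF r(1) x(1) j(1)] cos_x(2)[OF x(1)] hh(1) by (simp add: r_def)
  also have "\<dots> = \<rho> (wd f) t" unfolding t(1) rho_wd[OF f] j(2) by (simp add: x_def algebra_simps)
  finally show ?thesis using that[of "rcis r ((2 * real j + 1) * \<theta> + x)"] r by simp
qed

text \<open>First half of side 0, from the vertex at \<open>u = 0\<close> to the midpoint at
  \<open>u = 1/2\<close>. The parameter is proportional to the angle, as in
  \<open>polygon_side\<close>; second halves come from the reflected triangle.\<close>

definition sidept :: "real \<Rightarrow> real^3" where "sidept u = K (hh / cos (\<theta> - 2 * \<theta> * u)) (2 * \<theta> * u)"

lemma sidept:
  assumes u: "0 \<le> u" "u \<le> 1 / 2"
  shows "sidept u \<in> T" "lor (sidept u) (\<alpha> S2) = 0"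
    and "j < n \<Longrightarrow> J (polygon_side g j u) = \<rho> (wd (2 * int j)) (sidept u)"
    and "j < n \<Longrightarrow> J (polygon_side g j (1 - u)) = \<rho> (wd (2 * int j + 1)) (sidept u)"
proof -
  define x where "x = \<theta> - 2 * \<theta> * u"
  have x: "0 \<le> x" "x \<le> \<theta>" using u theta mult_left_mono[of u "1/2" "2 * \<theta>"] by (auto simp: x_def)
  have c: "cos x > 0" using cos_x(2)[of x] x by auto
  have s: "sidept u = K (hh / cos x) (2 * \<theta> * u)" by (simp add: sidept_def x_def)
  have \<psi>: "0 \<le> 2 * \<theta> * u" "2 * \<theta> * u \<le> \<theta>" using x u theta by (auto simp: x_def)
  have e: "hh / cos x * cos (\<theta> - 2 * \<theta> * u) = hh" using c by (simp add: x_def[symmetric])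
  show "sidept u \<in> T" "lor (sidept u) (\<alpha> S2) = 0"
    unfolding s using K_in_T[OF \<psi>, of "hh / cos x"] e c hh(1) by simp_all
  have side: "polygon_side g j t = rcis 1 (2 * \<theta> * (real j + t))" for j t
    using g by (simp add: polygon_side_def \<theta>_def n_def cis_rcis_eq)
  show "J (polygon_side g j u) = \<rho> (wd (2 * int j)) (sidept u)" if j: "j < n"
  proof -
    have f: "2 * int j \<in> flags" using j by (simp add: n_def)
    have "polygon_side g j u = rcis 1 ((2 * real j + 1) * \<theta> + (- x))"
      unfolding side by (simp add: x_def algebra_simps)
    then have "J (polygon_side g j u) = K (hh / cos x) ((2 * real j + 1) * \<theta> + (- x))"
      using J_polar[of 1 "- x" j] j x by simp
    also have "(2 * real j + 1) * \<theta> + (- x) = 2 * \<theta> * u + 2 * \<theta> * real j" by (simp add: x_def algebra_simps)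
    finally show ?thesis unfolding s rho_wd[OF f] by simp
  qed
  show "J (polygon_side g j (1 - u)) = \<rho> (wd (2 * int j + 1)) (sidept u)" if j: "j < n"
  proof -
    have f: "2 * int j + 1 \<in> flags" using j by (simp add: n_def)
    have "polygon_side g j (1 - u) = rcis 1 ((2 * real j + 1) * \<theta> + x)"
      unfolding side by (simp add: x_def algebra_simps)
    then have "J (polygon_side g j (1 - u)) = K (hh / cos x) ((2 * real j + 1) * \<theta> + x)"
      using J_polar[of 1 x j] j x by simp
    also have "(2 * real j + 1) * \<theta> + x = 2 * \<theta> - 2 * \<theta> * u + 2 * \<theta> * real j" by (simp add: x_def algebra_simps)
    finally show ?thesis unfolding s rho_wd[OF f] by simp
  qed
qed

lemma sidept_exists:
  assumes "t \<in> T" "lor t (\<alpha> S2) = 0"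
  obtains u where "0 \<le> u" "u \<le> 1/2" "t = sidept u"
proof -
  obtain s \<psi> where t: "t = K s \<psi>" "0 \<le> \<psi>" "\<psi> \<le> \<theta>" "0 \<le> s" "s * cos (\<theta> - \<psi>) = hh"
    using T_polar[OF assms(1)] assms(2) by metis
  have c: "cos (\<theta> - \<psi>) > 0" using cos_x(2)[of "\<theta> - \<psi>"] t by auto
  have "s = hh / cos (\<theta> - \<psi>)" unfolding t(5)[symmetric] using c by simp
  moreover have "2 * \<theta> * (\<psi> / (2 * \<theta>)) = \<psi>" using theta(1) by simp
  ultimately have "t = sidept (\<psi> / (2 * \<theta>))" unfolding sidept_def t(1) by simp
  moreover have "0 \<le> \<psi> / (2 * \<theta>)" "\<psi> / (2 * \<theta>) \<le> 1 / 2" using t theta(1) by (auto simp: field_simps)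
  ultimately show ?thesis using that by blast
qed

section \<open>Side pairings and the label-preserving group\<close>

lemma polygon_side_cball: "polygon_side g j t \<in> cball 0 1"
  by (simp add: polygon_side_def)

text \<open>Gluing joins the parameter \<open>t\<close> of side \<open>j\<close> to
  \<open>1 - t\<close> of side \<open>j + 2\<close>. On half-sides this is the flag permutation of
  \<open>S2\<close>, with one and the same point of \<open>T\<close> seen from both
  triangles.\<close>

lemma glued_flags:
  assumes "glued g z z'"
  obtains f t where "f \<in> flags" "t \<in> T" "lor t (\<alpha> S2) = 0" "J z = \<rho> (wd f) t" "J z' = \<rho> (wd (flag S2 f)) t"
proof -
  note goal = that
  have half: "thesis" if j: "j = 4 * i \<or> j = 4 * i + 1" and i: "i < g" and t: "t \<in> {0..1}"
    and z: "z = polygon_side g j t" "z' = polygon_side g (j + 2) (1 - t)" for i j t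
  proof -
    have jn: "j < n" "j + 2 < n" using i j by (auto simp: n_def)
    have fl: "flag S2 (2 * int j) = 2 * int (j + 2) + 1" "flag S2 (2 * int j + 1) = 2 * int (j + 2)"
      using i j by (auto simp: flag.simps)
    show thesis
    proof (cases "t \<le> 1/2")
      case True
      have u: "0 \<le> t" "t \<le> 1/2" using t True by auto
      show thesis
        by (rule goal[of "2 * int j" "sidept t"])
          (use sidept[OF u] jn z fl in \<open>simp_all add: n_def\<close>)
    next
      case False
      have u: "0 \<le> 1 - t" "1 - t \<le> 1/2" using t False by auto
      show thesis
        by (rule goal[of "2 * int j + 1" "sidept (1 - t)"])
          (use sidept(1,2)[OF u] sidept(4)[OF u jn(1)] sidept(3)[OF u jn(2)] jn z fl in \<open>simp_all add: n_def\<close>)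
    qed
  qed
  from assms show thesis
  proof cases
    case (glued_a i t)
    then show thesis using half[where j = "4 * i" and i = i and t = t] by simp
  next
    case (glued_b i t)
    then show thesis using half[where j = "4 * i + 1" and i = i and t = t] by (simp add: numeral_3_eq_3)
  qed
qed

lemma flags_glued:
  assumes f: "f \<in> flags" and t: "t \<in> T" "lor t (\<alpha> S2) = 0" and z: "z \<in> cball 0 1" "z' \<in> cball 0 1"
    and J: "J z = \<rho> (wd f) t" "J z' = \<rho> (wd (flag S2 f)) t"
  shows "glued g z z' \<or> glued g z' z"
proof -
  obtain u where u: "0 \<le> u" "u \<le> 1/2" "t = sidept u" by (rule sidept_exists[OF t])
  note sd = sidept(3,4)[OF u(1,2)]
  have ev: "z = polygon_side g j u" if "J z = \<rho> (wd (2 * int j)) t" "z \<in> cball 0 1" "j < n" for z j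
    using J_inj[OF that(2) polygon_side_cball[of j u]] that sd(1)[OF that(3)] u(3) by simp
  have od: "z = polygon_side g j (1 - u)" if "J z = \<rho> (wd (2 * int j + 1)) t" "z \<in> cball 0 1" "j < n" for z j
    using J_inj[OF that(2) polygon_side_cball[of j "1 - u"]] that sd(2)[OF that(3)] u(3) by simp
  define i where "i = nat (f div 8)"
  have i: "f div 8 = int i" "i < g" using f by (auto simp: i_def)
  have jn: "4 * i + 3 < n" using i by (simp add: n_def)
  have "f mod 8 \<in> {0..<8}" by simp
  also have "{0..<8} = {0, 1, 2, 3, 4, 5, 6, 7 :: int}" by auto
  finally have m: "f mod 8 \<in> {0, 1, 2, 3, 4, 5, 6, 7 :: int}" .
  have fi: "f = 8 * int i + f mod 8" using i(1) by (metis mult_div_mod_eq)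
  have uu: "u \<in> {0..1}" "1 - u \<in> {0..1}" using u by auto
  note ga = glued_a[OF i(2) uu(1)] glued_a[OF i(2) uu(2)] and gb = glued_b[OF i(2) uu(1)] glued_b[OF i(2) uu(2)]
  consider "f = 2 * int (4 * i)" "flag S2 f = 2 * int (4 * i + 2) + 1"
    | "f = 2 * int (4 * i) + 1" "flag S2 f = 2 * int (4 * i + 2)"
    | "f = 2 * int (4 * i + 1)" "flag S2 f = 2 * int (4 * i + 3) + 1"
    | "f = 2 * int (4 * i + 1) + 1" "flag S2 f = 2 * int (4 * i + 3)"
    | "f = 2 * int (4 * i + 2)" "flag S2 f = 2 * int (4 * i) + 1"
    | "f = 2 * int (4 * i + 2) + 1" "flag S2 f = 2 * int (4 * i)"
    | "f = 2 * int (4 * i + 3)" "flag S2 f = 2 * int (4 * i + 1) + 1"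
    | "f = 2 * int (4 * i + 3) + 1" "flag S2 f = 2 * int (4 * i + 1)"
  proof -
    have *: "flag S2 f = (if f mod 8 < 4 then (if even f then f + 5 else f + 3) else (if even f then f - 3 else f - 5))"
      using f by (simp add: flag.simps)
    have ef: "even f \<longleftrightarrow> even (f mod 8)" by (simp add: dvd_mod_iff)
    from m show thesis
    proof (elim insertE emptyE)
      assume "f mod 8 = 0" then show thesis using that(1) fi * ef by simp
    next
      assume "f mod 8 = 1" then show thesis using that(2) fi * ef by simp
    next
      assume "f mod 8 = 2" then show thesis using that(3) fi * ef by simp
    next
      assume "f mod 8 = 3" then show thesis using that(4) fi * ef by simp
    next
      assume "f mod 8 = 4" then show thesis using that(5) fi * ef by simp
    next
      assume "f mod 8 = 5" then show thesis using that(6) fi * ef by simp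
    next
      assume "f mod 8 = 6" then show thesis using that(7) fi * ef by simp
    next
      assume "f mod 8 = 7" then show thesis using that(8) fi * ef by simp
    qed
  qed
  then show ?thesis
  proof cases
    case 1
    then have "z = polygon_side g (4 * i) u" "z' = polygon_side g (4 * i + 2) (1 - u)"
      using ev[of z "4 * i"] od[of z' "4 * i + 2"] J z jn by auto
    then show ?thesis using ga by simp
  next
    case 2
    then have "z = polygon_side g (4 * i) (1 - u)" "z' = polygon_side g (4 * i + 2) u"
      using od[of z "4 * i"] ev[of z' "4 * i + 2"] J z jn by auto
    then show ?thesis using ga by simp
  next
    case 3
    then have "z = polygon_side g (4 * i + 1) u" "z' = polygon_side g (4 * i + 3) (1 - u)"
      using ev[of z "4 * i + 1"] od[of z' "4 * i + 3"] J z jn by auto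
    then show ?thesis using gb by simp
  next
    case 4
    then have "z = polygon_side g (4 * i + 1) (1 - u)" "z' = polygon_side g (4 * i + 3) u"
      using od[of z "4 * i + 1"] ev[of z' "4 * i + 3"] J z jn by auto
    then show ?thesis using gb by simp
  next
    case 5
    then have "z = polygon_side g (4 * i + 2) u" "z' = polygon_side g (4 * i) (1 - u)"
      using ev[of z "4 * i + 2"] od[of z' "4 * i"] J z jn by auto
    then show ?thesis using ga by simp
  next
    case 6
    then have "z = polygon_side g (4 * i + 2) (1 - u)" "z' = polygon_side g (4 * i) u"
      using od[of z "4 * i + 2"] ev[of z' "4 * i"] J z jn by auto
    then show ?thesis using ga by simp
  next
    case 7
    then have "z = polygon_side g (4 * i + 3) u" "z' = polygon_side g (4 * i + 1) (1 - u)"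
      using ev[of z "4 * i + 3"] od[of z' "4 * i + 1"] J z jn by auto
    then show ?thesis using gb by simp
  next
    case 8
    then have "z = polygon_side g (4 * i + 3) (1 - u)" "z' = polygon_side g (4 * i + 1) u"
      using od[of z "4 * i + 3"] ev[of z' "4 * i + 1"] J z jn by auto
    then show ?thesis using gb by simp
  qed
qed

text \<open>Both words use only the mirrors through the centre and have the same label, and the
  dihedral group of the centre acts freely on flags.\<close>

lemma wd_flag:
  assumes f: "f \<in> flags" and i: "i \<noteq> S2"
  shows "act \<tau> (wd (flag i f)) = act \<tau> (wd f @ [i])"
proof -
  let ?w = "rev (wd (flag i f)) @ wd f @ [i]"
  have ff: "flag i f \<in> flags" by (rule flag_in[OF f])
  have "i \<in> {S0, S1}" using i by (cases i) auto
  then have sw: "set ?w \<subseteq> {S0, S1}" using set_wd by auto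
  have wdf: "act flag (wd f) f = 0" if "f \<in> flags" for f
    using lab_wd[OF that] flag_rev(2)[of "wd f" 0] by (simp add: lab_def)
  have "act flag ?w (flag i f) = flag i f"
  proof -
    have "act flag ?w (flag i f) = act flag (rev (wd (flag i f))) 0" by (simp add: act_append wdf[OF f])
    also have "\<dots> = flag i f" using lab_wd[OF ff] by (simp add: lab_def)
    finally show ?thesis .
  qed
  from dihedral_free[OF _ sw ff this] have e: "act \<tau> ?w = act \<tau> []" by simp
  have "act \<tau> (wd f @ [i]) p = act \<tau> (wd (flag i f)) p" for p
  proof -
    have "act \<tau> (wd (flag i f)) (act \<tau> ?w p) = act \<tau> (wd f @ [i]) p" by (simp add: act_append)
    then show ?thesis using e by simp
  qed
  then show ?thesis by auto
qed

lemma glued_imp_deck: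
  assumes "glued g z z'" obtains w where "lab w = 0" "\<rho> w (J z) = J z'"
proof -
  obtain f t where ft: "f \<in> flags" "t \<in> T" "lor t (\<alpha> S2) = 0" "J z = \<rho> (wd f) t" "J z' = \<rho> (wd (flag S2 f)) t"
    by (rule glued_flags[OF assms])
  \<comment> \<open>The side pairing: move the triangle of \<open>f\<close> back to
    \<open>T\<close>, reflect in the side, and move on to the triangle of the partner flag. Its
    label is 0 because \<open>S2\<close> matches the two flags.\<close>
  define w where "w = wd (flag S2 f) @ [S2] @ rev (wd f)"
  have "lab w = act flag (wd f) (flag S2 (lab (wd (flag S2 f))))" by (simp add: w_def lab_append act_append)
  also have "\<dots> = act flag (wd f) (lab (wd f))" using lab_wd ft(1) flag_in[OF ft(1), of S2] by simp
  also have "\<dots> = 0" by (simp add: lab_def)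
  finally have "lab w = 0" .
  moreover have "mrefl S2 t = t" using ft(3) by (simp add: mrefl_def)
  then have "\<rho> w (J z) = J z'" by (simp add: w_def act_append ft)
  ultimately show ?thesis using that by blast
qed

lemma equivclp_imp_deck:
  assumes "equivclp (glued g) z z'"
  shows "\<exists>w. lab w = 0 \<and> \<rho> w (J z) = J z'"
  using assms
proof (induction rule: equivclp_induct)
  case base
  show ?case by (intro exI[of _ "[]"]) (simp add: lab_def)
next
  case (step y z')
  then obtain w where w: "lab w = 0" "\<rho> w (J z) = J y" by blast
  have "\<exists>v. lab v = 0 \<and> \<rho> v (J y) = J z'"
  proof (cases "glued g y z'")
    case True
    then show ?thesis using glued_imp_deck by metis
  next
    case False
    then have "glued g z' y" using step by blast
    then obtain v where v: "lab v = 0" "\<rho> v (J z') = J y" using glued_imp_deck by metis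
    have "act flag v 0 = 0" using v(1) flag_rev(2)[of v 0] by (simp add: lab_def)
    then have "lab (rev v) = 0" by (simp add: lab_def)
    moreover have "\<rho> (rev v) (J y) = J z'" unfolding v(2)[symmetric] by simp
    ultimately show ?thesis by blast
  qed
  then obtain v where v: "lab v = 0" "\<rho> v (J y) = J z'" by blast
  have "lab (v @ w) = 0" using v(1) w(1) by (simp add: lab_append) (simp add: lab_def)
  moreover have "\<rho> (v @ w) (J z) = J z'" using v w by (simp add: act_append)
  ultimately show ?case by blast
qed

text \<open>A walk around \<open>t\<close> through the triangles that contain it. Crossing
  \<open>S0\<close> or \<open>S1\<close> stays in the polygon and keeps the point of the disc;
  crossing \<open>S2\<close> is one gluing step.\<close>

lemma stabilizer_glued:
  assumes t: "t \<in> T" and u: "set u \<subseteq> {i. lor t (\<alpha> i) = 0}" and f: "f \<in> flags"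
    and z: "z \<in> cball 0 1" "z' \<in> cball 0 1" and J: "J z' = \<rho> (wd f) t" "J z = \<rho> (wd (act flag u f)) t"
  shows "equivclp (glued g) z z'"
  using u z(1) J(2)
proof (induction u arbitrary: z)
  case Nil
  then have "z = z'" using J_inj z(2) J by simp
  then show ?case by simp
next
  case (Cons i u)
  let ?f = "act flag u f"
  have ff: "?f \<in> flags" by (rule act_flag_in[OF f])
  obtain y where y: "y \<in> cball 0 1" "J y = \<rho> (wd ?f) t" by (rule flag_J[OF ff t])
  have yz: "equivclp (glued g) y z'" using Cons.IH[OF _ y] Cons.prems by simp
  have zi: "lor t (\<alpha> i) = 0" using Cons.prems by simp
  have Jz: "J z = \<rho> (wd (flag i ?f)) t" using Cons.prems by simp
  have "equivclp (glued g) z y"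
  proof (cases "i = S2")
    case True
    have "glued g y z \<or> glued g z y"
      using flags_glued[OF ff t _ y(1) Cons.prems(2) y(2)] zi Jz True by simp
    then show ?thesis using r_into_equivclp[of "glued g"] equivclp_sym[of "glued g"] by blast
  next
    case False
    have "J z = \<rho> (wd ?f @ [i]) t" unfolding Jz using act_tau_eqD(1)[OF wd_flag[OF ff False]] by simp
    also have "\<dots> = J y" using zi y(2) by (simp add: act_append mrefl_def)
    finally have "z = y" by (rule J_inj[OF Cons.prems(2) y(1)])
    then show ?thesis by simp
  qed
  then show ?case using yz by (rule equivclp_trans)
qed

lemma deck_imp_equivclp:
  assumes w: "lab w = 0" and z: "z \<in> cball 0 1" "z' \<in> cball 0 1" and J: "\<rho> w (J z) = J z'"
  shows "equivclp (glued g) z z'"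
proof -
  obtain f t where ft: "f \<in> flags" "t \<in> T" "J z = \<rho> (wd f) t" by (rule J_flag[OF z(1)])
  obtain f' t' where ft': "f' \<in> flags" "t' \<in> T" "J z' = \<rho> (wd f') t'" by (rule J_flag[OF z(2)])
  define v where "v = rev (wd f') @ w @ wd f"
  have vt: "\<rho> v t = t'" using J ft ft' by (simp add: v_def act_append)
  then have tt: "t' = t" "\<exists>u. set u \<subseteq> {i. lor t (\<alpha> i) = 0} \<and> act \<tau> u = act \<tau> v"
    using chamber_meet[OF ft(2), of v] ft'(2) by auto
  then obtain u where u: "set u \<subseteq> {i. lor t (\<alpha> i) = 0}" "act \<tau> u = act \<tau> v" by blast
  have "act \<tau> (wd f' @ u) = act \<tau> (w @ wd f)"
    using u(2) by (auto simp: v_def act_append fun_eq_iff)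
  from lab_cong[OF this] have "act flag (rev u) f' = f"
    using lab_wd[OF ft'(1)] lab_wd[OF ft(1)] w by (simp add: lab_append) (simp add: lab_def)
  then show ?thesis
    using stabilizer_glued[OF ft(2), of "rev u" f' z z'] u(1) ft'(1) z ft'(3) ft(3) tt(1) by simp
qed

lemma tiling_by_polygons:
  assumes z: "z \<in> hyperboloid"
  obtains w \<zeta> where "lab w = 0" "\<zeta> \<in> cball 0 1" "z = \<rho> w (J \<zeta>)"
proof -
  obtain v t where vt: "t \<in> T" "z = \<rho> v t" by (rule tiling[OF z])
  obtain \<zeta> where \<zeta>: "\<zeta> \<in> cball 0 1" "J \<zeta> = \<rho> (wd (lab v)) t" by (rule flag_J[OF lab_in vt(1)])
  \<comment> \<open>Going back from the tile to the first triangle of its polygon turns the label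
    into 0.\<close>
  define w where "w = v @ rev (wd (lab v))"
  have "lab w = act flag (wd (lab v)) (lab v)" by (simp add: w_def lab_append)
  also have "\<dots> = 0" using lab_wd[OF lab_in, of v] flag_rev(2)[of "wd (lab v)" 0] by (simp add: lab_def)
  finally show ?thesis using that[of w \<zeta>] \<zeta> vt by (simp add: w_def act_append)
qed

end

subsection \<open>The fundamental group as a deck group\<close>

lemma covering_space_pullback:
  assumes cov: "covering_space E p S" and h: "continuous_on K h" "h ` K \<subseteq> S"
  shows "covering_space {(k, e). k \<in> K \<and> e \<in> E \<and> h k = p e} fst K"
proof -
  define P where "P = {(k, e). k \<in> K \<and> e \<in> E \<and> h k = p e}"
  have P: "z \<in> P \<longleftrightarrow> fst z \<in> K \<and> snd z \<in> E \<and> h (fst z) = p (snd z)" for z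
    by (auto simp: P_def)
  have "covering_space P fst K"
  proof (rule covering_spaceI)
    show "continuous_on P fst" by (intro continuous_intros)
    have "k \<in> fst ` P" if k: "k \<in> K" for k
    proof -
      have "h k \<in> p ` E" using k h covering_space_imp_surjective[OF cov] by auto
      then obtain e where "e \<in> E" "h k = p e" by auto
      then have "(k, e) \<in> P" using k by (simp add: P)
      then show ?thesis by force
    qed
    then show "fst ` P = K" by (auto simp: P)
  next
    fix x assume x: "x \<in> K"
    then have "h x \<in> S" using h by auto
    then obtain T v where T: "h x \<in> T" "openin (top_of_set S) T" and v: "\<Union>v = E \<inter> p -` T"
      "\<forall>u\<in>v. openin (top_of_set E) u" "pairwise disjnt v" "\<forall>u\<in>v. \<exists>q. homeomorphism u T p q"
      using cov unfolding covering_space_def by blast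
    define T' where "T' = K \<inter> h -` T"
    define v' where "v' = (\<lambda>u. P \<inter> snd -` u) ` v"
    have 1: "openin (top_of_set K) T'" unfolding T'_def
      using continuous_openin_preimage[OF h(1) _ T(2)] h(2) by auto
    have 2: "\<Union>v' = P \<inter> fst -` T'"
    proof -
      have "\<Union>v' = P \<inter> snd -` (\<Union>v)" by (auto simp: v'_def)
      also have "\<dots> = P \<inter> fst -` T'" unfolding v(1) T'_def using P by auto
      finally show ?thesis .
    qed
    have 3: "\<forall>u\<in>v'. openin (top_of_set P) u"
    proof -
      have "openin (top_of_set P) (P \<inter> snd -` u)" if "u \<in> v" for u
        by (rule continuous_openin_preimage[where T = E]) (use v(2) that in \<open>auto intro!: continuous_intros simp: P\<close>)
      then show ?thesis by (auto simp: v'_def)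
    qed
    have 4: "pairwise disjnt v'"
      using v(3) unfolding v'_def pairwise_def disjnt_def by blast
    have 5: "\<forall>u\<in>v'. \<exists>q. homeomorphism u T' fst q"
    proof -
      have "\<exists>q. homeomorphism (P \<inter> snd -` u) T' fst q" if u: "u \<in> v" for u
      proof -
        obtain q where q: "homeomorphism u T p q" using v(4) u by blast
        have uE: "u \<subseteq> E" "\<And>e. e \<in> u \<Longrightarrow> p e \<in> T" using u v(1) by auto
        have qD: "q (p e) = e" if "e \<in> u" for e using q that by (simp add: homeomorphism_def)
        have qT: "q y \<in> u" "p (q y) = y" if "y \<in> T" for y using q that by (auto simp: homeomorphism_def)
        have cont: "continuous_on T' (\<lambda>k. q (h k))"
          by (rule continuous_on_compose2[OF homeomorphism_cont2[OF q] continuous_on_subset[OF h(1)]])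
            (auto simp: T'_def)
        have "homeomorphism (P \<inter> snd -` u) T' fst (\<lambda>k. (k, q (h k)))"
        proof (rule homeomorphismI)
          show "continuous_on (P \<inter> snd -` u) fst" by (intro continuous_intros)
          show "continuous_on T' (\<lambda>k. (k, q (h k)))" using cont by (intro continuous_intros)
          show "fst ` (P \<inter> snd -` u) \<subseteq> T'" using uE(2) by (auto simp: P T'_def)
          show "(\<lambda>k. (k, q (h k))) ` T' \<subseteq> P \<inter> snd -` u"
            using qT uE(1) subsetD[OF uE(1) qT(1)] by (auto simp: P T'_def)
          show "(fst z, q (h (fst z))) = z" if "z \<in> P \<inter> snd -` u" for z
            using that qD by (cases z) (auto simp: P)
        qed auto
        then show ?thesis by blast
      qed
      then show ?thesis by (auto simp: v'_def)
    qed
    show "\<exists>T. x \<in> T \<and> openin (top_of_set K) T \<and> (\<exists>v. \<Union>v = P \<inter> fst -` T \<and>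
        (\<forall>u\<in>v. openin (top_of_set P) u) \<and> pairwise disjnt v \<and> (\<forall>u\<in>v. \<exists>q. homeomorphism u T fst q))"
      using x T(1) 1 2 3 4 5 by (intro exI[of _ T'] conjI exI[of _ v']) (auto simp: T'_def)
  qed
  then show ?thesis unfolding P_def .
qed

text \<open>The library lifts maps only into bases that are normed spaces; pulling the covering back to the
  domain of the map removes this restriction.\<close>

lemma covering_space_lift_general_base:
  fixes p :: "'a::real_normed_vector \<Rightarrow> 'b::topological_space" and h :: "'c::real_normed_vector \<Rightarrow> 'b"
  assumes cov: "covering_space E p S" and h: "continuous_on K h" "h ` K \<subseteq> S"
    and K: "simply_connected K" "locally path_connected K" and z: "z \<in> K" "a \<in> E" "h z = p a"
  obtains f where "continuous_on K f" "f ` K \<subseteq> E" "f z = a" "\<And>k. k \<in> K \<Longrightarrow> p (f k) = h k"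
proof -
  let ?P = "{(k, e). k \<in> K \<and> e \<in> E \<and> h k = p e}"
  obtain s where s: "continuous_on K s" "s \<in> K \<rightarrow> ?P" "s z = (z, a)" "\<And>y. y \<in> K \<Longrightarrow> fst (s y) = y"
    by (rule covering_space_lift_strong[OF covering_space_pullback[OF cov h], of "(z, a)" z K id])
      (use z K in auto)
  have sk: "snd (s k) \<in> E \<and> p (snd (s k)) = h k" if "k \<in> K" for k
    using funcset_mem[OF s(2) that] s(4)[OF that] by (cases "s k") auto
  show thesis
    by (rule that[of "\<lambda>k. snd (s k)"]) (use s(1,3) sk in \<open>auto intro!: continuous_intros\<close>)
qed

section \<open>Monodromy of a covering with a simply transitive deck action\<close>

locale deck_covering =
  fixes E :: "'e::real_normed_vector set" and Q :: "'e \<Rightarrow> 'a::topological_space" and S :: "'a set"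
    and D :: "('e \<Rightarrow> 'e) set" and z0 :: 'e
  assumes covering: "covering_space E Q S"
    and simply_connected: "simply_connected E"
    and deck: "\<gamma> \<in> D \<Longrightarrow> continuous_on E \<gamma>" "\<gamma> \<in> D \<Longrightarrow> z \<in> E \<Longrightarrow> \<gamma> z \<in> E"
      "\<gamma> \<in> D \<Longrightarrow> z \<in> E \<Longrightarrow> Q (\<gamma> z) = Q z"
    and deck_comp: "\<gamma> \<in> D \<Longrightarrow> \<delta> \<in> D \<Longrightarrow> \<gamma> \<circ> \<delta> \<in> D"
    and deck_transitive: "z \<in> E \<Longrightarrow> z' \<in> E \<Longrightarrow> Q z = Q z' \<Longrightarrow> \<exists>\<gamma>\<in>D. \<gamma> z = z'"
    and deck_free: "\<gamma> \<in> D \<Longrightarrow> \<delta> \<in> D \<Longrightarrow> z \<in> E \<Longrightarrow> \<gamma> z = \<delta> z \<Longrightarrow> \<gamma> = \<delta>"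
    and z0: "z0 \<in> E"
begin

lemmas covering_continuous = covering_space_imp_continuous[OF covering]

lemma Q_in: "z \<in> E \<Longrightarrow> Q z \<in> S"
  using covering_space_imp_surjective[OF covering] by auto

definition lift_path :: "(real \<Rightarrow> 'a) \<Rightarrow> (real \<Rightarrow> 'e) \<Rightarrow> bool" where
  "lift_path p l \<longleftrightarrow> path l \<and> path_image l \<subseteq> E \<and> pathstart l = z0 \<and> (\<forall>t\<in>{0..1}. Q (l t) = p t)"

definition monodromy :: "(real \<Rightarrow> 'a) \<Rightarrow> ('e \<Rightarrow> 'e) \<Rightarrow> bool" where
  "monodromy p \<gamma> \<longleftrightarrow> \<gamma> \<in> D \<and> (\<exists>l. lift_path p l \<and> pathfinish l = \<gamma> z0)"

lemma lift_path_ex: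
  assumes "p \<in> loops S (Q z0)" obtains l where "lift_path p l"
proof -
  have p: "continuous_on {0..1} p" "p ` {0..1} \<subseteq> S" "p 0 = Q z0"
    using assms by (auto simp: loops_def path_def path_image_def pathstart_def)
  obtain f where "continuous_on {0..1} f" "f ` {0..1} \<subseteq> E" "f 0 = z0" "\<And>k. k \<in> {0..1} \<Longrightarrow> Q (f k) = p k"
    by (rule covering_space_lift_general_base[OF covering p(1,2) _ _ _ z0 p(3)])
      (auto intro: convex_imp_simply_connected convex_imp_locally_path_connected)
  then show thesis by (intro that[of f]) (auto simp: lift_path_def path_def path_image_def pathstart_def)
qed

lemma lift_path_unique:
  assumes "lift_path p l" "lift_path p l'" "t \<in> {0..1}" shows "l t = l' t"
proof (rule covering_space_lift_unique[OF covering, where a = 0 and T = "{0..1}" and f = "\<lambda>t. Q (l t)"])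
  note l = assms(1,2)[unfolded lift_path_def path_def path_image_def pathstart_def]
  show "continuous_on {0..1} (\<lambda>t. Q (l t))"
    by (rule continuous_on_compose2[OF covering_continuous]) (use l in auto)
  show "(\<lambda>t. Q (l t)) \<in> {0..1} \<rightarrow> S" using l Q_in by blast
  show "Q (l x) = Q (l' x)" if "x \<in> {0..1}" for x using l that by simp
qed (use assms in \<open>auto simp: lift_path_def path_def path_image_def pathstart_def\<close>)

lemma monodromy_ex:
  assumes "p \<in> loops S (Q z0)" obtains \<gamma> where "monodromy p \<gamma>"
proof -
  obtain l where l: "lift_path p l" by (rule lift_path_ex[OF assms])
  have "Q (pathfinish l) = Q z0" "pathfinish l \<in> E"
    using l assms by (auto simp: lift_path_def loops_def pathfinish_def path_image_def)
  then obtain \<gamma> where "\<gamma> \<in> D" "\<gamma> z0 = pathfinish l" using deck_transitive[OF z0] by metis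
  then show thesis using that l unfolding monodromy_def by metis
qed

lemma monodromy_unique: "monodromy p \<gamma> \<Longrightarrow> monodromy p \<delta> \<Longrightarrow> \<gamma> = \<delta>"
  unfolding monodromy_def pathfinish_def
  by (metis lift_path_unique deck_free z0 atLeastAtMost_iff order_refl zero_le_one)

lemma monodromy_homotopic:
  assumes h: "homotopic_paths S p q" and m: "monodromy p \<gamma>" shows "monodromy q \<gamma>"
proof -
  obtain l where l: "lift_path p l" "pathfinish l = \<gamma> z0" and \<gamma>: "\<gamma> \<in> D" using m by (auto simp: monodromy_def)
  obtain h :: "real \<times> real \<Rightarrow> 'a" where h': "continuous_on ({0..1} \<times> {0..1}) h" "h ` ({0..1} \<times> {0..1}) \<subseteq> S"
    "\<forall>x\<in>{0..1}. h (0, x) = p x" "\<forall>x\<in>{0..1}. h (1, x) = q x" "\<forall>t\<in>{0..1}. h (t, 0) = p 0 \<and> h (t, 1) = p 1"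
    using h unfolding homotopic_paths pathstart_def pathfinish_def o_def image_subset_iff_funcset by blast
  note h = h'(1,2) h'(3-4)[rule_format] conjunct1[OF h'(5)[rule_format]] conjunct2[OF h'(5)[rule_format]]
  have p0: "h (0, 0) = Q z0" using l(1) h(3)[of 0] by (auto simp: lift_path_def pathstart_def)
  have cs: "convex ({0..1::real} \<times> {0..1::real})" by (intro convex_Times) auto
  obtain H where H: "continuous_on ({0..1} \<times> {0..1}) H" "H ` ({0..1} \<times> {0..1}) \<subseteq> E" "H (0, 0) = z0"
    "\<And>k. k \<in> {0..1} \<times> {0..1} \<Longrightarrow> Q (H k) = h k"
    by (rule covering_space_lift_general_base[OF covering h(1,2) _ _ _ z0 p0])
      (auto intro: convex_imp_simply_connected convex_imp_locally_path_connected cs)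
  have cH: "continuous_on {0..1} (\<lambda>t. H (f t, f' t))"
    if "continuous_on {0..1} f" "continuous_on {0..1} f'" "f \<in> {0..1} \<rightarrow> {0..1}" "f' \<in> {0..1} \<rightarrow> {0..1}"
    for f f' :: "real \<Rightarrow> real"
    by (rule continuous_on_compose2[OF H(1)]) (use that in \<open>auto intro!: continuous_intros\<close>)
  have HE: "H (s, t) \<in> E" if "s \<in> {0..1}" "t \<in> {0..1}" for s t using H(2) that by (simp add: image_subset_iff)
  \<comment> \<open>The two sides of the square on which the homotopy is fixed lift to constant
    paths by uniqueness, so the lifts of \<open>p\<close> and \<open>q\<close> have the same end
    points.\<close>
  have const: "H (t, s) = H (0, s)" if s: "\<And>t. t \<in> {0..1} \<Longrightarrow> h (t, s) = p s" "s \<in> {0..1}" and t: "t \<in> {0..1}" for s t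
  proof (rule covering_space_lift_unique[of E Q S "\<lambda>t. H (t, s)" 0 "\<lambda>t. H (0, s)" "{0..1}" "\<lambda>t. p s"])
    show "covering_space E Q S" by (rule covering)
    show "continuous_on {0..1} (\<lambda>t. H (t, s))" by (rule cH) (use s(2) in \<open>auto intro!: continuous_intros\<close>)
    show "(\<lambda>t. p s) \<in> {0..1} \<rightarrow> S" unfolding h(3)[OF s(2), symmetric] using h(2) s(2) by (auto simp: image_subset_iff)
    show "p s = Q (H (x, s))" if "x \<in> {0..1}" for x using H(4) s that by simp
    show "p s = Q (H (0, s))" using H(4) s by simp
  qed (use HE s(2) t in auto)
  have s0: "H (1, 0) = z0" using const[of 0 1] h(5) H(3) by simp
  have "lift_path p (\<lambda>t. H (0, t))" unfolding lift_path_def path_def path_image_def pathstart_def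
    using cH[of "\<lambda>_. 0" "\<lambda>t. t"] HE H(3,4) h(3) by (auto intro!: continuous_intros)
  then have "H (0, 1) = l 1" by (rule lift_path_unique) (use l in auto)
  then have s1: "H (1, 1) = \<gamma> z0" using const[of 1 1] h(6) l(2) by (simp add: pathfinish_def)
  have "lift_path q (\<lambda>t. H (1, t))" unfolding lift_path_def path_def path_image_def pathstart_def
    using cH[of "\<lambda>_. 1" "\<lambda>t. t"] HE s0 H(4) h(4) by (auto intro!: continuous_intros)
  then show ?thesis unfolding monodromy_def using \<gamma> s1 by (auto simp: pathfinish_def)
qed

text \<open>The lift of \<open>q\<close> that continues the lift of \<open>p\<close> is the
  \<gamma>-translate of the lift starting at \<open>z0\<close>; hence composition follows the order
  of concatenation.\<close>

lemma monodromy_join: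
  assumes "monodromy p \<gamma>" "monodromy q \<delta>" shows "monodromy (p +++ q) (\<gamma> \<circ> \<delta>)"
proof -
  obtain l l' where l: "lift_path p l" "pathfinish l = \<gamma> z0" "lift_path q l'" "pathfinish l' = \<delta> z0"
    and \<gamma>: "\<gamma> \<in> D" "\<delta> \<in> D" using assms by (auto simp: monodromy_def)
  note ll = l(1,3)[unfolded lift_path_def]
  have c: "path (\<gamma> \<circ> l')" unfolding path_def
    by (rule continuous_on_compose[OF _ continuous_on_subset[OF deck(1)[OF \<gamma>(1)]]]) (use ll in \<open>auto simp: path_def path_image_def\<close>)
  have i: "path_image (\<gamma> \<circ> l') \<subseteq> E" using ll deck(2)[OF \<gamma>(1)] by (auto simp: path_image_def)
  have s: "pathstart (\<gamma> \<circ> l') = pathfinish l" "pathfinish (\<gamma> \<circ> l') = \<gamma> (\<delta> z0)"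
    using ll l by (auto simp: pathstart_compose pathfinish_compose)
  have Ql: "Q (l' t) = q t" "Q (\<gamma> (l' t)) = Q (l' t)" if "t \<in> {0..1}" for t
    using ll that deck(3)[OF \<gamma>(1), of "l' t"] by (auto simp: path_image_def image_subset_iff)
  have "lift_path (p +++ q) (l +++ (\<gamma> \<circ> l'))" unfolding lift_path_def
  proof (intro conjI ballI)
    fix t :: real assume t: "t \<in> {0..1}"
    show "Q ((l +++ (\<gamma> \<circ> l')) t) = (p +++ q) t"
      using ll Ql[of "2 * t - 1"] t by (auto simp: joinpaths_def)
  qed (use ll c s i in \<open>auto simp: path_image_join\<close>)
  then show ?thesis unfolding monodromy_def using s deck_comp[OF \<gamma>] by auto
qed

lemma monodromy_inj:
  assumes p: "p \<in> loops S (Q z0)" "q \<in> loops S (Q z0)" and m: "monodromy p \<gamma>" "monodromy q \<gamma>"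
  shows "homotopic_paths S p q"
proof -
  obtain l l' where l: "lift_path p l" "pathfinish l = \<gamma> z0" "lift_path q l'" "pathfinish l' = \<gamma> z0"
    using m by (auto simp: monodromy_def)
  note ll = l(1,3)[unfolded lift_path_def]
  have "homotopic_paths E l l'"
    using simply_connected ll l unfolding simply_connected_eq_homotopic_paths by auto
  then have "homotopic_paths S (Q \<circ> l) (Q \<circ> l')"
    by (rule homotopic_paths_continuous_image[OF _ covering_continuous]) (use Q_in in auto)
  moreover have "homotopic_paths S p (Q \<circ> l)" "homotopic_paths S q (Q \<circ> l')"
    using p ll by (auto intro!: homotopic_paths_eq simp: loops_def)
  ultimately show ?thesis by (meson homotopic_paths_sym homotopic_paths_trans)
qed

lemma monodromy_surj:
  assumes \<gamma>: "\<gamma> \<in> D" obtains p where "p \<in> loops S (Q z0)" "monodromy p \<gamma>"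
proof -
  have "path_connected E" using simply_connected by (rule simply_connected_imp_path_connected)
  then obtain l where l: "path l" "path_image l \<subseteq> E" "pathstart l = z0" "pathfinish l = \<gamma> z0"
    using z0 deck(2)[OF \<gamma> z0] unfolding path_connected_def by blast
  have "Q \<circ> l \<in> loops S (Q z0)" unfolding loops_def mem_Collect_eq
    using l path_continuous_image[OF l(1) continuous_on_subset[OF covering_continuous l(2)]] Q_in deck(3)[OF \<gamma> z0]
    by (auto simp: path_image_compose pathstart_compose pathfinish_compose)
  moreover have "monodromy (Q \<circ> l) \<gamma>" unfolding monodromy_def lift_path_def using l \<gamma> by auto
  ultimately show thesis by (rule that)
qed

definition deck_of :: "(real \<Rightarrow> 'a) set \<Rightarrow> 'e \<Rightarrow> 'e" where
  "deck_of c = (SOME \<gamma>. \<exists>p\<in>loops S (Q z0). c = path_class S p \<and> monodromy p \<gamma>)"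

lemma deck_of_eq:
  assumes p: "p \<in> loops S (Q z0)" and m: "monodromy p \<gamma>" shows "deck_of (path_class S p) = \<gamma>"
  unfolding deck_of_def
proof (rule some_equality)
  show "\<exists>q\<in>loops S (Q z0). path_class S p = path_class S q \<and> monodromy q \<gamma>" using p m by blast
  show "\<delta> = \<gamma>" if \<delta>: "\<exists>q\<in>loops S (Q z0). path_class S p = path_class S q \<and> monodromy q \<delta>" for \<delta>
  proof -
    obtain q where q: "path_class S p = path_class S q" "monodromy q \<delta>" using \<delta> by blast
    then have "homotopic_paths S p q" using p by (simp add: path_class_eq_iff)
    then show ?thesis using monodromy_homotopic[OF _ m] q(2) monodromy_unique by blast
  qed
qed

abbreviation "\<Gamma> \<equiv> fundamental_group S (Q z0)"

lemma carrier_deck_of: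
  assumes "c \<in> carrier \<Gamma>"
  obtains p where "p \<in> loops S (Q z0)" "c = path_class S p" "monodromy p (deck_of c)"
proof -
  obtain p where p: "p \<in> loops S (Q z0)" "c = path_class S p" using assms by (auto simp: fundamental_group_def)
  obtain \<gamma> where "monodromy p \<gamma>" by (rule monodromy_ex[OF p(1)])
  then show thesis using that p deck_of_eq by metis
qed

lemma deck_of_in: "c \<in> carrier \<Gamma> \<Longrightarrow> deck_of c \<in> D"
  using carrier_deck_of monodromy_def by metis

lemma deck_of_mult:
  assumes "c \<in> carrier \<Gamma>" "d \<in> carrier \<Gamma>" shows "deck_of (c \<otimes>\<^bsub>\<Gamma>\<^esub> d) = deck_of c \<circ> deck_of d"
proof -
  obtain p where p: "p \<in> loops S (Q z0)" "c = path_class S p" "monodromy p (deck_of c)" by (rule carrier_deck_of[OF assms(1)])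
  obtain q where q: "q \<in> loops S (Q z0)" "d = path_class S q" "monodromy q (deck_of d)" by (rule carrier_deck_of[OF assms(2)])
  have "c \<otimes>\<^bsub>\<Gamma>\<^esub> d = path_class S (p +++ q)" unfolding p(2) q(2) by (rule fundamental_group_mult[OF p(1) q(1)])
  then show ?thesis using deck_of_eq[OF loops_joinpaths[OF p(1) q(1)] monodromy_join[OF p(3) q(3)]] by simp
qed

lemma deck_of_inj:
  assumes "c \<in> carrier \<Gamma>" "d \<in> carrier \<Gamma>" "deck_of c = deck_of d" shows "c = d"
proof -
  obtain p where p: "p \<in> loops S (Q z0)" "c = path_class S p" "monodromy p (deck_of c)" by (rule carrier_deck_of[OF assms(1)])
  obtain q where q: "q \<in> loops S (Q z0)" "d = path_class S q" "monodromy q (deck_of d)" by (rule carrier_deck_of[OF assms(2)])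
  have "homotopic_paths S p q" by (rule monodromy_inj[OF p(1) q(1) p(3)]) (use q(3) assms(3) in simp)
  then show ?thesis using p q by (simp add: path_class_eq_iff)
qed

lemma deck_of_surj:
  assumes "\<gamma> \<in> D" obtains c where "c \<in> carrier \<Gamma>" "deck_of c = \<gamma>"
proof -
  obtain p where "p \<in> loops S (Q z0)" "monodromy p \<gamma>" by (rule monodromy_surj[OF assms])
  then show thesis using that[of "path_class S p"] deck_of_eq by (auto simp: fundamental_group_def)
qed

end

subsection \<open>The universal covering of the surface\<close>

lemma simply_connected_hyperboloid: "simply_connected hyperboloid"
proof -
  define k where "k v = Complex (v $ 1 / v $ 3) (v $ 2 / v $ 3)" for v :: "real^3"
  have k: "cmod (k v) < 1 \<and> klein (k v) = v" if v: "v \<in> hyperboloid" for v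
  proof -
    have h: "(v$1)\<^sup>2 + (v$2)\<^sup>2 = (v$3)\<^sup>2 - 1" "v$3 > 0"
      using v by (auto simp: hyperboloid_def lor_def power2_eq_square)
    have "(cmod (k v))\<^sup>2 = ((v$1)\<^sup>2 + (v$2)\<^sup>2) / (v$3)\<^sup>2"
      by (simp add: k_def cmod_power2 power_divide add_divide_distrib)
    also have "\<dots> = 1 - (1 / v$3)\<^sup>2" unfolding h(1) using h(2) by (simp add: diff_divide_distrib power_divide)
    finally have m: "1 - (cmod (k v))\<^sup>2 = (1 / v$3)\<^sup>2" by simp
    have "(1 / v$3)\<^sup>2 > 0" using h(2) by simp
    then have "cmod (k v) < 1" using m by (simp only: abs_square_less_1[of "cmod (k v)", simplified, symmetric])
    moreover have "sqrt (1 - (cmod (k v))\<^sup>2) = 1 / v$3" unfolding m using h(2) by (intro real_sqrt_unique) auto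
    ultimately show ?thesis using h(2) by (simp add: vec_eq_iff forall_3 klein_nth) (simp add: k_def)
  qed
  have "homeomorphism (ball 0 1) hyperboloid klein k"
  proof (rule homeomorphismI)
    show "continuous_on (ball 0 1) klein" by (rule continuous_on_subset[OF continuous_on_klein]) auto
    have "v $ 3 \<noteq> 0" if "v \<in> hyperboloid" for v using that by (auto simp: hyperboloid_def)
    then show "continuous_on hyperboloid k" unfolding k_def Complex_eq
      by (auto intro!: continuous_intros)
    show "klein ` ball 0 1 \<subseteq> hyperboloid" using klein_hyperboloid by auto
    show "k ` hyperboloid \<subseteq> ball 0 1" using k by auto
    show "k (klein w) = w" if "w \<in> ball 0 1" for w
      using that k[of "klein w"] klein_inj[of "k (klein w)" w] klein_hyperboloid[of w] by auto
    show "klein (k v) = v" if "v \<in> hyperboloid" for v using k that by auto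
  qed
  then have "ball (0::complex) 1 homeomorphic hyperboloid" by (auto simp: homeomorphic_def)
  moreover have "simply_connected (ball (0::complex) 1)" by (rule convex_imp_simply_connected) simp
  ultimately show ?thesis using homeomorphic_simply_connected by blast
qed

lemma openin_hball:
  assumes "z \<in> hyperboloid"
  shows "openin (top_of_set hyperboloid) {y \<in> hyperboloid. hdist z y < r}"
proof (cases "r \<ge> 0")
  case True
  then have "{y \<in> hyperboloid. hdist z y < r} = hyperboloid \<inter> (\<lambda>y. - lor z y) -` {..<cosh r}"
    using hdist_less_iff assms by auto
  then show ?thesis by (auto intro!: continuous_openin_preimage_gen continuous_intros)
next
  case False
  then have "{y \<in> hyperboloid. hdist z y < r} = {}" using hdist_nonneg[OF assms] by force
  then show ?thesis by (simp only: openin_empty)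
qed

lemma compact_hdist_bounded:
  assumes "compact A" "A \<subseteq> hyperboloid" "z \<in> hyperboloid"
  obtains r where "\<And>a. a \<in> A \<Longrightarrow> hdist z a \<le> r"
proof -
  have "compact ((\<lambda>a. - lor z a) ` A)" by (intro compact_continuous_image continuous_intros assms(1))
  then obtain B where B: "\<And>a. a \<in> A \<Longrightarrow> - lor z a \<le> B"
    by (metis bounded_imp_bdd_above compact_imp_bounded bdd_above.unfold imageI)
  have "hdist z a \<le> arcosh (max 1 B)" if "a \<in> A" for a
    using B[OF that] that assms by (subst hdist_le_iff) auto
  then show thesis by (rule that)
qed

lemma lorentz_map_continuous: "lorentz_map f \<Longrightarrow> continuous_on A f"
  using lorentz_mapD(1) linear_continuous_on linear_conv_bounded_linear by blast

locale deck_group =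
  fixes D :: "(real^3 \<Rightarrow> real^3) set" and \<epsilon> :: real
  assumes D_lorentz: "\<gamma> \<in> D \<Longrightarrow> lorentz_map \<gamma>"
    and D_id: "id \<in> D" and D_comp: "\<gamma> \<in> D \<Longrightarrow> \<delta> \<in> D \<Longrightarrow> \<gamma> \<circ> \<delta> \<in> D"
    and D_inverse: "\<gamma> \<in> D \<Longrightarrow> \<exists>\<delta>\<in>D. \<delta> \<circ> \<gamma> = id \<and> \<gamma> \<circ> \<delta> = id"
    and eps: "\<epsilon> > 0"
    and D_displacement: "\<gamma> \<in> D \<Longrightarrow> z \<in> hyperboloid \<Longrightarrow> hdist z (\<gamma> z) < \<epsilon> \<Longrightarrow> \<gamma> = id"
begin

lemma D_hyp: "\<gamma> \<in> D \<Longrightarrow> z \<in> hyperboloid \<Longrightarrow> \<gamma> z \<in> hyperboloid"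
  using lorentz_mapD(3) D_lorentz by blast

lemma D_hdist: "\<gamma> \<in> D \<Longrightarrow> hdist (\<gamma> x) (\<gamma> y) = hdist x y"
  using lorentz_mapD(7) D_lorentz by blast

lemma D_separated:
  assumes "\<gamma> \<in> D" "\<delta> \<in> D" "z \<in> hyperboloid" "hdist (\<gamma> z) (\<delta> z) < \<epsilon>" shows "\<gamma> = \<delta>"
proof -
  obtain \<gamma>' where \<gamma>': "\<gamma>' \<in> D" "\<gamma>' \<circ> \<gamma> = id" "\<gamma> \<circ> \<gamma>' = id" using D_inverse assms(1) by blast
  have "\<gamma>' (\<gamma> z) = z" using \<gamma>'(2) by (metis comp_apply id_apply)
  then have "hdist z ((\<gamma>' \<circ> \<delta>) z) = hdist (\<gamma> z) (\<delta> z)" using D_hdist[OF \<gamma>'(1), of "\<gamma> z" "\<delta> z"] by simp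
  then have "\<gamma>' \<circ> \<delta> = id" using D_displacement[OF D_comp[OF \<gamma>'(1) assms(2)] assms(3)] assms(4) by simp
  then have "\<gamma> \<circ> (\<gamma>' \<circ> \<delta>) = \<gamma>" by simp
  then show ?thesis using \<gamma>'(3) by (simp add: o_assoc)
qed

lemma finite_near:
  assumes z: "z \<in> hyperboloid" "y \<in> hyperboloid" shows "finite {\<gamma> \<in> D. hdist z (\<gamma> y) \<le> r}"
proof (rule ccontr)
  let ?N = "{\<gamma> \<in> D. hdist z (\<gamma> y) \<le> r}"
  assume inf: "infinite ?N"
  have "inj_on (\<lambda>\<gamma>. \<gamma> y) ?N"
  proof (rule inj_onI)
    fix \<gamma> \<delta> assume a: "\<gamma> \<in> ?N" "\<delta> \<in> ?N" "\<gamma> y = \<delta> y"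
    have "hdist (\<gamma> y) (\<delta> y) = 0" using a hdist_eq_0 D_hyp[OF _ z(2)] by simp
    then show "\<gamma> = \<delta>" using D_separated[of \<gamma> \<delta> y] a(1,2) z(2) eps by simp
  qed
  then have "infinite ((\<lambda>\<gamma>. \<gamma> y) ` ?N)" using inf finite_imageD by blast
  then obtain x where x: "x \<in> hyperboloid" "x islimpt ((\<lambda>\<gamma>. \<gamma> y) ` ?N)"
    using Heine_Borel_imp_Bolzano_Weierstrass[OF compact_hball[OF z(1), of r], of "(\<lambda>\<gamma>. \<gamma> y) ` ?N"] D_hyp[OF _ z(2)] by auto
  obtain U where U: "open U" "{v \<in> hyperboloid. hdist x v < \<epsilon> / 2} = hyperboloid \<inter> U"
    using openin_hball[OF x(1), of "\<epsilon> / 2"] unfolding openin_open by blast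
  have mem_U: "v \<in> U \<longleftrightarrow> hdist x v < \<epsilon> / 2" if "v \<in> hyperboloid" for v using U(2) that by blast
  have "hdist x x = 0" using hdist_eq_0[OF x(1) x(1)] by simp
  then have "x \<in> U" using mem_U[OF x(1)] eps by simp
  then have "infinite (U \<inter> (\<lambda>\<gamma>. \<gamma> y) ` ?N)" using x(2) U(1) unfolding islimpt_eq_acc_point by blast
  then obtain B where "B \<subseteq> U \<inter> (\<lambda>\<gamma>. \<gamma> y) ` ?N" "card B = 2"
    using infinite_arbitrarily_large by blast
  moreover obtain v v' where "B = {v, v'}" "v \<noteq> v'" using \<open>card B = 2\<close> by (auto simp: card_2_iff)
  ultimately have v: "v \<in> U \<inter> (\<lambda>\<gamma>. \<gamma> y) ` ?N" "v' \<in> U \<inter> (\<lambda>\<gamma>. \<gamma> y) ` ?N" "v \<noteq> v'" by blast+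
  then obtain \<gamma> \<delta> where gd: "\<gamma> \<in> D" "v = \<gamma> y" "\<delta> \<in> D" "v' = \<delta> y" by auto
  have hv: "v \<in> hyperboloid" "v' \<in> hyperboloid" using gd D_hyp z(2) by auto
  then have "hdist x v < \<epsilon> / 2" "hdist x v' < \<epsilon> / 2" using mem_U v(1,2) by blast+
  then have "hdist v v' < \<epsilon>" using hdist_triangle[of v x v'] hdist_commute[of v x] hv x(1) by linarith
  then have "\<gamma> = \<delta>" using D_separated[OF gd(1,3) z(2)] gd by simp
  then show False using v(3) gd by simp
qed

lemma D_open:
  assumes \<gamma>: "\<gamma> \<in> D" and U: "openin (top_of_set hyperboloid) U"
  shows "openin (top_of_set hyperboloid) (\<gamma> ` U)"
proof -
  obtain \<delta> where \<delta>: "\<delta> \<in> D" "\<delta> \<circ> \<gamma> = id" "\<gamma> \<circ> \<delta> = id" using D_inverse \<gamma> by blast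
  then have e: "\<delta> (\<gamma> v) = v" "\<gamma> (\<delta> v) = v" for v by (metis comp_apply id_apply)+
  have Us: "U \<subseteq> hyperboloid" using U openin_imp_subset by blast
  have "\<gamma> ` U = hyperboloid \<inter> \<delta> -` U"
  proof (intro subset_antisym subsetI)
    fix v assume "v \<in> hyperboloid \<inter> \<delta> -` U"
    then have "v = \<gamma> (\<delta> v)" "\<delta> v \<in> U" by (auto simp: e)
    then show "v \<in> \<gamma> ` U" by blast
  qed (use e D_hyp[OF \<gamma>] Us in auto)
  moreover have "openin (top_of_set hyperboloid) (hyperboloid \<inter> \<delta> -` U)"
    by (rule continuous_openin_preimage[OF lorentz_map_continuous[OF D_lorentz[OF \<delta>(1)]] _ U]) (use D_hyp[OF \<delta>(1)] in auto)
  ultimately show ?thesis by simp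
qed

lemma closedin_orbit:
  assumes A: "compact A" "A \<subseteq> hyperboloid"
  shows "closedin (top_of_set hyperboloid) (\<Union>\<gamma>\<in>D. \<gamma> ` A)"
proof -
  let ?W = "\<Union>\<gamma>\<in>D. \<gamma> ` A"
  have W: "?W \<subseteq> hyperboloid" using A(2) D_hyp by auto
  have "\<exists>V. openin (top_of_set hyperboloid) V \<and> z \<in> V \<and> V \<subseteq> hyperboloid - ?W" if z: "z \<in> hyperboloid - ?W" for z
  proof -
    have zh: "z \<in> hyperboloid" using z by blast
    obtain r where r: "\<And>a. a \<in> A \<Longrightarrow> hdist z a \<le> r" by (rule compact_hdist_bounded[OF A zh]) blast
    \<comment> \<open>Only these translates of \<open>A\<close> can come within distance 1 of
      \<open>z\<close>: if \<open>\<gamma> a\<close> does, then \<open>\<gamma> z\<close> is within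
      \<open>1 + r\<close> of \<open>z\<close>, because \<gamma> preserves the distance of
      \<open>a\<close> and \<open>z\<close>.\<close>
    define N where "N = {\<gamma> \<in> D. hdist z (\<gamma> z) \<le> 1 + r}"
    have "finite N" unfolding N_def by (rule finite_near[OF zh zh])
    moreover have "compact (\<gamma> ` A)" if "\<gamma> \<in> N" for \<gamma>
      using that D_lorentz unfolding N_def by (intro compact_continuous_image A(1) lorentz_map_continuous) auto
    ultimately have c: "closed (\<Union>\<gamma>\<in>N. \<gamma> ` A)" by (intro closed_UN ballI compact_imp_closed) auto
    define V where "V = {y \<in> hyperboloid. hdist z y < 1} \<inter> - (\<Union>\<gamma>\<in>N. \<gamma> ` A)"
    have "openin (top_of_set hyperboloid) V" unfolding V_def
      by (rule openin_Int_open[OF openin_hball[OF zh] open_Compl[OF c]])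
    moreover have "hdist z z = 0" using hdist_eq_0[OF zh zh] by simp
    then have "z \<in> V" using z unfolding V_def N_def by auto
    moreover have "y \<notin> ?W" if y: "y \<in> V" for y
    proof
      assume "y \<in> ?W"
      then obtain \<gamma> a where \<gamma>: "\<gamma> \<in> D" "a \<in> A" "y = \<gamma> a" by auto
      have ah: "a \<in> hyperboloid" using \<gamma>(2) A(2) by auto
      have "hdist z (\<gamma> z) \<le> hdist z y + hdist y (\<gamma> z)"
        by (rule hdist_triangle) (use zh D_hyp \<gamma> ah in auto)
      also have "hdist y (\<gamma> z) = hdist z a" unfolding \<gamma>(3) D_hdist[OF \<gamma>(1)] by (rule hdist_commute)
      finally have "\<gamma> \<in> N" using r[OF \<gamma>(2)] y \<gamma>(1) by (simp add: N_def V_def)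
      then show False using y \<gamma> by (auto simp: V_def)
    qed
    moreover have "V \<subseteq> hyperboloid" by (auto simp: V_def)
    ultimately show ?thesis by blast
  qed
  then have "openin (top_of_set hyperboloid) (hyperboloid - ?W)" using openin_subopen by (metis (no_types, lifting))
  then show ?thesis using W by (simp add: closedin_def)
qed

end

text \<open>\<open>P\<close> is a polygon with identifications, \<open>J\<close> a realisation of it whose translates under \<open>D\<close> tile
  the hyperboloid.\<close>

locale deck_polygon = deck_group D \<epsilon> for D \<epsilon> +
  fixes P :: "'c::t2_space set" and J :: "'c \<Rightarrow> real^3" and q :: "'c \<Rightarrow> 'a::topological_space" and S :: "'a set"
  assumes P: "compact P" and J: "continuous_on P J" "J ` P \<subseteq> hyperboloid"
    and tiles: "z \<in> hyperboloid \<Longrightarrow> \<exists>\<gamma>\<in>D. \<exists>\<zeta>\<in>P. z = \<gamma> (J \<zeta>)"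
    and q: "quotient_map (top_of_set P) (top_of_set S) q"
    and fibres: "\<zeta> \<in> P \<Longrightarrow> \<zeta>' \<in> P \<Longrightarrow> q \<zeta> = q \<zeta>' \<longleftrightarrow> (\<exists>\<gamma>\<in>D. \<gamma> (J \<zeta>) = J \<zeta>')"
begin

definition proj :: "real^3 \<Rightarrow> 'a" where
  "proj z = q (SOME \<zeta>. \<zeta> \<in> P \<and> (\<exists>\<gamma>\<in>D. z = \<gamma> (J \<zeta>)))"

lemma proj_eq: "\<gamma> \<in> D \<Longrightarrow> \<zeta> \<in> P \<Longrightarrow> proj (\<gamma> (J \<zeta>)) = q \<zeta>"
proof -
  assume a: "\<gamma> \<in> D" "\<zeta> \<in> P"
  define \<zeta>' where "\<zeta>' = (SOME \<zeta>'. \<zeta>' \<in> P \<and> (\<exists>\<delta>\<in>D. \<gamma> (J \<zeta>) = \<delta> (J \<zeta>')))"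
  have "\<zeta>' \<in> P \<and> (\<exists>\<delta>\<in>D. \<gamma> (J \<zeta>) = \<delta> (J \<zeta>'))" unfolding \<zeta>'_def by (rule someI[of _ \<zeta>]) (use a in auto)
  then obtain \<delta> where \<delta>: "\<zeta>' \<in> P" "\<delta> \<in> D" "\<gamma> (J \<zeta>) = \<delta> (J \<zeta>')" by blast
  obtain \<delta>' where \<delta>': "\<delta>' \<in> D" "\<delta>' \<circ> \<delta> = id" using D_inverse \<delta>(2) by blast
  have "(\<delta>' \<circ> \<gamma>) (J \<zeta>) = J \<zeta>'" using \<delta>(3) \<delta>'(2) by (metis comp_apply id_apply)
  then have "q \<zeta> = q \<zeta>'" using fibres[OF a(2) \<delta>(1)] D_comp[OF \<delta>'(1) a(1)] by blast
  then show ?thesis by (simp add: proj_def \<zeta>'_def)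
qed

lemma proj_J: "\<zeta> \<in> P \<Longrightarrow> proj (J \<zeta>) = q \<zeta>"
  using proj_eq[OF D_id] by simp

lemma proj_invariant: "\<gamma> \<in> D \<Longrightarrow> z \<in> hyperboloid \<Longrightarrow> proj (\<gamma> z) = proj z"
proof -
  assume a: "\<gamma> \<in> D" "z \<in> hyperboloid"
  then obtain \<delta> \<zeta> where d: "\<delta> \<in> D" "\<zeta> \<in> P" "z = \<delta> (J \<zeta>)" using tiles by blast
  then show ?thesis using proj_eq[OF D_comp[OF a(1) d(1)] d(2)] proj_eq[OF d(1,2)] by simp
qed

lemma proj_fibres:
  assumes z: "z \<in> hyperboloid" "z' \<in> hyperboloid" and eq: "proj z = proj z'" shows "\<exists>\<gamma>\<in>D. \<gamma> z = z'"
proof -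
  obtain \<delta> \<zeta> where d: "\<delta> \<in> D" "\<zeta> \<in> P" "z = \<delta> (J \<zeta>)" using tiles[OF z(1)] by blast
  obtain \<delta>' \<zeta>' where d': "\<delta>' \<in> D" "\<zeta>' \<in> P" "z' = \<delta>' (J \<zeta>')" using tiles[OF z(2)] by blast
  have "q \<zeta> = q \<zeta>'" using eq d d' proj_eq by metis
  then obtain \<gamma> where g: "\<gamma> \<in> D" "\<gamma> (J \<zeta>) = J \<zeta>'" using fibres d(2) d'(2) by blast
  obtain \<kappa> where k: "\<kappa> \<in> D" "\<kappa> \<circ> \<delta> = id" using D_inverse d(1) by blast
  have "\<kappa> z = J \<zeta>" using k(2) d(3) by (metis comp_apply id_apply)
  then have "(\<delta>' \<circ> (\<gamma> \<circ> \<kappa>)) z = z'" using d'(3) g(2) by simp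
  then show ?thesis using D_comp[OF d'(1) D_comp[OF g(1) k(1)]] by blast
qed

lemma proj_surj: "proj ` hyperboloid = S"
proof -
  have "q ` P = S" using q by (simp add: quotient_map_def)
  moreover have "proj ` hyperboloid = q ` P"
  proof (intro subset_antisym subsetI)
    show "y \<in> q ` P" if "y \<in> proj ` hyperboloid" for y using that tiles proj_eq by force
    show "y \<in> proj ` hyperboloid" if "y \<in> q ` P" for y using that J(2) proj_J by force
  qed
  ultimately show ?thesis by simp
qed

lemma proj_open:
  assumes U: "openin (top_of_set hyperboloid) U" shows "openin (top_of_set S) (proj ` U)"
proof -
  have Us: "U \<subseteq> hyperboloid" using U openin_imp_subset by blast
  have "{\<zeta> \<in> P. q \<zeta> \<in> proj ` U} = P \<inter> J -` (\<Union>\<gamma>\<in>D. \<gamma> ` U)"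
  proof (intro subset_antisym subsetI)
    fix \<zeta> assume "\<zeta> \<in> {\<zeta> \<in> P. q \<zeta> \<in> proj ` U}"
    then obtain u where u: "\<zeta> \<in> P" "u \<in> U" "proj u = proj (J \<zeta>)" using proj_J by auto
    then obtain \<gamma> where "\<gamma> \<in> D" "\<gamma> u = J \<zeta>" using proj_fibres[of u "J \<zeta>"] Us J(2) by auto
    then have "J \<zeta> \<in> \<gamma> ` U" using u(2) by (metis imageI)
    then show "\<zeta> \<in> P \<inter> J -` (\<Union>\<gamma>\<in>D. \<gamma> ` U)" using u(1) \<open>\<gamma> \<in> D\<close> by blast
  next
    fix \<zeta> assume "\<zeta> \<in> P \<inter> J -` (\<Union>\<gamma>\<in>D. \<gamma> ` U)"
    then obtain \<gamma> u where "\<zeta> \<in> P" "\<gamma> \<in> D" "u \<in> U" "J \<zeta> = \<gamma> u" by auto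
    then have "q \<zeta> = proj u" using proj_J[of \<zeta>] proj_invariant[of \<gamma> u] Us by auto
    then show "\<zeta> \<in> {\<zeta> \<in> P. q \<zeta> \<in> proj ` U}" using \<open>\<zeta> \<in> P\<close> \<open>u \<in> U\<close> by simp
  qed
  moreover have "openin (top_of_set P) (P \<inter> J -` (\<Union>\<gamma>\<in>D. \<gamma> ` U))"
    by (rule continuous_openin_preimage[OF J(1), where T = hyperboloid]) (use J(2) U D_open in auto)
  moreover have "proj ` U \<subseteq> S" using proj_surj Us by auto
  moreover have "openin (top_of_set P) {x \<in> P. q x \<in> V} \<longleftrightarrow> openin (top_of_set S) V" if "V \<subseteq> S" for V
    using q that by (simp add: quotient_map_def)
  ultimately show ?thesis by metis
qed

text \<open>Tested on closed sets: as the polygon is compact, the preimage of a closed set is the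
  orbit of a compact set, which is closed by local finiteness.\<close>

lemma proj_continuous: "continuous_on hyperboloid proj"
proof -
  have "closedin (top_of_set hyperboloid) (hyperboloid \<inter> proj -` F)" if F: "closedin (top_of_set S) F" for F
  proof -
    define A where "A = J ` (P \<inter> q -` F)"
    have "closedin (top_of_set P) {x \<in> topspace (top_of_set P). q x \<in> F}"
      by (rule closedin_continuous_map_preimage[OF quotient_imp_continuous_map[OF q] F])
    then have "closedin (top_of_set P) (P \<inter> q -` F)" by (simp add: Collect_conj_eq vimage_def)
    then have "compact (P \<inter> q -` F)" using closedin_compact P by blast
    then have A: "compact A" "A \<subseteq> hyperboloid" using J unfolding A_def
      by (auto intro!: compact_continuous_image intro: continuous_on_subset)
    have "hyperboloid \<inter> proj -` F = (\<Union>\<gamma>\<in>D. \<gamma> ` A)"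
    proof (intro subset_antisym subsetI)
      fix z assume z: "z \<in> hyperboloid \<inter> proj -` F"
      then obtain \<delta> \<zeta> where "\<delta> \<in> D" "\<zeta> \<in> P" "z = \<delta> (J \<zeta>)" using tiles[of z] by blast
      then show "z \<in> (\<Union>\<gamma>\<in>D. \<gamma> ` A)" using z proj_eq by (auto simp: A_def)
    next
      fix z assume "z \<in> (\<Union>\<gamma>\<in>D. \<gamma> ` A)"
      then show "z \<in> hyperboloid \<inter> proj -` F" using proj_eq J(2) D_hyp by (auto simp: A_def image_subset_iff)
    qed
    then show ?thesis using closedin_orbit[OF A] by simp
  qed
  then show ?thesis using continuous_on_closed_gen[of proj hyperboloid S] proj_surj by auto
qed

text \<open>Distinct translates of a ball of radius \<open>\<epsilon> / 2\<close> are disjoint,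
  since two points of such a ball are less than \<epsilon> apart; \<open>proj\<close> is open and
  injective on each of them.\<close>

lemma proj_covering: "covering_space hyperboloid proj S"
proof (rule covering_spaceI[OF proj_continuous proj_surj])
  fix x assume "x \<in> S"
  then obtain z where z: "z \<in> hyperboloid" "x = proj z" using proj_surj by auto
  define U where "U = {y \<in> hyperboloid. hdist z y < \<epsilon> / 2}"
  define v where "v = (\<lambda>\<gamma>. \<gamma> ` U) ` D"
  have U: "openin (top_of_set hyperboloid) U" "U \<subseteq> hyperboloid" unfolding U_def using openin_hball z by blast+
  have UU: "hdist u u' < \<epsilon>" if "u \<in> U" "u' \<in> U" for u u'
    using that hdist_triangle[of u z u'] hdist_commute[of u z] z(1) by (simp add: U_def)
  have "hdist z z = 0" using hdist_eq_0[OF z(1) z(1)] by simp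
  then have zU: "z \<in> U" using eps z(1) by (simp add: U_def)
  have 1: "\<Union>v = hyperboloid \<inter> proj -` (proj ` U)"
  proof (intro subset_antisym subsetI)
    fix y assume "y \<in> hyperboloid \<inter> proj -` (proj ` U)"
    then obtain u where "y \<in> hyperboloid" "u \<in> U" "proj u = proj y" by auto
    then obtain \<gamma> where "\<gamma> \<in> D" "\<gamma> u = y" using proj_fibres[of u y] U(2) by auto
    then show "y \<in> \<Union>v" using \<open>u \<in> U\<close> by (auto simp: v_def)
  qed (use U(2) D_hyp proj_invariant in \<open>auto simp: v_def\<close>)
  have disj: "\<gamma> = \<delta>" if gd: "\<gamma> \<in> D" "\<delta> \<in> D" "u \<in> U" "u' \<in> U" "\<gamma> u = \<delta> u'" for \<gamma> \<delta> u u'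
  proof (rule D_separated[OF gd(1,2), of u])
    show "hdist (\<gamma> u) (\<delta> u) < \<epsilon>" unfolding gd(5) D_hdist[OF gd(2)] using UU gd(3,4) by blast
  qed (use gd U in auto)
  have 2: "\<exists>h. homeomorphism W (proj ` U) proj h" if Wv: "W \<in> v" for W
  proof -
    obtain \<gamma> where \<gamma>: "\<gamma> \<in> D" "W = \<gamma> ` U" using Wv by (auto simp: v_def)
    have W: "openin (top_of_set hyperboloid) W" "W \<subseteq> hyperboloid" using \<gamma> D_open[OF \<gamma>(1) U(1)] D_hyp U(2) by auto
    have im: "proj ` W = proj ` U" unfolding \<gamma>(2) image_image using proj_invariant[OF \<gamma>(1)] U(2) by (intro image_cong) auto
    have inj: "inj_on proj W"
    proof (rule inj_onI)
      fix a b assume ab: "a \<in> W" "b \<in> W" "proj a = proj b"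
      then obtain u u' where u: "u \<in> U" "u' \<in> U" "a = \<gamma> u" "b = \<gamma> u'" using \<gamma>(2) by auto
      obtain \<delta> where d: "\<delta> \<in> D" "\<delta> a = b" using proj_fibres[of a b] ab W(2) by auto
      have "\<delta> \<circ> \<gamma> = \<gamma>" by (rule disj[OF D_comp[OF d(1) \<gamma>(1)] \<gamma>(1) u(1,2)]) (use d u in simp)
      then show "a = b" using d u by (metis comp_apply)
    qed
    have oo: "openin (top_of_set (proj ` U)) (proj ` V)" if "openin (top_of_set W) V" for V
    proof -
      have "openin (top_of_set S) (proj ` V)" by (rule proj_open) (use that W(1) openin_trans in blast)
      moreover have "proj ` V \<subseteq> proj ` U" using openin_imp_subset[OF that] im by auto
      moreover have "proj ` U \<subseteq> S" using U(2) proj_surj by auto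
      ultimately show ?thesis using openin_subset_trans by blast
    qed
    obtain h where "homeomorphism W (proj ` U) proj h"
      by (rule homeomorphism_injective_open_map[OF continuous_on_subset[OF proj_continuous W(2)] im inj oo])
    then show ?thesis by blast
  qed
  have 3: "pairwise disjnt v"
    unfolding pairwise_def disjnt_def v_def by (blast dest: disj)
  show "\<exists>T. x \<in> T \<and> openin (top_of_set S) T \<and> (\<exists>v. \<Union>v = hyperboloid \<inter> proj -` T \<and>
        (\<forall>u\<in>v. openin (top_of_set hyperboloid) u) \<and> pairwise disjnt v \<and> (\<forall>u\<in>v. \<exists>q. homeomorphism u T proj q))"
    using 1 2 3 proj_open[OF U(1)] zU z(2) D_open[OF _ U(1)]
    by (intro exI[of _ "proj ` U"] conjI exI[of _ v]) (auto simp: v_def)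
qed

end

section \<open>The surface group as a cocompact group of isometries\<close>

context surface
begin

text \<open>The words of label 0 act as the deck group of \<open>proj\<close>, and monodromy
  identifies this group with the fundamental group. \<open>o'\<close> is any point above the given
  base point, and the last constant bounds the distance from \<open>o'\<close> to the points of the
  central polygon.\<close>

theorem surface_group_is_lorentz_group:
  assumes S: "closed_orientable_surface g S" "x0 \<in> S"
  obtains \<rho>' o' \<epsilon> D where "lorentz_group (fundamental_group S x0) \<rho>' o' \<epsilon> D"
proof -
  obtain q where q: "quotient_map (top_of_set (cball (0::complex) 1)) (top_of_set S) q"
    "\<And>z w. z \<in> cball 0 1 \<Longrightarrow> w \<in> cball 0 1 \<Longrightarrow> q z = q w \<longleftrightarrow> equivclp (glued g) z w"
    using S(1) unfolding closed_orientable_surface_def by blast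
  obtain \<epsilon> where eps: "\<epsilon> > 0"
    "\<And>w z. lab w = 0 \<Longrightarrow> z \<in> hyperboloid \<Longrightarrow> hdist z (\<rho> w z) < \<epsilon> \<Longrightarrow> act \<tau> w = act \<tau> []"
    by (rule displacement) blast
  define D where "D = \<rho> ` {w. lab w = 0}"
  have lab0: "lab u = 0 \<Longrightarrow> act flag u 0 = 0" for u using flag_rev(2)[of u 0] by (simp add: lab_def)
  interpret deck_polygon D \<epsilon> "cball 0 1" J q S
  proof
    fix \<gamma> assume "\<gamma> \<in> D"
    then obtain w where w: "lab w = 0" "\<gamma> = \<rho> w" by (auto simp: D_def)
    show "lorentz_map \<gamma>" using w lorentz_act_mrefl by simp
    show "\<gamma> \<circ> \<delta> \<in> D" if \<delta>: "\<delta> \<in> D" for \<delta>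
    proof -
      obtain u where u: "lab u = 0" "\<delta> = \<rho> u" using \<delta> by (auto simp: D_def)
      have "lab (w @ u) = act flag (rev u) 0" using w by (simp add: lab_append)
      then have "lab (w @ u) = 0" using u(1) by (simp add: lab_def)
      moreover have "\<gamma> \<circ> \<delta> = \<rho> (w @ u)" by (simp add: w u act_append fun_eq_iff)
      ultimately show ?thesis by (auto simp: D_def)
    qed
    show "\<exists>\<delta>\<in>D. \<delta> \<circ> \<gamma> = id \<and> \<gamma> \<circ> \<delta> = id"
    proof (intro bexI[of _ "\<rho> (rev w)"])
      have "lab (rev w) = 0" using lab0[OF w(1)] by (simp add: lab_def)
      then show "\<rho> (rev w) \<in> D" by (auto simp: D_def)
    qed (simp add: w fun_eq_iff)
    show "\<gamma> = id" if "z \<in> hyperboloid" "hdist z (\<gamma> z) < \<epsilon>" for z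
      using act_tau_eqD(1)[OF eps(2)[OF w(1) that(1)]] that(2) w(2) by (simp add: fun_eq_iff)
  next
    have "lab [] = 0" by (simp add: lab_def)
    moreover have "\<rho> [] = id" by (simp add: fun_eq_iff)
    ultimately show "id \<in> D" by (force simp: D_def)
  next
    show "q \<zeta> = q \<zeta>' \<longleftrightarrow> (\<exists>\<gamma>\<in>D. \<gamma> (J \<zeta>) = J \<zeta>')" if "\<zeta> \<in> cball 0 1" "\<zeta>' \<in> cball 0 1" for \<zeta> \<zeta>'
      using q(2)[OF that] deck_imp_equivclp that equivclp_imp_deck by (auto simp: D_def)
    show "\<exists>\<gamma>\<in>D. \<exists>\<zeta>\<in>cball 0 1. z = \<gamma> (J \<zeta>)" if z: "z \<in> hyperboloid" for z
    proof -
      obtain w \<zeta> where "lab w = 0" "\<zeta> \<in> cball 0 1" "z = \<rho> w (J \<zeta>)" by (rule tiling_by_polygons[OF z])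
      then show ?thesis unfolding D_def by blast
    qed
  qed (use eps(1) q(1) continuous_on_J J_hyperboloid in auto)
  obtain o' where o': "o' \<in> hyperboloid" "x0 = proj o'" using S(2) proj_surj by auto
  interpret deck_covering hyperboloid proj S D o'
  proof
    show "\<gamma> = \<delta>" if "\<gamma> \<in> D" "\<delta> \<in> D" "z \<in> hyperboloid" "\<gamma> z = \<delta> z" for \<gamma> \<delta> z
      by (rule D_separated[OF that(1,2,3)]) (use that hdist_eq_0[of "\<delta> z" "\<delta> z"] D_hyp eps(1) in auto)
  qed (use proj_covering simply_connected_hyperboloid D_lorentz lorentz_map_continuous D_hyp proj_invariant
      D_comp proj_fibres o' in auto)
  obtain r where r: "\<And>a. a \<in> J ` cball 0 1 \<Longrightarrow> hdist o' a \<le> r"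
    by (rule compact_hdist_bounded[OF compact_continuous_image[OF continuous_on_J compact_cball] _ o'(1)])
      (use J_hyperboloid in auto)
  interpret \<Gamma>: group \<Gamma> unfolding o'(2)[symmetric] by (rule group_fundamental_group[OF S(2)])
  have "lorentz_group \<Gamma> deck_of o' \<epsilon> r"
  proof
    fix x assume x: "x \<in> carrier \<Gamma>"
    show "lorentz_map (deck_of x)" using D_lorentz deck_of_in[OF x] .
    show "det (matrix (deck_of x)) = 1" using det_rho deck_of_in[OF x] by (auto simp: D_def)
    show "deck_of (x \<otimes>\<^bsub>\<Gamma>\<^esub> y) = deck_of x \<circ> deck_of y" if "y \<in> carrier \<Gamma>" for y
      using deck_of_mult[OF x that] .
    show "\<epsilon> \<le> hdist z (deck_of x z)" if z: "x \<noteq> \<one>\<^bsub>\<Gamma>\<^esub>" "z \<in> hyperboloid" for z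
    proof (rule ccontr)
      assume "\<not> \<epsilon> \<le> hdist z (deck_of x z)"
      then have "deck_of x = id" using D_displacement[OF deck_of_in[OF x] z(2)] by simp
      then have "deck_of (x \<otimes>\<^bsub>\<Gamma>\<^esub> x) = deck_of x" using deck_of_mult[OF x x] by simp
      then have "x \<otimes>\<^bsub>\<Gamma>\<^esub> x = x" using deck_of_inj x by simp
      then show False using z(1) x by simp
    qed
  next
    fix z assume z: "z \<in> hyperboloid"
    then obtain \<gamma> \<zeta> where g: "\<gamma> \<in> D" "\<zeta> \<in> cball 0 1" "z = \<gamma> (J \<zeta>)" using tiles by blast
    obtain c where c: "c \<in> carrier \<Gamma>" "deck_of c = \<gamma>" by (rule deck_of_surj[OF g(1)])
    have "hdist z (deck_of c o') = hdist o' (J \<zeta>)" unfolding g(3) c(2) D_hdist[OF g(1)] by (rule hdist_commute)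
    then show "\<exists>x\<in>carrier \<Gamma>. hdist z (deck_of x o') \<le> r" using r[of "J \<zeta>"] g(2) c(1) by (metis imageI)
  qed (use eps(1) o'(1) in auto)
  then show thesis unfolding o'(2)[symmetric] by (rule that)
qed

end

subsection \<open>Hyperbolic length functions\<close>

definition gdist :: "('g, 'm) monoid_scheme \<Rightarrow> ('g \<Rightarrow> real) \<Rightarrow> 'g \<Rightarrow> 'g \<Rightarrow> real" where
  "gdist G ell x y = ell (inv\<^bsub>G\<^esub> x \<otimes>\<^bsub>G\<^esub> y)"

text \<open>A single constant \<open>C\<close> bounds all the additive errors of coarse hyperbolicity; \<open>power_geodesic\<close>
  says that \<open>1, u, hu, h\<^sup>k u, h\<^sup>k\<close> lie in this order near a geodesic, with \<open>u\<close> close to the axis of \<open>h\<close>.\<close>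

locale hyp_length = group G for G (structure) +
  fixes ell :: "'g \<Rightarrow> real" and C \<epsilon> :: real
  assumes ell_one: "ell \<one> = 0"
    and ell_nonneg: "x \<in> carrier G \<Longrightarrow> 0 \<le> ell x"
    and ell_inv: "x \<in> carrier G \<Longrightarrow> ell (inv x) = ell x"
    and ell_mult: "x \<in> carrier G \<Longrightarrow> y \<in> carrier G \<Longrightarrow> ell (x \<otimes> y) \<le> ell x + ell y"
    and C: "C \<ge> 1" and eps: "\<epsilon> > 0"
    and finite_ball: "finite {x \<in> carrier G. ell x \<le> R}"
    and four_points: "\<lbrakk>x \<in> carrier G; y \<in> carrier G; z \<in> carrier G; w \<in> carrier G\<rbrakk> \<Longrightarrow>
      gdist G ell x y + gdist G ell z w \<le>
        max (gdist G ell x z + gdist G ell y w) (gdist G ell x w + gdist G ell y z) + C"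
    and center: "\<lbrakk>x \<in> carrier G; y \<in> carrier G\<rbrakk> \<Longrightarrow> \<exists>u\<in>carrier G.
      ell u + gdist G ell u x \<le> ell x + C \<and> ell u + gdist G ell u y \<le> ell y + C \<and>
      gdist G ell x u + gdist G ell u y \<le> gdist G ell x y + C"
    and step: "x \<in> carrier G \<Longrightarrow> ell x \<ge> C \<Longrightarrow> \<exists>y\<in>carrier G. ell y \<le> ell x - 1 \<and> gdist G ell y x \<le> C"
    and power_geodesic: "\<lbrakk>h \<in> carrier G; h \<noteq> \<one>; k \<ge> 2\<rbrakk> \<Longrightarrow> \<exists>u\<in>carrier G.
      ell u + gdist G ell u (h \<otimes> u) + gdist G ell (h \<otimes> u) (h [^] (k::nat) \<otimes> u)
        + gdist G ell (h [^] k \<otimes> u) (h [^] k) \<le> ell (h [^] k) + C"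
    and power_growth: "\<lbrakk>h \<in> carrier G; h \<noteq> \<one>\<rbrakk> \<Longrightarrow> ell (h [^] (k::nat)) \<ge> \<epsilon> * real k - C"
    and roots: "\<lbrakk>x \<in> carrier G; x \<noteq> \<one>\<rbrakk> \<Longrightarrow> \<exists>c\<in>carrier G.
      \<forall>y\<in>carrier G. \<forall>k\<ge>1::nat. y [^] k = x \<longrightarrow> (\<exists>j::int. y = c [^] j)"
begin

abbreviation "d \<equiv> gdist G ell"

definition ball :: "real \<Rightarrow> 'g set" where "ball R = {x \<in> carrier G. ell x \<le> R}"

lemma ballD: "x \<in> ball R \<Longrightarrow> x \<in> carrier G" "x \<in> ball R \<Longrightarrow> ell x \<le> R"
  by (auto simp: ball_def)

lemma finite_ball' [simp]: "finite (ball R)"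
  using finite_ball by (simp add: ball_def)

lemma ball_mono: "R \<le> R' \<Longrightarrow> ball R \<subseteq> ball R'"
  by (auto simp: ball_def)

lemma inv_mult_cancel [simp]:
  assumes "x \<in> carrier G" "y \<in> carrier G"
  shows "inv x \<otimes> (x \<otimes> y) = y" "x \<otimes> (inv x \<otimes> y) = y"
  using assms by (simp_all add: m_assoc[symmetric])

lemma d_nonneg: "x \<in> carrier G \<Longrightarrow> y \<in> carrier G \<Longrightarrow> d x y \<ge> 0"
  by (simp add: gdist_def ell_nonneg)

lemma d_one [simp]: "x \<in> carrier G \<Longrightarrow> d \<one> x = ell x" "x \<in> carrier G \<Longrightarrow> d x \<one> = ell x"
  by (simp_all add: gdist_def ell_inv)

lemma d_commute: "x \<in> carrier G \<Longrightarrow> y \<in> carrier G \<Longrightarrow> d x y = d y x"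
  unfolding gdist_def using ell_inv[of "inv x \<otimes> y"] by (simp add: inv_mult_group)

lemma d_triangle: "x \<in> carrier G \<Longrightarrow> y \<in> carrier G \<Longrightarrow> z \<in> carrier G \<Longrightarrow> d x z \<le> d x y + d y z"
  unfolding gdist_def using ell_mult[of "inv x \<otimes> y" "inv y \<otimes> z"] by (simp add: m_assoc)

lemma d_left: "x \<in> carrier G \<Longrightarrow> y \<in> carrier G \<Longrightarrow> z \<in> carrier G \<Longrightarrow> d (z \<otimes> x) (z \<otimes> y) = d x y"
  by (simp add: gdist_def inv_mult_group m_assoc)

lemma one_in_ball: "R \<ge> 0 \<Longrightarrow> \<one> \<in> ball R"
  by (simp add: ball_def ell_one)

text \<open>Bounds both the growth of balls per unit of radius and the number of elements near a
  geodesic whose length has a given integer part.\<close>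

definition n0 :: real where "n0 = real (card (ball (2 * C + 1)))"

lemma n0: "n0 \<ge> 1"
proof -
  have "card (ball (2 * C + 1)) > 0" using one_in_ball[of "2 * C + 1"] C by (auto simp: card_gt_0_iff)
  then show ?thesis by (simp add: n0_def)
qed

text \<open>By \<open>step\<close> a long element is shortened by 1 through a jump of size at most
  \<open>C\<close>, so each unit of radius multiplies the cardinality by at most \<open>n0\<close>.
  The summand 2 absorbs the rounding and the initial ball.\<close>

lemma card_ball_le:
  assumes "R \<ge> 0" shows "real (card (ball R)) \<le> n0 powr (R + 2)"
proof -
  have step: "card (ball (C + real n)) \<le> card (ball (2 * C + 1)) ^ (n + 1)" for n
  proof (induction n)
    case 0
    have "ball C \<subseteq> ball (2 * C + 1)" using C by (intro ball_mono) simp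
    then show ?case by (simp add: card_mono)
  next
    case (Suc n)
    have "ball (C + real (Suc n)) \<subseteq> (\<lambda>(y, z). y \<otimes> z) ` (ball (C + real n) \<times> ball (2 * C + 1))"
    proof
      fix x assume x: "x \<in> ball (C + real (Suc n))"
      note xc = ballD(1)[OF x]
      have "\<exists>y \<in> ball (C + real n). d y x \<le> 2 * C + 1"
      proof (cases "ell x \<ge> C")
        case True
        with step[OF xc] obtain y where "y \<in> carrier G" "ell y \<le> ell x - 1" "d y x \<le> C" by blast
        then show ?thesis using ballD[OF x] C by (intro bexI[of _ y]) (auto simp: ball_def)
      next
        case False
        then show ?thesis using xc C by (intro bexI[of _ x]) (auto simp: ball_def gdist_def ell_one)
      qed
      then obtain y where y: "y \<in> ball (C + real n)" "d y x \<le> 2 * C + 1" by blast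
      then have "inv y \<otimes> x \<in> ball (2 * C + 1)" using ballD(1)[OF y(1)] xc by (simp add: ball_def gdist_def)
      moreover have "x = y \<otimes> (inv y \<otimes> x)" using ballD(1)[OF y(1)] xc by simp
      ultimately show "x \<in> (\<lambda>(y, z). y \<otimes> z) ` (ball (C + real n) \<times> ball (2 * C + 1))"
        using y(1) by (intro image_eqI[of _ _ "(y, inv y \<otimes> x)"]) auto
    qed
    then have "card (ball (C + real (Suc n))) \<le> card ((\<lambda>(y, z). y \<otimes> z) ` (ball (C + real n) \<times> ball (2 * C + 1)))"
      by (intro card_mono) auto
    also have "\<dots> \<le> card (ball (C + real n) \<times> ball (2 * C + 1))" by (intro card_image_le) auto
    also have "\<dots> \<le> card (ball (2 * C + 1)) ^ (n + 1) * card (ball (2 * C + 1))"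
      using Suc by (simp add: card_cartesian_product)
    finally show ?case by (simp add: mult.commute)
  qed
  define n where "n = nat \<lceil>R\<rceil>"
  have n: "R \<le> real n" "real n \<le> R + 1" using assms by (auto simp: n_def)
  have "ball R \<subseteq> ball (C + real n)" using C n by (intro ball_mono) simp
  then have "real (card (ball R)) \<le> real (card (ball (C + real n)))" by (simp add: card_mono)
  also have "\<dots> \<le> n0 ^ (n + 1)" using step[of n] by (simp add: n0_def flip: of_nat_power of_nat_mult)
  also have "\<dots> = n0 powr (real (n + 1))" using n0 by (subst powr_realpow) auto
  also have "\<dots> \<le> n0 powr (R + 2)" using n n0 by (intro powr_mono) auto
  finally show ?thesis .
qed

definition near :: "'g \<Rightarrow> real \<Rightarrow> 'g set" where
  "near h R = {u \<in> ball R. ell u + d u h \<le> ell h + C}"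

lemma near_subset: "near h R \<subseteq> ball R" by (auto simp: near_def)

lemma finite_near [simp]: "finite (near h R)"
  by (rule finite_subset[OF near_subset]) simp

definition nb :: "real \<Rightarrow> real" where "nb R = (R + 1) * n0"

lemma nb_nonneg: "R \<ge> 0 \<Longrightarrow> nb R \<ge> 0" using n0 by (simp add: nb_def)

text \<open>Points near the geodesic from \<open>1\<close> to \<open>h\<close> are determined by their length up to a bounded error.\<close>

lemma card_near:
  assumes h: "h \<in> carrier G" and R: "R \<ge> 0"
  shows "real (card (near h R)) \<le> nb R"
proof -
  define N where "N j = {u \<in> near h R. nat \<lfloor>ell u\<rfloor> = j}" for j
  have cN: "card (N j) \<le> card (ball (2 * C + 1))" for j
  proof (cases "N j = {}")
    case False
    then obtain v where v: "v \<in> N j" by blast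
    have "(\<lambda>u. inv v \<otimes> u) ` N j \<subseteq> ball (2 * C + 1)"
    proof clarify
      fix u assume u: "u \<in> N j"
      have uv: "u \<in> carrier G" "v \<in> carrier G" using u v by (auto simp: N_def near_def ball_def)
      have close: "\<bar>ell u - ell v\<bar> \<le> 1"
      proof -
        have "\<lfloor>ell u\<rfloor> = \<lfloor>ell v\<rfloor>" using u v ell_nonneg[OF uv(1)] ell_nonneg[OF uv(2)]
          by (simp add: N_def) (metis nat_eq_iff2 zero_le_floor)
        then show ?thesis by linarith
      qed
      \<comment> \<open>The pairs are \<open>v, u\<close> and \<open>\<one>, h\<close>: two elements
        of nearly equal length, both near the geodesic from \<open>\<one>\<close> to
        \<open>h\<close>, must be close to each other.\<close>
      have "d v u + d \<one> h \<le> max (d v \<one> + d u h) (d v h + d u \<one>) + C"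
        using uv h by (intro four_points) auto
      moreover have "ell u + d u h \<le> ell h + C" "ell v + d v h \<le> ell h + C"
        using u v by (auto simp: N_def near_def)
      ultimately have "d v u \<le> 2 * C + 1" using uv h close by (auto simp: max_def split: if_splits)
      then show "inv v \<otimes> u \<in> ball (2 * C + 1)" using uv by (simp add: ball_def gdist_def)
    qed
    moreover have "inj_on (\<lambda>u. inv v \<otimes> u) (N j)"
      using v by (intro inj_onI) (auto simp: N_def near_def ball_def)
    ultimately show ?thesis by (meson card_inj_on_le finite_ball')
  qed simp
  have "near h R \<subseteq> (\<Union>j\<in>{0..nat \<lfloor>R\<rfloor>}. N j)"
    by (auto simp: N_def near_def ball_def intro!: nat_mono floor_mono)
  then have "card (near h R) \<le> card (\<Union>j\<in>{0..nat \<lfloor>R\<rfloor>}. N j)"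
    by (intro card_mono) (auto simp: N_def)
  also have "\<dots> \<le> (\<Sum>j\<in>{0..nat \<lfloor>R\<rfloor>}. card (N j))" by (intro card_UN_le) auto
  also have "\<dots> \<le> (nat \<lfloor>R\<rfloor> + 1) * card (ball (2 * C + 1))"
    using sum_bounded_above[of "{0..nat \<lfloor>R\<rfloor>}" "\<lambda>j. card (N j)"] cN by simp
  finally have "real (card (near h R)) \<le> real (nat \<lfloor>R\<rfloor> + 1) * n0"
    unfolding n0_def by (simp only: of_nat_mult[symmetric] of_nat_le_iff)
  also have "\<dots> \<le> (R + 1) * n0" using R n0 by (intro mult_right_mono) linarith+
  finally show ?thesis by (simp add: nb_def)
qed

text \<open>For every \<open>s\<close> and \<open>h\<close> the center \<open>u\<close> of the triangle \<open>1, s, h\<close> splits both \<open>s = u \<cdot> u\<^sup>-\<^sup>1 s\<close> and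
  \<open>s\<^sup>-\<^sup>1 h = s\<^sup>-\<^sup>1 u \<cdot> u\<^sup>-\<^sup>1 h\<close> along geodesics; there are few such splittings of each factor.\<close>

lemma rapid_decay:
  fixes f \<xi> :: "'g \<Rightarrow> real"
  assumes R: "R \<ge> 0" and F: "F \<subseteq> ball R" and X: "finite X" "X \<subseteq> carrier G" and H: "finite H" "H \<subseteq> carrier G"
    and \<xi>: "\<And>g. g \<in> carrier G \<Longrightarrow> g \<notin> X \<Longrightarrow> \<xi> g = 0"
  shows "(\<Sum>h\<in>H. (\<Sum>s\<in>F. f s * \<xi> (inv s \<otimes> h))\<^sup>2) \<le> nb (R + C) ^ 3 * ((\<Sum>s\<in>F. (f s)\<^sup>2) * (\<Sum>g\<in>X. (\<xi> g)\<^sup>2))"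
proof -
  let ?P = "nb (R + C)" and ?R = "R + C"
  have R': "?R \<ge> 0" using R C by simp
  have P0: "?P \<ge> 0" using nb_nonneg[OF R'] .
  have finF: "finite F" by (rule finite_subset[OF F finite_ball'])
  have Fc: "s \<in> carrier G" "ell s \<le> R" if "s \<in> F" for s using F that by (auto simp: ball_def)
  obtain cen where cen: "\<And>s h. s \<in> carrier G \<Longrightarrow> h \<in> carrier G \<Longrightarrow> cen s h \<in> carrier G \<and>
      ell (cen s h) + d (cen s h) s \<le> ell s + C \<and> ell (cen s h) + d (cen s h) h \<le> ell h + C \<and>
      d s (cen s h) + d (cen s h) h \<le> d s h + C"
    using center by metis
  have cenb: "cen s h \<in> ball ?R" "cen s h \<in> near s ?R" "cen s h \<in> near h ?R" if "s \<in> F" "h \<in> carrier G" for s h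
    using cen[OF Fc(1)[OF that(1)] that(2)] d_nonneg[of "cen s h" s] Fc[OF that(1)]
    by (auto simp: ball_def near_def)
  \<comment> \<open>\<open>A u\<close> collects the squares of \<open>f\<close> at elements whose
    geodesic passes near \<open>u\<close>, \<open>B u h\<close> the squares of \<xi> over the
    splittings of \<open>h\<close> with centre \<open>u\<close>. The cube in the bound arises from
    three applications of \<open>card_near\<close>.\<close>
  define A where "A u = (\<Sum>s\<in>{s\<in>F. u \<in> near s ?R}. (f s)\<^sup>2)" for u
  define B where "B u h = (\<Sum>s\<in>{s\<in>F. cen s h = u}. (\<xi> (inv s \<otimes> h))\<^sup>2)" for u h
  have A0: "A u \<ge> 0" and B0: "B u h \<ge> 0" for u h by (auto simp: A_def B_def sum_nonneg)
  have conv: "(\<Sum>s\<in>F. f s * \<xi> (inv s \<otimes> h))\<^sup>2 \<le> ?P * (\<Sum>u\<in>ball ?R. A u * B u h)" if h: "h \<in> H" for h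
  proof -
    have hc: "h \<in> carrier G" using h H by blast
    let ?I = "\<lambda>u. \<Sum>s\<in>{s\<in>F. cen s h = u}. f s * \<xi> (inv s \<otimes> h)"
    have "(\<Sum>s\<in>F. f s * \<xi> (inv s \<otimes> h)) = (\<Sum>u\<in>near h ?R. ?I u)"
      using cenb hc finF by (intro sum.group[symmetric]) auto
    also have "(\<dots>)\<^sup>2 \<le> (\<Sum>u\<in>near h ?R. (?I u)\<^sup>2) * real (card (near h ?R))"
      by (rule sum_squared_le_sum_of_squares)
    also have "\<dots> \<le> (\<Sum>u\<in>near h ?R. (?I u)\<^sup>2) * ?P"
      using card_near[OF hc R'] by (intro mult_left_mono sum_nonneg) auto
    also have "\<dots> \<le> (\<Sum>u\<in>near h ?R. A u * B u h) * ?P"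
    proof (intro mult_right_mono P0 sum_mono)
      fix u
      have "(?I u)\<^sup>2 \<le> (\<Sum>s\<in>{s\<in>F. cen s h = u}. (f s)\<^sup>2) * B u h"
        unfolding B_def by (rule Cauchy_Schwarz_ineq_sum)
      also have "\<dots> \<le> A u * B u h"
        unfolding A_def using finF cenb hc B0 by (intro mult_right_mono sum_mono2) auto
      finally show "(?I u)\<^sup>2 \<le> A u * B u h" .
    qed
    also have "\<dots> \<le> (\<Sum>u\<in>ball ?R. A u * B u h) * ?P"
      using A0 B0 near_subset P0 by (intro mult_right_mono sum_mono2) auto
    finally show ?thesis by (simp add: mult.commute)
  qed
  have BH: "(\<Sum>h\<in>H. B u h) \<le> ?P * (\<Sum>g\<in>X. (\<xi> g)\<^sup>2)" if u: "u \<in> carrier G" for u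
  proof -
    let ?S = "SIGMA h:H. {s\<in>F. cen s h = u}"
    let ?S' = "{(h, s) \<in> ?S. inv s \<otimes> h \<in> X}"
    \<comment> \<open>Substitute \<open>t = inv s \<otimes> h\<close>: the centre property puts
      \<open>inv s \<otimes> u\<close> near the geodesic to \<open>t\<close>, and this element
      determines \<open>s\<close>, so each \<open>t\<close> occurs at most \<open>?P\<close>
      times.\<close>
    let ?T = "SIGMA t:X. {s\<in>F. inv s \<otimes> u \<in> near t ?R}"
    have "(\<Sum>h\<in>H. B u h) = (\<Sum>(h,s)\<in>?S. (\<xi> (inv s \<otimes> h))\<^sup>2)"
      unfolding B_def using H finF by (subst sum.Sigma) auto
    also have "\<dots> = (\<Sum>(h,s)\<in>?S'. (\<xi> (inv s \<otimes> h))\<^sup>2)"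
    proof (rule sum.mono_neutral_right)
      show "finite ?S" using H finF by auto
      show "\<forall>i\<in>?S - ?S'. (case i of (h,s) \<Rightarrow> (\<xi> (inv s \<otimes> h))\<^sup>2) = 0"
      proof -
        have "\<xi> (inv s \<otimes> h) = 0" if "h \<in> H" "s \<in> F" "inv s \<otimes> h \<notin> X" for h s
          using that H Fc(1)[of s] by (intro \<xi>) auto
        then show ?thesis by fastforce
      qed
    qed auto
    also have "\<dots> \<le> (\<Sum>(t,s)\<in>?T. (\<xi> t)\<^sup>2)"
    proof (rule sum_le_included[where i = "\<lambda>(t,s). (s \<otimes> t, s)"])
      show "finite ?S'" using H finF by (auto intro: finite_subset[of _ ?S])
      show "finite ?T" using X finF by auto
      show "\<forall>x\<in>?S'. \<exists>y\<in>?T. (case y of (t, s) \<Rightarrow> (s \<otimes> t, s)) = x \<and>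
           (case x of (h, s) \<Rightarrow> (\<xi> (inv s \<otimes> h))\<^sup>2) \<le> (case y of (t, s) \<Rightarrow> (\<xi> t)\<^sup>2)"
      proof
        fix x assume "x \<in> ?S'"
        then obtain h s where x: "x = (h, s)" "h \<in> H" "s \<in> F" "cen s h = u" "inv s \<otimes> h \<in> X" by auto
        have c: "h \<in> carrier G" "s \<in> carrier G" using x Fc H by auto
        have *: "ell u + d u s \<le> ell s + C" "d s u + d u h \<le> d s h + C" using cen[OF c(2,1)] x by auto
        have "ell (inv s \<otimes> u) \<le> ?R" using *(1) Fc(2)[OF x(3)] ell_nonneg[OF u] d_commute[OF c(2) u]
          by (simp add: gdist_def)
        moreover have "ell (inv s \<otimes> u) + d (inv s \<otimes> u) (inv s \<otimes> h) \<le> ell (inv s \<otimes> h) + C"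
          using *(2) c u by (simp add: d_left) (simp add: gdist_def)
        ultimately have "inv s \<otimes> u \<in> near (inv s \<otimes> h) ?R" using c u by (simp add: near_def ball_def)
        then show "\<exists>y\<in>?T. (case y of (t, s) \<Rightarrow> (s \<otimes> t, s)) = x \<and>
           (case x of (h, s) \<Rightarrow> (\<xi> (inv s \<otimes> h))\<^sup>2) \<le> (case y of (t, s) \<Rightarrow> (\<xi> t)\<^sup>2)"
          using x c by (intro bexI[of _ "(inv s \<otimes> h, s)"]) auto
      qed
    qed auto
    also have "\<dots> = (\<Sum>t\<in>X. (\<xi> t)\<^sup>2 * real (card {s\<in>F. inv s \<otimes> u \<in> near t ?R}))"
      using X finF by (subst sum.Sigma[symmetric]) (auto simp: mult.commute)
    also have "\<dots> \<le> (\<Sum>t\<in>X. (\<xi> t)\<^sup>2 * ?P)"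
    proof (intro sum_mono mult_left_mono)
      fix t assume t: "t \<in> X"
      have "card {s\<in>F. inv s \<otimes> u \<in> near t ?R} \<le> card (near t ?R)"
      proof (rule card_inj_on_le[where f = "\<lambda>s. inv s \<otimes> u"])
        show "inj_on (\<lambda>s. inv s \<otimes> u) {s \<in> F. inv s \<otimes> u \<in> near t ?R}"
        proof (intro inj_onI)
          fix s s' assume "s \<in> {s \<in> F. inv s \<otimes> u \<in> near t ?R}" "s' \<in> {s \<in> F. inv s \<otimes> u \<in> near t ?R}"
            and eq: "inv s \<otimes> u = inv s' \<otimes> u"
          then have "s \<in> carrier G" "s' \<in> carrier G" using Fc by auto
          with eq u show "s = s'" by (metis inv_closed inv_inv right_cancel)
        qed
      qed auto
      then show "real (card {s\<in>F. inv s \<otimes> u \<in> near t ?R}) \<le> ?P"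
        using card_near[OF _ R', of t] X t by (meson of_nat_le_iff order_trans subsetD)
    qed auto
    finally show ?thesis by (simp add: sum_distrib_left mult.commute)
  qed
  have AA: "(\<Sum>u\<in>ball ?R. A u) \<le> ?P * (\<Sum>s\<in>F. (f s)\<^sup>2)"
  proof -
    have "(\<Sum>u\<in>ball ?R. A u) = (\<Sum>u\<in>ball ?R. \<Sum>s\<in>F. if u \<in> near s ?R then (f s)\<^sup>2 else 0)"
      unfolding A_def by (rule sum.cong[OF refl], rule sum.inter_filter[OF finF])
    also have "\<dots> = (\<Sum>s\<in>F. \<Sum>u\<in>ball ?R. if u \<in> near s ?R then (f s)\<^sup>2 else 0)" by (rule sum.swap)
    also have "\<dots> = (\<Sum>s\<in>F. (f s)\<^sup>2 * real (card (near s ?R)))"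
    proof (intro sum.cong refl)
      fix s
      have "{u \<in> ball ?R. u \<in> near s ?R} = near s ?R" using near_subset by auto
      then show "(\<Sum>u\<in>ball ?R. if u \<in> near s ?R then (f s)\<^sup>2 else 0) = (f s)\<^sup>2 * real (card (near s ?R))"
        by (simp add: sum.inter_filter[symmetric])
    qed
    also have "\<dots> \<le> (\<Sum>s\<in>F. (f s)\<^sup>2 * ?P)"
      using card_near[OF Fc(1) R'] by (intro sum_mono mult_left_mono) auto
    finally show ?thesis by (simp add: sum_distrib_left mult.commute)
  qed
  have X0: "(\<Sum>g\<in>X. (\<xi> g)\<^sup>2) \<ge> 0" by (intro sum_nonneg) simp
  have "(\<Sum>h\<in>H. (\<Sum>s\<in>F. f s * \<xi> (inv s \<otimes> h))\<^sup>2) \<le> (\<Sum>h\<in>H. ?P * (\<Sum>u\<in>ball ?R. A u * B u h))"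
    by (intro sum_mono conv)
  also have "\<dots> = ?P * (\<Sum>u\<in>ball ?R. A u * (\<Sum>h\<in>H. B u h))"
    unfolding sum_distrib_left by (rule sum.swap)
  also have "\<dots> \<le> ?P * (\<Sum>u\<in>ball ?R. A u * (?P * (\<Sum>g\<in>X. (\<xi> g)\<^sup>2)))"
    by (intro mult_left_mono sum_mono BH A0 P0) (auto simp: ball_def)
  also have "\<dots> = ?P * ((\<Sum>u\<in>ball ?R. A u) * (?P * (\<Sum>g\<in>X. (\<xi> g)\<^sup>2)))"
    by (simp add: sum_distrib_right)
  also have "\<dots> \<le> ?P * ((?P * (\<Sum>s\<in>F. (f s)\<^sup>2)) * (?P * (\<Sum>g\<in>X. (\<xi> g)\<^sup>2)))"
    by (intro mult_left_mono mult_right_mono AA mult_nonneg_nonneg P0 X0)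
  finally show ?thesis by (simp add: power3_eq_cube mult_ac)
qed

text \<open>Halving the path costs one error \<open>C\<close> of the four-point condition.\<close>

lemma path_near_geodesic:
  assumes p: "\<And>t. p t \<in> carrier G" and a: "a \<in> carrier G"
    and jump: "\<And>t. i \<le> t \<Longrightarrow> t < j \<Longrightarrow> d (p t) (p (Suc t)) \<le> J" and J: "J \<ge> 0"
    and geo: "d (p i) a + d a (p j) \<le> d (p i) (p j) + c"
    and ij: "i \<le> j" "j - i \<le> 2 ^ L"
  shows "\<exists>t\<in>{i..j}. d (p t) a \<le> J + c + C * real L"
  using jump geo ij
proof (induction L arbitrary: i j c)
  case 0
  have "d (p i) (p j) \<le> J"
  proof (cases "i = j")
    case True then show ?thesis using J p by (simp add: gdist_def ell_one)
  next
    case False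
    then have "j = Suc i" using 0 by auto
    then show ?thesis using 0(1)[of i] by auto
  qed
  then have "d (p i) a \<le> J + c" using 0(2) d_nonneg[OF a p, of j] by linarith
  then show ?case using 0 by auto
next
  case (Suc L)
  define m where "m = i + (j - i) div 2"
  have m: "i \<le> m" "m \<le> j" "m - i \<le> 2 ^ L" "j - m \<le> 2 ^ L"
    using Suc.prems(3,4) by (auto simp: m_def)
  have "d (p i) (p j) + d a (p m) \<le> max (d (p i) a + d (p j) (p m)) (d (p i) (p m) + d (p j) a) + C"
    using p a by (intro four_points)
  then consider "d (p m) a + d a (p j) \<le> d (p m) (p j) + (c + C)" | "d (p i) a + d a (p m) \<le> d (p i) (p m) + (c + C)"
    using Suc.prems(2) d_commute[OF p a] d_commute[OF p p, of j m] by (force simp: max_def split: if_splits)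
  then show ?case
  proof cases
    case 1
    have "\<exists>t\<in>{m..j}. d (p t) a \<le> J + (c + C) + C * real L"
      using m Suc.prems(1) by (intro Suc.IH[OF _ 1]) auto
    then show ?thesis using m by (force simp: algebra_simps)
  next
    case 2
    have "\<exists>t\<in>{i..m}. d (p t) a \<le> J + (c + C) + C * real L"
      using m Suc.prems(1) by (intro Suc.IH[OF _ 2]) auto
    then show ?thesis using m by (force simp: algebra_simps)
  qed
qed

text \<open>The times are found one after the other, each on the remaining part of the path, which
  makes them ordered. Starting from a point known only up to an error \<open>e\<close> costs
  \<open>2 * e\<close>, so the errors are \<open>r\<close>, \<open>3 * r\<close> and
  \<open>7 * r\<close>. Halving \<open>n\<close> times is generous, but an error linear in
  \<open>n\<close> is affordable.\<close>

lemma path_near_power: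
  assumes p: "\<And>t. p t \<in> carrier G" "p 0 = \<one>" "p n = h [^] k" and h: "h \<in> carrier G" "h \<noteq> \<one>" "(k::nat) \<ge> 2"
    and jump: "\<And>t. t < n \<Longrightarrow> d (p t) (p (Suc t)) \<le> J" and J: "J \<ge> 0"
  obtains u t1 t2 t3 where "u \<in> carrier G" "t1 \<le> t2" "t2 \<le> t3" "t3 \<le> n"
    "d (p t1) u \<le> 7 * (J + C + C * real n)"
    "d (p t2) (h \<otimes> u) \<le> 7 * (J + C + C * real n)" "d (p t3) (h [^] k \<otimes> u) \<le> 7 * (J + C + C * real n)"
proof -
  define r where "r = J + C + C * real n"
  have r0: "r \<ge> 0" using J C by (simp add: r_def)
  have n2: "m \<le> 2 ^ n" if "m \<le> n" for m :: nat
    using that less_exp[of n] by linarith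
  obtain u where u: "u \<in> carrier G" "ell u + d u (h \<otimes> u) + d (h \<otimes> u) (h [^] k \<otimes> u)
        + d (h [^] k \<otimes> u) (h [^] k) \<le> ell (h [^] k) + C"
    using power_geodesic[OF h] by blast
  define a2 where "a2 = h \<otimes> u"
  define a3 where "a3 = h [^] k \<otimes> u"
  define g where "g = h [^] k"
  have c: "a2 \<in> carrier G" "a3 \<in> carrier G" "g \<in> carrier G" using u h by (auto simp: a2_def a3_def g_def)
  have geo: "ell u + d u a2 + d a2 a3 + d a3 g \<le> ell g + C" using u(2) by (simp add: a2_def a3_def g_def)
  have pn: "p n = g" by (simp add: g_def p)
  note tri = d_triangle and dn = d_nonneg
  have "\<exists>t\<in>{0..n}. d (p t) u \<le> J + C + C * real n"
  proof (rule path_near_geodesic[where J = J])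
    show "d (p 0) u + d u (p n) \<le> d (p 0) (p n) + C"
      using geo tri[of u a2 g] tri[of a2 a3 g] u c p(2) pn by simp
  qed (use p u jump J n2[of n] in auto)
  then obtain t1 where t1: "t1 \<le> n" "d (p t1) u \<le> r" by (auto simp: r_def)
  have "\<exists>t\<in>{t1..n}. d (p t) a2 \<le> J + (2 * r + C) + C * real n"
  proof (rule path_near_geodesic[where J = J])
    show "d (p t1) a2 + d a2 (p n) \<le> d (p t1) (p n) + (2 * r + C)"
      using geo tri[of "p t1" u a2] tri[of a2 a3 g] tri[of u "p t1" g] tri[of \<one> u g]
       d_commute[of u "p t1"] u c p(1) pn t1 by simp
  qed (use p c jump J n2[of "n - t1"] t1 in auto)
  then obtain t2 where t2: "t1 \<le> t2" "t2 \<le> n" "d (p t2) a2 \<le> 3 * r" by (auto simp: r_def)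
  have "\<exists>t\<in>{t2..n}. d (p t) a3 \<le> J + (2 * (3 * r) + C) + C * real n"
  proof (rule path_near_geodesic[where J = J])
    show "d (p t2) a3 + d a3 (p n) \<le> d (p t2) (p n) + (2 * (3 * r) + C)"
      using geo tri[of "p t2" a2 a3] tri[of a2 "p t2" g] tri[of \<one> u g] tri[of u a2 g]
       d_commute[of a2 "p t2"] u c p(1) pn t2 by simp
  qed (use p c jump J n2[of "n - t2"] t2 in auto)
  then obtain t3 where t3: "t2 \<le> t3" "t3 \<le> n" "d (p t3) a3 \<le> 7 * r" by (auto simp: r_def)
  show ?thesis
    by (rule that[of u t1 t2 t3])
      (use u t1 t2 t3 r0 in \<open>simp_all add: a2_def[symmetric] a3_def[symmetric] r_def[symmetric]\<close>)
qed

end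

subsection \<open>Words whose product is a proper power\<close>

text \<open>The coefficients may depend on the place, since the blocks can have different lengths;
  \<open>a\<close> is the index of the first place.\<close>

fun wt :: "(nat \<Rightarrow> 'g \<Rightarrow> real) \<Rightarrow> nat \<Rightarrow> 'g list \<Rightarrow> real" where
  "wt Y a [] = 1"
| "wt Y a (s # l) = Y a s * wt Y (Suc a) l"

lemma wt_append: "wt Y a (l @ m) = wt Y a l * wt Y (a + length l) m"
  by (induction l arbitrary: a) auto

lemma wt_nonneg: "(\<And>i s. Y i s \<ge> 0) \<Longrightarrow> wt Y a l \<ge> 0"
  by (induction l arbitrary: a) auto

lemma sum_product4:
  fixes f :: "_ \<Rightarrow> real"
  shows "(\<Sum>x\<in>A. \<Sum>y\<in>B. \<Sum>z\<in>C. \<Sum>w\<in>D. f x * (g y * (h z * k w))) = sum f A * (sum g B * (sum h C * sum k D))"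
  by (simp only: sum_distrib_left[symmetric] sum_distrib_right[symmetric])

section \<open>Convolution products as sums over words\<close>

context hyp_length
begin

definition mprod :: "'g list \<Rightarrow> 'g" where "mprod l = foldr (\<otimes>) l \<one>"

lemma mprod_simps [simp]: "mprod [] = \<one>" "mprod (s # l) = s \<otimes> mprod l"
  by (simp_all add: mprod_def)

lemma mprod_closed: "set l \<subseteq> carrier G \<Longrightarrow> mprod l \<in> carrier G"
  by (induction l) auto

lemma mprod_append: "set l \<subseteq> carrier G \<Longrightarrow> set m \<subseteq> carrier G \<Longrightarrow> mprod (l @ m) = mprod l \<otimes> mprod m"
  by (induction l) (auto simp: m_assoc mprod_closed)

definition lists_of :: "real \<Rightarrow> nat \<Rightarrow> 'g list set" where
  "lists_of J n = {l. set l \<subseteq> ball J \<and> length l = n}"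

lemma finite_lists_of [simp]: "finite (lists_of J n)"
  unfolding lists_of_def by (rule finite_lists_length_eq) simp

lemma lists_of_carrier: "l \<in> lists_of J n \<Longrightarrow> set l \<subseteq> carrier G"
  by (auto simp: lists_of_def ball_def)

lemma lists_of_0 [simp]: "lists_of J 0 = {[]}"
  by (auto simp: lists_of_def)

lemma ell_mprod: "l \<in> lists_of J n \<Longrightarrow> ell (mprod l) \<le> real n * J"
proof (induction l arbitrary: n)
  case (Cons s l)
  then obtain n' where n: "n = Suc n'" "l \<in> lists_of J n'" "s \<in> ball J"
    by (auto simp: lists_of_def)
  have "ell (s \<otimes> mprod l) \<le> ell s + ell (mprod l)"
    using n lists_of_carrier[OF n(2)] by (intro ell_mult mprod_closed) (auto simp: ball_def)
  then show ?case using Cons.IH[OF n(2)] n ballD(2)[OF n(3)] by (simp add: algebra_simps)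
qed (auto simp: ell_one lists_of_def)

text \<open>Convolution of \<open>Y a\<close>, ..., \<open>Y (a + n - 1)\<close>, each restricted to
  \<open>ball J\<close>, kept as a sum over words so that single words can be cut.\<close>

definition seg :: "real \<Rightarrow> (nat \<Rightarrow> 'g \<Rightarrow> real) \<Rightarrow> nat \<Rightarrow> nat \<Rightarrow> 'g \<Rightarrow> real" where
  "seg J Y a n g = (\<Sum>l\<in>{l \<in> lists_of J n. mprod l = g}. wt Y a l)"

lemma seg_nonneg: "(\<And>i s. Y i s \<ge> 0) \<Longrightarrow> seg J Y a n g \<ge> 0"
  unfolding seg_def by (intro sum_nonneg wt_nonneg) auto

lemma seg_outside:
  assumes "g \<notin> ball (real n * J)" shows "seg J Y a n g = 0"
proof -
  have "mprod l \<in> ball (real n * J)" if "l \<in> lists_of J n" for l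
    using ell_mprod[OF that] lists_of_carrier[OF that] by (simp add: ball_def mprod_closed)
  then have e: "{l \<in> lists_of J n. mprod l = g} = {}" using assms by auto
  show ?thesis unfolding seg_def e by simp
qed

lemma seg_0: "seg J Y a 0 g = (if g = \<one> then 1 else 0)"
proof -
  have "{l \<in> lists_of J 0. mprod l = g} = (if g = \<one> then {[]} else {})" by auto
  then show ?thesis by (simp add: seg_def)
qed

lemma sum_over_split_words:
  assumes g: "g \<in> carrier G"
  shows "(\<Sum>l\<in>{l \<in> lists_of J (m + n). mprod l = g}. F l) =
    (\<Sum>l\<in>lists_of J m. \<Sum>l'\<in>{l' \<in> lists_of J n. mprod l' = inv (mprod l) \<otimes> g}. F (l @ l'))"
    (is "?L = ?R")
proof -
  have "?R = (\<Sum>(l,l')\<in>(SIGMA l:lists_of J m. {l' \<in> lists_of J n. mprod l' = inv (mprod l) \<otimes> g}). F (l @ l'))"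
    by (subst sum.Sigma) auto
  also have "\<dots> = ?L"
  proof (rule sum.reindex_bij_witness[where j = "\<lambda>(l,l'). l @ l'" and i = "\<lambda>l. (take m l, drop m l)"])
    fix l assume l: "l \<in> {l \<in> lists_of J (m + n). mprod l = g}"
    then have c: "set (take m l) \<subseteq> ball J" "set (drop m l) \<subseteq> ball J"
      by (auto simp: lists_of_def dest: in_set_takeD in_set_dropD)
    then have "take m l \<in> lists_of J m" "drop m l \<in> lists_of J n" using l by (auto simp: lists_of_def)
    moreover from this have cc: "mprod (take m l) \<in> carrier G" "mprod (drop m l) \<in> carrier G"
      by (auto intro!: mprod_closed dest: lists_of_carrier)
    moreover have "mprod (take m l) \<otimes> mprod (drop m l) = g"
      using mprod_append[of "take m l" "drop m l"] c l by (auto simp: ball_def subset_iff)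
    ultimately show "(take m l, drop m l) \<in> (SIGMA l:lists_of J m. {l' \<in> lists_of J n. mprod l' = inv (mprod l) \<otimes> g})"
      by (auto)
  next
    fix p assume p: "p \<in> (SIGMA l:lists_of J m. {l' \<in> lists_of J n. mprod l' = inv (mprod l) \<otimes> g})"
    then obtain l l' where ll: "p = (l, l')" "l \<in> lists_of J m" "l' \<in> lists_of J n"
      "mprod l' = inv (mprod l) \<otimes> g" by auto
    then have "mprod (l @ l') = g" using g lists_of_carrier[OF ll(2)] lists_of_carrier[OF ll(3)]
      by (simp add: mprod_append mprod_closed)
    then show "(case p of (l, l') \<Rightarrow> l @ l') \<in> {l \<in> lists_of J (m + n). mprod l = g}"
      using ll by (auto simp: lists_of_def)
    show "(take m (case p of (l, l') \<Rightarrow> l @ l'), drop m (case p of (l, l') \<Rightarrow> l @ l')) = p"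
      using ll by (auto simp: lists_of_def)
  qed auto
  finally show ?thesis by simp
qed

lemma sum_lists_of_1: "(\<Sum>l\<in>lists_of J (Suc 0). F l) = (\<Sum>s\<in>ball J. F [s])"
proof (rule sum.reindex_bij_witness[where j = hd and i = "\<lambda>s. [s]"])
  fix l assume "l \<in> lists_of J (Suc 0)"
  then obtain s where "l = [s]" "s \<in> ball J" by (auto simp: lists_of_def length_Suc_conv)
  then show "[hd l] = l" "hd l \<in> ball J" "F [hd l] = F l" by auto
qed (auto simp: lists_of_def)

lemma seg_Suc:
  assumes g: "g \<in> carrier G"
  shows "seg J Y a (Suc n) g = (\<Sum>s\<in>ball J. Y a s * seg J Y (Suc a) n (inv s \<otimes> g))"
proof -
  have "seg J Y a (Suc n) g = (\<Sum>s\<in>ball J. \<Sum>l\<in>{l \<in> lists_of J n. mprod l = inv (s \<otimes> \<one>) \<otimes> g}. wt Y a ([s] @ l))"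
    unfolding seg_def using sum_over_split_words[OF g, where F = "wt Y a" and m = 1 and n = n and J = J]
    by (simp add: sum_lists_of_1)
  also have "\<dots> = (\<Sum>s\<in>ball J. Y a s * seg J Y (Suc a) n (inv s \<otimes> g))"
    unfolding seg_def by (intro sum.cong refl) (simp add: ballD sum_distrib_left)
  finally show ?thesis .
qed

text \<open>By \<open>rapid_decay\<close>, the square of a bound for the norm of convolution by
  \<open>Y i\<close> on square summable functions.\<close>

definition opc :: "real \<Rightarrow> (nat \<Rightarrow> 'g \<Rightarrow> real) \<Rightarrow> nat \<Rightarrow> real" where
  "opc J Y i = nb (J + C) ^ 3 * (\<Sum>s\<in>ball J. (Y i s)\<^sup>2)"

lemma opc_nonneg: "J \<ge> 0 \<Longrightarrow> opc J Y i \<ge> 0"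
  unfolding opc_def using C by (simp add: nb_nonneg sum_nonneg)

lemma seg_l2:
  assumes J: "J \<ge> 0"
  shows "(\<Sum>g\<in>ball (real n * J). (seg J Y a n g)\<^sup>2) \<le> (\<Prod>i\<in>{a..<a + n}. opc J Y i)"
proof (induction n arbitrary: a)
  case 0
  have "(\<Sum>g\<in>ball 0. (seg J Y a 0 g)\<^sup>2) = (\<Sum>g\<in>{\<one>}. (seg J Y a 0 g)\<^sup>2)"
    by (intro sum.mono_neutral_right) (auto simp: seg_0 one_in_ball)
  then show ?case by (simp add: seg_0)
next
  case (Suc n)
  have "(\<Sum>g\<in>ball (real (Suc n) * J). (seg J Y a (Suc n) g)\<^sup>2) =
     (\<Sum>g\<in>ball (real (Suc n) * J). (\<Sum>s\<in>ball J. Y a s * seg J Y (Suc a) n (inv s \<otimes> g))\<^sup>2)"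
    by (intro sum.cong refl) (simp add: seg_Suc ball_def)
  also have "\<dots> \<le> nb (J + C) ^ 3 * ((\<Sum>s\<in>ball J. (Y a s)\<^sup>2) * (\<Sum>g\<in>ball (real n * J). (seg J Y (Suc a) n g)\<^sup>2))"
    by (rule rapid_decay[OF J]) (auto simp: ball_def seg_outside intro: finite_ball)
  also have "\<dots> = opc J Y a * (\<Sum>g\<in>ball (real n * J). (seg J Y (Suc a) n g)\<^sup>2)"
    by (simp add: opc_def)
  also have "\<dots> \<le> opc J Y a * (\<Prod>i\<in>{Suc a..<Suc a + n}. opc J Y i)"
    by (intro mult_left_mono Suc opc_nonneg J)
  also have "\<dots> = (\<Prod>i\<in>{a..<a + Suc n}. opc J Y i)"
    using prod.atLeast_Suc_lessThan[of a "a + Suc n" "opc J Y"] by simp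
  finally show ?case .
qed

text \<open>An injective substitution does not increase the l2-norm; it will be a translation, an
  inversion or the taking of a power.\<close>

lemma seg_L2_set:
  assumes J: "J \<ge> 0" and U: "finite U" "inj_on \<phi> U"
  shows "L2_set (\<lambda>u. seg J Y a n (\<phi> u)) U \<le> sqrt (\<Prod>i\<in>{a..<a + n}. opc J Y i)"
  unfolding L2_set_def
proof (rule real_sqrt_le_mono)
  have "(\<Sum>u\<in>U. (seg J Y a n (\<phi> u))\<^sup>2) = (\<Sum>g\<in>\<phi> ` U. (seg J Y a n g)\<^sup>2)"
    using U by (simp add: sum.reindex)
  also have "\<dots> = (\<Sum>g\<in>\<phi> ` U \<inter> ball (real n * J). (seg J Y a n g)\<^sup>2)"
    using U by (intro sum.mono_neutral_right) (auto simp: seg_outside)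
  also have "\<dots> \<le> (\<Sum>g\<in>ball (real n * J). (seg J Y a n g)\<^sup>2)"
    by (intro sum_mono2) auto
  also have "\<dots> \<le> (\<Prod>i\<in>{a..<a + n}. opc J Y i)" by (rule seg_l2[OF J])
  finally show "(\<Sum>u\<in>U. (seg J Y a n (\<phi> u))\<^sup>2) \<le> (\<Prod>i\<in>{a..<a + n}. opc J Y i)" .
qed

lemma torsion_free:
  assumes "x \<in> carrier G" "x [^] (m::nat) = \<one>" "m \<ge> 1"
  shows "x = \<one>"
proof (rule ccontr)
  assume x: "x \<noteq> \<one>"
  obtain j :: nat where j: "real j > C / \<epsilon>" using reals_Archimedean2 by blast
  have "x [^] (m * j) = \<one>" using assms by (simp add: nat_pow_pow[symmetric])
  then have "0 \<ge> \<epsilon> * real (m * j) - C" using power_growth[OF assms(1) x, of "m * j"] by (simp add: ell_one)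
  moreover have "\<epsilon> * real j \<le> \<epsilon> * real (m * j)"
    using eps assms(3) by (intro mult_left_mono of_nat_mono) auto
  moreover have "\<epsilon> * real j > C" using j eps by (simp add: field_simps)
  ultimately show False by linarith
qed

lemma torsion_free_int:
  assumes "x \<in> carrier G" "x [^] (j::int) = \<one>" "x \<noteq> \<one>"
  shows "j = 0"
proof (rule ccontr)
  assume "j \<noteq> 0"
  have "x [^] (nat \<bar>j\<bar>) = \<one>"
    using assms(1,2) int_pow_neg[OF assms(1), of j]
    by (cases "j \<ge> 0") (auto simp: int_pow_int[symmetric])
  moreover have "nat \<bar>j\<bar> \<ge> 1" using \<open>j \<noteq> 0\<close> by linarith
  ultimately show False using torsion_free[OF assms(1)] assms(3) by blast
qed

lemma int_pow_cancel:
  assumes "x \<in> carrier G" "x [^] (i::int) = x [^] (j::int)" "x \<noteq> \<one>"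
  shows "i = j"
proof -
  have "x [^] (i - j) = \<one>" using assms by (simp add: int_pow_diff)
  from torsion_free_int[OF assms(1) this assms(3)] show ?thesis by simp
qed

text \<open>Both elements are powers of one \<open>c\<close> of infinite order. This makes the
  taking of powers an admissible substitution in \<open>seg_L2_set\<close>.\<close>

lemma power_inj:
  assumes v: "v \<in> carrier G" and w: "w \<in> carrier G" and m: "m \<ge> 1" and eq: "v [^] (m::nat) = w [^] m"
  shows "v = w"
proof (cases "v [^] m = \<one>")
  case True
  then show ?thesis using torsion_free v w m eq by metis
next
  case False
  obtain c where c: "c \<in> carrier G"
    "\<And>y k. y \<in> carrier G \<Longrightarrow> (k::nat) \<ge> 1 \<Longrightarrow> y [^] k = v [^] m \<Longrightarrow> \<exists>j::int. y = c [^] j"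
    using roots[of "v [^] m"] v False by auto
  obtain i j :: int where ij: "v = c [^] i" "w = c [^] j"
    using c(2)[OF v m refl] c(2)[OF w m eq[symmetric]] by blast
  have "c \<noteq> \<one>" using False ij by auto
  have "c [^] (i * int m) = c [^] (j * int m)"
    using eq c(1) unfolding ij by (simp add: int_pow_pow[symmetric] int_pow_int)
  then show ?thesis using int_pow_cancel[OF c(1) _ \<open>c \<noteq> \<one>\<close>, of "i * int m" "j * int m"] m ij by simp
qed

lemma conj_power:
  assumes "u \<in> carrier G" "v \<in> carrier G" "h \<in> carrier G" "u \<otimes> v = h \<otimes> u"
  shows "u \<otimes> v [^] (k::nat) = h [^] k \<otimes> u"
proof (induction k)
  case (Suc k)
  have "u \<otimes> v [^] Suc k = (u \<otimes> v [^] k) \<otimes> v" using assms by (simp add: m_assoc)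
  also have "\<dots> = h [^] k \<otimes> (h \<otimes> u)" using Suc assms by (simp add: m_assoc)
  finally show ?case using assms by (simp add: m_assoc)
qed (use assms in simp)

text \<open>A word whose product is \<open>h\<^sup>k\<close> is cut at the times when its path passes near \<open>u\<close>, \<open>hu\<close> and
  \<open>h\<^sup>k u\<close>; up to the errors \<open>z\<^sub>1, z\<^sub>2, z\<^sub>3\<close> the four pieces multiply to \<open>u\<close>, \<open>v\<close>, \<open>v\<^sup>k\<^sup>-\<^sup>1\<close> and \<open>u\<^sup>-\<^sup>1\<close>
  for \<open>v = u\<^sup>-\<^sup>1 h u\<close>. Cauchy--Schwarz in \<open>u\<close> and in \<open>v\<close> then involves only l2-norms.\<close>

lemma power_word_cut:
  assumes l: "l \<in> lists_of J n" and lh: "mprod l = h [^] k"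
    and h: "h \<in> carrier G" "h \<noteq> \<one>" "(k::nat) \<ge> 2" and J: "J \<ge> 0"
  defines "r \<equiv> 7 * (J + C + C * real n)"
  obtains u v z1 z2 z3 t1 t2 t3 l1 l2 l3 l4 where
    "t1 \<le> t2" "t2 \<le> t3" "t3 \<le> n" "z1 \<in> ball r" "z2 \<in> ball r" "z3 \<in> ball r"
    "u \<in> ball (real n * J + r)" "v \<in> ball (real n * J + 2 * r)" "v \<noteq> \<one>" "h = u \<otimes> v \<otimes> inv u"
    "l = l1 @ l2 @ l3 @ l4"
    "l1 \<in> lists_of J t1" "mprod l1 = u \<otimes> z1"
    "l2 \<in> lists_of J (t2 - t1)" "mprod l2 = inv z1 \<otimes> (v \<otimes> z2)"
    "l3 \<in> lists_of J (t3 - t2)" "mprod l3 = inv z2 \<otimes> (v [^] (k - 1) \<otimes> z3)"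
    "l4 \<in> lists_of J (n - t3)" "mprod l4 = inv z3 \<otimes> inv u"
proof -
  define p where "p t = mprod (take t l)" for t
  have lc: "set l \<subseteq> carrier G" "set l \<subseteq> ball J" "length l = n" using l by (auto simp: lists_of_def ball_def)
  have sub: "set (take t l) \<subseteq> carrier G" "set (drop t l) \<subseteq> carrier G" for t
    using lc by (auto dest: in_set_takeD in_set_dropD)
  have pc: "p t \<in> carrier G" for t unfolding p_def using sub by (intro mprod_closed)
  have p0: "p 0 = \<one>" "p n = h [^] k" using lc lh by (auto simp: p_def)
  have jump: "d (p t) (p (Suc t)) \<le> J" if "t < n" for t
  proof -
    have t: "l ! t \<in> ball J" using that lc by (auto simp: subset_iff)
    have "p (Suc t) = p t \<otimes> l ! t"
      using that lc sub[of t] t unfolding p_def by (simp add: take_Suc_conv_app_nth mprod_append ball_def)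
    then show ?thesis using t pc[of t] by (simp add: gdist_def ball_def)
  qed
  obtain u t1 t2 t3 where u: "u \<in> carrier G" and t: "t1 \<le> t2" "t2 \<le> t3" "t3 \<le> n"
    and near: "d (p t1) u \<le> r" "d (p t2) (h \<otimes> u) \<le> r" "d (p t3) (h [^] k \<otimes> u) \<le> r"
    unfolding r_def by (rule path_near_power[OF pc p0 h jump J])
  define z1 where "z1 = inv u \<otimes> p t1"
  define z2 where "z2 = inv (h \<otimes> u) \<otimes> p t2"
  define z3 where "z3 = inv (h [^] k \<otimes> u) \<otimes> p t3"
  define v where "v = inv u \<otimes> (h \<otimes> u)"
  have z: "z1 \<in> ball r" "z2 \<in> ball r" "z3 \<in> ball r"
    using near u h pc d_commute[of u "p t1"] d_commute[of "h \<otimes> u" "p t2"] d_commute[of "h [^] k \<otimes> u" "p t3"]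
    by (auto simp: ball_def gdist_def z1_def z2_def z3_def)
  have zc: "z1 \<in> carrier G" "z2 \<in> carrier G" "z3 \<in> carrier G" "v \<in> carrier G"
    using u h pc by (auto simp: z1_def z2_def z3_def v_def)
  have uv: "u \<otimes> v = h \<otimes> u" using u h by (simp add: v_def)
  have p1: "p t1 = u \<otimes> z1" using u pc by (simp add: z1_def)
  have p2: "p t2 = h \<otimes> (u \<otimes> z2)" using u h pc by (simp add: z2_def m_assoc[symmetric])
  have p3: "p t3 = h [^] k \<otimes> (u \<otimes> z3)" using u h pc by (simp add: z3_def m_assoc[symmetric])
  define l1 where "l1 = take t1 l"
  define l2 where "l2 = take (t2 - t1) (drop t1 l)"
  define l3 where "l3 = take (t3 - t2) (drop t2 l)"
  define l4 where "l4 = drop t3 l"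
  have cut: "take t2 l = l1 @ l2" "take t3 l = take t2 l @ l3" "l = take t3 l @ l4"
    using t by (auto simp: l1_def l2_def l3_def l4_def take_add[symmetric])
  have mem: "l1 \<in> lists_of J t1" "l2 \<in> lists_of J (t2 - t1)" "l3 \<in> lists_of J (t3 - t2)" "l4 \<in> lists_of J (n - t3)"
    using lc t by (auto simp: lists_of_def l1_def l2_def l3_def l4_def dest!: in_set_takeD in_set_dropD)
  have mc: "set l1 \<subseteq> carrier G" "set l2 \<subseteq> carrier G" "set l3 \<subseteq> carrier G" "set l4 \<subseteq> carrier G"
    using mem by (auto dest: lists_of_carrier)
  note cl = mprod_closed[OF mc(1)] mprod_closed[OF mc(2)] mprod_closed[OF mc(3)] mprod_closed[OF mc(4)]
  have m1: "mprod l1 = u \<otimes> z1" using p1 by (simp add: p_def l1_def)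
  have e2: "p t1 \<otimes> mprod l2 = p t2"
    unfolding p_def cut(1) using mprod_append[OF mc(1,2)] by (simp add: l1_def)
  have e3: "p t2 \<otimes> mprod l3 = p t3"
    unfolding p_def cut(2) using mprod_append[OF sub(1) mc(3)] by simp
  have e4: "p t3 \<otimes> mprod l4 = h [^] k"
    using mprod_append[OF sub(1)[of t3] mc(4)] cut(3) lh by (simp add: p_def)
  have m2: "mprod l2 = inv z1 \<otimes> (v \<otimes> z2)"
  proof -
    have "p t1 \<otimes> (inv z1 \<otimes> (v \<otimes> z2)) = (u \<otimes> v) \<otimes> z2" using zc u by (simp add: p1 m_assoc)
    also have "\<dots> = p t2" using zc u h by (simp add: uv p2 m_assoc)
    finally have "p t1 \<otimes> mprod l2 = p t1 \<otimes> (inv z1 \<otimes> (v \<otimes> z2))" using e2 by simp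
    then show ?thesis using pc cl zc by simp
  qed
  have m3: "mprod l3 = inv z2 \<otimes> (v [^] (k - 1) \<otimes> z3)"
  proof -
    have "p t2 \<otimes> (inv z2 \<otimes> (v [^] (k - 1) \<otimes> z3)) = h \<otimes> ((u \<otimes> v [^] (k - 1)) \<otimes> z3)"
      using zc u h by (simp add: p2 m_assoc)
    also have "\<dots> = (h \<otimes> h [^] (k - 1)) \<otimes> (u \<otimes> z3)"
      using zc u h by (simp add: conj_power[OF u zc(4) h(1) uv] m_assoc)
    also have "h \<otimes> h [^] (k - 1) = h [^] k" using h nat_pow_Suc2[OF h(1), of "k - 1"] by (metis Suc_diff_1 less_le_trans pos2)
    finally have "p t2 \<otimes> mprod l3 = p t2 \<otimes> (inv z2 \<otimes> (v [^] (k - 1) \<otimes> z3))" using e3 p3 by simp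
    then show ?thesis using pc cl zc by simp
  qed
  have m4: "mprod l4 = inv z3 \<otimes> inv u"
  proof -
    have "p t3 \<otimes> (inv z3 \<otimes> inv u) = h [^] k" using zc u h by (simp add: p3 m_assoc)
    then have "p t3 \<otimes> mprod l4 = p t3 \<otimes> (inv z3 \<otimes> inv u)" using e4 by simp
    then show ?thesis using pc cl zc u by simp
  qed
  have tJ: "real t1 * J \<le> real n * J" "real (t2 - t1) * J \<le> real n * J" using t J by (auto intro!: mult_right_mono)
  have uball: "u \<in> ball (real n * J + r)"
  proof -
    have "u = mprod l1 \<otimes> inv z1" using u zc by (simp add: m1 m_assoc)
    then have "ell u \<le> ell (mprod l1) + ell z1" using ell_mult[OF cl(1), of "inv z1"] zc by (simp add: ell_inv)
    then show ?thesis using ell_mprod[OF mem(1)] ballD(2)[OF z(1)] tJ u by (simp add: ball_def)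
  qed
  have vball: "v \<in> ball (real n * J + 2 * r)"
  proof -
    have "v = z1 \<otimes> (mprod l2 \<otimes> inv z2)" using zc by (simp add: m2 m_assoc)
    then have "ell v \<le> ell z1 + (ell (mprod l2) + ell z2)"
      using ell_mult[of z1 "mprod l2 \<otimes> inv z2"] ell_mult[OF cl(2), of "inv z2"] zc cl by (simp add: ell_inv)
    then show ?thesis using ell_mprod[OF mem(2)] ballD(2)[OF z(1)] ballD(2)[OF z(2)] tJ zc by (simp add: ball_def)
  qed
  have huv: "h = u \<otimes> v \<otimes> inv u" using u h zc by (simp add: uv m_assoc)
  have v1: "v \<noteq> \<one>" using huv u h by auto
  have "l = l1 @ l2 @ l3 @ l4" using cut by simp
  then show ?thesis using that t z uball vball v1 huv mem m1 m2 m3 m4 by blast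
qed

text \<open>For fixed cutting times and errors the double sum factors, as the outer pieces depend on
  \<open>u\<close> and the inner ones on \<open>v\<close>. Cauchy--Schwarz in each variable leaves
  four l2-norms of consecutive segments, whose bounds multiply to one product over all places. Times
  and errors are merely counted.\<close>

lemma sum_powers_le:
  fixes Y :: "nat \<Rightarrow> 'g \<Rightarrow> real" and n :: nat
  assumes Y: "\<And>i s. Y i s \<ge> 0" and J: "J \<ge> 0" and k: "(k::nat) \<ge> 2"
    and H: "finite H" "H \<subseteq> carrier G - {\<one>}"
  defines "r \<equiv> 7 * (J + C + C * real n)"
  shows "(\<Sum>h\<in>H. seg J Y 0 n (h [^] k)) \<le>
    real (n + 1) ^ 3 * real (card (ball r)) ^ 3 * sqrt (\<Prod>i<n. opc J Y i)"
proof -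
  define U where "U = ball (real n * J + r)"
  define V where "V = ball (real n * J + 2 * r) - {\<one>}"
  define TT where "TT = {(t1,t2,t3). t1 \<le> t2 \<and> t2 \<le> t3 \<and> t3 \<le> n}"
  define BB where "BB = ball r \<times> ball r \<times> ball r"
  define Q1 where "Q1 t1 z1 u = {l \<in> lists_of J t1. mprod l = u \<otimes> z1}" for t1 z1 u
  define Q2 where "Q2 t1 t2 z1 z2 v = {l \<in> lists_of J (t2 - t1). mprod l = inv z1 \<otimes> (v \<otimes> z2)}" for t1 t2 z1 z2 v
  define Q3 where "Q3 t2 t3 z2 z3 v = {l \<in> lists_of J (t3 - t2). mprod l = inv z2 \<otimes> (v [^] (k - 1) \<otimes> z3)}" for t2 t3 z2 z3 v
  define Q4 where "Q4 t3 z3 u = {l \<in> lists_of J (n - t3). mprod l = inv z3 \<otimes> inv u}" for t3 z3 u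
  have TTsub: "TT \<subseteq> {0..n} \<times> {0..n} \<times> {0..n}" by (auto simp: TT_def)
  then have finTT: "finite TT" by (rule finite_subset) auto
  have fin: "finite U" "finite V" "finite BB" by (auto simp: U_def V_def BB_def)
  have finQ: "finite (Q1 t1 z1 u)" "finite (Q2 t1 t2 z1 z2 v)" "finite (Q3 t2 t3 z2 z3 v)" "finite (Q4 t3 z3 u)"
    for t1 t2 t3 z1 z2 z3 u v by (auto simp: Q1_def Q2_def Q3_def Q4_def)
  have segQ: "seg J Y 0 t1 (u \<otimes> z1) = sum (wt Y 0) (Q1 t1 z1 u)"
    "seg J Y t1 (t2 - t1) (inv z1 \<otimes> (v \<otimes> z2)) = sum (wt Y t1) (Q2 t1 t2 z1 z2 v)"
    "seg J Y t2 (t3 - t2) (inv z2 \<otimes> (v [^] (k - 1) \<otimes> z3)) = sum (wt Y t2) (Q3 t2 t3 z2 z3 v)"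
    "seg J Y t3 (n - t3) (inv z3 \<otimes> inv u) = sum (wt Y t3) (Q4 t3 z3 u)" for t1 t2 t3 z1 z2 z3 u v
    by (simp_all add: seg_def Q1_def Q2_def Q3_def Q4_def)
  define QQ where "QQ = (\<lambda>((t1,t2,t3),(z1,z2,z3),u,v).
    Q1 t1 z1 u \<times> Q2 t1 t2 z1 z2 v \<times> Q3 t2 t3 z2 z3 v \<times> Q4 t3 z3 u)"
  define \<Theta> where "\<Theta> = TT \<times> BB \<times> U \<times> V"
  define W where "W = (\<lambda>(((t1::nat,t2::nat,t3::nat),(z1::'g,z2::'g,z3::'g),u::'g,v::'g),l1,l2,l3,l4).
     wt Y 0 l1 * (wt Y t1 l2 * (wt Y t2 l3 * wt Y t3 l4)))"
  define I where "I = (\<lambda>(((t1::nat,t2::nat,t3::nat),(z1::'g,z2::'g,z3::'g),u,v),l1::'g list,l2,l3,l4).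
     (u \<otimes> v \<otimes> inv u, l1 @ l2 @ l3 @ l4))"
  define SS where "SS = (SIGMA h:H. {l \<in> lists_of J n. mprod l = h [^] k})"
  define B where "B = real (card (ball r))"
  define S where "S = sqrt (\<Prod>i<n. opc J Y i)"
  have "(\<Sum>h\<in>H. seg J Y 0 n (h [^] k)) = (\<Sum>(h,l)\<in>SS. wt Y 0 l)"
    unfolding seg_def SS_def using H by (subst sum.Sigma) auto
  also have "\<dots> \<le> (\<Sum>q\<in>Sigma \<Theta> QQ. W q)"
  proof (rule sum_le_included[where i = I])
    show "finite SS" using H by (auto simp: SS_def)
    show "finite (Sigma \<Theta> QQ)"
      using finTT fin finQ by (auto simp: \<Theta>_def QQ_def intro!: finite_SigmaI)
    show "\<forall>y\<in>Sigma \<Theta> QQ. 0 \<le> W y" using wt_nonneg[of Y] Y by (auto simp: W_def)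
    show "\<forall>x\<in>SS. \<exists>y\<in>Sigma \<Theta> QQ. I y = x \<and> (case x of (h, l) \<Rightarrow> wt Y 0 l) \<le> W y"
    proof
      fix x assume "x \<in> SS"
      then obtain h l where x: "x = (h, l)" "h \<in> H" "l \<in> lists_of J n" "mprod l = h [^] k"
        by (auto simp: SS_def)
      have h: "h \<in> carrier G" "h \<noteq> \<one>" using x H by auto
      obtain u v z1 z2 z3 t1 t2 t3 l1 l2 l3 l4 where
        t: "t1 \<le> t2" "t2 \<le> t3" "t3 \<le> n" and z: "z1 \<in> ball r" "z2 \<in> ball r" "z3 \<in> ball r"
        and uv: "u \<in> ball (real n * J + r)" "v \<in> ball (real n * J + 2 * r)" "v \<noteq> \<one>" "h = u \<otimes> v \<otimes> inv u"
        and l: "l = l1 @ l2 @ l3 @ l4"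
        and lm: "l1 \<in> lists_of J t1" "mprod l1 = u \<otimes> z1"
        "l2 \<in> lists_of J (t2 - t1)" "mprod l2 = inv z1 \<otimes> (v \<otimes> z2)"
        "l3 \<in> lists_of J (t3 - t2)" "mprod l3 = inv z2 \<otimes> (v [^] (k - 1) \<otimes> z3)"
        "l4 \<in> lists_of J (n - t3)" "mprod l4 = inv z3 \<otimes> inv u"
        unfolding r_def by (rule power_word_cut[OF x(3,4) h k J])
      define q where "q = (((t1,t2,t3),(z1,z2,z3),u,v),l1,l2,l3,l4)"
      have "q \<in> Sigma \<Theta> QQ"
        using t z uv lm by (simp add: q_def \<Theta>_def QQ_def TT_def BB_def U_def V_def Q1_def Q2_def Q3_def Q4_def)
      moreover have "I q = x" by (simp add: I_def q_def x l uv(4)[symmetric])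
      moreover have "wt Y 0 l = W q"
      proof -
        have "length l1 = t1" "length l2 = t2 - t1" "length l3 = t3 - t2" using lm by (auto simp: lists_of_def)
        then show ?thesis using t by (simp add: l W_def q_def wt_append)
      qed
      ultimately show "\<exists>y\<in>Sigma \<Theta> QQ. I y = x \<and> (case x of (h, l) \<Rightarrow> wt Y 0 l) \<le> W y"
        using x by auto
    qed
  qed
  also have "\<dots> = (\<Sum>\<theta>\<in>\<Theta>. \<Sum>q\<in>QQ \<theta>. W (\<theta>, q))"
    using finTT fin finQ by (subst sum.Sigma) (auto simp: \<Theta>_def QQ_def)
  also have "\<dots> = (\<Sum>(t,z,u,v)\<in>\<Theta>. (case (t,z) of ((t1,t2,t3),(z1,z2,z3)) \<Rightarrow>
      seg J Y 0 t1 (u \<otimes> z1) * (seg J Y t1 (t2 - t1) (inv z1 \<otimes> (v \<otimes> z2)) *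
      (seg J Y t2 (t3 - t2) (inv z2 \<otimes> (v [^] (k - 1) \<otimes> z3)) * seg J Y t3 (n - t3) (inv z3 \<otimes> inv u)))))"
    by (intro sum.cong refl) (auto simp: QQ_def W_def sum.cartesian_product' sum_product4 segQ[symmetric])
  also have "\<dots> = (\<Sum>t\<in>TT. \<Sum>z\<in>BB. \<Sum>u\<in>U. \<Sum>v\<in>V. (case (t,z) of ((t1,t2,t3),(z1,z2,z3)) \<Rightarrow>
      seg J Y 0 t1 (u \<otimes> z1) * (seg J Y t1 (t2 - t1) (inv z1 \<otimes> (v \<otimes> z2)) *
      (seg J Y t2 (t3 - t2) (inv z2 \<otimes> (v [^] (k - 1) \<otimes> z3)) * seg J Y t3 (n - t3) (inv z3 \<otimes> inv u)))))"
    unfolding \<Theta>_def by (simp add: sum.cartesian_product')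
  also have "\<dots> \<le> (\<Sum>t\<in>TT. \<Sum>z\<in>BB. S)"
  proof (intro sum_mono)
    fix t z assume "t \<in> TT" "z \<in> BB"
    then obtain t1 t2 t3 z1 z2 z3 where tz: "t = (t1,t2,t3)" "z = (z1,z2,z3)" "t1 \<le> t2" "t2 \<le> t3" "t3 \<le> n"
      "z1 \<in> carrier G" "z2 \<in> carrier G" "z3 \<in> carrier G" by (auto simp: TT_def BB_def ball_def)
    have UV: "u \<in> U \<Longrightarrow> u \<in> carrier G" "u \<in> V \<Longrightarrow> u \<in> carrier G" for u by (auto simp: U_def V_def ball_def)
    define a where "a u = seg J Y 0 t1 (u \<otimes> z1)" for u
    define b where "b v = seg J Y t1 (t2 - t1) (inv z1 \<otimes> (v \<otimes> z2))" for v
    define c where "c v = seg J Y t2 (t3 - t2) (inv z2 \<otimes> (v [^] (k - 1) \<otimes> z3))" for v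
    define e where "e u = seg J Y t3 (n - t3) (inv z3 \<otimes> inv u)" for u
    define P where "P i j = sqrt (\<Prod>i\<in>{i..<j}. opc J Y i)" for i j
    have nn: "a u \<ge> 0" "b u \<ge> 0" "c u \<ge> 0" "e u \<ge> 0" for u
      using seg_nonneg[of Y] Y by (auto simp: a_def b_def c_def e_def)
    have P0: "P i j \<ge> 0" for i j unfolding P_def by (intro real_sqrt_ge_zero prod_nonneg opc_nonneg J)
    have a: "L2_set a U \<le> P 0 t1"
      unfolding a_def P_def using seg_L2_set[OF J fin(1), of "\<lambda>u. u \<otimes> z1" Y 0 t1] tz UV
      by (auto simp: inj_on_def)
    have b: "L2_set b V \<le> P t1 t2"
      unfolding b_def P_def using seg_L2_set[OF J fin(2), of "\<lambda>v. inv z1 \<otimes> (v \<otimes> z2)" Y t1 "t2 - t1"] tz UV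
      by (auto simp: inj_on_def)
    have c: "L2_set c V \<le> P t2 t3"
    proof -
      have "inj_on (\<lambda>v. inv z2 \<otimes> (v [^] (k - 1) \<otimes> z3)) V"
      proof (rule inj_onI)
        fix v w assume "v \<in> V" "w \<in> V" "inv z2 \<otimes> (v [^] (k - 1) \<otimes> z3) = inv z2 \<otimes> (w [^] (k - 1) \<otimes> z3)"
        then have "v [^] (k - 1) = w [^] (k - 1)" using tz UV by simp
        \<comment> \<open>Here \<open>k \<ge> 2\<close> enters, as the exponent \<open>k - 1\<close>
          must be positive.\<close>
        then show "v = w" using UV \<open>v \<in> V\<close> \<open>w \<in> V\<close> k by (intro power_inj[of v w "k - 1"]) auto
      qed
      from seg_L2_set[OF J fin(2) this, of Y t2 "t3 - t2"] show ?thesis using tz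
        unfolding c_def P_def by simp
    qed
    have e: "L2_set e U \<le> P t3 n"
    proof -
      have "inj_on (\<lambda>u. inv z3 \<otimes> inv u) U"
      proof (rule inj_onI)
        fix v w assume vw: "v \<in> U" "w \<in> U" "inv z3 \<otimes> inv v = inv z3 \<otimes> inv w"
        then have "inv v = inv w" using tz UV by simp
        then show "v = w" using UV vw by (metis inv_inv)
      qed
      from seg_L2_set[OF J fin(1) this, of Y t3 "n - t3"] show ?thesis using tz
        unfolding e_def P_def by simp
    qed
    have ae: "(\<Sum>u\<in>U. a u * e u) \<le> P 0 t1 * P t3 n"
      using L2_set_mult_ineq[of a e U] nn mult_mono[OF a e] P0 by (simp add: L2_set_nonneg)
    have bc: "(\<Sum>v\<in>V. b v * c v) \<le> P t1 t2 * P t2 t3"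
      using L2_set_mult_ineq[of b c V] nn mult_mono[OF b c] P0 by (simp add: L2_set_nonneg)
    have "(\<Sum>u\<in>U. \<Sum>v\<in>V. a u * (b v * (c v * e u))) = (\<Sum>u\<in>U. a u * e u) * (\<Sum>v\<in>V. b v * c v)"
      by (simp add: sum_product mult_ac)
    also have "\<dots> \<le> (P 0 t1 * P t3 n) * (P t1 t2 * P t2 t3)"
      using ae bc nn P0 by (intro mult_mono sum_nonneg mult_nonneg_nonneg) auto
    also have "\<dots> = P 0 t1 * P t1 t2 * P t2 t3 * P t3 n" by simp
    also have "\<dots> = P 0 n"
      using tz unfolding P_def by (simp add: real_sqrt_mult[symmetric] prod.atLeastLessThan_concat)
    finally show "(\<Sum>u\<in>U. \<Sum>v\<in>V. (case (t,z) of ((t1,t2,t3),(z1,z2,z3)) \<Rightarrow>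
      seg J Y 0 t1 (u \<otimes> z1) * (seg J Y t1 (t2 - t1) (inv z1 \<otimes> (v \<otimes> z2)) *
      (seg J Y t2 (t3 - t2) (inv z2 \<otimes> (v [^] (k - 1) \<otimes> z3)) * seg J Y t3 (n - t3) (inv z3 \<otimes> inv u))))) \<le> S"
      unfolding tz by (simp add: a_def b_def c_def e_def P_def S_def atLeast0LessThan)
  qed
  also have "\<dots> = real (card TT) * (B ^ 3 * S)"
    by (simp add: BB_def B_def card_cartesian_product power3_eq_cube)
  also have "\<dots> \<le> real (n + 1) ^ 3 * (B ^ 3 * S)"
  proof (intro mult_right_mono mult_nonneg_nonneg)
    have "card TT \<le> card ({0..n} \<times> {0..n} \<times> {0..n})" by (intro card_mono TTsub) auto
    also have "\<dots> = (n + 1) ^ 3" by (simp add: card_cartesian_product power3_eq_cube)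
    finally show "real (card TT) \<le> real (n + 1) ^ 3" by (simp only: of_nat_power[symmetric] of_nat_le_iff)
    show "S \<ge> 0" unfolding S_def by (intro real_sqrt_ge_zero prod_nonneg opc_nonneg J)
  qed (auto simp: B_def)
  finally show ?thesis by (simp add: B_def S_def mult_ac)
qed

end

subsection \<open>Subexponential growth\<close>

context hyp_length
begin

text \<open>All roots of \<open>g\<close> are powers of one \<open>c\<close>. Choosing between
  \<open>c\<close> and its inverse gives a positive exponent \<open>k\<close> and a base
  \<open>h\<close> of which all roots of \<open>g\<close> are powers; so \<open>h\<close> is not a
  proper power and \<open>k\<close> is the \<open>power_exponent\<close>. The number of divisors of
  \<open>k\<close> is estimated by \<open>k\<close> itself.\<close>

lemma root_of:
  assumes g: "g \<in> carrier G" "g \<noteq> \<one>"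
  obtains h k where "h \<in> carrier G" "h \<noteq> \<one>" "(k::nat) \<ge> 1" "g = h [^] k"
    "omega G g \<le> k" "k = 1 \<longrightarrow> omega G g = 1" "real k \<le> (ell g + C) / \<epsilon>"
proof -
  obtain c where c: "c \<in> carrier G"
    "\<And>y k. y \<in> carrier G \<Longrightarrow> (k::nat) \<ge> 1 \<Longrightarrow> y [^] k = g \<Longrightarrow> \<exists>j::int. y = c [^] j"
    using roots[OF g] by blast
  obtain j :: int where j: "g = c [^] j" using c(2)[OF g(1), of 1] g by auto
  have j0: "j \<noteq> 0" using j g by auto
  define h where "h = (if j > 0 then c else inv c)"
  define k where "k = nat \<bar>j\<bar>"
  have h: "h \<in> carrier G" using c by (simp add: h_def)
  have gk: "g = h [^] k"
    using j c(1) int_pow_neg[OF c(1), of j] j0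
    by (cases "j > 0") (auto simp: h_def k_def int_pow_int[symmetric] int_pow_inv)
  have k1: "k \<ge> 1" using j0 by (simp add: k_def)
  have h1: "h \<noteq> \<one>" using gk g by auto
  have rt: "\<exists>i::int. y = h [^] i" if "y \<in> carrier G" "(m::nat) \<ge> 1" "y [^] m = g" for y m
  proof -
    from c(2)[OF that] obtain i :: int where i: "y = c [^] i" by blast
    show ?thesis
    proof (cases "j > 0")
      case False
      have "c [^] i = (inv c) [^] (- i)" using c(1) by (simp add: int_pow_inv int_pow_neg)
      then show ?thesis using i False by (auto simp: h_def)
    qed (use i in \<open>auto simp: h_def\<close>)
  qed
  have npp: "\<not> proper_power G h"
  proof
    assume "proper_power G h"
    then obtain y m where y: "y \<in> carrier G" "(m::nat) \<ge> 2" "h = y [^] m" by (auto simp: proper_power_def)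
    have "y [^] (m * k) = g" using y by (simp add: gk nat_pow_pow)
    moreover have "m * k \<ge> 1" using y k1 by (metis One_nat_def Suc_leI less_le_trans mult_is_0 not_gr_zero not_one_le_zero numeral_2_eq_2 zero_less_Suc)
    ultimately obtain i :: int where i: "y = h [^] i" using rt[OF y(1)] by blast
    have "h [^] (i * int m) = h [^] (1::int)"
      using y(3) h unfolding i by (simp add: int_pow_pow[symmetric] int_pow_int)
    then have "i * int m = 1" using int_pow_cancel[OF h _ h1] by blast
    then have "int m dvd 1" by (metis dvd_triv_right)
    then show False using y(2) by simp
  qed
  have "power_exponent G g = k"
    unfolding power_exponent_def
  proof (rule the_equality)
    show "1 \<le> k \<and> (\<exists>\<gamma>0\<in>carrier G. \<not> proper_power G \<gamma>0 \<and> g = \<gamma>0 [^] k)" using k1 h npp gk by blast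
  next
    fix m :: nat assume "1 \<le> m \<and> (\<exists>\<gamma>0\<in>carrier G. \<not> proper_power G \<gamma>0 \<and> g = \<gamma>0 [^] m)"
    then obtain y where y: "m \<ge> 1" "y \<in> carrier G" "\<not> proper_power G y" "g = y [^] m" by blast
    obtain i :: int where i: "y = h [^] i" using rt[OF y(2,1)] y(4) by auto
    have "h [^] (i * int m) = h [^] (int k)"
      using y(4) gk h unfolding i by (simp add: int_pow_pow[symmetric] int_pow_int)
    then have im: "i * int m = int k" using int_pow_cancel[OF h _ h1] by blast
    then have "i > 0" using k1 y(1) by (smt (verit) mult_nonneg_nonneg of_nat_0_le_iff of_nat_1 of_nat_mono mult_nonpos_nonneg)
    moreover have "\<not> i \<ge> 2"
    proof
      assume "i \<ge> 2"
      then have "y = h [^] nat i" "nat i \<ge> 2" using i by (auto simp: int_pow_int[symmetric])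
      then show False using y(3) h unfolding proper_power_def by blast
    qed
    ultimately have "i = 1" by simp
    then show "m = k" using im by simp
  qed
  then have om: "omega G g = card {d. d dvd k}" using g by (simp add: omega_def)
  have "{d. d dvd k} \<subseteq> {1..k}" using k1 by (auto dest: dvd_imp_le intro: Suc_leI dvd_pos_nat)
  then have "card {d. d dvd k} \<le> k" using card_mono[of "{1..k}"] by simp
  moreover have "k = 1 \<longrightarrow> omega G g = 1" using om by simp
  moreover have "real k \<le> (ell g + C) / \<epsilon>"
    using power_growth[OF h h1, of k] eps unfolding gk[symmetric] by (simp add: field_simps)
  ultimately show ?thesis using that h h1 k1 gk om by metis
qed

end

section \<open>Powers of a group algebra element and their l2-norms\<close>

locale hyp_length_element = hyp_length G ell C \<epsilon> for G (structure) and ell :: "'g \<Rightarrow> real" and C \<epsilon> +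
  fixes x :: "'g \<Rightarrow> complex" and R :: real
  assumes x: "x \<in> carrier (group_algebra G)" and R: "R \<ge> 1" "supp x \<subseteq> ball R"
begin

text \<open>Coefficients of the powers of \<open>x\<close>, expanded over words so that they can be
  regrouped into blocks of any lengths.\<close>

definition cseg :: "nat \<Rightarrow> 'g \<Rightarrow> complex" where
  "cseg n g = (\<Sum>l\<in>{l \<in> lists_of R n. mprod l = g}. prod_list (map x l))"

lemma cseg_outside:
  assumes "g \<notin> ball (real n * R)" shows "cseg n g = 0"
proof -
  have "mprod l \<in> ball (real n * R)" if "l \<in> lists_of R n" for l
    using ell_mprod[OF that] lists_of_carrier[OF that] by (simp add: ball_def mprod_closed)
  then have e: "{l \<in> lists_of R n. mprod l = g} = {}" using assms by auto
  show ?thesis unfolding cseg_def e by simp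
qed

lemma cseg_0: "cseg 0 g = (if g = \<one> then 1 else 0)"
proof -
  have "{l \<in> lists_of R 0. mprod l = g} = (if g = \<one> then {[]} else {})" by auto
  then show ?thesis by (simp add: cseg_def)
qed

lemma cseg_1: "cseg 1 g = x g"
proof (cases "g \<in> ball R")
  case True
  then have "{l \<in> lists_of R 1. mprod l = g} = {[g]}"
    by (auto simp: lists_of_def ball_def length_Suc_conv)
  then show ?thesis by (simp add: cseg_def)
next
  case False
  then have "g \<notin> supp x" using R by blast
  then show ?thesis using cseg_outside[of g 1] False by (simp add: supp_def)
qed

lemma cseg_add:
  assumes g: "g \<in> carrier G"
  shows "cseg (m + n) g = (\<Sum>s\<in>ball (real m * R). cseg m s * cseg n (inv s \<otimes> g))"
proof -
  have "cseg (m + n) g = (\<Sum>l\<in>lists_of R m. prod_list (map x l) * cseg n (inv (mprod l) \<otimes> g))"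
  proof -
    have "cseg (m + n) g = (\<Sum>l\<in>lists_of R m. \<Sum>l'\<in>{l' \<in> lists_of R n. mprod l' = inv (mprod l) \<otimes> g}. prod_list (map x (l @ l')))"
      unfolding cseg_def by (rule sum_over_split_words[OF g])
    then show ?thesis by (simp add: cseg_def sum_distrib_left)
  qed
  also have "\<dots> = (\<Sum>s\<in>ball (real m * R). \<Sum>l\<in>{l \<in> lists_of R m. mprod l = s}. prod_list (map x l) * cseg n (inv (mprod l) \<otimes> g))"
  proof (rule sum.group[symmetric])
    show "mprod ` lists_of R m \<subseteq> ball (real m * R)"
      using ell_mprod by (auto simp: ball_def intro!: mprod_closed dest: lists_of_carrier[THEN subsetD])
  qed auto
  also have "\<dots> = (\<Sum>s\<in>ball (real m * R). cseg m s * cseg n (inv s \<otimes> g))"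
    by (intro sum.cong refl) (simp add: cseg_def sum_distrib_right)
  finally show ?thesis .
qed

abbreviation "A \<equiv> group_algebra G"

lemma power_eq_cseg: "x [^]\<^bsub>A\<^esub> n = cseg n"
proof (induction n)
  case 0
  show ?case by (auto simp: group_algebra_def cseg_0 nat_pow_def)
next
  case (Suc n)
  have "x [^]\<^bsub>A\<^esub> Suc n = cseg n \<otimes>\<^bsub>A\<^esub> x" using Suc by (simp add: nat_pow_def)
  also have "\<dots> = cseg (Suc n)"
  proof
    fix g
    have sn: "supp (cseg n) \<subseteq> ball (real n * R)" using cseg_outside by (force simp: supp_def)
    have sx: "supp x \<subseteq> carrier G" using x by (simp add: group_algebra_def)
    have eq: "(cseg n \<otimes>\<^bsub>A\<^esub> x) g = (\<Sum>(a, b) | a \<in> supp (cseg n) \<and> b \<in> supp x \<and> a \<otimes> b = g. cseg n a * x b)"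
      by (simp add: group_algebra_def)
    show "(cseg n \<otimes>\<^bsub>A\<^esub> x) g = cseg (Suc n) g"
    proof (cases "g \<in> carrier G")
      case True
      let ?S = "{a \<in> supp (cseg n). inv a \<otimes> g \<in> supp x}"
      have "(cseg n \<otimes>\<^bsub>A\<^esub> x) g = (\<Sum>a\<in>?S. cseg n a * x (inv a \<otimes> g))"
        unfolding eq
      proof (rule sum.reindex_bij_witness[where j = fst and i = "\<lambda>a. (a, inv a \<otimes> g)"])
        fix p assume "p \<in> {(a, b). a \<in> supp (cseg n) \<and> b \<in> supp x \<and> a \<otimes> b = g}"
        then obtain a b where p: "p = (a, b)" "a \<in> supp (cseg n)" "b \<in> supp x" "a \<otimes> b = g" by auto
        have "a \<in> carrier G" "b \<in> carrier G" using p sn sx by (auto simp: ball_def)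
        then have "inv a \<otimes> g = b" using p by auto
        then show "(fst p, inv (fst p) \<otimes> g) = p" "fst p \<in> ?S"
          "cseg n (fst p) * x (inv (fst p) \<otimes> g) = (case p of (a, b) \<Rightarrow> cseg n a * x b)"
          using p by auto
      next
        fix a assume "a \<in> ?S"
        moreover from this have "a \<in> carrier G" using sn by (auto simp: ball_def)
        ultimately show "(a, inv a \<otimes> g) \<in> {(a, b). a \<in> supp (cseg n) \<and> b \<in> supp x \<and> a \<otimes> b = g}"
          using True by auto
      qed auto
      also have "\<dots> = (\<Sum>a\<in>ball (real n * R). cseg n a * x (inv a \<otimes> g))"
        using sn by (intro sum.mono_neutral_left) (auto simp: supp_def)
      also have "\<dots> = cseg (Suc n) g" using cseg_add[OF True, of n 1] cseg_1 by simp
      finally show ?thesis .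
    next
      case False
      have e: "{(a, b). a \<in> supp (cseg n) \<and> b \<in> supp x \<and> a \<otimes> b = g} = {}"
        using False sn sx by (auto simp: ball_def)
      have "(cseg n \<otimes>\<^bsub>A\<^esub> x) g = 0" unfolding eq e by (rule sum.empty)
      then show ?thesis using cseg_outside[of g "Suc n"] False by (simp add: ball_def)
    qed
  qed
  finally show ?case .
qed

definition nrm :: "nat \<Rightarrow> real" where "nrm n = (\<Sum>g\<in>ball (real n * R). (cmod (cseg n g))\<^sup>2)"

lemma nrm_nonneg: "nrm n \<ge> 0" unfolding nrm_def by (intro sum_nonneg) simp

lemma l2_cseg: "cseg n \<in> l2_space G" "l2_norm G (cseg n) = sqrt (nrm n)"
proof -
  have *: "((\<lambda>h. (cmod (cseg n h))\<^sup>2) has_sum nrm n) (carrier G)"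
  proof (rule has_sum_cong_neutral[THEN iffD1])
    show "((\<lambda>h. (cmod (cseg n h))\<^sup>2) has_sum nrm n) (ball (real n * R))"
      unfolding nrm_def by (rule has_sum_finite) simp
    show "\<And>x. x \<in> carrier G - ball (real n * R) \<Longrightarrow> (cmod (cseg n x))\<^sup>2 = 0" using cseg_outside by simp
    show "\<And>x. x \<in> ball (real n * R) - carrier G \<Longrightarrow> (cmod (cseg n x))\<^sup>2 = 0" by (auto simp: ball_def)
  qed simp
  have "supp (cseg n) \<subseteq> carrier G" using cseg_outside by (force simp: supp_def ball_def)
  then show "cseg n \<in> l2_space G" using * by (auto simp: l2_space_def summable_on_def)
  show "l2_norm G (cseg n) = sqrt (nrm n)" using * by (simp add: l2_norm_def infsumI)
qed

lemma left_regular_cseg: "left_regular G x (cseg n) = cseg (Suc n)"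
proof
  fix g
  show "left_regular G x (cseg n) g = cseg (Suc n) g"
  proof (cases "g \<in> carrier G")
    case True
    have "cseg (Suc n) g = (\<Sum>s\<in>ball R. x s * cseg n (inv s \<otimes> g))"
      using cseg_add[OF True, of 1 n] cseg_1 by simp
    also have "\<dots> = (\<Sum>s\<in>supp x. x s * cseg n (inv s \<otimes> g))"
      using R(2) by (intro sum.mono_neutral_right) (auto simp: supp_def)
    finally show ?thesis using True by (simp add: left_regular_def)
  next
    case False
    then show ?thesis using cseg_outside[of g "Suc n"] by (simp add: left_regular_def ball_def)
  qed
qed

text \<open>A crude Cauchy--Schwarz bound. It ensures that the set whose supremum is
  \<open>l2_opnorm\<close> is bounded above, without which the supremum would say nothing about its
  members.\<close>

lemma left_regular_bounded:
  assumes "\<xi> \<in> l2_space G"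
  shows "l2_norm G (left_regular G x \<xi>) \<le> sqrt ((\<Sum>s\<in>supp x. (cmod (x s))\<^sup>2) * real (card (supp x))) * l2_norm G \<xi>"
proof -
  let ?X = "\<Sum>s\<in>supp x. (cmod (x s))\<^sup>2"
  have sx: "supp x \<subseteq> carrier G" "finite (supp x)" using x by (simp_all add: group_algebra_def)
  have sm: "(\<lambda>h. (cmod (\<xi> h))\<^sup>2) summable_on carrier G" using assms by (simp add: l2_space_def)
  define N where "N = (\<Sum>\<^sub>\<infinity>h\<in>carrier G. (cmod (\<xi> h))\<^sup>2)"
  have bij: "bij_betw (\<lambda>h. inv s \<otimes> h) (carrier G) (carrier G)" if "s \<in> carrier G" for s
    by (rule bij_betw_byWitness[where f' = "\<lambda>h. s \<otimes> h"]) (use that in auto)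
  have shift: "(\<lambda>h. (cmod (\<xi> (inv s \<otimes> h)))\<^sup>2) summable_on carrier G"
    "(\<Sum>\<^sub>\<infinity>h\<in>carrier G. (cmod (\<xi> (inv s \<otimes> h)))\<^sup>2) = N" if "s \<in> supp x" for s
    using summable_on_reindex_bij_betw[OF bij, of s "\<lambda>h. (cmod (\<xi> h))\<^sup>2"] sm that sx
      infsum_reindex_bij_betw[OF bij, of s "\<lambda>h. (cmod (\<xi> h))\<^sup>2"] by (auto simp: N_def)
  define B where "B h = ?X * (\<Sum>s\<in>supp x. (cmod (\<xi> (inv s \<otimes> h)))\<^sup>2)" for h
  have Bs: "B summable_on carrier G" "(\<Sum>\<^sub>\<infinity>h\<in>carrier G. B h) = ?X * (real (card (supp x)) * N)"
  proof -
    have "((\<lambda>h. \<Sum>s\<in>supp x. (cmod (\<xi> (inv s \<otimes> h)))\<^sup>2) has_sum (\<Sum>s\<in>supp x. N)) (carrier G)"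
    proof -
      have "((\<lambda>h. \<Sum>s\<in>F. (cmod (\<xi> (inv s \<otimes> h)))\<^sup>2) has_sum (\<Sum>s\<in>F. N)) (carrier G)"
        if "finite F" "F \<subseteq> supp x" for F
        using that
      proof (induction F)
        case (insert s F)
        have "((\<lambda>h. (cmod (\<xi> (inv s \<otimes> h)))\<^sup>2) has_sum N) (carrier G)"
          using shift[of s] insert.prems by (metis has_sum_infsum insert_subset)
        moreover have "((\<lambda>h. \<Sum>s\<in>F. (cmod (\<xi> (inv s \<otimes> h)))\<^sup>2) has_sum (\<Sum>s\<in>F. N)) (carrier G)"
          by (rule insert.IH) (use insert.prems in auto)
        ultimately show ?case unfolding sum.insert[OF insert.hyps] by (rule has_sum_add)
      qed simp
      then show ?thesis using sx(2) by blast
    qed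
    then have "(B has_sum ?X * (\<Sum>s\<in>supp x. N)) (carrier G)" unfolding B_def by (rule has_sum_cmult_right)
    then show "B summable_on carrier G" "(\<Sum>\<^sub>\<infinity>h\<in>carrier G. B h) = ?X * (real (card (supp x)) * N)"
      by (auto simp: summable_on_def infsumI)
  qed
  have le: "(cmod (left_regular G x \<xi> h))\<^sup>2 \<le> B h" if "h \<in> carrier G" for h
  proof -
    have "cmod (left_regular G x \<xi> h) \<le> (\<Sum>s\<in>supp x. cmod (x s) * cmod (\<xi> (inv s \<otimes> h)))"
      using that norm_sum[of "\<lambda>s. x s * \<xi> (inv s \<otimes> h)" "supp x"] by (simp add: left_regular_def norm_mult)
    then have "(cmod (left_regular G x \<xi> h))\<^sup>2 \<le> (\<Sum>s\<in>supp x. cmod (x s) * cmod (\<xi> (inv s \<otimes> h)))\<^sup>2"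
      by (intro power_mono) auto
    also have "\<dots> \<le> B h" unfolding B_def by (rule Cauchy_Schwarz_ineq_sum)
    finally show ?thesis .
  qed
  have "(\<Sum>\<^sub>\<infinity>h\<in>carrier G. (cmod (left_regular G x \<xi> h))\<^sup>2) \<le> (\<Sum>\<^sub>\<infinity>h\<in>carrier G. B h)"
    by (intro infsum_mono summable_on_comparison_test[OF Bs(1)] Bs(1)) (use le in auto)
  then have "l2_norm G (left_regular G x \<xi>) \<le> sqrt (?X * (real (card (supp x)) * N))"
    unfolding l2_norm_def Bs(2) by (rule real_sqrt_le_mono)
  also have "\<dots> = sqrt (?X * real (card (supp x))) * l2_norm G \<xi>"
    by (simp add: l2_norm_def N_def real_sqrt_mult)
  finally show ?thesis .
qed

definition op :: real where "op = l2_opnorm G (left_regular G x)"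

lemma op_bound:
  assumes "\<xi> \<in> l2_space G" "l2_norm G \<xi> \<le> 1"
  shows "l2_norm G (left_regular G x \<xi>) \<le> op"
  unfolding op_def l2_opnorm_def
proof (rule cSUP_upper)
  let ?K = "sqrt ((\<Sum>s\<in>supp x. (cmod (x s))\<^sup>2) * real (card (supp x)))"
  have "?K \<ge> 0" by (simp add: sum_nonneg)
  show "bdd_above ((\<lambda>\<xi>. l2_norm G (left_regular G x \<xi>)) ` {\<xi> \<in> l2_space G. l2_norm G \<xi> \<le> 1})"
  proof (rule bdd_aboveI2)
    fix \<xi> assume "\<xi> \<in> {\<xi> \<in> l2_space G. l2_norm G \<xi> \<le> 1}"
    then show "l2_norm G (left_regular G x \<xi>) \<le> ?K"
      using left_regular_bounded[of \<xi>] mult_left_mono[OF _ \<open>?K \<ge> 0\<close>, of "l2_norm G \<xi>" 1] by auto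
  qed
qed (use assms in simp)

lemma nrm_0: "nrm 0 = 1"
proof -
  have "nrm 0 = (\<Sum>g\<in>{\<one>}. (cmod (cseg 0 g))\<^sup>2)"
    unfolding nrm_def by (rule sum.mono_neutral_right) (auto simp: cseg_0 one_in_ball)
  then show ?thesis by (simp add: cseg_0)
qed

lemma op_nonneg: "op \<ge> 0"
proof -
  have "l2_norm G (left_regular G x (cseg 0)) \<le> op"
    by (rule op_bound) (simp_all add: l2_cseg nrm_0)
  moreover have "l2_norm G (left_regular G x (cseg 0)) \<ge> 0"
    unfolding left_regular_cseg by (simp add: l2_cseg nrm_nonneg)
  ultimately show ?thesis by simp
qed

text \<open>\<open>cseg n\<close> is the image of the unit vector at \<open>\<one>\<close> under the
  \<open>n\<close>-th iterate of the operator, and \<open>sqrt (nrm n)\<close> is its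
  l2-norm.\<close>

lemma nrm_le: "sqrt (nrm n) \<le> op ^ n"
proof (induction n)
  case 0
  show ?case by (simp add: nrm_0)
next
  case (Suc n)
  have "sqrt (nrm (Suc n)) \<le> op * sqrt (nrm n)"
  proof (cases "nrm n = 0")
    \<comment> \<open>Normalisation is impossible here, but the vector is 0 and so is its
      image.\<close>
    case True
    have z: "cseg n g = 0" for g
    proof (cases "g \<in> ball (real n * R)")
      case g: True
      from True have "\<forall>g\<in>ball (real n * R). (cmod (cseg n g))\<^sup>2 = 0"
        unfolding nrm_def by (subst (asm) sum_nonneg_eq_0_iff) auto
      then show ?thesis using g by simp
    qed (simp add: cseg_outside)
    have "cseg (Suc n) g = 0" for g
      unfolding left_regular_cseg[symmetric] by (simp add: left_regular_def z)
    then show ?thesis using True by (simp add: nrm_def)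
  next
    case False
    then have pos: "sqrt (nrm n) > 0" using nrm_nonneg[of n] by simp
    define c where "c = 1 / sqrt (nrm n)"
    define \<xi> where "\<xi> = (\<lambda>g. complex_of_real c * cseg n g)"
    have scale: "l2_norm G (\<lambda>g. complex_of_real c * f g) = c * l2_norm G f" for f
    proof -
      have "(cmod (complex_of_real c * f h))\<^sup>2 = c\<^sup>2 * (cmod (f h))\<^sup>2" for h
        by (simp add: norm_mult power_mult_distrib)
      then show ?thesis using pos by (simp add: l2_norm_def infsum_cmult_right' real_sqrt_mult c_def)
    qed
    have "\<xi> \<in> l2_space G"
    proof -
      have "supp (cseg n) \<subseteq> carrier G" "(\<lambda>h. (cmod (cseg n h))\<^sup>2) summable_on carrier G"
        using l2_cseg(1)[of n] by (auto simp: l2_space_def)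
      moreover have "(\<lambda>h. (cmod (\<xi> h))\<^sup>2) = (\<lambda>h. c\<^sup>2 * (cmod (cseg n h))\<^sup>2)"
        by (simp add: \<xi>_def norm_mult power_mult_distrib)
      ultimately show ?thesis
        by (auto simp: l2_space_def \<xi>_def supp_def intro: summable_on_cmult_right)
    qed
    moreover have "l2_norm G \<xi> \<le> 1" unfolding \<xi>_def scale l2_cseg using pos by (simp add: c_def)
    ultimately have "l2_norm G (left_regular G x \<xi>) \<le> op" by (rule op_bound)
    moreover have "left_regular G x \<xi> = (\<lambda>g. complex_of_real c * cseg (Suc n) g)"
      unfolding left_regular_cseg[symmetric] by (auto simp: left_regular_def \<xi>_def sum_distrib_left mult_ac)
    ultimately have "c * sqrt (nrm (Suc n)) \<le> op" using scale l2_cseg by simp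
    then show ?thesis using pos by (simp add: c_def field_simps)
  qed
  also have "\<dots> \<le> op * op ^ n" by (intro mult_left_mono Suc op_nonneg)
  finally show ?case by simp
qed

text \<open>Grouping the letters of a word into blocks makes all coefficients nonnegative without losing
  more than the rapid decay constant per block.\<close>

lemma cseg_le_seg:
  assumes q: "\<And>i. real (q i) * R \<le> J"
  shows "g \<in> carrier G \<Longrightarrow> cmod (cseg (\<Sum>i\<in>{a..<a + N}. q i) g) \<le> seg J (\<lambda>i s. cmod (cseg (q i) s)) a N g"
proof (induction N arbitrary: a g)
  case 0
  then show ?case by (simp add: cseg_0 seg_0)
next
  case (Suc N)
  let ?Y = "\<lambda>i s. cmod (cseg (q i) s)"
  have "(\<Sum>i\<in>{a..<a + Suc N}. q i) = q a + (\<Sum>i\<in>{Suc a..<Suc a + N}. q i)"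
    using sum.atLeast_Suc_lessThan[of a "a + Suc N" q] by simp
  then have "cmod (cseg (\<Sum>i\<in>{a..<a + Suc N}. q i) g) =
     cmod (\<Sum>s\<in>ball (real (q a) * R). cseg (q a) s * cseg (\<Sum>i\<in>{Suc a..<Suc a + N}. q i) (inv s \<otimes> g))"
    using cseg_add[OF Suc.prems] by simp
  also have "\<dots> \<le> (\<Sum>s\<in>ball (real (q a) * R). ?Y a s * cmod (cseg (\<Sum>i\<in>{Suc a..<Suc a + N}. q i) (inv s \<otimes> g)))"
    by (rule order_trans[OF norm_sum]) (simp add: norm_mult)
  also have "\<dots> \<le> (\<Sum>s\<in>ball (real (q a) * R). ?Y a s * seg J ?Y (Suc a) N (inv s \<otimes> g))"
    using Suc.prems by (intro sum_mono mult_left_mono Suc.IH) (auto simp: ball_def)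
  also have "\<dots> \<le> (\<Sum>s\<in>ball J. ?Y a s * seg J ?Y (Suc a) N (inv s \<otimes> g))"
    using q by (intro sum_mono2 ball_mono) (auto intro!: mult_nonneg_nonneg seg_nonneg)
  also have "\<dots> = seg J ?Y a (Suc N) g" using seg_Suc[OF Suc.prems] by simp
  finally show ?case .
qed

text \<open>The identity contributes at most the l2-norm of the power. A proper power is
  \<open>h\<^sup>k\<close> with \<open>2 \<le> k \<le> M\<close>, as its length bounds
  \<open>k\<close>; one factor \<open>M + 1\<close> counts the exponents and the other bounds
  \<open>\<bar>\<omega> - 1\<bar>\<close>.\<close>

lemma u1_cseg_bound:
  assumes p: "p = (\<Sum>i<N. q i)" and q: "\<And>i. real (q i) * R \<le> J" and J: "J \<ge> 1"
  defines "M \<equiv> (real p * R + C) / \<epsilon>" and "r \<equiv> 7 * (J + C + C * real N)"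
  shows "cmod (u1 G (cseg p)) \<le>
     (1 + (M + 1)\<^sup>2 * (real (N + 1) ^ 3 * real (card (ball r)) ^ 3 * sqrt (nb (J + C) ^ (3 * N)))) * op ^ p"
proof -
  let ?Y = "\<lambda>i s. cmod (cseg (q i) s)"
  have sp: "supp (cseg p) \<subseteq> ball (real p * R)" using cseg_outside by (force simp: supp_def)
  then have fin: "finite (supp (cseg p))" by (rule finite_subset) simp
  define S where "S = supp (cseg p) - {\<one>}"
  have Sc: "g \<in> carrier G" "g \<noteq> \<one>" "ell g \<le> real p * R" if "g \<in> S" for g
    using that sp by (auto simp: S_def ball_def)
  have "\<forall>g\<in>S. \<exists>hk. fst hk \<in> carrier G \<and> fst hk \<noteq> \<one> \<and> snd hk \<ge> 1 \<and> g = fst hk [^] (snd hk :: nat) \<and>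
      omega G g \<le> snd hk \<and> (snd hk = 1 \<longrightarrow> omega G g = 1) \<and> real (snd hk) \<le> (ell g + C) / \<epsilon>"
  proof
    fix g assume "g \<in> S"
    then obtain h and k :: nat where hk: "h \<in> carrier G" "h \<noteq> \<one>" "k \<ge> 1" "g = h [^] k"
      "omega G g \<le> k" "k = 1 \<longrightarrow> omega G g = 1" "real k \<le> (ell g + C) / \<epsilon>"
      using root_of[OF Sc(1,2)] by metis
    then show "\<exists>hk. fst hk \<in> carrier G \<and> fst hk \<noteq> \<one> \<and> snd hk \<ge> 1 \<and> g = fst hk [^] (snd hk :: nat) \<and>
      omega G g \<le> snd hk \<and> (snd hk = 1 \<longrightarrow> omega G g = 1) \<and> real (snd hk) \<le> (ell g + C) / \<epsilon>"
      by (intro exI[of _ "(h, k)"]) (simp only: fst_conv snd_conv simp_thms)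
  qed
  from bchoice[OF this] obtain hk where hk: "\<forall>g\<in>S. fst (hk g) \<in> carrier G \<and> fst (hk g) \<noteq> \<one> \<and> snd (hk g) \<ge> 1 \<and>
      g = fst (hk g) [^] (snd (hk g) :: nat) \<and> omega G g \<le> snd (hk g) \<and> (snd (hk g) = 1 \<longrightarrow> omega G g = 1) \<and>
      real (snd (hk g)) \<le> (ell g + C) / \<epsilon>" ..
  define rt where "rt g = fst (hk g)" for g
  define ex where "ex g = snd (hk g)" for g
  have rt: "\<And>g. g \<in> S \<Longrightarrow> rt g \<in> carrier G \<and> rt g \<noteq> \<one> \<and> ex g \<ge> 1 \<and> g = rt g [^] (ex g :: nat) \<and>
      omega G g \<le> ex g \<and> (ex g = 1 \<longrightarrow> omega G g = 1) \<and> real (ex g) \<le> (ell g + C) / \<epsilon>"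
    using hk unfolding rt_def ex_def by blast
  define m where "m = nat \<lfloor>M\<rfloor>"
  define H where "H = rt ` S"
  have M0: "M \<ge> 0" using R C eps by (simp add: M_def)
  have exm: "ex g \<le> m" if "g \<in> S" for g
  proof -
    have "real (ex g) \<le> (ell g + C) / \<epsilon>" using rt[OF that] by blast
    also have "\<dots> \<le> M" unfolding M_def using Sc(3)[OF that] eps by (intro divide_right_mono) auto
    finally show ?thesis by (simp add: m_def le_nat_floor)
  qed
  have H: "finite H" "H \<subseteq> carrier G - {\<one>}" using fin rt by (auto simp: H_def S_def)
  define w where "w g = cmod (complex_of_nat (omega G g) - 1)" for g
  have u1: "cmod (u1 G (cseg p)) \<le> (\<Sum>g\<in>supp (cseg p). cmod (cseg p g) * w g)"
    unfolding u1_def w_def by (rule order_trans[OF norm_sum]) (simp add: norm_mult)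
  also have "\<dots> \<le> (\<Sum>g\<in>insert \<one> S. cmod (cseg p g) * w g)"
    using fin by (intro sum_mono2) (auto simp: S_def w_def)
  also have "\<dots> = cmod (cseg p \<one>) * w \<one> + (\<Sum>g\<in>S. cmod (cseg p g) * w g)"
    using fin by (subst sum.insert) (auto simp: S_def)
  also have "w \<one> = 1" by (simp add: w_def omega_def)
  finally have 1: "cmod (u1 G (cseg p)) \<le> cmod (cseg p \<one>) + (\<Sum>g\<in>S. cmod (cseg p g) * w g)" by simp
  have one: "cmod (cseg p \<one>) \<le> op ^ p"
  proof -
    have "(cmod (cseg p \<one>))\<^sup>2 \<le> nrm p"
      unfolding nrm_def using R by (intro member_le_sum) (auto simp: one_in_ball)
    then have "cmod (cseg p \<one>) \<le> sqrt (nrm p)" by (rule real_le_rsqrt)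
    with nrm_le show ?thesis by (rule order_trans[rotated])
  qed
  define T where "T = real (N + 1) ^ 3 * real (card (ball r)) ^ 3 * sqrt (\<Prod>i<N. opc J ?Y i)"
  have T0: "T \<ge> 0" unfolding T_def using J
    by (intro mult_nonneg_nonneg real_sqrt_ge_zero prod_nonneg opc_nonneg) auto
  have "(\<Sum>g\<in>S. cmod (cseg p g) * w g) = (\<Sum>g\<in>{g\<in>S. ex g \<ge> 2}. cmod (cseg p g) * w g)"
  proof (rule sum.mono_neutral_right)
    show "\<forall>i\<in>S - {g \<in> S. 2 \<le> ex g}. cmod (cseg p i) * w i = 0"
    proof
      fix g assume g: "g \<in> S - {g \<in> S. 2 \<le> ex g}"
      then have "ex g = 1" using rt[of g] by force
      then show "cmod (cseg p g) * w g = 0" using rt[of g] g by (simp add: w_def)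
    qed
  qed (use fin in \<open>auto simp: S_def\<close>)
  also have "\<dots> \<le> (\<Sum>(k,h)\<in>{2..m} \<times> H. seg J ?Y 0 N (h [^] k) * (M + 1))"
  proof (rule sum_le_included[where i = "\<lambda>(k,h). h [^] k"])
    show "\<forall>y\<in>{2..m} \<times> H. 0 \<le> (case y of (k,h) \<Rightarrow> seg J ?Y 0 N (h [^] k) * (M + 1))"
      using M0 by (auto intro!: mult_nonneg_nonneg seg_nonneg)
    show "\<forall>g\<in>{g \<in> S. 2 \<le> ex g}. \<exists>y\<in>{2..m} \<times> H. (case y of (k, h) \<Rightarrow> h [^] k) = g \<and>
        cmod (cseg p g) * w g \<le> (case y of (k,h) \<Rightarrow> seg J ?Y 0 N (h [^] k) * (M + 1))"
    proof
      fix g assume g: "g \<in> {g \<in> S. 2 \<le> ex g}"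
      then have gS: "g \<in> S" by simp
      have "cmod (cseg p g) \<le> seg J ?Y 0 N g"
        using cseg_le_seg[OF q Sc(1)[OF gS], where a = 0 and N = N] p by (simp add: atLeast0LessThan)
      moreover have "w g \<le> M + 1"
      proof -
        have "w g \<le> real (omega G g) + 1" unfolding w_def
          using norm_triangle_ineq4[of "complex_of_nat (omega G g)" 1] by simp
        also have "\<dots> \<le> real m + 1" using rt[OF gS] exm[OF gS] by simp
        also have "\<dots> \<le> M + 1" using M0 by (simp add: m_def)
        finally show ?thesis .
      qed
      ultimately have "cmod (cseg p g) * w g \<le> seg J ?Y 0 N g * (M + 1)"
        by (intro mult_mono) (auto simp: w_def intro!: seg_nonneg)
      then show "\<exists>y\<in>{2..m} \<times> H. (case y of (k, h) \<Rightarrow> h [^] k) = g \<and>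
        cmod (cseg p g) * w g \<le> (case y of (k,h) \<Rightarrow> seg J ?Y 0 N (h [^] k) * (M + 1))"
        using rt[OF gS] g exm[OF gS] by (intro bexI[of _ "(ex g, rt g)"]) (auto simp: H_def)
    qed
  qed (use fin H in \<open>auto simp: S_def\<close>)
  also have "\<dots> = (\<Sum>k\<in>{2..m}. (\<Sum>h\<in>H. seg J ?Y 0 N (h [^] k)) * (M + 1))"
    by (simp add: sum.cartesian_product[symmetric] sum_distrib_right)
  also have "\<dots> \<le> (\<Sum>k\<in>{2..m}. T * (M + 1))"
    using sum_powers_le[where Y = ?Y and n = N and J = J and H = H] J H M0 unfolding T_def r_def
    by (intro sum_mono mult_right_mono) auto
  also have "\<dots> = real (card {2..m}) * (T * (M + 1))" by simp
  also have "\<dots> \<le> (M + 1) * (T * (M + 1))"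
  proof (intro mult_right_mono)
    have "real (card {2..m}) \<le> real m" by simp
    also have "\<dots> \<le> M" using M0 by (simp add: m_def)
    finally have "real (card {2..m}) \<le> M" .
    then show "real (card {2..m}) \<le> M + 1" by simp
  qed (use T0 M0 in auto)
  finally have 2: "(\<Sum>g\<in>S. cmod (cseg p g) * w g) \<le> (M + 1)\<^sup>2 * T" by (simp add: power2_eq_square mult_ac)
  \<comment> \<open>The coefficients of a block are those of \<open>cseg (q i)\<close>, with l2-norm
    at most \<open>op ^ (q i)\<close>. The block lengths add up to \<open>p\<close>, so the product
    over the blocks is \<open>op ^ p\<close> apart from one rapid decay constant per block.\<close>
  have opcY: "opc J ?Y i \<le> nb (J + C) ^ 3 * (op ^ (q i))\<^sup>2" for i
  proof -
    have "(\<Sum>s\<in>ball J. (?Y i s)\<^sup>2) = nrm (q i)"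
      unfolding nrm_def using ball_mono[OF q[of i]] cseg_outside by (intro sum.mono_neutral_right) auto
    also have "\<dots> = (sqrt (nrm (q i)))\<^sup>2" using nrm_nonneg by simp
    also have "\<dots> \<le> (op ^ (q i))\<^sup>2" using nrm_le nrm_nonneg by (intro power_mono) auto
    finally show ?thesis unfolding opc_def using nb_nonneg[of "J + C"] J C by (intro mult_left_mono) auto
  qed
  have nb0: "nb (J + C) \<ge> 0" using J C by (intro nb_nonneg) auto
  have "(\<Prod>i<N. opc J ?Y i) \<le> (\<Prod>i<N. nb (J + C) ^ 3 * (op ^ (q i))\<^sup>2)"
    using opcY opc_nonneg J by (intro prod_mono) auto
  also have "\<dots> = (nb (J + C) ^ 3) ^ N * (\<Prod>i<N. op ^ (q i))\<^sup>2"
    by (simp add: prod.distrib prod_power_distrib)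
  also have "(\<Prod>i<N. op ^ (q i)) = op ^ p" unfolding p by (rule power_sum[symmetric])
  finally have "sqrt (\<Prod>i<N. opc J ?Y i) \<le> sqrt ((nb (J + C) ^ 3) ^ N * (op ^ p)\<^sup>2)" by (rule real_sqrt_le_mono)
  also have "\<dots> = sqrt (nb (J + C) ^ (3 * N)) * op ^ p"
    using op_nonneg by (simp add: real_sqrt_mult power_mult)
  finally have "T \<le> real (N + 1) ^ 3 * real (card (ball r)) ^ 3 * (sqrt (nb (J + C) ^ (3 * N)) * op ^ p)"
    unfolding T_def by (intro mult_left_mono) auto
  then have "(M + 1)\<^sup>2 * T \<le> (M + 1)\<^sup>2 * (real (N + 1) ^ 3 * real (card (ball r)) ^ 3 * (sqrt (nb (J + C) ^ (3 * N)) * op ^ p))"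
    by (intro mult_left_mono) auto
  with 1 2 one show ?thesis by (simp add: algebra_simps)
qed

lemma subexponential_bound:
  obtains K where "K > 0" "\<And>p. p \<ge> 1 \<Longrightarrow>
    cmod (u1 G (cseg p)) \<le> exp (K * (sqrt (real p) + 2) * ln (sqrt (real p) + 3)) * op ^ p"
proof -
  \<comment> \<open>\<open>c1\<close> accounts for the number and size of the exponents,
    \<open>c2\<close> for the volume of the error balls and \<open>c3\<close> for the rapid decay
    constants.\<close>
  define c1 where "c1 = (R + C) / \<epsilon> + 1"
  define c2 where "c2 = 9 * (R + C) * ln n0"
  define c3 where "c3 = (R + C + 1) * n0"
  have c: "c1 \<ge> 1" "c2 \<ge> 0" "c3 \<ge> 1"
    using R C eps n0 mult_mono[of 1 "R + C + 1" 1 n0] by (auto simp: c1_def c2_def c3_def)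
  define K where "K = ln 2 + 2 * ln c1 + 7 + 6 * c2 + 3 * ln c3 + 3"
  have "ln c1 \<ge> 0" "ln c3 \<ge> 0" "ln (2::real) > 0" using c by auto
  then have "K > 0" using c(2) unfolding K_def by linarith
  moreover have "cmod (u1 G (cseg p)) \<le> exp (K * (sqrt (real p) + 2) * ln (sqrt (real p) + 3)) * op ^ p"
    if p: "p \<ge> 1" for p :: nat
  proof -
    define t where "t = sqrt (real p)"
    have t: "t \<ge> 1" "real p = t * t" using p by (auto simp: t_def)
    define s where "s = nat \<lceil>t\<rceil>"
    have s: "t \<le> real s" "real s \<le> t + 1" "s \<ge> 1" using t by (auto simp: s_def) linarith+
    \<comment> \<open>\<open>b\<close> blocks of length \<open>s\<close>, about \<surd>p, and one
      possibly empty block for the remainder; \<open>p \<le> s * s\<close> gives at most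
      \<open>s + 1\<close> blocks.\<close>
    define b where "b = p div s"
    define N where "N = b + 1"
    define q where "q i = (if i < b then s else if i = b then p mod s else 0)" for i
    have sq: "real p \<le> real (s * s)" using t s mult_mono[of t "real s" t "real s"] by simp
    then have "b \<le> s" unfolding b_def using s(3) by (metis of_nat_le_iff div_le_mono nonzero_mult_div_cancel_right not_one_le_zero)
    then have N: "real N \<le> t + 2" using s by (simp add: N_def)
    have pq: "p = (\<Sum>i<N. q i)"
    proof -
      have "(\<Sum>i<N. q i) = b * s + p mod s" by (simp add: N_def q_def)
      then show ?thesis by (simp add: b_def)
    qed
    define J where "J = real s * R"
    have qs: "q i \<le> s" for i using s(3) by (auto simp: q_def intro: less_imp_le mod_less_divisor)
    then have qJ: "real (q i) * R \<le> J" for i using R by (simp add: J_def mult_right_mono)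
    have J1: "J \<ge> 1" using s R mult_mono[of 1 "real s" 1 R] by (simp add: J_def)
    have J2: "J \<le> (t + 1) * R" unfolding J_def using s R by (intro mult_right_mono) auto
    define M where "M = (real p * R + C) / \<epsilon>"
    define r where "r = 7 * (J + C + C * real N)"
    define X where "X = (M + 1)\<^sup>2 * (real (N + 1) ^ 3 * real (card (ball r)) ^ 3 * sqrt (nb (J + C) ^ (3 * N)))"
    have bound: "cmod (u1 G (cseg p)) \<le> (1 + X) * op ^ p"
      using u1_cseg_bound[OF pq qJ J1] unfolding X_def M_def r_def .
    define L where "L = ln (t + 3)"
    have t3: "exp L = t + 3" using t by (simp add: L_def)
    have L1: "L \<ge> 1"
    proof -
      have "exp 1 \<le> t + 3" using exp_le t by simp
      then show ?thesis using t3 by (metis exp_le_cancel_iff)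
    qed
    have M1: "0 \<le> M + 1" "M + 1 \<le> c1 * (t + 3)\<^sup>2"
    proof -
      have "real p * R + C \<le> (t + 3)\<^sup>2 * R + (t + 3)\<^sup>2 * C"
      proof (intro add_mono mult_right_mono)
        show "real p \<le> (t + 3)\<^sup>2" using t by (simp add: power2_eq_square algebra_simps)
        have "1 \<le> (t + 3)\<^sup>2" using t by (intro one_le_power) auto
        then show "C \<le> (t + 3)\<^sup>2 * C" using C mult_right_mono[of 1 "(t+3)\<^sup>2" C] by simp
      qed (use R in auto)
      then have "M \<le> ((t + 3)\<^sup>2 * R + (t + 3)\<^sup>2 * C) / \<epsilon>" unfolding M_def using eps by (intro divide_right_mono) auto
      moreover have "1 \<le> (t + 3)\<^sup>2" using t by (intro one_le_power) auto
      ultimately show "M + 1 \<le> c1 * (t + 3)\<^sup>2" by (simp add: c1_def field_simps)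
      show "0 \<le> M + 1" using R C eps by (simp add: M_def add_nonneg_nonneg)
    qed
    have e1: "(M + 1)\<^sup>2 \<le> exp (2 * ln c1 + 4 * L)"
    proof -
      have "(M + 1)\<^sup>2 \<le> (c1 * (t + 3)\<^sup>2)\<^sup>2" using M1 by (intro power_mono) auto
      also have "\<dots> = (exp (ln c1) * (exp L)\<^sup>2)\<^sup>2" using c t3 by simp
      also have "\<dots> = exp (2 * ln c1 + 4 * L)" by (simp flip: exp_of_nat_mult exp_add)
      finally show ?thesis .
    qed
    have e2: "real (N + 1) ^ 3 \<le> exp (3 * L)"
    proof -
      have "real (N + 1) ^ 3 \<le> (exp L) ^ 3" using N t3 by (intro power_mono) auto
      then show ?thesis by (simp flip: exp_of_nat_mult)
    qed
    have e3: "real (card (ball r)) ^ 3 \<le> exp (6 * c2 * (t + 2))"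
    proof -
      have r0: "r \<ge> 0" using J1 C by (simp add: r_def)
      have "C * real N \<le> C * (t + 2)" using N C by (intro mult_left_mono) auto
      then have "r + 2 \<le> 7 * ((t + 1) * R + C + C * (t + 2)) + 2" using J2 by (simp add: r_def)
      also have "\<dots> \<le> 7 * ((t + 3) * (R + C)) + 2 * ((t + 3) * (R + C))"
      proof (intro add_mono mult_left_mono)
        show "(t + 1) * R + C + C * (t + 2) \<le> (t + 3) * (R + C)" using R by (simp add: algebra_simps)
        have "1 \<le> (t + 3) * (R + C)" using t R C mult_mono[of 1 "t + 3" 1 "R + C"] by simp
        then show "2 \<le> 2 * ((t + 3) * (R + C))" by simp
      qed auto
      finally have r2: "r + 2 \<le> 9 * (R + C) * (t + 3)" by (simp add: algebra_simps)
      have "real (card (ball r)) \<le> n0 powr (r + 2)" by (rule card_ball_le[OF r0])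
      also have "\<dots> \<le> n0 powr (9 * (R + C) * (t + 3))" using r2 n0 by (intro powr_mono) auto
      also have "\<dots> = exp (c2 * (t + 3))" using n0 by (simp add: powr_def c2_def mult_ac)
      finally have "real (card (ball r)) ^ 3 \<le> exp (c2 * (t + 3)) ^ 3" by (intro power_mono) auto
      also have "\<dots> = exp (3 * (c2 * (t + 3)))" by (simp flip: exp_of_nat_mult)
      also have "\<dots> \<le> exp (6 * c2 * (t + 2))"
      proof -
        have "3 * (t + 3) \<le> 6 * (t + 2)" using t by simp
        from mult_left_mono[OF this c(2)] show ?thesis by (simp add: mult_ac)
      qed
      finally show ?thesis .
    qed
    have e4: "1 \<le> sqrt (nb (J + C) ^ (3 * N))" "sqrt (nb (J + C) ^ (3 * N)) \<le> exp (3 * (t + 2) * (ln c3 + L))"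
    proof -
      have n1: "nb (J + C) \<ge> 1" using J1 C n0 mult_mono[of 1 "J + C + 1" 1 n0] by (simp add: nb_def)
      have "J + C + 1 \<le> (R + C + 1) * (t + 3)"
      proof -
        have "(R + C + 1) * (t + 3) = R * t + 3 * R + C * t + 3 * C + t + 3" by (simp add: algebra_simps)
        moreover have "J \<le> R * t + R" using J2 by (simp add: algebra_simps)
        moreover have "0 \<le> C * t" using C t by simp
        ultimately show ?thesis using R(1) C t(1) by linarith
      qed
      then have "nb (J + C) \<le> c3 * (t + 3)" using n0 mult_right_mono[of "J + C + 1" "(R + C + 1) * (t + 3)" n0]
        by (simp add: nb_def c3_def mult_ac)
      also have "\<dots> = exp (ln c3 + L)" using c t3 by (simp add: exp_add)
      finally have n2: "nb (J + C) \<le> exp (ln c3 + L)" .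
      have n3: "1 \<le> nb (J + C) ^ (3 * N)" using n1 by (rule one_le_power)
      then show "1 \<le> sqrt (nb (J + C) ^ (3 * N))" by simp
      have "sqrt (nb (J + C) ^ (3 * N)) \<le> nb (J + C) ^ (3 * N)"
        using n3 real_sqrt_le_mono[of "nb (J + C) ^ (3 * N)" "(nb (J + C) ^ (3 * N))\<^sup>2"] self_le_power[OF n3, of 2] by simp
      also have "\<dots> \<le> exp (ln c3 + L) ^ (3 * N)" using n1 n2 by (intro power_mono) auto
      also have "\<dots> = exp (3 * real N * (ln c3 + L))" by (simp flip: exp_of_nat_mult)
      also have "\<dots> \<le> exp (3 * (t + 2) * (ln c3 + L))" using N c L1 by (simp add: mult_right_mono)
      finally show "sqrt (nb (J + C) ^ (3 * N)) \<le> exp (3 * (t + 2) * (ln c3 + L))" .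
    qed
    have "X \<le> exp (2 * ln c1 + 4 * L) * (exp (3 * L) * exp (6 * c2 * (t + 2)) * exp (3 * (t + 2) * (ln c3 + L)))"
      unfolding X_def using e1 e2 e3 e4 by (intro mult_mono mult_nonneg_nonneg) auto
    also have "\<dots> = exp (2 * ln c1 + 7 * L + 6 * c2 * (t + 2) + 3 * (t + 2) * (ln c3 + L))"
      by (simp flip: exp_add)
    finally have X: "X \<le> exp (2 * ln c1 + 7 * L + 6 * c2 * (t + 2) + 3 * (t + 2) * (ln c3 + L))" (is "_ \<le> exp ?E") .
    have "?E \<ge> 0" using c L1 t by (intro add_nonneg_nonneg mult_nonneg_nonneg) auto
    then have "1 + X \<le> exp (ln 2) * exp ?E" using X by simp (smt (verit) one_le_exp_iff)
    also have "\<dots> = exp (ln 2 + ?E)" by (simp add: exp_add)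
    also have "ln 2 + ?E \<le> K * ((t + 2) * L)"
    proof -
      define W where "W = (t + 2) * L"
      have u: "1 \<le> W" "L \<le> W" "t + 2 \<le> W"
        using t L1 mult_mono[of 1 "t + 2" 1 L] by (auto simp: W_def)
      have "ln 2 * 1 \<le> ln 2 * W" "2 * ln c1 * 1 \<le> 2 * ln c1 * W"
        "6 * c2 * (t + 2) \<le> 6 * c2 * W" "3 * ln c3 * (t + 2) \<le> 3 * ln c3 * W"
        using u c by (intro mult_left_mono; simp)+
      moreover have "ln 2 + ?E = ln 2 + 2 * ln c1 + 7 * L + 6 * c2 * (t + 2) + 3 * ln c3 * (t + 2) + 3 * W"
        by (simp add: W_def algebra_simps)
      moreover have "K * W = ln 2 * W + 2 * ln c1 * W + 7 * W + 6 * c2 * W + 3 * ln c3 * W + 3 * W"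
        by (simp add: K_def algebra_simps)
      ultimately show ?thesis using u(2) unfolding W_def[symmetric] by linarith
    qed
    finally have "1 + X \<le> exp (K * (t + 2) * L)" by (simp add: mult.assoc)
    then have "(1 + X) * op ^ p \<le> exp (K * (t + 2) * L) * op ^ p"
      using op_nonneg by (intro mult_right_mono) auto
    with bound show ?thesis unfolding t_def L_def by linarith
  qed
  ultimately show ?thesis using that by blast
qed

theorem limsup_u1_le:
  "limsup (\<lambda>p. ereal (root p (cmod (u1 G (x [^]\<^bsub>A\<^esub> p))))) \<le> ereal (l2_opnorm G (left_regular G x))"
proof -
  obtain K where K: "K > 0" "\<And>p. p \<ge> 1 \<Longrightarrow>
    cmod (u1 G (cseg p)) \<le> exp (K * (sqrt (real p) + 2) * ln (sqrt (real p) + 3)) * op ^ p"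
    by (rule subexponential_bound) blast
  define b where "b p = exp (K * (sqrt (real p) + 2) * ln (sqrt (real p) + 3) / real p) * op" for p :: nat
  have "root p (cmod (u1 G (x [^]\<^bsub>A\<^esub> p))) \<le> b p" if "p \<ge> 1" for p
  proof -
    have "root p (cmod (u1 G (x [^]\<^bsub>A\<^esub> p))) \<le> root p (exp (K * (sqrt (real p) + 2) * ln (sqrt (real p) + 3)) * op ^ p)"
      unfolding power_eq_cseg using K(2)[OF that] that by (intro real_root_le_mono) auto
    also have "\<dots> = root p (exp (K * (sqrt (real p) + 2) * ln (sqrt (real p) + 3))) * op"
      using that op_nonneg by (simp add: real_root_mult real_root_power_cancel)
    also have "root p (exp (K * (sqrt (real p) + 2) * ln (sqrt (real p) + 3))) =
        exp (K * (sqrt (real p) + 2) * ln (sqrt (real p) + 3) / real p)"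
      using that by (intro real_root_pos_unique) (auto simp: exp_of_nat_mult[symmetric])
    finally show ?thesis by (simp add: b_def)
  qed
  then have "limsup (\<lambda>p. ereal (root p (cmod (u1 G (x [^]\<^bsub>A\<^esub> p))))) \<le> limsup (\<lambda>p. ereal (b p))"
    by (intro Limsup_mono) (auto simp: eventually_sequentially)
  also have "\<dots> = ereal op"
  proof (rule lim_imp_Limsup)
    \<comment> \<open>The exponent is of order \<open>ln p / \<surd>p\<close>, so the subexponential
      factor disappears under the \<open>p\<close>-th root.\<close>
    have "(\<lambda>p. exp (K * (sqrt (real p) + 2) * ln (sqrt (real p) + 3) / real p)) \<longlonglongrightarrow> 1"
      using K(1) by real_asymp
    then have "b \<longlonglongrightarrow> 1 * op" unfolding b_def by (intro tendsto_mult tendsto_const)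
    then show "(\<lambda>p. ereal (b p)) \<longlonglongrightarrow> ereal op" by simp
  qed simp
  finally show ?thesis by (simp add: op_def)
qed

end

subsection \<open>Orbit lengths of surface groups\<close>

context lorentz_group
begin

definition orbit_length :: "'g \<Rightarrow> real" where "orbit_length x = hdist o' (\<rho> x o')"

text \<open>One constant for all axioms of \<open>hyp_length\<close>: \<open>6 * ln 2\<close> comes
  from the four-point condition, multiples of \<open>D\<close> from replacing points of the plane by
  orbit points (at most \<open>6 * D\<close> is used), and \<open>axis_const\<close> from the paths
  along an axis.\<close>

definition error_const :: real where "error_const = 1 + 6 * ln 2 + 8 * D + \<bar>axis_const\<bar>"

lemma rho_hdist: "x \<in> carrier G \<Longrightarrow> hdist (\<rho> x y) (\<rho> x z) = hdist y z"
  using lorentz_mapD(7) lorentz by blast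

lemma rho_hyp: "x \<in> carrier G \<Longrightarrow> z \<in> hyperboloid \<Longrightarrow> \<rho> x z \<in> hyperboloid"
  using lorentz_mapD(3) lorentz by blast

lemmas orbit_hyp = rho_hyp[OF _ o']

lemma rho_mult: "x \<in> carrier G \<Longrightarrow> y \<in> carrier G \<Longrightarrow> \<rho> (x \<otimes> y) z = \<rho> x (\<rho> y z)"
  by (simp add: hom)

lemma D_nonneg: "D \<ge> 0"
  using cobounded[OF o'] hdist_nonneg[OF o' orbit_hyp] by force

lemma error_const: "1 + 6 * ln 2 + 8 * D \<le> error_const" "1 + 8 * D + axis_const \<le> error_const"
proof -
  have "(0::real) \<le> ln 2" by simp
  then show "1 + 6 * ln 2 + 8 * D \<le> error_const" "1 + 8 * D + axis_const \<le> error_const"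
    using abs_ge_self[of axis_const] abs_ge_zero[of axis_const] unfolding error_const_def by linarith+
qed

lemma ln_2_nonneg: "(0::real) \<le> ln 2"
  by simp

lemma gdist_orbit:
  assumes "x \<in> carrier G" "y \<in> carrier G"
  shows "gdist G orbit_length x y = hdist (\<rho> x o') (\<rho> y o')"
proof -
  have "\<rho> x (\<rho> (inv x \<otimes> y) o') = \<rho> y o'"
    using assms rho_mult[of x "inv x \<otimes> y" o'] by (simp add: m_assoc[symmetric])
  then show ?thesis using rho_hdist[OF assms(1), of o' "\<rho> (inv x \<otimes> y) o'"] by (simp add: gdist_def orbit_length_def)
qed

lemma rho_inj: "x \<in> carrier G \<Longrightarrow> y \<in> carrier G \<Longrightarrow> \<rho> x = \<rho> y \<Longrightarrow> x = y"
proof -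
  assume a: "x \<in> carrier G" "y \<in> carrier G" "\<rho> x = \<rho> y"
  have "\<rho> (inv x \<otimes> y) = id" using a hom[of "inv x" y] hom[of "inv x" x] rho_one by simp
  then have "inv x \<otimes> y = \<one>" using rho_id[of "inv x \<otimes> y"] a by simp
  then show ?thesis using a by (metis inv_equality inv_inv inv_closed)
qed

lemma finite_orbit_ball: "finite {x \<in> carrier G. orbit_length x \<le> R}"
proof -
  interpret deck_group "\<rho> ` carrier G" \<epsilon>
  proof
    fix \<gamma> assume "\<gamma> \<in> \<rho> ` carrier G"
    then obtain x where x: "x \<in> carrier G" "\<gamma> = \<rho> x" by auto
    show "lorentz_map \<gamma>" using x lorentz by simp
    show "\<gamma> \<circ> \<delta> \<in> \<rho> ` carrier G" if \<delta>: "\<delta> \<in> \<rho> ` carrier G" for \<delta>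
    proof -
      obtain y where "y \<in> carrier G" "\<delta> = \<rho> y" using \<delta> by auto
      then show ?thesis using x hom[of x y] by (metis m_closed imageI)
    qed
    have "\<rho> (inv x) \<circ> \<gamma> = id" "\<gamma> \<circ> \<rho> (inv x) = id"
      using x hom[of "inv x" x] hom[of x "inv x"] rho_one by simp_all
    then show "\<exists>\<delta>\<in>\<rho> ` carrier G. \<delta> \<circ> \<gamma> = id \<and> \<gamma> \<circ> \<delta> = id" using x(1) by blast
    show "\<gamma> = id" if "z \<in> hyperboloid" "hdist z (\<gamma> z) < \<epsilon>" for z
      using free[OF x(1) _ that(1)] that(2) rho_one x(2) by fastforce
  next
    show "id \<in> \<rho> ` carrier G" using rho_one by (metis one_closed imageI)
  qed (rule eps)
  have "\<rho> ` {x \<in> carrier G. orbit_length x \<le> R} \<subseteq> {\<gamma> \<in> \<rho> ` carrier G. hdist o' (\<gamma> o') \<le> R}"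
    by (auto simp: orbit_length_def)
  then have "finite (\<rho> ` {x \<in> carrier G. orbit_length x \<le> R})" using finite_near[OF o' o'] finite_subset by blast
  then show ?thesis by (rule finite_imageD) (auto intro!: inj_onI rho_inj)
qed

lemma orbit_center:
  assumes x: "x \<in> carrier G" and y: "y \<in> carrier G"
  shows "\<exists>u\<in>carrier G. hdist o' (\<rho> u o') + hdist (\<rho> u o') (\<rho> x o') \<le> hdist o' (\<rho> x o') + error_const \<and>
    hdist o' (\<rho> u o') + hdist (\<rho> u o') (\<rho> y o') \<le> hdist o' (\<rho> y o') + error_const \<and>
    hdist (\<rho> x o') (\<rho> u o') + hdist (\<rho> u o') (\<rho> y o') \<le> hdist (\<rho> x o') (\<rho> y o') + error_const"
proof -
  define X where "X = \<rho> x o'"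
  define Y where "Y = \<rho> y o'"
  have h: "X \<in> hyperboloid" "Y \<in> hyperboloid" using orbit_hyp x y by (auto simp: X_def Y_def)
  \<comment> \<open>The Gromov product of \<open>X\<close> and \<open>Y\<close> at
    \<open>o'\<close>: the point at this distance on the geodesic to \<open>X\<close> is an
    approximate centre of the triangle.\<close>
  define s where "s = (hdist o' X + hdist o' Y - hdist X Y) / 2"
  have "0 \<le> s" "s \<le> hdist o' X"
    using hdist_triangle[of X o' Y] hdist_triangle[of o' X Y] hdist_commute[of X o'] h o' by (auto simp: s_def)
  then obtain m where m: "m \<in> hyperboloid" "hdist o' m = s" "hdist m X = hdist o' X - s"
    by (rule geodesic_point[OF o' h(1)])
  have "hdist m Y + hdist o' X \<le> max (hdist m o' + hdist Y X) (hdist m X + hdist Y o') + 6 * ln 2"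
    by (rule four_point) (use m h o' in auto)
  moreover have "hdist m o' + hdist Y X = hdist m X + hdist Y o'"
    using m by (simp add: hdist_commute[of m o'] hdist_commute[of Y X] hdist_commute[of Y o'] s_def field_simps)
  ultimately have mY: "hdist m Y \<le> hdist o' Y - s + 6 * ln 2"
    using m(3) hdist_commute[of Y o'] by simp
  obtain u where u: "u \<in> carrier G" "hdist m (\<rho> u o') \<le> D" using cobounded[OF m(1)] by blast
  define U where "U = \<rho> u o'"
  have U: "U \<in> hyperboloid" "hdist m U \<le> D" using orbit_hyp u by (auto simp: U_def)
  note tri = hdist_triangle[of o' m U] hdist_triangle[of U m X] hdist_triangle[of U m Y]
  have "hdist o' U \<le> s + D" "hdist U X \<le> D + (hdist o' X - s)" "hdist U Y \<le> D + (hdist o' Y - s + 6 * ln 2)"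
    using tri U m mY h o' hdist_commute[of U m] by auto
  moreover have "2 * D + 6 * ln 2 \<le> error_const" using D_nonneg error_const ln_2_nonneg by linarith
  moreover have "(0::real) \<le> ln 2" by simp
  moreover have "2 * s = hdist o' X + hdist o' Y - hdist X Y" by (simp add: s_def)
  moreover have "hdist X U = hdist U X" by (rule hdist_commute)
  ultimately have "hdist o' U + hdist U X \<le> hdist o' X + error_const \<and>
    hdist o' U + hdist U Y \<le> hdist o' Y + error_const \<and> hdist X U + hdist U Y \<le> hdist X Y + error_const"
    by linarith
  then show ?thesis using u(1) unfolding X_def Y_def U_def by blast
qed

lemma orbit_step:
  assumes x: "x \<in> carrier G" and far: "hdist o' (\<rho> x o') \<ge> error_const"
  shows "\<exists>y\<in>carrier G. hdist o' (\<rho> y o') \<le> hdist o' (\<rho> x o') - 1 \<and> hdist (\<rho> y o') (\<rho> x o') \<le> error_const"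
proof -
  \<comment> \<open>Go back by \<open>D + 1\<close> along the geodesic; rounding to the orbit loses
    at most \<open>D\<close>, which leaves a gain of 1.\<close>
  have "0 \<le> hdist o' (\<rho> x o') - (D + 1)" "hdist o' (\<rho> x o') - (D + 1) \<le> hdist o' (\<rho> x o')"
    using far D_nonneg error_const ln_2_nonneg by linarith+
  then obtain z where z: "z \<in> hyperboloid" "hdist o' z = hdist o' (\<rho> x o') - (D + 1)"
      "hdist z (\<rho> x o') = hdist o' (\<rho> x o') - (hdist o' (\<rho> x o') - (D + 1))"
    by (rule geodesic_point[OF o' orbit_hyp[OF x]])
  obtain y where y: "y \<in> carrier G" "hdist z (\<rho> y o') \<le> D" using cobounded[OF z(1)] by blast
  have "hdist o' (\<rho> y o') \<le> hdist o' (\<rho> x o') - 1"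
    using hdist_triangle[of o' z "\<rho> y o'"] z y o' orbit_hyp by auto
  moreover have "hdist (\<rho> y o') (\<rho> x o') \<le> 2 * D + 1"
    using hdist_triangle[of "\<rho> y o'" z "\<rho> x o'"] z y x orbit_hyp hdist_commute[of z "\<rho> y o'"] by auto
  moreover have "2 * D + 1 \<le> error_const" using D_nonneg error_const ln_2_nonneg by linarith
  ultimately show ?thesis using y(1) by (meson order_trans)
qed

text \<open>\<open>u\<close> is an orbit point within \<open>D\<close> of the axis point
  \<open>a\<close> given by \<open>axis_displacement\<close>. Over the four segments the replacement
  of \<open>a\<close> and its translates by orbit points costs \<open>6 * D\<close>, and
  \<open>axis_const\<close> compares the path with the displacement of \<open>o'\<close>.\<close>

lemma orbit_power_geodesic:
  assumes h: "h \<in> carrier G" "h \<noteq> \<one>" and k: "(k::nat) \<ge> 2"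
  shows "\<exists>u\<in>carrier G. hdist o' (\<rho> u o') + hdist (\<rho> u o') (\<rho> (h \<otimes> u) o')
    + hdist (\<rho> (h \<otimes> u) o') (\<rho> (h [^] k \<otimes> u) o') + hdist (\<rho> (h [^] k \<otimes> u) o') (\<rho> (h [^] k) o')
      \<le> hdist o' (\<rho> (h [^] k) o') + error_const"
proof -
  obtain a t where a: "a \<in> hyperboloid" "t \<ge> \<epsilon>" "\<And>k::nat. hdist a (\<rho> (h [^] k) a) = real k * t"
    "\<And>k::nat. k \<ge> 1 \<Longrightarrow> hdist o' (\<rho> (h [^] k) o') \<ge> 2 * hdist o' a + real k * t - axis_const"
    by (rule axis_displacement[OF h]) blast
  obtain u where u: "u \<in> carrier G" "hdist a (\<rho> u o') \<le> D" using cobounded[OF a(1)] by blast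
  define U where "U = \<rho> u o'"
  have U: "U \<in> hyperboloid" "hdist a U \<le> D" "hdist U a \<le> D"
    using orbit_hyp u hdist_commute[of a U] by (auto simp: U_def)
  have move: "hdist U (\<rho> (h [^] j) U) \<le> 2 * D + real j * t" for j :: nat
  proof -
    have c: "h [^] j \<in> carrier G" using h by simp
    have "hdist U (\<rho> (h [^] j) U) \<le> hdist U a + hdist a (\<rho> (h [^] j) U)"
      by (rule hdist_triangle) (use U a rho_hyp c in auto)
    also have "hdist a (\<rho> (h [^] j) U) \<le> hdist a (\<rho> (h [^] j) a) + hdist (\<rho> (h [^] j) a) (\<rho> (h [^] j) U)"
      by (rule hdist_triangle) (use U a rho_hyp c in auto)
    finally show ?thesis using U a(3) rho_hdist[OF c] by simp
  qed
  have oU: "hdist o' U \<le> hdist o' a + D" using hdist_triangle[of o' a U] o' a(1) U by auto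
  have pk: "h [^] k = h \<otimes> h [^] (k - 1)" using k nat_pow_Suc2[OF h(1), of "k - 1"] by simp
  have hk: "h [^] k \<in> carrier G" "h [^] (k - 1) \<in> carrier G" using h by auto
  have "hdist U (\<rho> (h \<otimes> u) o') \<le> 2 * D + t"
    using move[of 1] h u by (simp add: rho_mult U_def)
  moreover have "hdist (\<rho> (h \<otimes> u) o') (\<rho> (h [^] k \<otimes> u) o') \<le> 2 * D + real (k - 1) * t"
    using move[of "k - 1"] h u hk unfolding pk by (simp add: rho_mult rho_hdist U_def)
  moreover have "hdist (\<rho> (h [^] k \<otimes> u) o') (\<rho> (h [^] k) o') = hdist o' U"
    using u hk by (simp add: rho_mult rho_hdist U_def hdist_commute)
  moreover have "real (k - 1) * t = real k * t - t" using k by (simp add: of_nat_diff algebra_simps)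
  moreover have "hdist o' (\<rho> (h [^] k) o') \<ge> 2 * hdist o' a + real k * t - axis_const" using a(4) k by simp
  moreover have "6 * D + axis_const \<le> error_const" using D_nonneg error_const ln_2_nonneg by linarith
  ultimately have "hdist o' U + hdist U (\<rho> (h \<otimes> u) o') + hdist (\<rho> (h \<otimes> u) o') (\<rho> (h [^] k \<otimes> u) o')
      + hdist (\<rho> (h [^] k \<otimes> u) o') (\<rho> (h [^] k) o') \<le> hdist o' (\<rho> (h [^] k) o') + error_const"
    using oU by linarith
  then show ?thesis using u(1) unfolding U_def by blast
qed

lemma hyp_length: "hyp_length G orbit_length error_const \<epsilon>"
proof
  show "orbit_length \<one> = 0" using hdist_eq_0[OF o' o'] by (simp add: orbit_length_def rho_one)
  show "error_const \<ge> 1" using D_nonneg error_const ln_2_nonneg by linarith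
  show "finite {x \<in> carrier G. orbit_length x \<le> R}" for R by (rule finite_orbit_ball)
  show "\<epsilon> > 0" by (rule eps)
next
  fix x assume x: "x \<in> carrier G"
  show "0 \<le> orbit_length x" unfolding orbit_length_def by (rule hdist_nonneg[OF o' orbit_hyp[OF x]])
  show "orbit_length (inv x) = orbit_length x"
    using rho_hdist[OF x, of o' "\<rho> (inv x) o'"] x rho_mult[of x "inv x" o']
    by (simp add: orbit_length_def rho_one hdist_commute)
  show "orbit_length (x \<otimes> y) \<le> orbit_length x + orbit_length y" if y: "y \<in> carrier G" for y
    using hdist_triangle[of o' "\<rho> x o'" "\<rho> (x \<otimes> y) o'"] x y o' orbit_hyp rho_hyp rho_hdist[OF x, of o' "\<rho> y o'"]
    by (simp add: orbit_length_def rho_mult)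
  show "\<exists>y\<in>carrier G. orbit_length y \<le> orbit_length x - 1 \<and> gdist G orbit_length y x \<le> error_const"
    if "orbit_length x \<ge> error_const"
    using orbit_step[OF x] that x by (simp add: orbit_length_def[symmetric] gdist_orbit[symmetric] cong: conj_cong bex_cong)
  show "\<exists>u\<in>carrier G. orbit_length u + gdist G orbit_length u x \<le> orbit_length x + error_const \<and>
      orbit_length u + gdist G orbit_length u y \<le> orbit_length y + error_const \<and>
      gdist G orbit_length x u + gdist G orbit_length u y \<le> gdist G orbit_length x y + error_const"
    if y: "y \<in> carrier G" for y
    using orbit_center[OF x y] x y by (auto simp: orbit_length_def gdist_orbit)
  show "\<exists>c\<in>carrier G. \<forall>y\<in>carrier G. \<forall>k\<ge>1::nat. y [^] k = x \<longrightarrow> (\<exists>j::int. y = c [^] j)" if "x \<noteq> \<one>"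
    using roots_cyclic[OF x that] by metis
next
  fix x y z w assume "x \<in> carrier G" "y \<in> carrier G" "z \<in> carrier G" "w \<in> carrier G"
  then have "gdist G orbit_length x y + gdist G orbit_length z w \<le>
        max (gdist G orbit_length x z + gdist G orbit_length y w) (gdist G orbit_length x w + gdist G orbit_length y z) + 6 * ln 2"
    by (simp only: gdist_orbit) (intro four_point orbit_hyp)
  then show "gdist G orbit_length x y + gdist G orbit_length z w \<le>
        max (gdist G orbit_length x z + gdist G orbit_length y w) (gdist G orbit_length x w + gdist G orbit_length y z) + error_const"
    using D_nonneg error_const by linarith
next
  fix h and k :: nat assume h: "h \<in> carrier G" "h \<noteq> \<one>"
  show "\<exists>u\<in>carrier G. orbit_length u + gdist G orbit_length u (h \<otimes> u) + gdist G orbit_length (h \<otimes> u) (h [^] k \<otimes> u)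
        + gdist G orbit_length (h [^] k \<otimes> u) (h [^] k) \<le> orbit_length (h [^] k) + error_const" if "k \<ge> 2"
    using orbit_power_geodesic[OF h that] h by (auto simp: orbit_length_def gdist_orbit)
  obtain a t where a: "a \<in> hyperboloid" "t \<ge> \<epsilon>"
    "\<And>k::nat. k \<ge> 1 \<Longrightarrow> hdist o' (\<rho> (h [^] k) o') \<ge> 2 * hdist o' a + real k * t - axis_const"
    by (rule axis_displacement[OF h]) blast
  show "orbit_length (h [^] k) \<ge> \<epsilon> * real k - error_const"
  proof (cases "k = 0")
    case True
    have "0 \<le> error_const" using D_nonneg error_const ln_2_nonneg by linarith
    then show ?thesis using True hdist_eq_0[OF o' o'] by (simp add: orbit_length_def rho_one)
  next
    case False
    have "\<epsilon> * real k \<le> real k * t" using a(2) by (metis mult.commute mult_left_mono of_nat_0_le_iff)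
    moreover have "axis_const \<le> error_const" using D_nonneg error_const ln_2_nonneg by linarith
    moreover have "hdist o' (\<rho> (h [^] k) o') \<ge> 2 * hdist o' a + real k * t - axis_const" using a(3)[of k] False by simp
    ultimately show ?thesis using hdist_nonneg[OF o' a(1)] unfolding orbit_length_def by linarith
  qed
qed

end

theorem theorem1p8:
  fixes S :: "'a::topological_space set" and x0 :: 'a and g :: nat
    and \<Gamma> :: "(real \<Rightarrow> 'a) set monoid" and x :: "(real \<Rightarrow> 'a) set \<Rightarrow> complex"
  assumes "g \<ge> 2"
    and "closed_orientable_surface g S" and "x0 \<in> S"
    and "\<Gamma> = fundamental_group S x0"
    and "x \<in> carrier (group_algebra \<Gamma>)"
    and "adjoint_elem \<Gamma> x = x"
  shows "limsup (\<lambda>p. ereal (root p (cmod (u1 \<Gamma> (x [^]\<^bsub>group_algebra \<Gamma>\<^esub> p)))))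
    \<le> ereal (l2_opnorm \<Gamma> (left_regular \<Gamma> x))"
proof -
  interpret surface g by unfold_locales (rule assms(1))
  obtain \<rho>' o' \<epsilon> D where "lorentz_group \<Gamma> \<rho>' o' \<epsilon> D"
    using surface_group_is_lorentz_group[OF assms(2,3)] unfolding assms(4) by blast
  then interpret L: lorentz_group \<Gamma> \<rho>' o' \<epsilon> D .
  interpret H: hyp_length \<Gamma> L.orbit_length L.error_const \<epsilon> by (rule L.hyp_length)
  have fin: "finite (supp x)" and sub: "supp x \<subseteq> carrier \<Gamma>" using assms(5) by (auto simp: group_algebra_def)
  \<comment> \<open>Inserting 1 gives \<open>R \<ge> 1\<close> and keeps the maximum meaningful for
    \<open>x = 0\<close>.\<close>
  define R where "R = Max (insert 1 (L.orbit_length ` supp x))"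
  have "R \<ge> 1" "\<And>y. y \<in> supp x \<Longrightarrow> L.orbit_length y \<le> R" using fin by (auto simp: R_def)
  then interpret hyp_length_element \<Gamma> L.orbit_length L.error_const \<epsilon> x R
    using assms(5) sub by unfold_locales (auto simp: H.ball_def)
  show ?thesis by (rule limsup_u1_le)
qed

end
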